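(* Let $K$ be a differential field with a finite set $\Delta$ of pairwise commuting derivations, and let $A$ be a differential $K$-algebra, local with maximal ideal $\mathfrak m$, of the form $K\{x_1,\dots,x_n\}_{\mathfrak p}$ for some elements $x_1,\dots,x_n\in A$ and some prime differential ideal $\mathfrak p$ of $K\{x_1,\dots,x_n\}$. Suppose that the local ring $A$ is regular. Let $x=(x_1,\dots,x_n)$ be a system of regular local generators of $A$, let $B\subseteq A$ be the differential subalgebra generated over $K$ by $x$, and let $\mathfrak p$ denote the contraction of $\mathfrak m$ to $B$. Let $\overline{x}$ be the image of $x$ in $B/\mathfrak p$, let $M=\mathfrak m/\mathfrak m^2$, and let $\overline{dx}=(\overline{dx}_1,\dots,\overline{dx}_n)$ be the image of $(dx_1,\dots,dx_n)$ in $A/\mathfrak m\otimes_A\Omega_{A/K}=\mathfrak m/\mathfrak m^2$. Then $$\chi^{M}_{\overline{dx}}(t)=\chi^B_x(t)=\chi^{B/\mathfrak p}_{\overline{x}}(t)+\chi^A_x(t).$$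
   Context: All rings are commutative with identity, and differential rings contain $\mathbb Q$. $K\{x_1,\dots,x_n\}$ is the differential $K$-algebra generated by $x_1,\dots,x_n$. $\theta$ denotes a derivative operator, that is, a product of elements of $\Delta$, and $\operatorname{ord}\theta$ is its order. $\dim$ of a ring is Krull dimension. $\Omega_{A/K}$ is the module of Kähler differentials, a differential $A$-module. A system of local generators of $A$ is a family $x=(x_1,\dots,x_n)$ in $A$ such that $A=K\{x_1,\dots,x_n\}_{\mathfrak p}$ for a prime differential ideal $\mathfrak p$ of $B=K\{x_1,\dots,x_n\}$. For such a system put $B_t=K[\theta x_i\mid 1\le i\le n,\ \operatorname{ord}\theta\le t]$, $\mathfrak p_t=B_t\cap\mathfrak p$, $A_t=(B_t)_{\mathfrak p_t}$, and $(B/\mathfrak p)_t=K[\theta\overline{x}_i\mid 1\le i\le n,\ \operatorname{ord}\theta\le t]$. The ring $A$ is called regular if the following two conditions hold. (A1) The unique $K$-algebra homomorphism $\tau_A\colon S_K(\mathfrak m/\mathfrak m^2)\to\bigoplus_{d\ge0}\mathfrak m^d/\mathfrak m^{d+1}$ extending the identity mapping of $\mathfrak m/\mathfrak m^2$ is an isomorphism, where $S_K$ is the symmetric algebra over $K$. (A2) There exists a system of local generators of $A$ such that the natural map $\phi_r\colon A/\mathfrak m\otimes_{A_r}\Omega_{A_r/K}\to A/\mathfrak m\otimes_A\Omega_{A/K}$ is injective for all $r\ge0$. A system of local generators as in (A2) is called a system of regular local generators of $A$. The functions are $\chi^B_x(t)=\dim B_t$, $\chi^{B/\mathfrak p}_{\overline{x}}(t)=\dim(B/\mathfrak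 p)_t$, $\chi^A_x(t)=\dim A_t$, and $\chi^M_{\overline{dx}}(t)=\dim_K M_t$, where $M_t\subseteq M$ is the $K$-linear span of the elements $\theta\,\overline{dx}_i$ with $1\le i\le n$ and $\operatorname{ord}\theta\le t$. *)

theory Defs
  imports "HOL-Library.Multiset" "HOL-Library.Extended_Nat"
    "HOL-Algebra.Embedded_Algebras" "HOL-Algebra.Generated_Rings" "HOL-Algebra.Ideal_Product"
begin

section \<open>Differential rings, fields and algebras\<close>

text \<open>The derivations are indexed by the elements of a set \<open>\<Delta>\<close> of symbols, so that the same
  \<open>\<Delta>\<close> acts on different rings.  The last axiom says that the ring contains the rationals.\<close>

locale differential_ring = cring R for R (structure) +
  fixes \<Delta> :: "'d set" and der :: "'d \<Rightarrow> 'a \<Rightarrow> 'a"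
  assumes der_closed: "\<lbrakk>i \<in> \<Delta>; a \<in> carrier R\<rbrakk> \<Longrightarrow> der i a \<in> carrier R"
    and der_add: "\<lbrakk>i \<in> \<Delta>; a \<in> carrier R; b \<in> carrier R\<rbrakk> \<Longrightarrow> der i (a \<oplus> b) = der i a \<oplus> der i b"
    and der_mult: "\<lbrakk>i \<in> \<Delta>; a \<in> carrier R; b \<in> carrier R\<rbrakk>
      \<Longrightarrow> der i (a \<otimes> b) = der i a \<otimes> b \<oplus> a \<otimes> der i b"
    and der_commute: "\<lbrakk>i \<in> \<Delta>; j \<in> \<Delta>; a \<in> carrier R\<rbrakk> \<Longrightarrow> der i (der j a) = der j (der i a)"
    and contains_rationals: "0 < (k::nat) \<Longrightarrow> [k] \<cdot> \<one> \<in> Units R"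

definition differential_field :: "('k, 'l) ring_scheme \<Rightarrow> 'd set \<Rightarrow> ('d \<Rightarrow> 'k \<Rightarrow> 'k) \<Rightarrow> bool"
  where "differential_field K \<Delta> dK \<longleftrightarrow> field K \<and> differential_ring K \<Delta> dK"

definition differential_algebra ::
  "('k, 'l) ring_scheme \<Rightarrow> ('d \<Rightarrow> 'k \<Rightarrow> 'k) \<Rightarrow> ('k, 'a, 'b) module_scheme \<Rightarrow> ('d \<Rightarrow> 'a \<Rightarrow> 'a)
    \<Rightarrow> 'd set \<Rightarrow> bool"
  where "differential_algebra K dK A dA \<Delta> \<longleftrightarrow>
    differential_ring K \<Delta> dK \<and> differential_ring A \<Delta> dA \<and> algebra K A \<and>
    (\<forall>i\<in>\<Delta>. \<forall>c\<in>carrier K. dA i (c \<odot>\<^bsub>A\<^esub> \<one>\<^bsub>A\<^esub>) = dK i c \<odot>\<^bsub>A\<^esub> \<one>\<^bsub>A\<^esub>)"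

text \<open>The derivative operators of order at most \<open>t\<close> are the words of length at most \<open>t\<close> in the
  derivations (which commute, so that words with the same letters define the same operator).\<close>

definition derivatives_upto :: "'d set \<Rightarrow> ('d \<Rightarrow> 'a \<Rightarrow> 'a) \<Rightarrow> 'a list \<Rightarrow> nat \<Rightarrow> 'a set"
  where "derivatives_upto \<Delta> der xs t =
    {foldr der w a |w a. w \<in> lists \<Delta> \<and> length w \<le> t \<and> a \<in> set xs}"

definition scalars :: "('k, 'l) ring_scheme \<Rightarrow> ('k, 'a, 'b) module_scheme \<Rightarrow> 'a set"
  where "scalars K A = (\<lambda>c. c \<odot>\<^bsub>A\<^esub> \<one>\<^bsub>A\<^esub>) ` carrier K"

definition diff_generate ::
  "('k, 'l) ring_scheme \<Rightarrow> ('k, 'a, 'b) module_scheme \<Rightarrow> 'd set \<Rightarrow> ('d \<Rightarrow> 'a \<Rightarrow> 'a) \<Rightarrow> 'a list \<Rightarrow> 'a set"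
  where "diff_generate K A \<Delta> der xs =
    \<Inter>{S. subring S A \<and> scalars K A \<subseteq> S \<and> set xs \<subseteq> S \<and> (\<forall>i\<in>\<Delta>. der i ` S \<subseteq> S)}"

definition generate_upto ::
  "('k, 'l) ring_scheme \<Rightarrow> ('k, 'a, 'b) module_scheme \<Rightarrow> 'd set \<Rightarrow> ('d \<Rightarrow> 'a \<Rightarrow> 'a) \<Rightarrow> 'a list
    \<Rightarrow> nat \<Rightarrow> 'a set"
  where "generate_upto K A \<Delta> der xs t =
    generate_ring A (scalars K A \<union> derivatives_upto \<Delta> der xs t)"


section \<open>Commutative algebra\<close>

definition local_ring :: "('a, 'b) ring_scheme \<Rightarrow> 'a set \<Rightarrow> bool"
  where "local_ring A m \<longleftrightarrow> cring A \<and> maximalideal m A \<and> (\<forall>I. maximalideal I A \<longrightarrow> I = m)"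

definition krull_dim :: "('a, 'b) ring_scheme \<Rightarrow> enat"
  where "krull_dim R = Sup {enat l |l. \<exists>P :: nat \<Rightarrow> 'a set.
    (\<forall>i\<le>l. primeideal (P i) R) \<and> (\<forall>i<l. P i \<subset> P (Suc i))}"

text \<open>Let \<open>S\<close> be a subring of \<open>A\<close> and \<open>T\<close> a multiplicative subset of \<open>S\<close> consisting of units
  of \<open>A\<close>.  Then the canonical map from the localization of \<open>S\<close> at \<open>T\<close> to \<open>A\<close> is injective,
  and the localization is identified with its image, the following subring of \<open>A\<close>.\<close>

definition fractions_in :: "('a, 'b) ring_scheme \<Rightarrow> 'a set \<Rightarrow> 'a set \<Rightarrow> 'a set"
  where "fractions_in A S T = {b \<otimes>\<^bsub>A\<^esub> inv\<^bsub>A\<^esub> s |b s. b \<in> S \<and> s \<in> T}"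

primrec ideal_power :: "('a, 'b) ring_scheme \<Rightarrow> 'a set \<Rightarrow> nat \<Rightarrow> 'a set"
  where "ideal_power A I 0 = carrier A"
  | "ideal_power A I (Suc d) = I \<cdot>\<^bsub>A\<^esub> ideal_power A I d"


subsection \<open>Modules\<close>

text \<open>The record of modules has ring multiplication and unit as fields; for modules that are not
  algebras these fields carry no information.\<close>

definition self_module :: "('a, 'b) ring_scheme \<Rightarrow> ('a, 'a) module"
  where "self_module R = \<lparr>carrier = carrier R, mult = mult R, one = one R, zero = zero R,
    add = add R, smult = mult R\<rparr>"

definition module_homs ::
  "('r, 'l) ring_scheme \<Rightarrow> ('r, 'm, 'b) module_scheme \<Rightarrow> ('r, 'n, 'c) module_scheme \<Rightarrow> ('m \<Rightarrow> 'n) set"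
  where "module_homs R M N = {h. h \<in> carrier M \<rightarrow> carrier N \<and>
    (\<forall>u\<in>carrier M. \<forall>v\<in>carrier M. h (u \<oplus>\<^bsub>M\<^esub> v) = h u \<oplus>\<^bsub>N\<^esub> h v) \<and>
    (\<forall>r\<in>carrier R. \<forall>u\<in>carrier M. h (r \<odot>\<^bsub>M\<^esub> u) = r \<odot>\<^bsub>N\<^esub> h u)}"

definition algebra_homs ::
  "('r, 'l) ring_scheme \<Rightarrow> ('r, 'm, 'b) module_scheme \<Rightarrow> ('r, 'n, 'c) module_scheme \<Rightarrow> ('m \<Rightarrow> 'n) set"
  where "algebra_homs R A B = ring_hom A B \<inter> module_homs R A B"

definition module_span :: "('r, 'l) ring_scheme \<Rightarrow> ('r, 'm, 'b) module_scheme \<Rightarrow> 'm set \<Rightarrow> 'm set"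
  where "module_span R M S = \<Inter>{N. submodule N R M \<and> S \<subseteq> N}"

text \<open>For a submodule \<open>N\<close> of a module this is the quotient module, and for an ideal \<open>N\<close> of an
  algebra the quotient algebra.  As in the library's construction of quotient rings, the operations
  on cosets take all representatives.\<close>

definition quot_module :: "('r, 'm, 'b) module_scheme \<Rightarrow> 'm set \<Rightarrow> ('r, 'm set) module"
  where "quot_module M N = \<lparr>carrier = carrier (M Quot N), mult = mult (M Quot N),
    one = one (M Quot N), zero = zero (M Quot N), add = add (M Quot N),
    smult = (\<lambda>r C. \<Union>u\<in>C. N +>\<^bsub>M\<^esub> (r \<odot>\<^bsub>M\<^esub> u))\<rparr>"

definition quot_der :: "('a, 'b) ring_scheme \<Rightarrow> 'a set \<Rightarrow> ('d \<Rightarrow> 'a \<Rightarrow> 'a) \<Rightarrow> 'd \<Rightarrow> 'a set \<Rightarrow> 'a set"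
  where "quot_der A I der i C = (\<Union>u\<in>C. I +>\<^bsub>A\<^esub> der i u)"

definition free_module :: "('r, 'l) ring_scheme \<Rightarrow> 's set \<Rightarrow> ('r, 's \<Rightarrow> 'r) module"
  where "free_module R S = \<lparr>
    carrier = {f. (\<forall>s. f s \<in> carrier R) \<and> (\<forall>s. s \<notin> S \<longrightarrow> f s = \<zero>\<^bsub>R\<^esub>) \<and> finite {s. f s \<noteq> \<zero>\<^bsub>R\<^esub>}},
    mult = undefined, one = undefined, zero = (\<lambda>_. \<zero>\<^bsub>R\<^esub>),
    add = (\<lambda>f g s. f s \<oplus>\<^bsub>R\<^esub> g s),
    smult = (\<lambda>r f s. r \<otimes>\<^bsub>R\<^esub> f s)\<rparr>"

definition free_gen :: "('r, 'l) ring_scheme \<Rightarrow> 's \<Rightarrow> 's \<Rightarrow> 'r"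
  where "free_gen R s = (\<lambda>s'. if s' = s then \<one>\<^bsub>R\<^esub> else \<zero>\<^bsub>R\<^esub>)"


subsection \<open>Kaehler differentials\<close>

definition kaehler_relations :: "('k, 'l) ring_scheme \<Rightarrow> ('k, 'a, 'b) module_scheme \<Rightarrow> ('a \<Rightarrow> 'a) set"
  where "kaehler_relations K A = (let F = free_module A (carrier A); e = free_gen A in
    {e (a \<oplus>\<^bsub>A\<^esub> b) \<ominus>\<^bsub>F\<^esub> (e a \<oplus>\<^bsub>F\<^esub> e b) |a b. a \<in> carrier A \<and> b \<in> carrier A} \<union>
    {e (a \<otimes>\<^bsub>A\<^esub> b) \<ominus>\<^bsub>F\<^esub> ((a \<odot>\<^bsub>F\<^esub> e b) \<oplus>\<^bsub>F\<^esub> (b \<odot>\<^bsub>F\<^esub> e a)) |a b. a \<in> carrier A \<and> b \<in> carrier A} \<union>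
    {e c |c. c \<in> scalars K A})"

definition kaehler_null :: "('k, 'l) ring_scheme \<Rightarrow> ('k, 'a, 'b) module_scheme \<Rightarrow> ('a \<Rightarrow> 'a) set"
  where "kaehler_null K A = module_span A (free_module A (carrier A)) (kaehler_relations K A)"

definition kaehler ::
  "('k, 'l) ring_scheme \<Rightarrow> ('k, 'a, 'b) module_scheme \<Rightarrow> ('a, ('a \<Rightarrow> 'a) set) module"
  where "kaehler K A = quot_module (free_module A (carrier A)) (kaehler_null K A)"

definition kaehler_d ::
  "('k, 'l) ring_scheme \<Rightarrow> ('k, 'a, 'b) module_scheme \<Rightarrow> 'a \<Rightarrow> ('a \<Rightarrow> 'a) set"
  where "kaehler_d K A a = kaehler_null K A +>\<^bsub>free_module A (carrier A)\<^esub> free_gen A a"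


subsection \<open>Tensor products\<close>

definition tensor_relations ::
  "('r, 'l) ring_scheme \<Rightarrow> ('r, 'm, 'b) module_scheme \<Rightarrow> ('r, 'n, 'c) module_scheme
    \<Rightarrow> ('m \<times> 'n \<Rightarrow> 'r) set"
  where "tensor_relations R M N =
    (let F = free_module R (carrier M \<times> carrier N); e = free_gen R in
    {e (u \<oplus>\<^bsub>M\<^esub> u', v) \<ominus>\<^bsub>F\<^esub> (e (u, v) \<oplus>\<^bsub>F\<^esub> e (u', v)) |u u' v.
       u \<in> carrier M \<and> u' \<in> carrier M \<and> v \<in> carrier N} \<union>
    {e (u, v \<oplus>\<^bsub>N\<^esub> v') \<ominus>\<^bsub>F\<^esub> (e (u, v) \<oplus>\<^bsub>F\<^esub> e (u, v')) |u v v'.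
       u \<in> carrier M \<and> v \<in> carrier N \<and> v' \<in> carrier N} \<union>
    {e (r \<odot>\<^bsub>M\<^esub> u, v) \<ominus>\<^bsub>F\<^esub> (r \<odot>\<^bsub>F\<^esub> e (u, v)) |r u v.
       r \<in> carrier R \<and> u \<in> carrier M \<and> v \<in> carrier N} \<union>
    {e (u, r \<odot>\<^bsub>N\<^esub> v) \<ominus>\<^bsub>F\<^esub> (r \<odot>\<^bsub>F\<^esub> e (u, v)) |r u v.
       r \<in> carrier R \<and> u \<in> carrier M \<and> v \<in> carrier N})"

definition tensor_null ::
  "('r, 'l) ring_scheme \<Rightarrow> ('r, 'm, 'b) module_scheme \<Rightarrow> ('r, 'n, 'c) module_scheme
    \<Rightarrow> ('m \<times> 'n \<Rightarrow> 'r) set"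
  where "tensor_null R M N =
    module_span R (free_module R (carrier M \<times> carrier N)) (tensor_relations R M N)"

definition tensor ::
  "('r, 'l) ring_scheme \<Rightarrow> ('r, 'm, 'b) module_scheme \<Rightarrow> ('r, 'n, 'c) module_scheme
    \<Rightarrow> ('r, ('m \<times> 'n \<Rightarrow> 'r) set) module"
  where "tensor R M N = quot_module (free_module R (carrier M \<times> carrier N)) (tensor_null R M N)"

definition pure_tensor ::
  "('r, 'l) ring_scheme \<Rightarrow> ('r, 'm, 'b) module_scheme \<Rightarrow> ('r, 'n, 'c) module_scheme
    \<Rightarrow> 'm \<Rightarrow> 'n \<Rightarrow> ('m \<times> 'n \<Rightarrow> 'r) set"
  where "pure_tensor R M N u v =
    tensor_null R M N +>\<^bsub>free_module R (carrier M \<times> carrier N)\<^esub> free_gen R (u, v)"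


subsection \<open>Symmetric algebras\<close>

text \<open>Polynomials in the variables \<open>V\<close>: the monomials are the finite multisets of variables.\<close>

definition polynomial_algebra ::
  "('k, 'l) ring_scheme \<Rightarrow> 'v set \<Rightarrow> ('k, 'v multiset \<Rightarrow> 'k) module"
  where "polynomial_algebra K V = (free_module K {w. set_mset w \<subseteq> V})
    \<lparr>mult := (\<lambda>f g w. \<Oplus>\<^bsub>K\<^esub>u\<in>{u. u \<subseteq># w}. f u \<otimes>\<^bsub>K\<^esub> g (w - u)),
     one := free_gen K {#}\<rparr>"

definition symmetric_relations ::
  "('k, 'l) ring_scheme \<Rightarrow> ('k, 'v, 'b) module_scheme \<Rightarrow> ('v multiset \<Rightarrow> 'k) set"
  where "symmetric_relations K V =
    (let P = polynomial_algebra K (carrier V); X = (\<lambda>v. free_gen K {#v#}) in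
    {X (u \<oplus>\<^bsub>V\<^esub> v) \<ominus>\<^bsub>P\<^esub> (X u \<oplus>\<^bsub>P\<^esub> X v) |u v. u \<in> carrier V \<and> v \<in> carrier V} \<union>
    {X (c \<odot>\<^bsub>V\<^esub> v) \<ominus>\<^bsub>P\<^esub> (c \<odot>\<^bsub>P\<^esub> X v) |c v. c \<in> carrier K \<and> v \<in> carrier V})"

definition symmetric_algebra ::
  "('k, 'l) ring_scheme \<Rightarrow> ('k, 'v, 'b) module_scheme \<Rightarrow> ('k, ('v multiset \<Rightarrow> 'k) set) module"
  where "symmetric_algebra K V = quot_module (polynomial_algebra K (carrier V))
    (Idl\<^bsub>polynomial_algebra K (carrier V)\<^esub> (symmetric_relations K V))"

definition symmetric_incl ::
  "('k, 'l) ring_scheme \<Rightarrow> ('k, 'v, 'b) module_scheme \<Rightarrow> 'v \<Rightarrow> ('v multiset \<Rightarrow> 'k) set"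
  where "symmetric_incl K V v =
    Idl\<^bsub>polynomial_algebra K (carrier V)\<^esub> (symmetric_relations K V)
      +>\<^bsub>polynomial_algebra K (carrier V)\<^esub> free_gen K {#v#}"


subsection \<open>The associated graded algebra\<close>

definition graded_piece :: "('k, 'a, 'b) module_scheme \<Rightarrow> 'a set \<Rightarrow> nat \<Rightarrow> ('k, 'a set) module"
  where "graded_piece A m d =
    quot_module (A\<lparr>carrier := ideal_power A m d\<rparr>) (ideal_power A m (Suc d))"

definition associated_graded :: "('k, 'a, 'b) module_scheme \<Rightarrow> 'a set \<Rightarrow> ('k, nat \<Rightarrow> 'a set) module"
  where "associated_graded A m = \<lparr>
    carrier = {g. (\<forall>d. g d \<in> carrier (graded_piece A m d)) \<and>
                  finite {d. g d \<noteq> \<zero>\<^bsub>graded_piece A m d\<^esub>}},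
    mult = (\<lambda>g h d. \<Oplus>\<^bsub>graded_piece A m d\<^esub>i\<in>{..d}.
              [mod ideal_power A m (Suc d):] (g i) \<Otimes>\<^bsub>A\<^esub> (h (d - i))),
    one = (\<lambda>d. if d = 0 then ideal_power A m 1 +>\<^bsub>A\<^esub> \<one>\<^bsub>A\<^esub> else \<zero>\<^bsub>graded_piece A m d\<^esub>),
    zero = (\<lambda>d. \<zero>\<^bsub>graded_piece A m d\<^esub>),
    add = (\<lambda>g h d. g d \<oplus>\<^bsub>graded_piece A m d\<^esub> h d),
    smult = (\<lambda>c g d. c \<odot>\<^bsub>graded_piece A m d\<^esub> g d)\<rparr>"

abbreviation cotangent :: "('k, 'a, 'b) module_scheme \<Rightarrow> 'a set \<Rightarrow> ('k, 'a set) module"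
  where "cotangent A m \<equiv> graded_piece A m 1"

definition in_degree_one :: "('k, 'a, 'b) module_scheme \<Rightarrow> 'a set \<Rightarrow> 'a set \<Rightarrow> nat \<Rightarrow> 'a set"
  where "in_degree_one A m v = (\<lambda>d. if d = 1 then v else \<zero>\<^bsub>graded_piece A m d\<^esub>)"


section \<open>Regular differential local algebras\<close>

text \<open>\<open>local_generators K A \<Delta> der xs p\<close>: \<open>p\<close> is a prime differential ideal of
  \<open>B = K{xs}\<close>, taken inside \<open>A\<close>, and the canonical map from \<open>B\<^sub>p\<close> to \<open>A\<close> exists and
  is bijective (see \<^const>\<open>fractions_in\<close>).\<close>

definition local_generators ::
  "('k, 'l) ring_scheme \<Rightarrow> ('k, 'a, 'b) module_scheme \<Rightarrow> 'd set \<Rightarrow> ('d \<Rightarrow> 'a \<Rightarrow> 'a)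
    \<Rightarrow> 'a list \<Rightarrow> 'a set \<Rightarrow> bool"
  where "local_generators K A \<Delta> der xs p \<longleftrightarrow>
    (let B = diff_generate K A \<Delta> der xs in
      set xs \<subseteq> carrier A \<and>
      primeideal p (A\<lparr>carrier := B\<rparr>) \<and> (\<forall>i\<in>\<Delta>. der i ` p \<subseteq> p) \<and>
      B - p \<subseteq> Units A \<and> carrier A = fractions_in A B (B - p))"

definition local_upto ::
  "('k, 'l) ring_scheme \<Rightarrow> ('k, 'a, 'b) module_scheme \<Rightarrow> 'd set \<Rightarrow> ('d \<Rightarrow> 'a \<Rightarrow> 'a)
    \<Rightarrow> 'a list \<Rightarrow> 'a set \<Rightarrow> nat \<Rightarrow> 'a set"
  where "local_upto K A \<Delta> der xs p t =
    (let B\<^sub>t = generate_upto K A \<Delta> der xs t; p\<^sub>t = B\<^sub>t \<inter> p in fractions_in A B\<^sub>t (B\<^sub>t - p\<^sub>t))"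

abbreviation residue_module :: "('k, 'a, 'b) module_scheme \<Rightarrow> 'a set \<Rightarrow> ('a, 'a set) module"
  where "residue_module A m \<equiv> quot_module (self_module A) m"

text \<open>For a \<open>K\<close>-subalgebra \<open>S\<close> of \<open>A\<close>, the module
  \<open>A/m \<otimes>\<^bsub>S\<^esub> \<Omega>\<^bsub>S/K\<^esub>\<close> and its element \<open>u \<otimes> da\<close>.\<close>

definition residue_kaehler ::
  "('k, 'l) ring_scheme \<Rightarrow> ('k, 'a, 'b) module_scheme \<Rightarrow> 'a set \<Rightarrow> 'a set
    \<Rightarrow> ('a, ('a set \<times> ('a \<Rightarrow> 'a) set \<Rightarrow> 'a) set) module"
  where "residue_kaehler K A m S =
    tensor (A\<lparr>carrier := S\<rparr>) (residue_module A m) (kaehler K (A\<lparr>carrier := S\<rparr>))"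

definition residue_d ::
  "('k, 'l) ring_scheme \<Rightarrow> ('k, 'a, 'b) module_scheme \<Rightarrow> 'a set \<Rightarrow> 'a set
    \<Rightarrow> 'a set \<Rightarrow> 'a \<Rightarrow> ('a set \<times> ('a \<Rightarrow> 'a) set \<Rightarrow> 'a) set"
  where "residue_d K A m S u a =
    pure_tensor (A\<lparr>carrier := S\<rparr>) (residue_module A m) (kaehler K (A\<lparr>carrier := S\<rparr>))
      u (kaehler_d K (A\<lparr>carrier := S\<rparr>) a)"

text \<open>The natural map is additive and sends \<open>u \<otimes> da\<close> to \<open>u \<otimes> da\<close>.  As the elements
  \<open>u \<otimes> da\<close> generate the source as an abelian group, this determines it.\<close>

definition is_natural_map ::
  "('k, 'l) ring_scheme \<Rightarrow> ('k, 'a, 'b) module_scheme \<Rightarrow> 'a set \<Rightarrow> 'a set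
    \<Rightarrow> (('a set \<times> ('a \<Rightarrow> 'a) set \<Rightarrow> 'a) set \<Rightarrow> ('a set \<times> ('a \<Rightarrow> 'a) set \<Rightarrow> 'a) set) \<Rightarrow> bool"
  where "is_natural_map K A m S \<phi> \<longleftrightarrow>
    \<phi> \<in> module_homs (A\<lparr>carrier := S\<rparr>) (residue_kaehler K A m S) (residue_kaehler K A m (carrier A)) \<and>
    (\<forall>u\<in>carrier (residue_module A m). \<forall>a\<in>S.
      \<phi> (residue_d K A m S u a) = residue_d K A m (carrier A) u a)"

definition regular_local_generators ::
  "('k, 'l) ring_scheme \<Rightarrow> ('k, 'a, 'b) module_scheme \<Rightarrow> 'a set \<Rightarrow> 'd set \<Rightarrow> ('d \<Rightarrow> 'a \<Rightarrow> 'a)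
    \<Rightarrow> 'a list \<Rightarrow> bool"
  where "regular_local_generators K A m \<Delta> der xs \<longleftrightarrow>
    (\<exists>p. local_generators K A \<Delta> der xs p \<and>
      (\<forall>r. \<exists>\<phi>. is_natural_map K A m (local_upto K A \<Delta> der xs p r) \<phi> \<and>
        inj_on \<phi> (carrier (residue_kaehler K A m (local_upto K A \<Delta> der xs p r)))))"

text \<open>The symmetric algebra is taken over the base field \<open>K\<close>, so in degree 0 the condition on
  \<open>\<tau>\<close> says that \<open>K \<rightarrow> A/m\<close> is bijective.  The homomorphism \<open>\<tau>\<close> is uniquely
  determined by its values on \<open>m/m\<^sup>2\<close>.\<close>

definition regular_differential_local_algebra ::
  "('k, 'l) ring_scheme \<Rightarrow> ('k, 'a, 'b) module_scheme \<Rightarrow> 'a set \<Rightarrow> 'd set \<Rightarrow> ('d \<Rightarrow> 'a \<Rightarrow> 'a) \<Rightarrow> bool"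
  where "regular_differential_local_algebra K A m \<Delta> der \<longleftrightarrow>
    (\<exists>\<tau>. \<tau> \<in> algebra_homs K (symmetric_algebra K (cotangent A m)) (associated_graded A m) \<and>
      (\<forall>v\<in>carrier (cotangent A m). \<tau> (symmetric_incl K (cotangent A m) v) = in_degree_one A m v) \<and>
      bij_betw \<tau> (carrier (symmetric_algebra K (cotangent A m))) (carrier (associated_graded A m))) \<and>
    (\<exists>xs. regular_local_generators K A m \<Delta> der xs)"

text \<open>The natural map from \<open>m/m\<^sup>2\<close> to \<open>A/m \<otimes>\<^bsub>A\<^esub> \<Omega>\<^bsub>A/K\<^esub>\<close> induced by
  \<open>u \<mapsto> 1 \<otimes> du\<close>; the union is over representatives of the same coset.\<close>

definition cotangent_map ::
  "('k, 'l) ring_scheme \<Rightarrow> ('k, 'a, 'b) module_scheme \<Rightarrow> 'a set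
    \<Rightarrow> 'a set \<Rightarrow> ('a set \<times> ('a \<Rightarrow> 'a) set \<Rightarrow> 'a) set"
  where "cotangent_map K A m C =
    (\<Union>u\<in>C. residue_d K A m (carrier A) \<one>\<^bsub>residue_module A m\<^esub> u)"

definition dx_bar ::
  "('k, 'l) ring_scheme \<Rightarrow> ('k, 'a, 'b) module_scheme \<Rightarrow> 'a set \<Rightarrow> 'a \<Rightarrow> 'a set"
  where "dx_bar K A m a = inv_into (carrier (cotangent A m)) (cotangent_map K A m)
    (residue_d K A m (carrier A) \<one>\<^bsub>residue_module A m\<^esub> a)"


section \<open>The characteristic functions\<close>

definition chi_algebra ::
  "('k, 'l) ring_scheme \<Rightarrow> ('k, 'a, 'b) module_scheme \<Rightarrow> 'd set \<Rightarrow> ('d \<Rightarrow> 'a \<Rightarrow> 'a) \<Rightarrow> 'a list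
    \<Rightarrow> nat \<Rightarrow> enat"
  where "chi_algebra K B \<Delta> der xs t = krull_dim (B\<lparr>carrier := generate_upto K B \<Delta> der xs t\<rparr>)"

definition chi_local ::
  "('k, 'l) ring_scheme \<Rightarrow> ('k, 'a, 'b) module_scheme \<Rightarrow> 'd set \<Rightarrow> ('d \<Rightarrow> 'a \<Rightarrow> 'a) \<Rightarrow> 'a list
    \<Rightarrow> 'a set \<Rightarrow> nat \<Rightarrow> enat"
  where "chi_local K A \<Delta> der xs p t = krull_dim (A\<lparr>carrier := local_upto K A \<Delta> der xs p t\<rparr>)"

text \<open>For a family \<open>vs\<close> in \<open>m/m\<^sup>2\<close>, the dimension of the \<open>K\<close>-span of the derivatives of
  \<open>vs\<close> up to order \<open>t\<close>, computed with the library's notion of dimension over a subfield in the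
  \<open>K\<close>-algebra \<open>A/m\<^sup>2\<close> that contains \<open>m/m\<^sup>2\<close>.\<close>

definition chi_cotangent ::
  "('k, 'l) ring_scheme \<Rightarrow> ('k, 'a, 'b) module_scheme \<Rightarrow> 'a set \<Rightarrow> 'd set \<Rightarrow> ('d \<Rightarrow> 'a \<Rightarrow> 'a)
    \<Rightarrow> 'a set list \<Rightarrow> nat \<Rightarrow> enat"
  where "chi_cotangent K A m \<Delta> der vs t =
    (let I = ideal_power A m 2; Q = quot_module A I in
      enat (ring.dim Q (scalars K Q)
        (module_span K (cotangent A m) (derivatives_upto \<Delta> (quot_der A I der) vs t))))"

end

theory Submission
  imports Defs "HOL-Library.Multiset_Order"
begin

text \<open>
  Fix an order \<open>t\<close>, and let \<open>B\<^sub>t\<close>, \<open>A\<^sub>t\<close> and \<open>M\<^sub>t\<close> be the algebra, its localization and the subspace of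
  \<open>m/m\<^sup>2\<close> that belong to the derivatives up to order \<open>t\<close>.  All three characteristic functions are compared
  with \<open>e = dim M\<^sub>t\<close>.

  In degree 0 the isomorphism \<open>\<tau>\<close> of regularity says \<open>A = K + m\<close>.  So \<open>B/p = K\<close>, whose dimension is 0
  (\<open>residue_dimension\<close>), and every \<open>a\<close> is a scalar \<open>eps a\<close> plus \<open>dm a \<in> m\<close>.  The assignment
  \<open>u \<otimes> da \<mapsto> eps(u) \<cdot> dm(a)\<close> is compatible with the relations of differentials and tensors modulo the
  square of the maximal ideal, for \<open>A\<close> and for every \<open>K\<close>-subalgebra (\<open>lam_tn\<close>).  It inverts
  \<open>m/m\<^sup>2 \<rightarrow> A/m \<otimes> \<Omega>\<^bsub>A/K\<^esub>\<close> (\<open>cotangent_map_bij\<close>), and \<open>dx\<close> is the class of \<open>dm x\<close>, so that \<open>M\<^sub>t\<close> is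
  spanned by the classes of the \<open>dm z\<close> with \<open>z\<close> a derivative of order at most \<open>t\<close>.  The injectivity of
  the natural maps becomes \<open>m\<^sub>t \<inter> m\<^sup>2 = m\<^sub>t\<^sup>2\<close> for the maximal ideal \<open>m\<^sub>t\<close> of \<open>A\<^sub>t\<close> (\<open>natural_map_injective\<close>).  Hence elements
  \<open>y\<^sub>1, \<dots>, y\<^sub>e\<close> of \<open>B\<^sub>t \<inter> m\<close> that give a basis of \<open>M\<^sub>t\<close> generate \<open>m\<^sub>t\<close> modulo its square
  (\<open>generators_span\<close>).

  The injectivity of \<open>\<tau>\<close> makes the \<open>y\<^sub>i\<close> analytically independent: a form of degree \<open>d\<close> in them that lies
  in \<open>m\<^bsup>d+1\<^esup>\<close> is zero (\<open>forms_independent\<close>).  The ring \<open>A\<^sub>t\<close> is Noetherian by Hilbert's basis theorem, so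
  by Krull's intersection theorem each nonzero element has an initial form in the \<open>y\<^sub>i\<close>, and \<open>A\<^sub>t\<close> is a
  domain (\<open>S_integral\<close>).  This gives \<open>e \<le> dim A\<^sub>t \<le> dim B\<^sub>t \<le> e\<close> (\<open>krull_dims\<close>), in which the inequality in
  the middle is the contraction of primes.

  For the lower bound, Coquand and Lombardi's elementary characterization of the dimension is used: an
  algebraic identity that would exclude a chain of primes built from the \<open>y\<^sub>i\<close> has a lexicographically
  first monomial with coefficient 1, which contradicts independence.  For the upper bound, a chain of \<open>l\<close>
  inclusions of primes in \<open>B\<^sub>t\<close> yields \<open>l\<close> algebraically independent elements.  In characteristic 0
  derivations extend along finitely generated domains up to a common denominator, so for \<open>l > e\<close> some
  nonzero \<open>K\<close>-derivation \<open>D\<close> of \<open>B\<^sub>t\<close> kills all \<open>y\<^sub>i\<close>.  But the ideal \<open>N\<close> of \<open>A\<^sub>t\<close> generated by the values of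
  \<open>D\<close> satisfies \<open>N \<subseteq> m\<^sub>t N\<close>, because \<open>m\<^sub>t\<close> is generated by the \<open>y\<^sub>i\<close> modulo its square, and Nakayama's
  lemma gives \<open>N = 0\<close>.
\<close>

section \<open>Noetherian rings\<close>

text \<open>The Noetherian condition as a maximality principle for arbitrary families of ideals: each later
  use picks an ideal that is maximal with some property.\<close>

definition ideal_acc :: "('a, 'b) ring_scheme \<Rightarrow> bool"
  where "ideal_acc R \<longleftrightarrow> (\<forall>C. C \<noteq> {} \<and> (\<forall>I\<in>C. ideal I R) \<longrightarrow> (\<exists>M\<in>C. \<forall>I\<in>C. M \<subseteq> I \<longrightarrow> I = M))"

text \<open>Ideals of a subring, expressed without the modified record.\<close>

definition ideal_in :: "('a, 'b) ring_scheme \<Rightarrow> 'a set \<Rightarrow> 'a set \<Rightarrow> bool"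
  where "ideal_in R S J \<longleftrightarrow> J \<subseteq> S \<and> \<zero>\<^bsub>R\<^esub> \<in> J \<and> (\<forall>a\<in>J. \<forall>b\<in>J. a \<oplus>\<^bsub>R\<^esub> b \<in> J) \<and>
    (\<forall>s\<in>S. \<forall>a\<in>J. s \<otimes>\<^bsub>R\<^esub> a \<in> J)"

lemma (in cring) subring_cring: "subring S R ==> cring (R\<lparr>carrier := S\<rparr>)"
  using subcring_iff[of S] subcringI'[of S] subringE(1) by blast

lemma (in cring) ideal_in_iff:
  assumes S: "subring S R"
  shows "ideal J (R\<lparr>carrier := S\<rparr>) \<longleftrightarrow> ideal_in R S J"
proof
  interpret T: cring "R\<lparr>carrier := S\<rparr>" by (rule subring_cring[OF S])
  assume J: "ideal J (R\<lparr>carrier := S\<rparr>)"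
  interpret J: ideal J "R\<lparr>carrier := S\<rparr>" by (rule J)
  show "ideal_in R S J"
    unfolding ideal_in_def using J.a_subset J.zero_closed J.a_closed J.I_l_closed by auto
next
  interpret T: cring "R\<lparr>carrier := S\<rparr>" by (rule subring_cring[OF S])
  assume J: "ideal_in R S J"
  note SR = subringE[OF S]
  have neg: "\<ominus> a \<in> J" if "a \<in> J" for a
  proof -
    have "a \<in> carrier R" using that J SR(1) unfolding ideal_in_def by auto
    hence "\<ominus> a = (\<ominus> \<one>) \<otimes> a" by (simp add: l_minus)
    moreover have "\<ominus> \<one> \<in> S" using SR(3,5) by blast
    ultimately show ?thesis using J that unfolding ideal_in_def by auto
  qed
  have inv_eq: "inv\<^bsub>add_monoid (R\<lparr>carrier := S\<rparr>)\<^esub> a = \<ominus> a" if "a \<in> S" for a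
  proof (rule T.add.inv_equality[unfolded a_inv_def])
    show "\<ominus> a \<oplus>\<^bsub>R\<lparr>carrier := S\<rparr>\<^esub> a = \<zero>\<^bsub>R\<lparr>carrier := S\<rparr>\<^esub>"
      using that SR(1) by (simp add: l_neg subsetD)
  qed (use that SR(5) in auto)
  show "ideal J (R\<lparr>carrier := S\<rparr>)"
  proof (rule idealI)
    show "subgroup J (add_monoid (R\<lparr>carrier := S\<rparr>))"
      using J neg inv_eq unfolding ideal_in_def by (unfold_locales) auto
  next
    fix a s assume as: "a \<in> J" "s \<in> carrier (R\<lparr>carrier := S\<rparr>)"
    have "a \<in> carrier R" "s \<in> carrier R" using as J SR(1) unfolding ideal_in_def by auto
    moreover have "s \<otimes> a \<in> J" using J as unfolding ideal_in_def by auto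
    ultimately show "s \<otimes>\<^bsub>R\<lparr>carrier := S\<rparr>\<^esub> a \<in> J" "a \<otimes>\<^bsub>R\<lparr>carrier := S\<rparr>\<^esub> s \<in> J"
      by (auto simp: m_comm[of a s])
  qed (rule T.ring_axioms)
qed

subsection \<open>Polynomial expressions in one element\<close>

primrec (in ring) horner :: "'a \<Rightarrow> 'a list \<Rightarrow> 'a"
  where "horner x [] = \<zero>"
  | "horner x (c # cs) = c \<oplus> x \<otimes> horner x cs"

fun (in ring) list_add :: "'a list \<Rightarrow> 'a list \<Rightarrow> 'a list"
  where "list_add [] ds = ds"
  | "list_add cs [] = cs"
  | "list_add (c # cs) (d # ds) = (c \<oplus> d) # list_add cs ds"

context cring
begin

lemma list_add_Nil2 [simp]: "list_add cs [] = cs"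
  by (cases cs) auto

lemma horner_closed [simp, intro]:
  "\<lbrakk>x \<in> carrier R; set cs \<subseteq> carrier R\<rbrakk> \<Longrightarrow> horner x cs \<in> carrier R"
  by (induction cs) auto

lemma set_list_add:
  assumes "subring S R" "set cs \<subseteq> S" "set ds \<subseteq> S"
  shows "set (list_add cs ds) \<subseteq> S"
  using assms(2,3) by (induction cs ds rule: list_add.induct) (auto intro: subringE(7)[OF assms(1)])

lemma length_list_add: "length (list_add cs ds) = max (length cs) (length ds)"
  by (induction cs ds rule: list_add.induct) auto

lemma last_list_add:
  "length cs = length ds ==> cs \<noteq> [] ==> last (list_add cs ds) = last cs \<oplus> last ds"
proof (induction cs ds rule: list_add.induct)
  case (3 c cs d ds)
  thus ?case by (cases cs; cases ds) auto
qed auto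

lemma horner_list_add:
  assumes "x \<in> carrier R" "set cs \<subseteq> carrier R" "set ds \<subseteq> carrier R"
  shows "horner x (list_add cs ds) = horner x cs \<oplus> horner x ds"
  using assms(2,3)
proof (induction cs ds rule: list_add.induct)
  case (3 c cs d ds)
  hence c: "c \<in> carrier R" "d \<in> carrier R" "horner x cs \<in> carrier R" "horner x ds \<in> carrier R"
    and IH: "horner x (list_add cs ds) = horner x cs \<oplus> horner x ds"
    using assms(1) by auto
  show ?case unfolding list_add.simps horner.simps IH using c assms(1) by algebra
qed (use assms in auto)

lemma horner_smult:
  assumes "x \<in> carrier R" "set cs \<subseteq> carrier R" "a \<in> carrier R"
  shows "horner x (map ((\<otimes>) a) cs) = a \<otimes> horner x cs"
  using assms(2)
proof (induction cs)
  case (Cons c cs)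
  hence c: "c \<in> carrier R" "horner x cs \<in> carrier R"
    and IH: "horner x (map ((\<otimes>) a) cs) = a \<otimes> horner x cs"
    using assms(1) by auto
  show ?case unfolding list.map horner.simps IH using c assms(1,3) by algebra
qed (use assms in auto)

lemma horner_snoc_zero:
  assumes "x \<in> carrier R" "set cs \<subseteq> carrier R"
  shows "horner x (cs @ [\<zero>]) = horner x cs"
  using assms(2) by (induction cs) (use assms(1) in auto)

lemma horner_add_last:
  assumes "x \<in> carrier R" "set cs \<subseteq> carrier R" "r \<in> carrier R"
  shows "horner x (cs @ [r]) = horner x cs \<oplus> horner x (replicate (length cs) \<zero> @ [r])"
  using assms(2)
proof (induction cs)
  case (Cons c cs)
  hence c: "c \<in> carrier R" "horner x cs \<in> carrier R"
     "horner x (replicate (length cs) \<zero> @ [r]) \<in> carrier R"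
    and IH: "horner x (cs @ [r]) = horner x cs \<oplus> horner x (replicate (length cs) \<zero> @ [r])"
    using assms(1,3) by (auto intro!: horner_closed)
  show ?case unfolding append_Cons horner.simps IH length_Cons replicate_Suc using c assms(1,3) by algebra
qed (use assms in auto)

lemma set_smult:
  assumes "subring S R" "set cs \<subseteq> S" "a \<in> S"
  shows "set (map ((\<otimes>) a) cs) \<subseteq> S"
  using assms subringE(6) by (metis (no_types, lifting) image_subset_iff list.set_map subsetD)

text \<open>The subring usually denoted by \<open>S[x]\<close>.\<close>

definition adjoin :: "'a set \<Rightarrow> 'a \<Rightarrow> 'a set"
  where "adjoin S x = {horner x cs |cs. set cs \<subseteq> S}"

lemma adjoinI: "set cs \<subseteq> S ==> horner x cs \<in> adjoin S x"
  by (auto simp: adjoin_def)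

lemma adjoin_incl:
  assumes "subring S R" "x \<in> carrier R"
  shows "S \<subseteq> adjoin S x" "x \<in> adjoin S x"
proof
  fix s assume "s \<in> S"
  thus "s \<in> adjoin S x" using adjoinI[of "[s]" S x] assms subringE(1)[OF assms(1)] by (auto simp: subsetD)
next
  show "x \<in> adjoin S x" using adjoinI[of "[\<zero>,\<one>]" S x] assms subringE(2,3)[OF assms(1)] by auto
qed

lemma subring_adjoin:
  assumes S: "subring S R" and x: "x \<in> carrier R"
  shows "subring (adjoin S x) R"
proof (rule subringI)
  note SR = subringE[OF S]
  show sub: "adjoin S x \<subseteq> carrier R" unfolding adjoin_def using x SR(1) by auto
  show "\<one> \<in> adjoin S x" using adjoin_incl(1)[OF S x] SR(3) by blast
  have smult: "a \<otimes> h \<in> adjoin S x" if ah: "a \<in> S" "h \<in> adjoin S x" for a h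
  proof -
    obtain cs where cs: "h = horner x cs" "set cs \<subseteq> S" using ah(2) by (auto simp: adjoin_def)
    hence "a \<otimes> h = horner x (map ((\<otimes>) a) cs)" using horner_smult[OF x order_trans[OF cs(2) SR(1)], of a] SR(1) ah(1) by auto
    thus ?thesis using adjoinI[OF set_smult[OF S cs(2) ah(1)]] by simp
  qed
  show add: "h \<oplus> k \<in> adjoin S x" if hk: "h \<in> adjoin S x" "k \<in> adjoin S x" for h k
  proof -
    obtain cs ds where cs: "h = horner x cs" "set cs \<subseteq> S" "k = horner x ds" "set ds \<subseteq> S"
      using hk by (auto simp: adjoin_def)
    hence "h \<oplus> k = horner x (list_add cs ds)" using horner_list_add[OF x order_trans[OF cs(2) SR(1)] order_trans[OF cs(4) SR(1)]] by simp
    thus ?thesis using adjoinI[OF set_list_add[OF S cs(2,4)]] by simp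
  qed
  show "\<ominus> h \<in> adjoin S x" if h: "h \<in> adjoin S x" for h
  proof -
    have "\<ominus> h = (\<ominus> \<one>) \<otimes> h" using h sub by (simp add: l_minus subsetD)
    thus ?thesis using smult[OF _ h] SR(3,5) by auto
  qed
  show "h \<otimes> k \<in> adjoin S x" if hk: "h \<in> adjoin S x" "k \<in> adjoin S x" for h k
  proof -
    obtain cs where cs: "h = horner x cs" "set cs \<subseteq> S" using hk by (auto simp: adjoin_def)
    have "horner x cs \<otimes> k \<in> adjoin S x" using cs(2)
    proof (induction cs)
      case Nil
      thus ?case using adjoinI[of "[]" S x] hk(2) sub by (auto simp: subsetD)
    next
      case (Cons c cs)
      have car: "c \<in> carrier R" "horner x cs \<in> carrier R" "k \<in> carrier R" using Cons.prems SR(1) hk(2) sub x by auto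
      obtain ds where ds: "horner x cs \<otimes> k = horner x ds" "set ds \<subseteq> S" using Cons by (auto simp: adjoin_def)
      have "x \<otimes> (horner x cs \<otimes> k) = horner x (\<zero> # ds)" using ds SR(1) x by auto
      hence "x \<otimes> (horner x cs \<otimes> k) \<in> adjoin S x" using adjoinI[of "\<zero> # ds" S x] ds(2) SR(2) by auto
      hence "c \<otimes> k \<oplus> x \<otimes> (horner x cs \<otimes> k) \<in> adjoin S x" using add smult[OF _ hk(2)] Cons.prems by auto
      moreover have "horner x (c # cs) \<otimes> k = c \<otimes> k \<oplus> x \<otimes> (horner x cs \<otimes> k)"
        unfolding horner.simps using car x by algebra
      ultimately show ?case by simp
    qed
    thus ?thesis using cs by simp
  qed
qed

lemma adjoin_min:
  assumes T: "subring T R" and "S \<subseteq> T" "x \<in> T"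
  shows "adjoin S x \<subseteq> T"
proof
  fix h assume "h \<in> adjoin S x"
  then obtain cs where h: "h = horner x cs" "set cs \<subseteq> S" by (auto simp: adjoin_def)
  have "horner x cs \<in> T" using h(2)
    by (induction cs) (use assms subringE[OF T] in auto)
  thus "h \<in> T" by (simp add: h)
qed

lemma generate_ring_insert:
  assumes H: "H \<subseteq> carrier R" and x: "x \<in> carrier R"
  shows "generate_ring R (insert x H) = adjoin (generate_ring R H) x"
proof
  have S: "subring (generate_ring R H) R" by (rule generate_ring_is_subring[OF H])
  show "generate_ring R (insert x H) \<subseteq> adjoin (generate_ring R H) x"
    using generate_ring_min_subring1[OF _ subring_adjoin[OF S x], of "insert x H"]
      adjoin_incl[OF S x] H x generate_ring.incl[of _ H R] by blast
  show "adjoin (generate_ring R H) x \<subseteq> generate_ring R (insert x H)"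
    using adjoin_min[OF generate_ring_is_subring[of "insert x H"], of "generate_ring R H" x]
      mono_generate_ring[of H "insert x H"] H x by (auto intro: generate_ring.incl)
qed

end

section \<open>The basis theorem\<close>

context cring
begin

text \<open>The leading coefficients of the elements of an ideal of \<open>S[x]\<close> that have an expression of degree \<open>k\<close>.
  As \<open>x\<close> may be algebraic, expressions are not unique.\<close>

definition lead_coeffs :: "'a set \<Rightarrow> 'a \<Rightarrow> 'a set \<Rightarrow> nat \<Rightarrow> 'a set"
  where "lead_coeffs S x J k = {r \<in> S. \<exists>cs. set cs \<subseteq> S \<and> length cs = k \<and> horner x (cs @ [r]) \<in> J}"

lemma lead_coeffs_ideal:
  assumes S: "subring S R" and x: "x \<in> carrier R" and J: "ideal_in R (adjoin S x) J"
  shows "ideal_in R S (lead_coeffs S x J k)"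
  unfolding ideal_in_def
proof (intro conjI ballI)
  note SR = subringE[OF S]
  show "lead_coeffs S x J k \<subseteq> S" unfolding lead_coeffs_def by auto
  have "horner x (replicate n \<zero>) = \<zero>" for n by (induction n) (use x in auto)
  hence "horner x (replicate k \<zero> @ [\<zero>]) \<in> J"
    using J horner_snoc_zero[OF x, of "replicate k \<zero>"] unfolding ideal_in_def by (auto simp: set_replicate_conv_if)
  thus "\<zero> \<in> lead_coeffs S x J k" unfolding lead_coeffs_def using SR(2)
    by (auto intro!: exI[of _ "replicate k \<zero>"])
next
  note SR = subringE[OF S]
  fix a b assume "a \<in> lead_coeffs S x J k" "b \<in> lead_coeffs S x J k"
  then obtain cs ds where cs: "a \<in> S" "set cs \<subseteq> S" "length cs = k" "horner x (cs @ [a]) \<in> J"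
    "b \<in> S" "set ds \<subseteq> S" "length ds = k" "horner x (ds @ [b]) \<in> J" unfolding lead_coeffs_def by auto
  have "list_add (cs @ [a]) (ds @ [b]) = list_add cs ds @ [a \<oplus> b]"
    using cs(3,7) by (induction cs ds arbitrary: k rule: list_add.induct) auto
  moreover have "horner x (list_add (cs @ [a]) (ds @ [b])) \<in> J"
  proof -
    have "set (cs @ [a]) \<subseteq> S" "set (ds @ [b]) \<subseteq> S" using cs by auto
    thus ?thesis
      using J cs(4,8) horner_list_add[OF x order_trans[OF _ SR(1)] order_trans[OF _ SR(1)]] unfolding ideal_in_def by metis
  qed
  ultimately show "a \<oplus> b \<in> lead_coeffs S x J k"
    unfolding lead_coeffs_def using cs SR(7) set_list_add[OF S cs(2,6)] length_list_add[of cs ds]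
    by (auto intro!: exI[of _ "list_add cs ds"])
next
  note SR = subringE[OF S]
  fix s a assume s: "s \<in> S" and "a \<in> lead_coeffs S x J k"
  then obtain cs where cs: "a \<in> S" "set cs \<subseteq> S" "length cs = k" "horner x (cs @ [a]) \<in> J"
    unfolding lead_coeffs_def by auto
  have "s \<in> adjoin S x" using s adjoin_incl(1)[OF S x] by auto
  moreover have "set (cs @ [a]) \<subseteq> S" using cs by auto
  ultimately have "horner x (map ((\<otimes>) s) (cs @ [a])) \<in> J"
    using J cs(4) horner_smult[OF x order_trans[OF _ SR(1)]] SR(1) s unfolding ideal_in_def by (metis subsetD)
  thus "s \<otimes> a \<in> lead_coeffs S x J k"
    unfolding lead_coeffs_def using cs s SR(6) set_smult[OF S cs(2) s]
    by (auto intro!: exI[of _ "map ((\<otimes>) s) cs"])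
qed

lemma lead_coeffs_Suc:
  assumes S: "subring S R" and x: "x \<in> carrier R" and J: "ideal_in R (adjoin S x) J"
    and "k \<le> l"
  shows "lead_coeffs S x J k \<subseteq> lead_coeffs S x J l"
  using \<open>k \<le> l\<close>
proof (induction rule: dec_induct)
  case (step n)
  have "lead_coeffs S x J n \<subseteq> lead_coeffs S x J (Suc n)"
  proof
    fix a assume "a \<in> lead_coeffs S x J n"
    then obtain cs where cs: "a \<in> S" "set cs \<subseteq> S" "length cs = n" "horner x (cs @ [a]) \<in> J"
      unfolding lead_coeffs_def by auto
    have "x \<otimes> horner x (cs @ [a]) \<in> J" using J cs(4) adjoin_incl(2)[OF S x] unfolding ideal_in_def by auto
    moreover have "set (cs @ [a]) \<subseteq> carrier R" using cs(1,2) subringE(1)[OF S] by auto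
    hence "horner x (cs @ [a]) \<in> carrier R" using x by blast
    ultimately have "horner x ((\<zero> # cs) @ [a]) \<in> J" using x by simp
    thus "a \<in> lead_coeffs S x J (Suc n)"
      unfolding lead_coeffs_def using cs subringE(2)[OF S] by (auto intro!: exI[of _ "\<zero> # cs"])
  qed
  thus ?case using step by auto
qed auto

lemma lead_coeffs_mono: "J \<subseteq> J' ==> lead_coeffs S x J k \<subseteq> lead_coeffs S x J' k"
  unfolding lead_coeffs_def by auto

text \<open>Division by leading terms, one degree at a time.\<close>

lemma lead_coeffs_determine:
  assumes S: "subring S R" and x: "x \<in> carrier R"
    and J: "ideal_in R (adjoin S x) J" and J': "ideal_in R (adjoin S x) J'" and "J \<subseteq> J'"
    and eq: "\<And>k. lead_coeffs S x J' k \<subseteq> lead_coeffs S x J k"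
  shows "J' = J"
proof -
  note SR = subringE[OF S]
  have neg: "\<ominus> \<one> \<in> adjoin S x" using adjoin_incl(1)[OF S x] SR(3,5) by auto
  have "horner x cs \<in> J" if "set cs \<subseteq> S" "horner x cs \<in> J'" for cs
    using that
  proof (induction cs rule: length_induct)
    case (1 cs)
    show ?case
    proof (cases cs rule: rev_cases)
      case Nil
      thus ?thesis using J unfolding ideal_in_def by auto
    next
      case (snoc cs' r)
      hence "r \<in> lead_coeffs S x J' (length cs')" using 1(2,3) unfolding lead_coeffs_def by auto
      then obtain ds where ds: "set ds \<subseteq> S" "length ds = length cs'" "horner x (ds @ [r]) \<in> J"
        using eq unfolding lead_coeffs_def by blast
      define es where "es = list_add cs' (map ((\<otimes>) (\<ominus> \<one>)) ds)"
      have cs': "set cs' \<subseteq> S" "r \<in> S" using 1(2) snoc by auto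
      have "set (map ((\<otimes>) (\<ominus> \<one>)) ds) \<subseteq> S" using set_smult[OF S ds(1)] SR(3,5) by auto
      hence es: "set es \<subseteq> S" "length es < length cs"
        unfolding es_def using set_list_add[OF S cs'(1)] ds(2) snoc by (auto simp: length_list_add)
      note car = order_trans[OF ds(1) SR(1)] order_trans[OF cs'(1) SR(1)] subsetD[OF SR(1) cs'(2)]
      have mcar: "set (map ((\<otimes>) (\<ominus> \<one>)) ds) \<subseteq> carrier R" using car(1) by auto
      define t where "t = horner x (replicate (length cs') \<zero> @ [r])"
      have tc: "t \<in> carrier R" unfolding t_def using x car by (intro horner_closed) auto
      have e1: "horner x es = horner x cs' \<oplus> (\<ominus> \<one>) \<otimes> horner x ds"
        unfolding es_def horner_list_add[OF x car(2) mcar] using horner_smult[OF x car(1)] by simp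
      have e2: "horner x cs = horner x cs' \<oplus> t" unfolding snoc t_def by (rule horner_add_last[OF x car(2,3)])
      have e3: "horner x (ds @ [r]) = horner x ds \<oplus> t" unfolding t_def
        using horner_add_last[OF x car(1,3)] ds(2) by simp
      have hc: "horner x cs' \<in> carrier R" "horner x ds \<in> carrier R" using x car by auto
      have e4: "horner x es = horner x cs \<oplus> (\<ominus> \<one>) \<otimes> horner x (ds @ [r])"
        unfolding e1 e2 e3 using hc tc by algebra
      have "horner x es \<in> J'" unfolding e4 using 1(3) J' neg ds(3) \<open>J \<subseteq> J'\<close> unfolding ideal_in_def by auto
      hence "horner x es \<in> J" using 1(1) es by auto
      hence "horner x es \<oplus> horner x (ds @ [r]) \<in> J" using J ds(3) unfolding ideal_in_def by auto
      moreover have "horner x es \<oplus> horner x (ds @ [r]) = horner x cs"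
        unfolding e1 e2 e3 using hc tc by algebra
      ultimately show ?thesis by simp
    qed
  qed
  hence "J' \<subseteq> J" using J' unfolding ideal_in_def adjoin_def by blast
  thus ?thesis using \<open>J \<subseteq> J'\<close> by auto
qed

text \<open>Hilbert's basis theorem.  A maximal member of the family is found by first maximizing the ideals of
  leading coefficients; these determine an ideal among its subideals.\<close>

lemma ideal_acc_adjoin:
  assumes S: "subring S R" and x: "x \<in> carrier R" and acc: "ideal_acc (R\<lparr>carrier := S\<rparr>)"
  shows "ideal_acc (R\<lparr>carrier := adjoin S x\<rparr>)"
  unfolding ideal_acc_def ideal_in_iff[OF subring_adjoin[OF S x]]
proof (intro allI impI, elim conjE)
  fix C :: "'a set set" assume ne: "C \<noteq> {}" and C: "\<forall>I\<in>C. ideal_in R (adjoin S x) I"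
  have accS: "\<exists>M\<in>D. \<forall>I\<in>D. M \<subseteq> I \<longrightarrow> I = M" if "D \<noteq> {}" "\<And>I. I \<in> D ==> ideal_in R S I" for D
    using acc that unfolding ideal_acc_def ideal_in_iff[OF S] by blast
  let ?L = "lead_coeffs S x"
  have Lid: "ideal_in R S (?L J k)" if "J \<in> C" for J k
    using lead_coeffs_ideal[OF S x] C that by blast
  have "\<exists>M\<in>{?L J k |J k. J \<in> C}. \<forall>I\<in>{?L J k |J k. J \<in> C}. M \<subseteq> I \<longrightarrow> I = M"
  proof (rule accS)
    show "{?L J k |J k. J \<in> C} \<noteq> {}" using ne by blast
    show "ideal_in R S I" if "I \<in> {?L J k |J k. J \<in> C}" for I using that Lid by blast
  qed
  then obtain J0 k0 where J0: "J0 \<in> C"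
    and "\<forall>I\<in>{?L J k |J k. J \<in> C}. ?L J0 k0 \<subseteq> I \<longrightarrow> I = ?L J0 k0" by blast
  hence max: "\<And>J k. J \<in> C ==> ?L J0 k0 \<subseteq> ?L J k ==> ?L J k = ?L J0 k0" by blast
  have "\<exists>J1\<in>C. J0 \<subseteq> J1 \<and> (\<forall>J\<in>C. J1 \<subseteq> J \<longrightarrow> (\<forall>k<n. ?L J k = ?L J1 k))" for n
  proof (induction n)
    case 0
    show ?case using J0 by auto
  next
    case (Suc n)
    then obtain J1 where C1: "J1 \<in> C" and J1': "J0 \<subseteq> J1 \<and> (\<forall>J\<in>C. J1 \<subseteq> J \<longrightarrow> (\<forall>k<n. ?L J k = ?L J1 k))"
      by (rule bexE)
    from J1' have J1: "J1 \<in> C" "J0 \<subseteq> J1" "\<And>J k. J \<in> C ==> J1 \<subseteq> J ==> k < n ==> ?L J k = ?L J1 k"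
      using C1 conjunct2[OF J1', THEN bspec, THEN mp, THEN spec, THEN mp] by blast+
    have "\<exists>M\<in>{?L J n |J. J \<in> C \<and> J1 \<subseteq> J}. \<forall>I\<in>{?L J n |J. J \<in> C \<and> J1 \<subseteq> J}. M \<subseteq> I \<longrightarrow> I = M"
    proof (rule accS)
      show "{?L J n |J. J \<in> C \<and> J1 \<subseteq> J} \<noteq> {}" using C1 by blast
      show "ideal_in R S I" if "I \<in> {?L J n |J. J \<in> C \<and> J1 \<subseteq> J}" for I using that Lid by blast
    qed
    then obtain J2 where J2: "J2 \<in> C" "J1 \<subseteq> J2"
      and max2: "\<forall>I\<in>{?L J n |J. J \<in> C \<and> J1 \<subseteq> J}. ?L J2 n \<subseteq> I \<longrightarrow> I = ?L J2 n" by blast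
    have L2: "?L J k = ?L J2 k" if "J \<in> C" "J2 \<subseteq> J" "k < Suc n" for J k
    proof (cases "k = n")
      case True
      have "?L J n \<in> {?L J n |J. J \<in> C \<and> J1 \<subseteq> J}" using that J2(2) by blast
      thus ?thesis using max2 lead_coeffs_mono[OF that(2), of S x n] True by blast
    next
      case False
      hence "k < n" using that(3) by simp
      thus ?thesis using J1(3)[OF that(1) order_trans[OF J2(2) that(2)]] J1(3)[OF J2] by simp
    qed
    show ?case
      by (intro bexI[OF _ J2(1)] conjI ballI impI allI order_trans[OF J1(2) J2(2)], rule L2)
  qed
  then obtain J1 where C1: "J1 \<in> C" and J1': "J0 \<subseteq> J1 \<and> (\<forall>J\<in>C. J1 \<subseteq> J \<longrightarrow> (\<forall>k<k0. ?L J k = ?L J1 k))"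
    by (elim meta_allE[of _ k0] bexE)
  from J1' have J1: "J1 \<in> C" "J0 \<subseteq> J1"
    "\<And>J k. J \<in> C ==> J1 \<subseteq> J ==> k < k0 ==> ?L J k = ?L J1 k"
    using C1 conjunct2[OF J1', THEN bspec, THEN mp, THEN spec, THEN mp] by blast+
  have top: "?L J k = ?L J0 k0" if "J \<in> C" "J0 \<subseteq> J" "k0 \<le> k" for J k
  proof (rule max[OF that(1)])
    show "?L J0 k0 \<subseteq> ?L J k"
      by (rule order_trans[OF lead_coeffs_mono[OF that(2)] lead_coeffs_Suc[OF S x bspec[OF C that(1)] that(3)]])
  qed
  have "J = J1" if J: "J \<in> C" "J1 \<subseteq> J" for J
  proof (rule lead_coeffs_determine[OF S x])
    show "?L J k \<subseteq> ?L J1 k" for k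
    proof (cases "k < k0")
      case True
      thus ?thesis using J1(3)[OF J] by simp
    next
      case False
      hence "k0 \<le> k" by simp
      thus ?thesis using top[OF J(1) order_trans[OF J1(2) J(2)]] top[OF J1(1,2)] by simp
    qed
  qed (rule bspec[OF C C1] bspec[OF C J(1)] J(2))+
  thus "\<exists>M\<in>C. \<forall>I\<in>C. M \<subseteq> I \<longrightarrow> I = M" by (intro bexI[OF _ J1(1)] ballI impI)
qed

lemma ideal_acc_subfield:
  assumes F: "subfield F R"
  shows "ideal_acc (R\<lparr>carrier := F\<rparr>)"
proof -
  have "field (R\<lparr>carrier := F\<rparr>)" using subfield_iff(2)[OF F] .
  hence I: "I = {\<zero>} \<or> I = F" if "ideal I (R\<lparr>carrier := F\<rparr>)" for I
    using field.all_ideals[of "R\<lparr>carrier := F\<rparr>"] that by auto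
  show ?thesis
    unfolding ideal_acc_def
  proof (intro allI impI, elim conjE)
    fix C assume "C \<noteq> {}" and C: "\<forall>I\<in>C. ideal I (R\<lparr>carrier := F\<rparr>)"
    have sub: "I = {\<zero>} \<or> I = F" if "I \<in> C" for I by (rule I[OF bspec[OF C that]])
    have "\<zero> \<in> F" using subringE(2)[OF subfieldE(1)[OF F]] .
    show "\<exists>M\<in>C. \<forall>I\<in>C. M \<subseteq> I \<longrightarrow> I = M"
    proof (cases "F \<in> C")
      case True
      show ?thesis
      proof (rule bexI[OF _ True], intro ballI impI)
        fix I assume "I \<in> C" "F \<subseteq> I"
        thus "I = F" using sub[of I] \<open>\<zero> \<in> F\<close> by auto
      qed
    next
      case False
      obtain I0 where I0: "I0 \<in> C" using \<open>C \<noteq> {}\<close> by auto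
      have "I = {\<zero>}" if "I \<in> C" for I using sub[OF that] that False by auto
      from this[OF I0] this show ?thesis by (intro bexI[OF _ I0] ballI impI) simp
    qed
  qed
qed

lemma ideal_acc_generate:
  assumes F: "subfield F R" and "finite Z" "Z \<subseteq> carrier R"
  shows "ideal_acc (R\<lparr>carrier := generate_ring R (F \<union> Z)\<rparr>)"
  using assms(2,3)
proof (induction Z)
  case empty
  have "generate_ring R F = F"
    using generate_ringI[of F F] subfieldE(1,3)[OF F] by auto
  thus ?case using ideal_acc_subfield[OF F] by simp
next
  case (insert x Z)
  have FZ: "F \<union> Z \<subseteq> carrier R" using subfieldE(3)[OF F] insert by auto
  have "generate_ring R (F \<union> insert x Z) = adjoin (generate_ring R (F \<union> Z)) x"
    using generate_ring_insert[OF FZ, of x] insert.prems by simp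
  thus ?case using ideal_acc_adjoin[OF generate_ring_is_subring[OF FZ], of x] insert by simp
qed

text \<open>An ideal of a ring of fractions is determined by its contraction.\<close>

lemma ideal_acc_fractions:
  assumes B: "subring B R" and S: "subring S R" and "B \<subseteq> S" and acc: "ideal_acc (R\<lparr>carrier := B\<rparr>)"
    and frac: "\<And>a. a \<in> S ==> \<exists>s\<in>B. \<exists>t\<in>S. s \<otimes> a \<in> B \<and> t \<otimes> (s \<otimes> a) = a"
  shows "ideal_acc (R\<lparr>carrier := S\<rparr>)"
  unfolding ideal_acc_def ideal_in_iff[OF S]
proof (intro allI impI, elim conjE)
  fix C :: "'a set set" assume ne: "C \<noteq> {}" and C: "\<forall>I\<in>C. ideal_in R S I"
  have "ideal_in R B (J \<inter> B)" if "J \<in> C" for J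
  proof -
    note J = bspec[OF C that, unfolded ideal_in_def]
    show ?thesis
      unfolding ideal_in_def using J \<open>B \<subseteq> S\<close> subringE(2,6,7)[OF B] by (intro conjI ballI) auto
  qed
  hence "\<exists>M\<in>(\<lambda>J. J \<inter> B) ` C. \<forall>I\<in>(\<lambda>J. J \<inter> B) ` C. M \<subseteq> I \<longrightarrow> I = M"
    using acc[unfolded ideal_acc_def ideal_in_iff[OF B], THEN spec, THEN mp, of "(\<lambda>J. J \<inter> B) ` C"] ne by simp
  then obtain M' where "M' \<in> (\<lambda>J. J \<inter> B) ` C"
    and max: "\<forall>I\<in>(\<lambda>J. J \<inter> B) ` C. M' \<subseteq> I \<longrightarrow> I = M'" by (rule bexE)
  then obtain M where MC: "M \<in> C" and M': "M' = M \<inter> B" by (auto elim!: imageE)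
  have M: "J \<inter> B = M \<inter> B" if "J \<in> C" "M \<inter> B \<subseteq> J \<inter> B" for J
    using bspec[OF max imageI[OF that(1)]] that(2) unfolding M' by blast
  have "J \<subseteq> M" if J: "J \<in> C" "M \<subseteq> J" for J
  proof
    fix a assume a: "a \<in> J"
    then obtain s t where st: "s \<in> B" "t \<in> S" "s \<otimes> a \<in> B" "t \<otimes> (s \<otimes> a) = a"
      using frac[of a] bspec[OF C J(1), unfolded ideal_in_def] by auto
    have "s \<otimes> a \<in> J \<inter> B" using st(1,3) a bspec[OF C J(1), unfolded ideal_in_def] \<open>B \<subseteq> S\<close> by auto
    hence "s \<otimes> a \<in> M" using M[OF J(1)] J(2) by blast
    hence "t \<otimes> (s \<otimes> a) \<in> M" using st(2) bspec[OF C MC, unfolded ideal_in_def] by auto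
    thus "a \<in> M" using st(4) by simp
  qed
  thus "\<exists>M\<in>C. \<forall>I\<in>C. M \<subseteq> I \<longrightarrow> I = M" by (intro bexI[OF _ MC] ballI impI equalityI)
qed

end

section \<open>Nakayama's lemma and Krull's intersection theorem\<close>

context cring
begin

lemma ideal_power_ideal: "ideal I R ==> ideal (ideal_power R I k) R"
  by (induction k) (auto intro: oneideal ideal_prod_is_ideal)

lemma ideal_prod_mono: "I \<subseteq> I' ==> J \<subseteq> J' ==> I \<cdot> J \<subseteq> I' \<cdot> J'"
proof
  fix a assume "I \<subseteq> I'" "J \<subseteq> J'" "a \<in> I \<cdot> J"
  from this(3) show "a \<in> I' \<cdot> J'"
    by (induction rule: ideal_prod.induct) (use \<open>I \<subseteq> I'\<close> \<open>J \<subseteq> J'\<close> in \<open>auto intro: ideal_prod.intros\<close>)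
qed

lemma ideal_power_mono: "I \<subseteq> J ==> ideal_power R I k \<subseteq> ideal_power R J k"
  by (induction k) (auto intro: ideal_prod_mono[THEN subsetD])

lemma ideal_power_add:
  assumes I: "ideal I R"
  shows "ideal_power R I (a + b) = ideal_power R I a \<cdot> ideal_power R I b"
proof (induction a)
  case 0
  have "carrier R \<cdot> ideal_power R I b = ideal_power R I b \<cdot> carrier R"
    by (rule ideal_prod_commute[OF oneideal ideal_power_ideal[OF I]])
  thus ?case using ideal_prod_one[OF ideal_power_ideal[OF I]] by simp
next
  case (Suc a)
  thus ?case using ideal_prod_assoc[OF I ideal_power_ideal[OF I] ideal_power_ideal[OF I]] by simp
qed

lemma ideal_power_mult:
  assumes I: "ideal I R"
  shows "ideal_power R I (n * r) = ideal_power R (ideal_power R I n) r"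
  by (induction r) (simp_all add: ideal_power_add[OF I])

lemma ideal_power_decreasing:
  assumes I: "ideal I R" and "a \<le> b"
  shows "ideal_power R I b \<subseteq> ideal_power R I a"
  using \<open>a \<le> b\<close>
proof (induction rule: dec_induct)
  case (step n)
  thus ?case using ideal_prod_inter[OF I ideal_power_ideal[OF I, of n]] by auto
qed auto

lemma mem_add_PIdl:
  assumes "ideal Q R" "x \<in> carrier R"
  shows "z \<in> set_add R Q (PIdl x) \<longleftrightarrow> (\<exists>q\<in>Q. \<exists>a\<in>carrier R. z = q \<oplus> a \<otimes> x)"
  unfolding set_add_def' cgenideal_def by auto

lemma ideal_add_PIdl: "ideal Q R ==> x \<in> carrier R ==> ideal (set_add R Q (PIdl x)) R"
  by (rule add_ideals[OF _ cgenideal_ideal])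

lemma add_PIdl_incl:
  assumes Q: "ideal Q R" and x: "x \<in> carrier R"
  shows "Q \<subseteq> set_add R Q (PIdl x)" "x \<in> set_add R Q (PIdl x)"
proof -
  interpret Q: ideal Q R by (rule Q)
  show "Q \<subseteq> set_add R Q (PIdl x)"
  proof
    fix q assume q: "q \<in> Q"
    hence "q = q \<oplus> \<zero> \<otimes> x" using x Q.a_subset by auto
    thus "q \<in> set_add R Q (PIdl x)" using mem_add_PIdl[OF assms] q by blast
  qed
  have "x = \<zero> \<oplus> \<one> \<otimes> x" using x by simp
  thus "x \<in> set_add R Q (PIdl x)" using mem_add_PIdl[OF assms] Q.zero_closed by blast
qed

lemma ideal_power_add_PIdl:
  assumes P: "ideal P R" and x: "x \<in> carrier R"
  shows "ideal_power R (set_add R P (PIdl x)) n \<subseteq> set_add R (ideal_power R P n) (PIdl x)"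
proof (induction n)
  case 0
  show ?case using add_PIdl_incl(1)[OF oneideal x] by simp
next
  case (Suc n)
  let ?Q = "ideal_power R P n"
  have Q: "ideal ?Q R" "ideal (P \<cdot> ?Q) R" using P ideal_power_ideal ideal_prod_is_ideal by auto
  interpret T: ideal "set_add R (P \<cdot> ?Q) (PIdl x)" R by (rule ideal_add_PIdl[OF Q(2) x])
  have "a \<in> set_add R (P \<cdot> ?Q) (PIdl x)" if "a \<in> (set_add R P (PIdl x)) \<cdot> (set_add R ?Q (PIdl x))" for a
    using that
  proof (induction rule: ideal_prod.induct)
    case (prod i j)
    obtain p b q c where e: "p \<in> P" "b \<in> carrier R" "i = p \<oplus> b \<otimes> x" "q \<in> ?Q" "c \<in> carrier R" "j = q \<oplus> c \<otimes> x"
      using prod mem_add_PIdl[OF P x] mem_add_PIdl[OF Q(1) x] by auto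
    have c: "p \<in> carrier R" "q \<in> carrier R" using e ideal.Icarr P Q by metis+
    have "i \<otimes> j = p \<otimes> q \<oplus> (b \<otimes> q \<oplus> p \<otimes> c \<oplus> b \<otimes> x \<otimes> c) \<otimes> x" unfolding e using e c x by algebra
    moreover have "p \<otimes> q \<in> P \<cdot> ?Q" using e by (auto intro: ideal_prod.prod)
    moreover have "b \<otimes> q \<oplus> p \<otimes> c \<oplus> b \<otimes> x \<otimes> c \<in> carrier R" using e c x by auto
    ultimately show ?case using mem_add_PIdl[OF Q(2) x] by blast
  qed (rule T.a_closed)
  moreover have "ideal_power R (set_add R P (PIdl x)) (Suc n) \<subseteq> (set_add R P (PIdl x)) \<cdot> (set_add R ?Q (PIdl x))"
    using ideal_prod_mono[OF order_refl Suc] by simp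
  ultimately show ?case by auto
qed

lemma ideal_power_add_PIdl2:
  assumes Q: "ideal Q R" and x: "x \<in> carrier R"
  shows "ideal_power R (set_add R Q (PIdl x)) r \<subseteq> set_add R Q (PIdl (x [^] r))"
proof (induction r)
  case 0
  have "z \<in> set_add R Q (PIdl \<one>)" if "z \<in> carrier R" for z
  proof -
    have "z = \<zero> \<oplus> z \<otimes> \<one>" using that by simp
    thus ?thesis
      using mem_add_PIdl[OF Q one_closed] that additive_subgroup.zero_closed[OF ideal.axioms(1)[OF Q]] by blast
  qed
  thus ?case by auto
next
  case (Suc r)
  interpret Q: ideal Q R by (rule Q)
  interpret T: ideal "set_add R Q (PIdl (x [^] Suc r))" R by (rule ideal_add_PIdl[OF Q]) (use x in simp)
  have xr: "x [^] r \<in> carrier R" "x [^] Suc r \<in> carrier R" using x by auto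
  have "a \<in> set_add R Q (PIdl (x [^] Suc r))" if "a \<in> (set_add R Q (PIdl x)) \<cdot> (set_add R Q (PIdl (x [^] r)))" for a
    using that
  proof (induction rule: ideal_prod.induct)
    case (prod i j)
    obtain p b q c where e: "p \<in> Q" "b \<in> carrier R" "i = p \<oplus> b \<otimes> x" "q \<in> Q" "c \<in> carrier R" "j = q \<oplus> c \<otimes> x [^] r"
      using prod mem_add_PIdl[OF Q x] mem_add_PIdl[OF Q xr(1)] by auto
    have c: "p \<in> carrier R" "q \<in> carrier R" using e Q.Icarr by metis+
    have "i \<otimes> j = p \<otimes> (q \<oplus> c \<otimes> x [^] r) \<oplus> (b \<otimes> x) \<otimes> q \<oplus> (b \<otimes> c) \<otimes> (x [^] r \<otimes> x)"
      unfolding e using e c x xr(1) by algebra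
    moreover have "p \<otimes> (q \<oplus> c \<otimes> x [^] r) \<oplus> (b \<otimes> x) \<otimes> q \<in> Q"
      using e c x xr Q.I_l_closed Q.I_r_closed Q.a_closed by auto
    moreover have "b \<otimes> c \<in> carrier R" using e by auto
    ultimately show ?case using mem_add_PIdl[OF Q xr(2)] by auto
  qed (rule T.a_closed)
  moreover have "ideal_power R (set_add R Q (PIdl x)) (Suc r) \<subseteq> (set_add R Q (PIdl x)) \<cdot> (set_add R Q (PIdl (x [^] r)))"
    using ideal_prod_mono[OF order_refl Suc] by simp
  ultimately show ?case by auto
qed

lemma ideal_acc_max:
  assumes "ideal_acc R" "P I0" "\<And>I. P I ==> ideal I R"
  obtains M where "P M" "\<And>I. P I ==> M \<subseteq> I ==> I = M"
proof -
  have "\<exists>M\<in>Collect P. \<forall>I\<in>Collect P. M \<subseteq> I \<longrightarrow> I = M"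
    by (rule assms(1)[unfolded ideal_acc_def, THEN spec, THEN mp]) (use assms(2,3) in auto)
  then obtain M where "M \<in> Collect P" "\<forall>I\<in>Collect P. M \<subseteq> I \<longrightarrow> I = M" by (rule bexE)
  thus thesis using that[of M] by (metis mem_Collect_eq)
qed

text \<open>A maximal proper subideal \<open>M\<close> of \<open>N\<close> replaces a finite set of generators: \<open>N = M + (u)\<close> and
  \<open>u \<in> mN\<close> give \<open>(1 - c) u \<in> M\<close> with \<open>c \<in> m\<close>.\<close>

lemma nakayama:
  assumes acc: "ideal_acc R" and m: "ideal m R" and units: "\<And>a. a \<in> m ==> \<one> \<ominus> a \<in> Units R"
    and N: "ideal N R" and incl: "N \<subseteq> m \<cdot> N"
  shows "N = {\<zero>}"
proof (rule ccontr)
  interpret N: ideal N R by (rule N)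
  interpret m: ideal m R by (rule m)
  assume "N \<noteq> {\<zero>}"
  hence "{\<zero>} \<subset> N" using N.zero_closed by auto
  then obtain M where M0: "ideal M R \<and> M \<subset> N"
    and max: "\<And>I. ideal I R \<and> I \<subset> N ==> M \<subseteq> I ==> I = M"
    using ideal_acc_max[OF acc, of "\<lambda>I. ideal I R \<and> I \<subset> N" "{\<zero>}"] zeroideal by metis
  note M = conjunct1[OF M0] conjunct2[OF M0]
  interpret M: ideal M R by (rule M(1))
  obtain u where u: "u \<in> N" "u \<notin> M" using M(2) by blast
  have uc: "u \<in> carrier R" using u N.Icarr by auto
  have "set_add R M (PIdl u) \<subseteq> N"
  proof
    fix z assume "z \<in> set_add R M (PIdl u)"
    then obtain q a where "q \<in> M" "a \<in> carrier R" "z = q \<oplus> a \<otimes> u" using mem_add_PIdl[OF M(1) uc] by auto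
    thus "z \<in> N" using u M(2) N.a_closed N.I_l_closed by auto
  qed
  hence eq: "set_add R M (PIdl u) = N"
    using max[OF conjI, OF ideal_add_PIdl[OF M(1) uc] _ add_PIdl_incl(1)[OF M(1) uc]]
      add_PIdl_incl(2)[OF M(1) uc] u(2) by (metis psubsetI)
  have "\<exists>q\<in>M. \<exists>c\<in>m. z = q \<oplus> c \<otimes> u" if "z \<in> m \<cdot> N" for z
    using that
  proof (induction rule: ideal_prod.induct)
    case (prod i j)
    then obtain q a where j: "q \<in> M" "a \<in> carrier R" "j = q \<oplus> a \<otimes> u" using mem_add_PIdl[OF M(1) uc] eq by auto
    have c: "i \<in> carrier R" "q \<in> carrier R" using prod j m.Icarr M.Icarr by auto
    have "i \<otimes> j = i \<otimes> q \<oplus> (i \<otimes> a) \<otimes> u" unfolding j using c uc j by algebra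
    thus ?case using j prod m.I_r_closed M.I_l_closed c by blast
  next
    case (sum s1 s2)
    then obtain q c q' c' where e: "q \<in> M" "c \<in> m" "s1 = q \<oplus> c \<otimes> u" "q' \<in> M" "c' \<in> m" "s2 = q' \<oplus> c' \<otimes> u" by auto
    hence "q \<in> carrier R" "c \<in> carrier R" "q' \<in> carrier R" "c' \<in> carrier R" using m.Icarr M.Icarr by auto
    hence "s1 \<oplus> s2 = (q \<oplus> q') \<oplus> (c \<oplus> c') \<otimes> u" unfolding e using uc by algebra
    thus ?case using e m.a_closed M.a_closed by blast
  qed
  then obtain q c where qc: "q \<in> M" "c \<in> m" "u = q \<oplus> c \<otimes> u" using incl u by blast
  have c: "q \<in> carrier R" "c \<in> carrier R" using qc m.Icarr M.Icarr by auto
  have "(\<one> \<ominus> c) \<otimes> u = u \<ominus> c \<otimes> u" using c uc by algebra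
  also have "\<dots> = (q \<oplus> c \<otimes> u) \<ominus> c \<otimes> u" using qc(3) by simp
  also have "\<dots> = q" using c uc by algebra
  finally have "inv (\<one> \<ominus> c) \<otimes> ((\<one> \<ominus> c) \<otimes> u) \<in> M" using qc units M.I_l_closed by auto
  moreover have "inv (\<one> \<ominus> c) \<otimes> ((\<one> \<ominus> c) \<otimes> u) = u"
    using units[OF qc(2)] uc c by (simp add: m_assoc[symmetric])
  ultimately show False using u by simp
qed

text \<open>Krull's intersection theorem before the appeal to Nakayama's lemma.  Let \<open>Q\<close> be maximal with
  \<open>Q \<inter> N = I N\<close>.  Then every element of \<open>I\<close> has a power in \<open>Q\<close>, so a power of \<open>I\<close> lies in \<open>Q\<close>, and so does \<open>N\<close>.\<close>

lemma krull_intersection: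
  assumes acc: "ideal_acc R" and I: "ideal I R" and N: "ideal N R"
    and incl: "\<And>k. N \<subseteq> ideal_power R I k"
  shows "N \<subseteq> I \<cdot> N"
proof -
  have IN: "ideal (I \<cdot> N) R" "I \<cdot> N \<subseteq> N" using ideal_prod_is_ideal[OF I N] ideal_prod_inter[OF I N] by auto
  obtain Q where Q0: "ideal Q R \<and> Q \<inter> N = I \<cdot> N"
    and maxQ: "\<And>J. ideal J R \<and> J \<inter> N = I \<cdot> N ==> Q \<subseteq> J ==> J = Q"
    using ideal_acc_max[OF acc, of "\<lambda>J. ideal J R \<and> J \<inter> N = I \<cdot> N" "I \<cdot> N"] IN
    by (metis Int_absorb2)
  note Q = conjunct1[OF Q0] conjunct2[OF Q0]
  interpret Q: ideal Q R by (rule Q(1))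
  interpret I: ideal I R by (rule I)
  interpret N: ideal N R by (rule N)
  have nil: "\<exists>n. x [^] (n::nat) \<in> Q" if x: "x \<in> I" for x
  proof -
    have xc: "x \<in> carrier R" using x I.Icarr by auto
    define c where "c n = {r \<in> carrier R. x [^] (n::nat) \<otimes> r \<in> Q}" for n
    have cid: "ideal (c n) R" for n
    proof -
      have "ideal_in R (carrier R) (c n)"
        unfolding ideal_in_def c_def using Q.a_closed Q.zero_closed Q.I_l_closed xc
        by (auto simp: r_distr m_lcomm[of "x [^] n"])
      thus ?thesis using ideal_in_iff[OF carrier_is_subring] by simp
    qed
    obtain M where M: "\<exists>n. M = c n" and max: "\<And>I. \<exists>n. I = c n ==> M \<subseteq> I ==> I = M"
      by (rule ideal_acc_max[OF acc, of "\<lambda>I. \<exists>n. I = c n" "c 0"]) (use cid in auto)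
    from M obtain n where M: "M = c n" by (rule exE)
    have n: "c k = c n" if "c n \<subseteq> c k" for k
    proof -
      have "c k = M" by (rule max) (use that M in auto)
      thus ?thesis using M by simp
    qed
    have "c n \<subseteq> c (Suc n)"
    proof
      fix r assume "r \<in> c n"
      hence r: "r \<in> carrier R" "x [^] n \<otimes> r \<in> Q" by (auto simp: c_def)
      have "x [^] n \<in> carrier R" using xc by simp
      hence "x [^] n \<otimes> x \<otimes> r = x \<otimes> (x [^] n \<otimes> r)" using xc r(1) by algebra
      thus "r \<in> c (Suc n)" unfolding c_def using r Q.I_l_closed[OF r(2) xc] by simp
    qed
    hence cn: "c (Suc n) = c n" by (rule n)
    have xn: "x [^] n \<in> carrier R" using xc by simp
    have "(set_add R Q (PIdl (x [^] n))) \<inter> N \<subseteq> Q"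
    proof
      fix z assume z: "z \<in> (set_add R Q (PIdl (x [^] n))) \<inter> N"
      then obtain q r where qr: "q \<in> Q" "r \<in> carrier R" "z = q \<oplus> r \<otimes> x [^] n" using mem_add_PIdl[OF Q(1) xn] by auto
      have qc: "q \<in> carrier R" using qr Q.Icarr by auto
      have "x \<otimes> z \<in> Q" using z x Q(2) ideal_prod.prod[of x I z N R] by auto
      moreover have "x [^] Suc n \<otimes> r = x \<otimes> z \<oplus> (\<ominus> x) \<otimes> q"
      proof -
        have "x [^] Suc n \<otimes> r = x [^] n \<otimes> x \<otimes> r" by simp
        also have "\<dots> = x \<otimes> z \<oplus> (\<ominus> x) \<otimes> q" unfolding qr(3) using xn xc qc qr(2) by algebra
        finally show ?thesis .
      qed
      ultimately have "x [^] Suc n \<otimes> r \<in> Q" using qr(1) xc Q.I_l_closed Q.a_closed by auto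
      hence "r \<in> c (Suc n)" unfolding c_def using qr by auto
      hence "x [^] n \<otimes> r \<in> Q" using cn unfolding c_def by auto
      thus "z \<in> Q" using qr Q.a_closed xn by (simp add: m_comm)
    qed
    hence "(set_add R Q (PIdl (x [^] n))) \<inter> N = I \<cdot> N"
      using Q(2) add_PIdl_incl(1)[OF Q(1) xn] by blast
    from maxQ[OF conjI, OF ideal_add_PIdl[OF Q(1) xn] this add_PIdl_incl(1)[OF Q(1) xn]]
    have "x [^] n \<in> Q" using add_PIdl_incl(2)[OF Q(1) xn] by simp
    thus ?thesis by blast
  qed
  have "ideal_power R {\<zero>} 1 \<subseteq> Q" using ideal_prod_one[OF zeroideal] Q.zero_closed by simp
  hence "ideal {\<zero>} R \<and> {\<zero>} \<subseteq> I \<and> (\<exists>n. ideal_power R {\<zero>} n \<subseteq> Q)"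
    using zeroideal I.zero_closed by blast
  then obtain P where P0: "ideal P R \<and> P \<subseteq> I \<and> (\<exists>n. ideal_power R P n \<subseteq> Q)"
    and maxP: "\<And>J. ideal J R \<and> J \<subseteq> I \<and> (\<exists>n. ideal_power R J n \<subseteq> Q) ==> P \<subseteq> J ==> J = P"
    by (rule ideal_acc_max[OF acc]) auto
  note P = conjunct1[OF P0] conjunct1[OF conjunct2[OF P0]] conjunct2[OF conjunct2[OF P0]]
  have "P = I"
  proof (rule ccontr)
    assume "P \<noteq> I"
    then obtain x where x: "x \<in> I" "x \<notin> P" using P(2) by blast
    have xc: "x \<in> carrier R" using x I.Icarr by auto
    obtain n where n: "ideal_power R P n \<subseteq> Q" using P(3) by blast
    obtain r where r: "x [^] (r::nat) \<in> Q" using nil[OF x(1)] by blast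
    let ?J = "set_add R P (PIdl x)"
    have J: "ideal ?J R" by (rule ideal_add_PIdl[OF P(1) xc])
    have "ideal_power R ?J n \<subseteq> set_add R Q (PIdl x)"
      using ideal_power_add_PIdl[OF P(1) xc, of n] n unfolding set_add_def' by blast
    hence "ideal_power R ?J (n * r) \<subseteq> ideal_power R (set_add R Q (PIdl x)) r"
      unfolding ideal_power_mult[OF J] by (rule ideal_power_mono)
    also have "\<dots> \<subseteq> set_add R Q (PIdl (x [^] r))" by (rule ideal_power_add_PIdl2[OF Q(1) xc])
    also have "\<dots> \<subseteq> Q"
    proof
      fix z assume "z \<in> set_add R Q (PIdl (x [^] r))"
      then obtain q a where "q \<in> Q" "a \<in> carrier R" "z = q \<oplus> a \<otimes> x [^] r" using mem_add_PIdl[OF Q(1)] xc by auto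
      thus "z \<in> Q" using r Q.I_l_closed Q.a_closed by auto
    qed
    finally have "\<exists>n. ideal_power R ?J n \<subseteq> Q" by blast
    moreover have "?J \<subseteq> I"
    proof
      fix z assume "z \<in> ?J"
      then obtain q a where "q \<in> P" "a \<in> carrier R" "z = q \<oplus> a \<otimes> x" using mem_add_PIdl[OF P(1) xc] by auto
      thus "z \<in> I" using P(2) x I.I_l_closed I.a_closed by auto
    qed
    ultimately have "?J = P" by (intro maxP[OF conjI[OF J conjI]] add_PIdl_incl(1)[OF P(1) xc])
    thus False using add_PIdl_incl(2)[OF P(1) xc] x by simp
  qed
  then obtain n where "ideal_power R I n \<subseteq> Q" using P(3) by blast
  hence "N \<subseteq> Q" using incl by blast
  thus ?thesis using Q(2) by blast
qed

end

section \<open>Extensions of derivations\<close>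

primrec (in ring) horner_deriv :: "'a \<Rightarrow> 'a list \<Rightarrow> 'a"
  where "horner_deriv x [] = \<zero>"
  | "horner_deriv x (c # cs) = horner x cs \<oplus> x \<otimes> horner_deriv x cs"

text \<open>Derivations on a subring with values in the whole ring.\<close>

definition (in ring) derivation_on :: "'a set \<Rightarrow> ('a \<Rightarrow> 'a) \<Rightarrow> bool"
  where "derivation_on S D \<longleftrightarrow> D ` S \<subseteq> carrier R \<and>
    (\<forall>a\<in>S. \<forall>b\<in>S. D (a \<oplus> b) = D a \<oplus> D b) \<and> (\<forall>a\<in>S. \<forall>b\<in>S. D (a \<otimes> b) = D a \<otimes> b \<oplus> a \<otimes> D b)"

text \<open>The value that the chain rule prescribes at the element with coefficients \<open>cs\<close>, for the extension of
  \<open>g D\<close> that maps \<open>x\<close> to \<open>\<xi>\<close>; the factor \<open>g\<close> will be a common denominator.\<close>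

primrec (in ring) chain_rule :: "('a \<Rightarrow> 'a) \<Rightarrow> 'a \<Rightarrow> 'a \<Rightarrow> 'a \<Rightarrow> 'a list \<Rightarrow> 'a"
  where "chain_rule D g \<xi> x [] = \<zero>"
  | "chain_rule D g \<xi> x (c # cs) = (g \<otimes> D c \<oplus> \<xi> \<otimes> horner x cs) \<oplus> x \<otimes> chain_rule D g \<xi> x cs"

definition (in ring) transcendental_over :: "'a set \<Rightarrow> 'a \<Rightarrow> bool"
  where "transcendental_over S x \<longleftrightarrow> (\<forall>cs. set cs \<subseteq> S \<and> horner x cs = \<zero> \<longrightarrow> set cs \<subseteq> {\<zero>})"

context cring
begin

lemma derivation_onD:
  assumes "derivation_on S D"
  shows "a \<in> S ==> D a \<in> carrier R"
    and "a \<in> S ==> b \<in> S ==> D (a \<oplus> b) = D a \<oplus> D b"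
    and "a \<in> S ==> b \<in> S ==> D (a \<otimes> b) = D a \<otimes> b \<oplus> a \<otimes> D b"
  using assms unfolding derivation_on_def by auto

lemma derivation_on_zero:
  assumes "derivation_on S D" "subring S R"
  shows "D \<zero> = \<zero>"
proof -
  have "\<zero> \<in> S" using subringE(2)[OF assms(2)] .
  hence "D \<zero> = D \<zero> \<oplus> D \<zero>" "D \<zero> \<in> carrier R"
    using derivation_onD(2)[OF assms(1) \<open>\<zero> \<in> S\<close> \<open>\<zero> \<in> S\<close>] derivation_onD(1)[OF assms(1)] by auto
  thus ?thesis by (metis add.r_cancel_one')
qed

lemma derivation_on_one:
  assumes "derivation_on S D" "subring S R"
  shows "D \<one> = \<zero>"
proof -
  have "\<one> \<in> S" using subringE(3)[OF assms(2)] .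
  hence "D \<one> = D \<one> \<oplus> D \<one>" "D \<one> \<in> carrier R"
    using derivation_onD(3)[OF assms(1) \<open>\<one> \<in> S\<close> \<open>\<one> \<in> S\<close>] derivation_onD(1)[OF assms(1)] by auto
  thus ?thesis by (metis add.r_cancel_one')
qed

context
  fixes S D g \<xi> x
  assumes S: "subring S R" and D: "derivation_on S D"
    and g: "g \<in> carrier R" and \<xi>: "\<xi> \<in> carrier R" and x: "x \<in> carrier R"
begin

private lemma SR: "set cs \<subseteq> S ==> set cs \<subseteq> carrier R"
  using subringE(1)[OF S] by auto

private lemma hc: "set cs \<subseteq> S ==> horner x cs \<in> carrier R"
  using SR x by blast

lemma horner_deriv_closed: "set cs \<subseteq> S ==> horner_deriv x cs \<in> carrier R"
  by (induction cs) (use x hc in auto)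

lemma chain_rule_closed: "set cs \<subseteq> S ==> chain_rule D g \<xi> x cs \<in> carrier R"
  by (induction cs) (use x hc g \<xi> derivation_onD(1)[OF D] in auto)

lemma chain_rule_eq:
  "set cs \<subseteq> S ==> chain_rule D g \<xi> x cs = g \<otimes> horner x (map D cs) \<oplus> \<xi> \<otimes> horner_deriv x cs"
proof (induction cs)
  case (Cons c cs)
  hence cs: "c \<in> S" "set cs \<subseteq> S" by auto
  have "set (map D cs) \<subseteq> carrier R" using cs derivation_onD(1)[OF D] by auto
  hence c: "D c \<in> carrier R" "horner x (map D cs) \<in> carrier R" "horner_deriv x cs \<in> carrier R"
      "horner x cs \<in> carrier R"
    using derivation_onD(1)[OF D cs(1)] horner_deriv_closed[OF cs(2)] hc[OF cs(2)] x by auto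
  have "chain_rule D g \<xi> x (c # cs) = (g \<otimes> D c \<oplus> \<xi> \<otimes> horner x cs)
      \<oplus> x \<otimes> (g \<otimes> horner x (map D cs) \<oplus> \<xi> \<otimes> horner_deriv x cs)"
    using Cons.IH[OF cs(2)] by simp
  also have "\<dots> = g \<otimes> (D c \<oplus> x \<otimes> horner x (map D cs)) \<oplus> \<xi> \<otimes> (horner x cs \<oplus> x \<otimes> horner_deriv x cs)"
    using c g \<xi> x by algebra
  finally show ?case by simp
qed (use g \<xi> in auto)

lemma chain_rule_list_add:
  "set cs \<subseteq> S ==> set ds \<subseteq> S ==>
    chain_rule D g \<xi> x (list_add cs ds) = chain_rule D g \<xi> x cs \<oplus> chain_rule D g \<xi> x ds"
proof (induction cs ds rule: list_add.induct)
  case (3 c cs d ds)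
  hence cs: "c \<in> S" "set cs \<subseteq> S" "d \<in> S" "set ds \<subseteq> S" by auto
  have c: "D c \<in> carrier R" "D d \<in> carrier R" "horner x cs \<in> carrier R" "horner x ds \<in> carrier R"
    "chain_rule D g \<xi> x cs \<in> carrier R" "chain_rule D g \<xi> x ds \<in> carrier R"
    using derivation_onD(1)[OF D cs(1)] derivation_onD(1)[OF D cs(3)] hc[OF cs(2)] hc[OF cs(4)]
      chain_rule_closed[OF cs(2)] chain_rule_closed[OF cs(4)] by auto
  have "chain_rule D g \<xi> x (list_add (c # cs) (d # ds)) =
     (g \<otimes> (D c \<oplus> D d) \<oplus> \<xi> \<otimes> (horner x cs \<oplus> horner x ds))
      \<oplus> x \<otimes> (chain_rule D g \<xi> x cs \<oplus> chain_rule D g \<xi> x ds)"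
    using 3(1)[OF cs(2,4)] derivation_onD(2)[OF D cs(1,3)] horner_list_add[OF x SR[OF cs(2)] SR[OF cs(4)]] by simp
  also have "\<dots> = chain_rule D g \<xi> x (c # cs) \<oplus> chain_rule D g \<xi> x (d # ds)"
    unfolding chain_rule.simps using c g \<xi> x by algebra
  finally show ?case .
qed (use chain_rule_closed in \<open>auto simp del: chain_rule.simps(2) simp: SR\<close>)

lemma chain_rule_smult:
  assumes "a \<in> S"
  shows "set cs \<subseteq> S ==>
    chain_rule D g \<xi> x (map ((\<otimes>) a) cs) = a \<otimes> chain_rule D g \<xi> x cs \<oplus> (g \<otimes> D a) \<otimes> horner x cs"
proof (induction cs)
  case (Cons c cs)
  hence cs: "c \<in> S" "set cs \<subseteq> S" by auto
  have c: "D c \<in> carrier R" "D a \<in> carrier R" "a \<in> carrier R" "c \<in> carrier R" "horner x cs \<in> carrier R"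
    "chain_rule D g \<xi> x cs \<in> carrier R"
    using derivation_onD(1)[OF D cs(1)] derivation_onD(1)[OF D assms] hc[OF cs(2)] chain_rule_closed[OF cs(2)]
      subringE(1)[OF S] cs(1) assms by auto
  have "chain_rule D g \<xi> x (map ((\<otimes>) a) (c # cs)) =
     (g \<otimes> (D a \<otimes> c \<oplus> a \<otimes> D c) \<oplus> \<xi> \<otimes> (a \<otimes> horner x cs))
      \<oplus> x \<otimes> (a \<otimes> chain_rule D g \<xi> x cs \<oplus> (g \<otimes> D a) \<otimes> horner x cs)"
    using Cons.IH[OF cs(2)] derivation_onD(3)[OF D assms cs(1)] horner_smult[OF x SR[OF cs(2)] c(3)] by simp
  also have "\<dots> = a \<otimes> chain_rule D g \<xi> x (c # cs) \<oplus> (g \<otimes> D a) \<otimes> horner x (c # cs)"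
    unfolding chain_rule.simps horner.simps using c g \<xi> x by algebra
  finally show ?case .
qed (use derivation_onD(1)[OF D assms] assms subringE(1)[OF S] g in auto)

lemma chain_rule_zeros: "set cs \<subseteq> {\<zero>} ==> chain_rule D g \<xi> x cs = \<zero>"
proof (induction cs)
  case (Cons c cs)
  have "horner x cs = \<zero>" if "set cs \<subseteq> {\<zero>}" for cs using that by (induction cs) (use x in auto)
  thus ?case using Cons derivation_on_zero[OF D S] g \<xi> x by auto
qed auto

lemma chain_rule_shift:
  assumes "set cs \<subseteq> S" "horner x cs = \<zero>" "chain_rule D g \<xi> x cs = \<zero>"
  shows "horner x (replicate k \<zero> @ cs) = \<zero> \<and> chain_rule D g \<xi> x (replicate k \<zero> @ cs) = \<zero>"
  by (induction k) (use assms derivation_on_zero[OF D S] g \<xi> x in auto)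

lemma chain_rule_snoc_zero: "set cs \<subseteq> S ==> chain_rule D g \<xi> x (cs @ [\<zero>]) = chain_rule D g \<xi> x cs"
proof (induction cs)
  case (Cons c cs)
  thus ?case using horner_snoc_zero[OF x SR, of cs] by simp
qed (use derivation_on_zero[OF D S] g \<xi> x in auto)

text \<open>The chain rule defines a derivation on \<open>S[x]\<close> as soon as it respects the relations of \<open>x\<close>.\<close>

lemma derivation_extends:
  assumes wd: "\<And>cs. set cs \<subseteq> S ==> horner x cs = \<zero> ==> chain_rule D g \<xi> x cs = \<zero>"
  shows "\<exists>D'. derivation_on (adjoin S x) D' \<and> (\<forall>s\<in>S. D' s = g \<otimes> D s) \<and> D' x = \<xi>"
proof -
  let ?\<Delta> = "chain_rule D g \<xi> x"
  define D' where "D' h = ?\<Delta> (SOME cs. set cs \<subseteq> S \<and> horner x cs = h)" for h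
  have D': "D' (horner x cs) = ?\<Delta> cs" if cs: "set cs \<subseteq> S" for cs
  proof -
    define ds where "ds = (SOME ds. set ds \<subseteq> S \<and> horner x ds = horner x cs)"
    have ds: "set ds \<subseteq> S" "horner x ds = horner x cs"
      using someI[of "\<lambda>ds. set ds \<subseteq> S \<and> horner x ds = horner x cs" cs] cs unfolding ds_def by auto
    have m1: "\<ominus> \<one> \<in> S" using subringE(3,5)[OF S] by auto
    have "D \<one> \<oplus> D (\<ominus> \<one>) = \<zero>"
      using derivation_onD(2)[OF D subringE(3)[OF S] m1] derivation_on_zero[OF D S] by (simp add: r_neg)
    hence Dm: "D (\<ominus> \<one>) = \<zero>" using derivation_on_one[OF D S] derivation_onD(1)[OF D m1] by simp
    let ?es = "list_add cs (map ((\<otimes>) (\<ominus> \<one>)) ds)"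
    have mds: "set (map ((\<otimes>) (\<ominus> \<one>)) ds) \<subseteq> S" by (rule set_smult[OF S ds(1) m1])
    have "horner x ?es = horner x cs \<oplus> \<ominus> \<one> \<otimes> horner x ds"
      using horner_list_add[OF x SR[OF cs] SR[OF mds]] horner_smult[OF x SR[OF ds(1)], of "\<ominus> \<one>"] by simp
    also have "\<dots> = \<zero>" unfolding ds(2) using hc[OF cs] by algebra
    finally have "?\<Delta> ?es = \<zero>" using wd[OF set_list_add[OF S cs mds]] by simp
    moreover have "?\<Delta> ?es = ?\<Delta> cs \<oplus> (\<ominus> \<one> \<otimes> ?\<Delta> ds \<oplus> (g \<otimes> D (\<ominus> \<one>)) \<otimes> horner x ds)"
      using chain_rule_list_add[OF cs mds] chain_rule_smult[OF m1 ds(1)] by simp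
    moreover have "\<dots> = ?\<Delta> cs \<oplus> \<ominus> ?\<Delta> ds"
      unfolding Dm using g hc[OF ds(1)] chain_rule_closed[OF ds(1)] chain_rule_closed[OF cs] by algebra
    ultimately have "?\<Delta> cs = ?\<Delta> ds"
      using chain_rule_closed[OF ds(1)] chain_rule_closed[OF cs] by (metis add.inv_closed minus_equality minus_minus)
    thus ?thesis unfolding D'_def ds_def by simp
  qed
  have sub: "subring (adjoin S x) R" by (rule subring_adjoin[OF S x])
  note TR = subringE[OF sub]
  have clo: "D' h \<in> carrier R" if "h \<in> adjoin S x" for h
    using that D' chain_rule_closed unfolding adjoin_def by auto
  have add: "D' (h \<oplus> k) = D' h \<oplus> D' k" if hk: "h \<in> adjoin S x" "k \<in> adjoin S x" for h k
  proof -
    obtain cs ds where c: "h = horner x cs" "set cs \<subseteq> S" "k = horner x ds" "set ds \<subseteq> S"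
      using hk unfolding adjoin_def by auto
    have "h \<oplus> k = horner x (list_add cs ds)" using horner_list_add[OF x SR[OF c(2)] SR[OF c(4)]] c by simp
    thus ?thesis using D'[OF set_list_add[OF S c(2,4)]] D'[OF c(2)] D'[OF c(4)] chain_rule_list_add[OF c(2,4)] c(1,3)
      by simp
  qed
  have smult: "D' (a \<otimes> h) = a \<otimes> D' h \<oplus> g \<otimes> D a \<otimes> h" if ah: "a \<in> S" "h \<in> adjoin S x" for a h
  proof -
    obtain cs where c: "h = horner x cs" "set cs \<subseteq> S" using ah unfolding adjoin_def by auto
    have "a \<otimes> h = horner x (map ((\<otimes>) a) cs)" using horner_smult[OF x SR[OF c(2)]] subringE(1)[OF S] c(1) ah(1) by auto
    thus ?thesis using D'[OF set_smult[OF S c(2) ah(1)]] D'[OF c(2)] chain_rule_smult[OF ah(1) c(2)] c(1) by simp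
  qed
  have xmult: "D' (x \<otimes> h) = x \<otimes> D' h \<oplus> \<xi> \<otimes> h" if h: "h \<in> adjoin S x" for h
  proof -
    obtain cs where c: "h = horner x cs" "set cs \<subseteq> S" using h unfolding adjoin_def by auto
    have "x \<otimes> h = horner x (\<zero> # cs)" using c hc[OF c(2)] x by simp
    moreover have "set (\<zero> # cs) \<subseteq> S" using c(2) subringE(2)[OF S] by simp
    ultimately have "D' (x \<otimes> h) = chain_rule D g \<xi> x (\<zero> # cs)" using D'[of "\<zero> # cs"] by metis
    hence "D' (x \<otimes> h) = (g \<otimes> D \<zero> \<oplus> \<xi> \<otimes> h) \<oplus> x \<otimes> D' h" using D'[OF c(2)] c(1) by simp
    also have "\<dots> = x \<otimes> D' h \<oplus> \<xi> \<otimes> h"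
      using derivation_on_zero[OF D S] clo[OF h] h TR(1) g \<xi> x by (simp add: a_comm subsetD)
    finally show ?thesis .
  qed
  have onS: "D' s = g \<otimes> D s" if s: "s \<in> S" for s
  proof -
    have "s \<in> carrier R" using s subringE(1)[OF S] by auto
    hence "s = horner x [s]" using x by simp
    thus ?thesis using D'[of "[s]"] s g \<xi> x derivation_onD(1)[OF D s] by simp
  qed
  have onx: "D' x = \<xi>"
  proof -
    have one: "\<one> \<in> S" using subringE(3)[OF S] .
    hence "D' \<one> = \<zero>" using onS derivation_on_one[OF D S] g by simp
    thus ?thesis using xmult[of \<one>] adjoin_incl(1)[OF S x] one x \<xi> by auto
  qed
  have leib: "D' (horner x cs \<otimes> k) = D' (horner x cs) \<otimes> k \<oplus> horner x cs \<otimes> D' k"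
    if "set cs \<subseteq> S" and k: "k \<in> adjoin S x" for cs k
    using that(1)
  proof (induction cs)
    case Nil
    have "D' \<zero> = \<zero>" using onS[OF subringE(2)[OF S]] derivation_on_zero[OF D S] g by simp
    thus ?case using k TR(1) clo[OF k] by auto
  next
    case (Cons c cs)
    hence cs: "c \<in> S" "set cs \<subseteq> S" by auto
    have h: "horner x cs \<in> adjoin S x" "c \<in> adjoin S x" "x \<in> adjoin S x"
      using adjoinI[OF cs(2)] adjoin_incl[OF S x] cs(1) by auto
    have car: "c \<in> carrier R" "horner x cs \<in> carrier R" "k \<in> carrier R" "D c \<in> carrier R"
      "D' k \<in> carrier R" "D' (horner x cs) \<in> carrier R"
      using h k TR(1) clo derivation_onD(1)[OF D cs(1)] by auto
    have e: "horner x (c # cs) \<otimes> k = c \<otimes> k \<oplus> x \<otimes> (horner x cs \<otimes> k)"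
      unfolding horner.simps using car x by algebra
    have "D' (horner x (c # cs) \<otimes> k) = (c \<otimes> D' k \<oplus> g \<otimes> D c \<otimes> k) \<oplus>
        (x \<otimes> (D' (horner x cs) \<otimes> k \<oplus> horner x cs \<otimes> D' k) \<oplus> \<xi> \<otimes> (horner x cs \<otimes> k))"
      unfolding e using add[OF TR(6)[OF h(2) k] TR(6)[OF h(3) TR(6)[OF h(1) k]]] smult[OF cs(1) k]
        xmult[OF TR(6)[OF h(1) k]] Cons.IH[OF cs(2)] by simp
    moreover have "D' (horner x (c # cs)) = g \<otimes> D c \<oplus> (x \<otimes> D' (horner x cs) \<oplus> \<xi> \<otimes> horner x cs)"
      using add[OF h(2) TR(6)[OF h(3) h(1)]] onS[OF cs(1)] xmult[OF h(1)] by simp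
    ultimately show ?case unfolding horner.simps using car x g \<xi> by algebra
  qed
  have "derivation_on (adjoin S x) D'"
    unfolding derivation_on_def using clo add leib unfolding adjoin_def by blast
  thus ?thesis using onS onx by blast
qed

lemma derivation_extends_transc:
  assumes "transcendental_over S x"
  shows "\<exists>D'. derivation_on (adjoin S x) D' \<and> (\<forall>s\<in>S. D' s = g \<otimes> D s) \<and> D' x = \<xi>"
  by (rule derivation_extends, rule chain_rule_zeros)
     (use assms in \<open>auto simp: transcendental_over_def\<close>)

end

lemma horner_deriv_list:
  assumes S: "subring S R" and x: "x \<in> carrier R"
  shows "set cs \<subseteq> S ==> cs \<noteq> [] ==> \<exists>ds. set ds \<subseteq> S \<and> length ds = length cs - 1 \<and> horner x ds = horner_deriv x cs \<and>
    (length cs > 1 \<longrightarrow> last ds = add_pow R (length cs - 1) (last cs))"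
proof (induction cs)
  case (Cons c cs)
  note SR = subringE[OF S]
  have cs: "set cs \<subseteq> S" "c \<in> S" using Cons.prems by auto
  have hc: "horner x cs \<in> carrier R" using x order_trans[OF cs(1) SR(1)] by auto
  show ?case
  proof (cases "cs = []")
    case True
    thus ?thesis using x by (intro exI[of _ "[]"]) auto
  next
    case False
    then obtain ds where ds: "set ds \<subseteq> S" "length ds = length cs - 1" "horner x ds = horner_deriv x cs"
      "length cs > 1 \<longrightarrow> last ds = add_pow R (length cs - 1) (last cs)" using Cons.IH[OF cs(1)] by blast
    have zds: "set (\<zero> # ds) \<subseteq> S" using ds(1) SR(2) by auto
    have dc: "horner x ds \<in> carrier R" using x order_trans[OF ds(1) SR(1)] by auto
    have len: "length (\<zero> # ds) = length cs" using ds(2) False by (cases cs) auto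
    have "last cs \<in> set cs" using False by simp
    hence "last cs \<in> carrier R" using cs(1) SR(1) by blast
    have lst: "last (list_add cs (\<zero> # ds)) = add_pow R (length cs) (last cs)"
    proof (cases "length cs > 1")
      case True
      hence "ds \<noteq> []" using len by auto
      hence "last (list_add cs (\<zero> # ds)) = last cs \<oplus> add_pow R (length cs - 1) (last cs)"
        using last_list_add[OF len[symmetric] False] ds(4) True by simp
      also have "\<dots> = add_pow R (Suc (length cs - 1)) (last cs)" using \<open>last cs \<in> carrier R\<close> by (simp add: a_comm)
      finally show ?thesis using False by simp
    next
      case one: False
      hence "length cs = 1" using False by (cases cs) auto
      hence "ds = []" using len by simp
      thus ?thesis using last_list_add[OF len[symmetric] False] \<open>last cs \<in> carrier R\<close> \<open>length cs = 1\<close> by simp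
    qed
    show ?thesis
    proof (intro exI[of _ "list_add cs (\<zero> # ds)"] conjI impI)
      show "set (list_add cs (\<zero> # ds)) \<subseteq> S" by (rule set_list_add[OF S cs(1) zds])
      show "length (list_add cs (\<zero> # ds)) = length (c # cs) - 1" using len by (simp add: length_list_add)
      show "horner x (list_add cs (\<zero> # ds)) = horner_deriv x (c # cs)"
        using horner_list_add[OF x order_trans[OF cs(1) SR(1)] order_trans[OF zds SR(1)]] ds(3) dc x by simp
      show "last (list_add cs (\<zero> # ds)) = add_pow R (length (c # cs) - 1) (last (c # cs))" using lst False by simp
    qed
  qed
qed auto

end

context "domain"
begin

text \<open>For a relation \<open>G\<close> of \<open>x\<close> of least degree, \<open>G'(x)\<close> is not zero in characteristic 0.  With this factor the
  chain rule respects \<open>G\<close>, and by pseudo-division all relations.\<close>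

lemma derivation_extends_algebraic:
  assumes S: "subring S R" and D: "derivation_on S D" and x: "x \<in> carrier R"
    and char0: "\<And>k::nat. 0 < k ==> add_pow R (k) (\<one>) \<noteq> \<zero>"
    and alg: "\<not> transcendental_over S x"
  shows "\<exists>g\<in>carrier R. g \<noteq> \<zero> \<and> (\<exists>D'. derivation_on (adjoin S x) D' \<and> (\<forall>s\<in>S. D' s = g \<otimes> D s))"
proof -
  note SR = subringE[OF S]
  let ?rel = "\<lambda>cs. set cs \<subseteq> S \<and> horner x cs = \<zero> \<and> \<not> set cs \<subseteq> {\<zero>}"
  obtain G where G: "?rel G" and minG: "\<And>cs. length cs < length G ==> \<not> ?rel cs"
    using ex_has_least_nat[of ?rel _ length] alg unfolding transcendental_over_def by (metis (no_types, lifting) leD)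
  have GS: "set G \<subseteq> S" "horner x G = \<zero>" using G by auto
  have Gne: "G \<noteq> []" using G by auto
  have lastS: "last G \<in> S" using Gne GS by auto
  have last: "last G \<noteq> \<zero>"
  proof
    assume l: "last G = \<zero>"
    have Gs: "G = butlast G @ [\<zero>]" using Gne l by (metis append_butlast_last_id)
    have bS: "set (butlast G) \<subseteq> S" using GS(1) by (auto dest: in_set_butlastD)
    have "horner x (butlast G) = \<zero>"
      using horner_snoc_zero[OF x order_trans[OF bS SR(1)]] Gs GS(2) by simp
    moreover have "\<not> set (butlast G) \<subseteq> {\<zero>}" using G Gs by (metis Un_subset_iff empty_set insert_subset list.simps(15) set_append subset_insertI2 subset_refl)
    ultimately show False using minG[of "butlast G"] bS Gne by simp
  qed
  obtain ds where ds: "set ds \<subseteq> S" "length ds = length G - 1" "horner x ds = horner_deriv x G"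
    "length G > 1 \<longrightarrow> last ds = add_pow R (length G - 1) (last G)"
    using horner_deriv_list[OF S x GS(1) Gne] by blast
  define g where "g = horner_deriv x G"
  define \<xi> where "\<xi> = \<ominus> horner x (map D G)"
  have gc: "g \<in> carrier R" unfolding g_def ds(3)[symmetric] using x order_trans[OF ds(1) SR(1)] by blast
  have mc: "set (map D G) \<subseteq> carrier R" using derivation_onD(1)[OF D] GS by auto
  hence hc: "horner x (map D G) \<in> carrier R" using x by blast
  hence \<xi>c: "\<xi> \<in> carrier R" unfolding \<xi>_def by simp
  have lG: "last G \<in> carrier R" using lastS SR(1) by auto
  have len: "length G > 1"
  proof (rule ccontr)
    assume "\<not> length G > 1"
    hence "length G = 1" using Gne by (cases G) auto
    then obtain c where "G = [c]" by (auto simp: length_Suc_conv)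
    thus False using GS(2) last x lG by auto
  qed
  have "g \<noteq> \<zero>"
  proof
    assume "g = \<zero>"
    hence "horner x ds = \<zero>" unfolding g_def using ds(3) by simp
    moreover have "length ds < length G" using ds(2) Gne by simp
    ultimately have "set ds \<subseteq> {\<zero>}" using minG[of ds] ds(1) by blast
    moreover have "ds \<noteq> []" using ds(2) len by auto
    ultimately have "last ds = \<zero>" by (metis last_in_set singletonD subsetD)
    hence "add_pow R (length G - 1) (last G) = \<zero>" using ds(4) len by simp
    hence "(add_pow R (length G - 1) (\<one>)) \<otimes> last G = \<zero>" using add_pow_ldistr[OF one_closed lG, of "length G - 1"] lG by simp
    thus False using integral[of "add_pow R (length G - 1) (\<one>)" "last G"] char0[of "length G - 1"] len last lG by simp
  qed
  let ?\<Delta> = "chain_rule D g \<xi> x"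
  note cl = chain_rule_closed[OF S D gc \<xi>c x] and eq = chain_rule_eq[OF S D gc \<xi>c x]
    and sm = chain_rule_smult[OF S D gc \<xi>c x] and ad = chain_rule_list_add[OF S D gc \<xi>c x]
    and sn = chain_rule_snoc_zero[OF S D gc \<xi>c x] and sh = chain_rule_shift[OF S D gc \<xi>c x]
  have \<Delta>G: "?\<Delta> G = \<zero>"
    using eq[OF GS(1)] hc gc unfolding g_def[symmetric] \<xi>_def by (simp add: m_comm r_neg l_minus r_minus)
  have "?\<Delta> cs = \<zero>" if "set cs \<subseteq> S" "horner x cs = \<zero>" for cs
    using that
  proof (induction cs rule: length_induct)
    case (1 cs)
    show ?case
    proof (cases "set cs \<subseteq> {\<zero>}")
      case True
      thus ?thesis by (rule chain_rule_zeros[OF S D gc \<xi>c x])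
    next
      case False
      hence ge: "length G \<le> length cs" using minG[of cs] 1(2,3) by (metis not_le)
      hence csne: "cs \<noteq> []" using Gne by auto
      define E where "E = replicate (length cs - length G) \<zero> @ G"
      define b where "b = \<ominus> last cs"
      define c where "c = last G"
      have ES: "set E \<subseteq> S" unfolding E_def using GS(1) SR(2) by auto
      have E: "horner x E = \<zero>" "?\<Delta> E = \<zero>" unfolding E_def using sh[OF GS \<Delta>G] by auto
      have lcs: "last cs \<in> S" using csne 1(2) by auto
      have bc: "b \<in> S" "c \<in> S" "b \<in> carrier R" "c \<in> carrier R" "last cs \<in> carrier R"
        unfolding b_def c_def using lcs lastS SR(1,5) lG by auto
      define H where "H = list_add (map ((\<otimes>) c) cs) (map ((\<otimes>) b) E)"
      have ms: "set (map ((\<otimes>) c) cs) \<subseteq> S" "set (map ((\<otimes>) b) E) \<subseteq> S"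
        using set_smult[OF S 1(2) bc(2)] set_smult[OF S ES bc(1)] .
      have HS: "set H \<subseteq> S" unfolding H_def by (rule set_list_add[OF S ms])
      have lenE: "length E = length cs" unfolding E_def using ge by simp
      have lenH: "length H = length cs" unfolding H_def using lenE by (simp add: length_list_add)
      have "last H = c \<otimes> last cs \<oplus> b \<otimes> last E"
        unfolding H_def using last_list_add[of "map ((\<otimes>) c) cs" "map ((\<otimes>) b) E"] lenE csne
        by (metis (no_types, lifting) last_map length_0_conv length_map)
      also have "last E = c" unfolding E_def c_def using Gne by simp
      also have "c \<otimes> last cs \<oplus> b \<otimes> c = \<zero>" unfolding b_def using bc(4,5) by algebra
      finally have "last H = \<zero>" .
      hence Hs: "H = butlast H @ [\<zero>]" using csne lenH by (metis append_butlast_last_id length_0_conv)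
      have bS: "set (butlast H) \<subseteq> S" using HS by (auto dest: in_set_butlastD)
      have "horner x H = c \<otimes> horner x cs \<oplus> b \<otimes> horner x E"
        unfolding H_def using horner_list_add[OF x order_trans[OF ms(1) SR(1)] order_trans[OF ms(2) SR(1)]]
          horner_smult[OF x order_trans[OF 1(2) SR(1)] bc(4)] horner_smult[OF x order_trans[OF ES SR(1)] bc(3)] by simp
      hence hH: "horner x H = \<zero>" using 1(3) E bc by simp
      have "horner x (butlast H) = \<zero>"
        using horner_snoc_zero[OF x order_trans[OF bS SR(1)]] Hs hH by simp
      hence "?\<Delta> (butlast H) = \<zero>" using 1(1) bS lenH csne by (metis diff_less length_butlast length_greater_0_conv zero_less_one)
      hence "?\<Delta> H = \<zero>" using sn[OF bS] Hs by simp
      moreover have "?\<Delta> H = (c \<otimes> ?\<Delta> cs \<oplus> g \<otimes> D c \<otimes> horner x cs) \<oplus> (b \<otimes> ?\<Delta> E \<oplus> g \<otimes> D b \<otimes> horner x E)"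
        unfolding H_def ad[OF ms] sm[OF bc(2) 1(2)] sm[OF bc(1) ES] ..
      ultimately have "c \<otimes> ?\<Delta> cs = \<zero>"
        using 1(3) E bc gc cl[OF 1(2)] derivation_onD(1)[OF D bc(1)] derivation_onD(1)[OF D bc(2)] by simp
      thus ?thesis using integral[of c "?\<Delta> cs"] last bc(4) cl[OF 1(2)] unfolding c_def by auto
    qed
  qed
  thus ?thesis using derivation_extends[OF S D gc \<xi>c x] gc \<open>g \<noteq> \<zero>\<close> by metis
qed

end

section \<open>Derivations and chains of primes\<close>

primrec (in ring) tower :: "'a set \<Rightarrow> 'a list \<Rightarrow> 'a set"
  where "tower F [] = F"
  | "tower F (f # fs) = {horner f cs |cs. set cs \<subseteq> tower F fs}"

primrec (in ring) transcendental_tower :: "'a set \<Rightarrow> 'a list \<Rightarrow> bool"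
  where "transcendental_tower F [] = True"
  | "transcendental_tower F (f # fs) \<longleftrightarrow>
      transcendental_over (tower F fs) f \<and> transcendental_tower F fs"

context cring
begin

lemma tower_Cons: "tower F (f # fs) = adjoin (tower F fs) f"
  by (simp add: adjoin_def)

lemma tower_props:
  assumes "subring F R" "set fs \<subseteq> carrier R"
  shows "subring (tower F fs) R" "F \<subseteq> tower F fs" "set fs \<subseteq> tower F fs"
proof -
  have "subring (tower F fs) R \<and> F \<subseteq> tower F fs \<and> set fs \<subseteq> tower F fs"
    using assms(2)
  proof (induction fs)
    case (Cons f fs)
    thus ?case unfolding tower_Cons
      using subring_adjoin[of "tower F fs" f] adjoin_incl[of "tower F fs" f] by auto
  qed (use assms in auto)
  thus "subring (tower F fs) R" "F \<subseteq> tower F fs" "set fs \<subseteq> tower F fs" by auto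
qed

text \<open>The partial derivatives of the tower.\<close>

lemma tower_derivations:
  assumes F: "subring F R" and "set fs \<subseteq> carrier R" "transcendental_tower F fs" "i < length fs"
  shows "\<exists>D. derivation_on (tower F fs) D \<and> D ` F \<subseteq> {\<zero>} \<and>
    (\<forall>j<length fs. D (fs ! j) = (if j = i then \<one> else \<zero>))"
  using assms(2-4)
proof (induction fs arbitrary: i)
  case (Cons f fs)
  let ?T = "tower F fs"
  have f: "f \<in> carrier R" "set fs \<subseteq> carrier R" "transcendental_over ?T f" "transcendental_tower F fs"
    using Cons.prems by auto
  note T = tower_props[OF F f(2)]
  show ?case
  proof (cases i)
    case 0
    have D0: "derivation_on ?T (\<lambda>_. \<zero>)"
      unfolding derivation_on_def using subringE(1)[OF T(1)] by (auto simp: subset_iff)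
    from derivation_extends_transc[OF T(1) D0 one_closed one_closed f(1,3)]
    obtain D where D: "derivation_on (adjoin ?T f) D" "\<forall>s\<in>?T. D s = \<one> \<otimes> \<zero>" "D f = \<one>" by auto
    hence "D s = \<zero>" if "s \<in> ?T" for s using that by simp
    hence "D ((f # fs) ! j) = (if j = i then \<one> else \<zero>)" if "j < length (f # fs)" for j
      using that T(3) D(3) 0 nth_mem[of "j - 1" fs] by (cases j) (auto simp: subset_iff)
    moreover have "D ` F \<subseteq> {\<zero>}" using T(2) D(2) by auto
    ultimately show ?thesis unfolding tower_Cons using D(1) by blast
  next
    case (Suc k)
    then obtain D0 where D0: "derivation_on ?T D0" "D0 ` F \<subseteq> {\<zero>}"
      "\<forall>j<length fs. D0 (fs ! j) = (if j = k then \<one> else \<zero>)"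
      using Cons.IH[OF f(2,4), of k] Cons.prems by auto
    from derivation_extends_transc[OF T(1) D0(1) one_closed zero_closed f(1,3)]
    obtain D where D: "derivation_on (adjoin ?T f) D" "\<forall>s\<in>?T. D s = \<one> \<otimes> D0 s" "D f = \<zero>" by auto
    hence DT: "D s = D0 s" if "s \<in> ?T" for s using that derivation_onD(1)[OF D0(1)] by simp
    have "D ((f # fs) ! j) = (if j = i then \<one> else \<zero>)" if "j < length (f # fs)" for j
      using that T(3) D(3) DT D0(3) Suc by (cases j) (auto simp: subset_iff)
    moreover have "D ` F \<subseteq> {\<zero>}" using T(2) DT D0(2) by auto
    ultimately show ?thesis unfolding tower_Cons using D(1) by blast
  qed
qed simp

end

context "domain"
begin

text \<open>The denominators of the single steps multiply up in a domain.\<close>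

lemma derivation_extends_generate:
  assumes char0: "\<And>k::nat. 0 < k ==> add_pow R k \<one> \<noteq> \<zero>"
    and "finite Z" "Z \<subseteq> carrier R" and S: "subring S R" and D: "derivation_on S D"
  shows "\<exists>g\<in>carrier R. g \<noteq> \<zero> \<and> (\<exists>D'. derivation_on (generate_ring R (S \<union> Z)) D' \<and> (\<forall>s\<in>S. D' s = g \<otimes> D s))"
  using assms(2,3)
proof (induction Z)
  case empty
  have "generate_ring R S = S" using generate_ringI[of S S] subringE(1)[OF S] S by auto
  moreover have "\<forall>s\<in>S. D s = \<one> \<otimes> D s" using derivation_onD(1)[OF D] by simp
  ultimately show ?case using D one_closed by (metis Un_empty_right one_not_zero)
next
  case (insert x Z)
  let ?T = "generate_ring R (S \<union> Z)"
  have SZ: "S \<union> Z \<subseteq> carrier R" using subringE(1)[OF S] insert by auto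
  have T: "subring ?T R" by (rule generate_ring_is_subring[OF SZ])
  have x: "x \<in> carrier R" using insert by auto
  have ST: "S \<subseteq> ?T" by (auto intro: generate_ring.incl)
  obtain g D1 where g: "g \<in> carrier R" "g \<noteq> \<zero>" "derivation_on ?T D1" "\<forall>s\<in>S. D1 s = g \<otimes> D s"
    using insert by auto
  have eq: "generate_ring R (S \<union> insert x Z) = adjoin ?T x"
    using generate_ring_insert[OF SZ x] by simp
  have "\<exists>h\<in>carrier R. h \<noteq> \<zero> \<and> (\<exists>D'. derivation_on (adjoin ?T x) D' \<and> (\<forall>s\<in>?T. D' s = h \<otimes> D1 s))"
  proof (cases "transcendental_over ?T x")
    case True
    from derivation_extends_transc[OF T g(3) one_closed one_closed x this]
    show ?thesis by (metis one_closed one_not_zero)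
  next
    case False
    show ?thesis by (rule derivation_extends_algebraic[OF T g(3) x _ False]) (rule char0)
  qed
  then obtain h D2 where h: "h \<in> carrier R" "h \<noteq> \<zero>" "derivation_on (adjoin ?T x) D2" "\<forall>s\<in>?T. D2 s = h \<otimes> D1 s"
    by auto
  have "D2 s = (h \<otimes> g) \<otimes> D s" if "s \<in> S" for s
    using that h(1,4) g(1,4) ST derivation_onD(1)[OF D that] by (simp add: m_assoc subset_iff)
  moreover have "h \<otimes> g \<in> carrier R" "h \<otimes> g \<noteq> \<zero>" using h g integral by auto
  ultimately show ?case unfolding eq using h(3) by blast
qed

text \<open>Derivations that are dual to the \<open>f i\<close> up to nonzero factors and kill \<open>Y\<close>.\<close>

definition diagonal_derivations :: "'a set \<Rightarrow> 'i set \<Rightarrow> ('i \<Rightarrow> 'a) \<Rightarrow> bool"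
  where "diagonal_derivations Y I f \<longleftrightarrow> (\<exists>D. \<forall>i\<in>I. derivation_on (carrier R) (D i) \<and> D i ` Y \<subseteq> {\<zero>} \<and>
    (\<forall>j\<in>I. D i (f j) = \<zero> \<longleftrightarrow> i \<noteq> j))"

lemma derivation_combination:
  assumes D: "derivation_on (carrier R) D" and E: "derivation_on (carrier R) E" and ab: "a \<in> carrier R" "b \<in> carrier R"
  shows "derivation_on (carrier R) (\<lambda>z. a \<otimes> D z \<ominus> b \<otimes> E z)"
  unfolding derivation_on_def
proof (intro conjI ballI)
  show "(\<lambda>z. a \<otimes> D z \<ominus> b \<otimes> E z) ` carrier R \<subseteq> carrier R"
    using ab derivation_onD(1)[OF D] derivation_onD(1)[OF E] by auto
  fix u v assume uv: "u \<in> carrier R" "v \<in> carrier R"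
  note c = uv ab derivation_onD(1)[OF D uv(1)] derivation_onD(1)[OF D uv(2)]
    derivation_onD(1)[OF E uv(1)] derivation_onD(1)[OF E uv(2)]
  show "a \<otimes> D (u \<oplus> v) \<ominus> b \<otimes> E (u \<oplus> v) = a \<otimes> D u \<ominus> b \<otimes> E u \<oplus> (a \<otimes> D v \<ominus> b \<otimes> E v)"
    unfolding derivation_onD(2)[OF D uv] derivation_onD(2)[OF E uv] using c by algebra
  show "a \<otimes> D (u \<otimes> v) \<ominus> b \<otimes> E (u \<otimes> v) = (a \<otimes> D u \<ominus> b \<otimes> E u) \<otimes> v \<oplus> u \<otimes> (a \<otimes> D v \<ominus> b \<otimes> E v)"
    unfolding derivation_onD(3)[OF D uv] derivation_onD(3)[OF E uv] using c by algebra
qed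

text \<open>Elimination: if some \<open>D i y\<close> is not zero, it serves as a pivot that clears \<open>y\<close> in all others.\<close>

lemma diagonal_derivations_step:
  assumes "diagonal_derivations Y I f" "f ` I \<subseteq> carrier R" "Y \<subseteq> carrier R" "y \<in> carrier R" "finite I"
  shows "\<exists>I'\<subseteq>I. card I \<le> Suc (card I') \<and> diagonal_derivations (insert y Y) I' f"
proof -
  obtain D where D: "\<And>i. i \<in> I ==> derivation_on (carrier R) (D i)" "\<And>i z. i \<in> I ==> z \<in> Y ==> D i z = \<zero>"
    "\<And>i j. i \<in> I ==> j \<in> I ==> D i (f j) = \<zero> \<longleftrightarrow> i \<noteq> j"
    using assms(1) unfolding diagonal_derivations_def by (auto simp: image_subset_iff)
  show ?thesis
  proof (cases "\<forall>i\<in>I. D i y = \<zero>")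
    case True
    hence "diagonal_derivations (insert y Y) I f"
      unfolding diagonal_derivations_def
    proof (intro exI[of _ D] ballI conjI)
      fix i assume i: "i \<in> I"
      show "D i ` insert y Y \<subseteq> {\<zero>}" using D(2)[OF i] True i by (auto simp: image_subset_iff)
    qed (rule D(1,3); assumption)+
    thus ?thesis by (intro exI[of _ I]) simp
  next
    case False
    then obtain k where k: "k \<in> I" "D k y \<noteq> \<zero>" by auto
    have c: "D i z \<in> carrier R" if "i \<in> I" "z \<in> carrier R" for i z using derivation_onD(1)[OF D(1)] that by auto
    define E where "E i z = D k y \<otimes> D i z \<ominus> D i y \<otimes> D k z" for i z
    have "diagonal_derivations (insert y Y) (I - {k}) f"
      unfolding diagonal_derivations_def
    proof (intro exI[of _ E] ballI conjI)
      fix i assume i: "i \<in> I - {k}"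
      have iI: "i \<in> I" using i by simp
      show "derivation_on (carrier R) (E i)"
        unfolding E_def by (rule derivation_combination[OF D(1)[OF iI] D(1)[OF k(1)] c[OF k(1) assms(4)] c[OF iI assms(4)]])
      have "E i y = \<zero>" unfolding E_def using c[OF k(1) assms(4)] c[OF iI assms(4)] by algebra
      moreover have "E i z = \<zero>" if "z \<in> Y" for z
        unfolding E_def D(2)[OF iI that] D(2)[OF k(1) that] using c[OF k(1) assms(4)] c[OF iI assms(4)] by algebra
      ultimately show "E i ` insert y Y \<subseteq> {\<zero>}" by auto
      fix j assume j: "j \<in> I - {k}"
      hence fj: "j \<in> I" "f j \<in> carrier R" using assms(2) by auto
      have "D k (f j) = \<zero>" using D(3)[OF k(1) fj(1)] j by auto
      hence "E i (f j) = D k y \<otimes> D i (f j)"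
        unfolding E_def using c[OF k(1) assms(4)] c[OF iI assms(4)] c[OF iI fj(2)] by (simp add: minus_eq)
      thus "E i (f j) = \<zero> \<longleftrightarrow> i \<noteq> j"
        using D(3)[OF iI fj(1)] k(2) integral_iff[OF c[OF k(1) assms(4)] c[OF iI fj(2)]] by auto
    qed
    moreover have "card I \<le> Suc (card (I - {k}))" using k(1) assms(5) by (simp add: card_Diff_singleton)
    ultimately show ?thesis by (intro exI[of _ "I - {k}"]) auto
  qed
qed

text \<open>Each condition \<open>D y = 0\<close> costs at most one derivation.\<close>

lemma diagonal_derivations_kill:
  assumes "finite I" "diagonal_derivations F I f" "f ` I \<subseteq> carrier R" "F \<subseteq> carrier R"
    and "set ys \<subseteq> carrier R" "length ys < card I"
  shows "\<exists>D. derivation_on (carrier R) D \<and> D ` (F \<union> set ys) \<subseteq> {\<zero>} \<and> (\<exists>a\<in>carrier R. D a \<noteq> \<zero>)"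
proof -
  have "\<exists>I'\<subseteq>I. card I \<le> length ys + card I' \<and> diagonal_derivations (F \<union> set ys) I' f"
    using assms(5)
  proof (induction ys)
    case Nil
    thus ?case using assms(2) by auto
  next
    case (Cons y ys)
    then obtain I' where I': "I' \<subseteq> I" "card I \<le> length ys + card I'" "diagonal_derivations (F \<union> set ys) I' f" by auto
    have "\<exists>I''\<subseteq>I'. card I' \<le> Suc (card I'') \<and> diagonal_derivations (insert y (F \<union> set ys)) I'' f"
      by (rule diagonal_derivations_step[OF I'(3)]) (use I'(1) assms Cons.prems in \<open>auto intro: finite_subset\<close>)
    then obtain I'' where "I'' \<subseteq> I'" "card I' \<le> Suc (card I'')" "diagonal_derivations (insert y (F \<union> set ys)) I'' f"
      by blast
    thus ?case using I' by (intro exI[of _ I'']) auto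
  qed
  then obtain I' where I': "I' \<subseteq> I" "card I \<le> length ys + card I'" "diagonal_derivations (F \<union> set ys) I' f" by blast
  hence "I' \<noteq> {}" using assms(6) by auto
  then obtain i where i: "i \<in> I'" by auto
  then obtain D where "\<forall>i\<in>I'. derivation_on (carrier R) (D i) \<and> D i ` (F \<union> set ys) \<subseteq> {\<zero>} \<and>
    (\<forall>j\<in>I'. D i (f j) = \<zero> \<longleftrightarrow> i \<noteq> j)" using I'(3) unfolding diagonal_derivations_def by (rule_tac exE)
  hence "derivation_on (carrier R) (D i)" "D i ` (F \<union> set ys) \<subseteq> {\<zero>}" "D i (f i) \<noteq> \<zero>"
    using i by auto
  thus ?thesis using i I'(1) assms(3) by blast
qed

lemma transcendental_tower_length:
  assumes char0: "\<And>k::nat. 0 < k ==> add_pow R k \<one> \<noteq> \<zero>"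
    and F: "subring F R" and Z: "finite Z" "Z \<subseteq> carrier R" and gen: "carrier R = generate_ring R (F \<union> Z)"
    and fs: "set fs \<subseteq> carrier R" "transcendental_tower F fs" and ys: "set ys \<subseteq> carrier R"
    and determined: "\<And>D a. derivation_on (carrier R) D ==> D ` (F \<union> set ys) \<subseteq> {\<zero>} ==> a \<in> carrier R ==> D a = \<zero>"
  shows "length fs \<le> length ys"
proof (rule ccontr)
  assume "\<not> length fs \<le> length ys"
  note T = tower_props[OF F fs(1)]
  have TZ: "generate_ring R (tower F fs \<union> Z) = carrier R"
  proof
    show "generate_ring R (tower F fs \<union> Z) \<subseteq> carrier R"
      using generate_ring_incl subringE(1)[OF T(1)] Z(2) by auto
    show "carrier R \<subseteq> generate_ring R (tower F fs \<union> Z)"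
      using mono_generate_ring[of "F \<union> Z" "tower F fs \<union> Z"] T(2) subringE(1)[OF T(1)] Z(2) gen by auto
  qed
  have "\<exists>D. derivation_on (carrier R) D \<and> D ` F \<subseteq> {\<zero>} \<and> (\<forall>j\<in>{..<length fs}. D (fs ! j) = \<zero> \<longleftrightarrow> i \<noteq> j)"
    if i: "i < length fs" for i
  proof -
    obtain D where D: "derivation_on (tower F fs) D" "D ` F \<subseteq> {\<zero>}"
      "\<forall>j<length fs. D (fs ! j) = (if j = i then \<one> else \<zero>)"
      using tower_derivations[OF F fs i] by auto
    obtain g D' where g: "g \<in> carrier R" "g \<noteq> \<zero>" "derivation_on (carrier R) D'" "\<And>s. s \<in> tower F fs ==> D' s = g \<otimes> D s"
      using derivation_extends_generate[OF char0 Z T(1) D(1)] unfolding TZ by blast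
    have "D' (fs ! j) = \<zero> \<longleftrightarrow> i \<noteq> j" if "j < length fs" for j
      using g(4)[OF subsetD[OF T(3) nth_mem[OF that]]] that D(3) g(1,2) by auto
    moreover have "D' ` F \<subseteq> {\<zero>}"
    proof (rule image_subsetI)
      fix a assume "a \<in> F"
      hence "D a = \<zero>" "a \<in> tower F fs" using D(2) T(2) by auto
      thus "D' a \<in> {\<zero>}" using g(1,4) by simp
    qed
    ultimately show ?thesis using g(3) by (intro exI[of _ D']) simp
  qed
  hence "\<exists>D. \<forall>i\<in>{..<length fs}. derivation_on (carrier R) (D i) \<and> D i ` F \<subseteq> {\<zero>} \<and> (\<forall>j\<in>{..<length fs}. D i (fs ! j) = \<zero> \<longleftrightarrow> i \<noteq> j)"
    by (intro bchoice) auto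
  hence "diagonal_derivations F {..<length fs} ((!) fs)"
    unfolding diagonal_derivations_def .
  from diagonal_derivations_kill[OF _ this _ _ ys] show False
    using determined fs(1) subringE(1)[OF F] \<open>\<not> length fs \<le> length ys\<close> by (fastforce simp: subset_iff)
qed

text \<open>Choose \<open>f\<close> in \<open>P (Suc i)\<close> and not in \<open>P i\<close>.  If an expression in \<open>f\<close> over the previous tower lies in
  \<open>P i\<close>, its constant term lies in \<open>P (Suc i)\<close> and vanishes, and \<open>f\<close> can be cancelled modulo \<open>P i\<close>.\<close>

lemma prime_chain_transcendental_tower:
  assumes F: "subfield F R" and P: "\<And>i. i \<le> l ==> primeideal (P i) R" and strict: "\<And>i. i < l ==> P i \<subset> P (Suc i)"
  shows "\<exists>fs. length fs = l \<and> set fs \<subseteq> carrier R \<and> transcendental_tower F fs"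
proof -
  note FR = subfieldE(1)[OF F]
  have "\<exists>fs. length fs = l - i \<and> set fs \<subseteq> carrier R \<and> transcendental_tower F fs \<and> tower F fs \<inter> P i \<subseteq> {\<zero>}"
    if "i \<le> l" for i
    using that
  proof (induction rule: inc_induct)
    case base
    interpret P: primeideal "P l" R by (rule P) simp
    have "a = \<zero>" if a: "a \<in> F" "a \<in> P l" for a
    proof (rule ccontr)
      assume "a \<noteq> \<zero>"
      hence u: "inv a \<in> F" "inv a \<otimes> a = \<one>" using subfield_m_inv[OF F, of a] a by auto
      have "inv a \<otimes> a \<in> P l" using P.I_l_closed[OF a(2)] u(1) subfieldE(3)[OF F] by auto
      hence "\<one> \<in> P l" using u by simp
      thus False using P.one_imp_carrier P.I_notcarr by auto
    qed
    thus ?case by auto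
  next
    case (step i)
    then obtain fs where fs: "length fs = l - Suc i" "set fs \<subseteq> carrier R" "transcendental_tower F fs"
      "tower F fs \<inter> P (Suc i) \<subseteq> {\<zero>}" by auto
    interpret P: primeideal "P i" R by (rule P) (use step in simp)
    interpret P': primeideal "P (Suc i)" R by (rule P) (use step in simp)
    obtain f where f: "f \<in> P (Suc i)" "f \<notin> P i" using strict[OF step(2)] by blast
    have fc: "f \<in> carrier R" using f P'.Icarr by auto
    note T = tower_props[OF FR fs(2)]
    have main: "set cs \<subseteq> tower F fs ==> horner f cs \<in> P i ==> set cs \<subseteq> {\<zero>}" for cs
    proof (induction cs)
      case (Cons c cs)
      have cs: "c \<in> tower F fs" "set cs \<subseteq> tower F fs" using Cons.prems by auto
      have c: "c \<in> carrier R" "horner f cs \<in> carrier R"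
        using cs subringE(1)[OF T(1)] fc order_trans[OF cs(2) subringE(1)[OF T(1)]] by auto
      have "horner f (c # cs) \<oplus> \<ominus> (f \<otimes> horner f cs) \<in> P (Suc i)"
        using Cons.prems(2) strict[OF step(2)] P'.I_r_closed[OF f(1) c(2)] P'.a_closed P'.a_inv_closed by blast
      moreover have "horner f (c # cs) \<oplus> \<ominus> (f \<otimes> horner f cs) = c"
        unfolding horner.simps using c fc by algebra
      ultimately have "c = \<zero>" using fs(4) cs(1) by auto
      hence "f \<otimes> horner f cs \<in> P i" using Cons.prems(2) c fc by simp
      hence "horner f cs \<in> P i" using P.I_prime[OF fc c(2)] f(2) by blast
      thus ?case using Cons.IH cs(2) \<open>c = \<zero>\<close> by auto
    qed auto
    have zero: "horner f cs = \<zero>" if "set cs \<subseteq> {\<zero>}" for cs using that by (induction cs) (use fc in auto)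
    have "transcendental_over (tower F fs) f"
      unfolding transcendental_over_def
    proof (intro allI impI, elim conjE)
      fix cs assume "set cs \<subseteq> tower F fs" "horner f cs = \<zero>"
      thus "set cs \<subseteq> {\<zero>}" by (intro main) simp_all
    qed
    moreover have "tower F (f # fs) \<inter> P i \<subseteq> {\<zero>}"
    proof
      fix a assume a: "a \<in> tower F (f # fs) \<inter> P i"
      then obtain cs where cs: "a = horner f cs" "set cs \<subseteq> tower F fs" by auto
      hence "set cs \<subseteq> {\<zero>}" using a by (intro main) simp_all
      thus "a \<in> {\<zero>}" using zero cs(1) by simp
    qed
    moreover have "length (f # fs) = l - i" using fs(1) step by simp
    ultimately show ?case using fs fc by (intro exI[of _ "f # fs"]) auto
  qed
  from this[of 0] show ?thesis by auto
qed

text \<open>A chain that is too long would leave a nonzero derivation that kills \<open>F\<close> and \<open>ys\<close>.\<close>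

lemma krull_dim_le:
  assumes char0: "\<And>k::nat. 0 < k ==> add_pow R k \<one> \<noteq> \<zero>"
    and F: "subfield F R" and Z: "finite Z" "Z \<subseteq> carrier R" and gen: "carrier R = generate_ring R (F \<union> Z)"
    and ys: "set ys \<subseteq> carrier R"
    and determined: "\<And>D a. derivation_on (carrier R) D ==> D ` (F \<union> set ys) \<subseteq> {\<zero>} ==> a \<in> carrier R ==> D a = \<zero>"
  shows "krull_dim R \<le> enat (length ys)"
  unfolding krull_dim_def
proof (rule Sup_least)
  fix d assume "d \<in> {enat l |l. \<exists>P :: nat \<Rightarrow> 'a set. (\<forall>i\<le>l. primeideal (P i) R) \<and> (\<forall>i<l. P i \<subset> P (Suc i))}"
  then obtain l and P :: "nat \<Rightarrow> 'a set" where l: "d = enat l" "\<forall>i\<le>l. primeideal (P i) R" "\<forall>i<l. P i \<subset> P (Suc i)" by auto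
  obtain fs where fs: "length fs = l" "set fs \<subseteq> carrier R" "transcendental_tower F fs"
    using prime_chain_transcendental_tower[OF F, of l P] l by auto
  have "length fs \<le> length ys"
    by (rule transcendental_tower_length[OF _ subfieldE(1)[OF F] Z gen fs(2,3) ys]) (rule char0 determined; assumption)+
  thus "d \<le> enat (length ys)" using l(1) fs(1) by simp
qed

end

section \<open>Construction of chains of primes\<close>

text \<open>The iterated monoid of Coquand and Lombardi.  That it avoids 0 for some list of length \<open>n\<close> characterizes
  Krull dimension at least \<open>n\<close>.\<close>

primrec lex_monoid :: "('a, 'b) ring_scheme \<Rightarrow> 'a list \<Rightarrow> 'a set"
  where "lex_monoid R [] = {\<one>\<^bsub>R\<^esub>}"
  | "lex_monoid R (a # as) =
      {a [^]\<^bsub>R\<^esub> k \<otimes>\<^bsub>R\<^esub> (s \<oplus>\<^bsub>R\<^esub> a \<otimes>\<^bsub>R\<^esub> c) |(k::nat) s c. s \<in> lex_monoid R as \<and> c \<in> carrier R}"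

context cring
begin

lemma lex_monoid_carrier: "set as \<subseteq> carrier R ==> lex_monoid R as \<subseteq> carrier R"
  by (induction as) auto

lemma lex_monoid_one: "set as \<subseteq> carrier R ==> \<one> \<in> lex_monoid R as"
proof (induction as)
  case (Cons a as)
  hence e: "\<one> = a [^] (0::nat) \<otimes> (\<one> \<oplus> a \<otimes> \<zero>)" and "\<one> \<in> lex_monoid R as" by simp_all
  hence "a [^] (0::nat) \<otimes> (\<one> \<oplus> a \<otimes> \<zero>) \<in> lex_monoid R (a # as)"
    unfolding lex_monoid.simps using zero_closed by blast
  thus ?case using e by simp
qed simp

lemma lex_monoid_mult:
  "set as \<subseteq> carrier R ==> u \<in> lex_monoid R as ==> v \<in> lex_monoid R as ==> u \<otimes> v \<in> lex_monoid R as"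
proof (induction as arbitrary: u v)
  case (Cons a as)
  obtain k s c k' s' c' where e: "u = a [^] (k::nat) \<otimes> (s \<oplus> a \<otimes> c)" "s \<in> lex_monoid R as" "c \<in> carrier R"
    "v = a [^] (k'::nat) \<otimes> (s' \<oplus> a \<otimes> c')" "s' \<in> lex_monoid R as" "c' \<in> carrier R"
    using Cons.prems by auto
  have a: "a \<in> carrier R" "set as \<subseteq> carrier R" using Cons.prems by auto
  have s: "s \<in> carrier R" "s' \<in> carrier R" using e(2,5) lex_monoid_carrier[OF a(2)] by auto
  have p: "a [^] k \<in> carrier R" "a [^] k' \<in> carrier R" using a by auto
  have "u \<otimes> v = (a [^] k \<otimes> a [^] k') \<otimes> (s \<otimes> s' \<oplus> a \<otimes> (s \<otimes> c' \<oplus> c \<otimes> s' \<oplus> a \<otimes> c \<otimes> c'))"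
    unfolding e(1,4) using a(1) s p e(3,6) by algebra
  also have "a [^] k \<otimes> a [^] k' = a [^] (k + k')" using a by (simp add: nat_pow_mult)
  finally have "u \<otimes> v = a [^] (k + k') \<otimes> (s \<otimes> s' \<oplus> a \<otimes> (s \<otimes> c' \<oplus> c \<otimes> s' \<oplus> a \<otimes> c \<otimes> c'))" .
  moreover have "s \<otimes> s' \<in> lex_monoid R as" using Cons.IH[OF a(2) e(2,5)] .
  moreover have "s \<otimes> c' \<oplus> c \<otimes> s' \<oplus> a \<otimes> c \<otimes> c' \<in> carrier R" using a(1) s e(3,6) by auto
  ultimately show ?case unfolding lex_monoid.simps by blast
qed simp

lemma exists_prime_avoiding:
  assumes acc: "ideal_acc R" and I: "ideal I R" and disj: "I \<inter> M = {}"
    and M: "\<one> \<in> M" "\<And>u v. u \<in> M ==> v \<in> M ==> u \<otimes> v \<in> M"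
  shows "\<exists>P. primeideal P R \<and> I \<subseteq> P \<and> P \<inter> M = {}"
proof -
  obtain P where P0: "ideal P R \<and> I \<subseteq> P \<and> P \<inter> M = {}"
    and max: "\<And>J. ideal J R \<and> I \<subseteq> J \<and> J \<inter> M = {} ==> P \<subseteq> J ==> J = P"
    by (rule ideal_acc_max[OF acc, of "\<lambda>J. ideal J R \<and> I \<subseteq> J \<and> J \<inter> M = {}" I]) (use I disj in simp_all)
  hence P: "ideal P R" "I \<subseteq> P" "P \<inter> M = {}" by simp_all
  interpret P: ideal P R by (rule P(1))
  have meets: "\<exists>p\<in>P. \<exists>r\<in>carrier R. p \<oplus> r \<otimes> a \<in> M" if a: "a \<in> carrier R" "a \<notin> P" for a
  proof (rule ccontr)
    assume "\<not> ?thesis"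
    hence no: "p \<oplus> r \<otimes> a \<notin> M" if "p \<in> P" "r \<in> carrier R" for p r using that by blast
    have "set_add R P (PIdl a) \<inter> M = {}"
    proof (rule ccontr)
      assume "set_add R P (PIdl a) \<inter> M \<noteq> {}"
      then obtain z where z: "z \<in> set_add R P (PIdl a)" "z \<in> M" by blast
      then obtain p r where "p \<in> P" "r \<in> carrier R" "z = p \<oplus> r \<otimes> a" using mem_add_PIdl[OF P(1) a(1)] by blast
      thus False using no z(2) by simp
    qed
    hence "set_add R P (PIdl a) = P"
      using ideal_add_PIdl[OF P(1) a(1)] add_PIdl_incl(1)[OF P(1) a(1)] P(2) by (intro max conjI) auto
    thus False using add_PIdl_incl(2)[OF P(1) a(1)] a(2) by simp
  qed
  have "primeideal P R"
  proof (rule primeidealI[OF P(1) is_cring])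
    show "carrier R \<noteq> P" using M(1) P(3) one_closed by blast
    fix a b assume ab: "a \<in> carrier R" "b \<in> carrier R" "a \<otimes> b \<in> P"
    show "a \<in> P \<or> b \<in> P"
    proof (rule ccontr)
      assume "\<not> ?thesis"
      then obtain p r q s where e: "p \<in> P" "r \<in> carrier R" "p \<oplus> r \<otimes> a \<in> M" "q \<in> P" "s \<in> carrier R" "q \<oplus> s \<otimes> b \<in> M"
        using meets[OF ab(1)] meets[OF ab(2)] by blast
      have c: "p \<in> carrier R" "q \<in> carrier R" using e P.Icarr by auto
      have "(p \<oplus> r \<otimes> a) \<otimes> (q \<oplus> s \<otimes> b) = p \<otimes> (q \<oplus> s \<otimes> b) \<oplus> (r \<otimes> a) \<otimes> q \<oplus> (r \<otimes> s) \<otimes> (a \<otimes> b)"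
        using c e(2,5) ab(1,2) by algebra
      also have "\<dots> \<in> P" using e c ab P.I_l_closed P.I_r_closed P.a_closed by auto
      finally show False using M(2)[OF e(3,6)] P(3) by blast
    qed
  qed
  thus ?thesis using P by blast
qed

text \<open>A prime \<open>P\<close> that avoids the monoid of \<open>a # as\<close> does not contain \<open>a\<close>, and \<open>P + (a)\<close> still avoids the
  monoid of \<open>as\<close>, so that the chain continues above it.\<close>

lemma lex_monoid_prime_chain:
  assumes acc: "ideal_acc R"
  shows "set as \<subseteq> carrier R ==> ideal I R ==> I \<inter> lex_monoid R as = {} ==>
    \<exists>P :: nat \<Rightarrow> 'a set. (\<forall>i\<le>length as. primeideal (P i) R) \<and> (\<forall>i<length as. P i \<subset> P (Suc i)) \<and> I \<subseteq> P 0"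
proof (induction as arbitrary: I)
  case Nil
  from exists_prime_avoiding[OF acc Nil(2,3)] obtain P where "primeideal P R" "I \<subseteq> P" by auto
  thus ?case by (intro exI[of _ "\<lambda>_. P"]) auto
next
  case (Cons a as)
  have a: "a \<in> carrier R" "set as \<subseteq> carrier R" using Cons.prems by auto
  obtain P0 where P0: "primeideal P0 R" "I \<subseteq> P0" "P0 \<inter> lex_monoid R (a # as) = {}"
    using exists_prime_avoiding[OF acc Cons.prems(2,3) lex_monoid_one[OF Cons.prems(1)] lex_monoid_mult[OF Cons.prems(1)]]
    by auto
  interpret P0: primeideal P0 R by (rule P0(1))
  let ?J = "set_add R P0 (PIdl a)"
  have "?J \<inter> lex_monoid R as = {}"
  proof (rule ccontr)
    assume "?J \<inter> lex_monoid R as \<noteq> {}"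
    then obtain z where z: "z \<in> ?J" "z \<in> lex_monoid R as" by blast
    from z(1) obtain p r where "p \<in> P0" "r \<in> carrier R" "z = p \<oplus> r \<otimes> a"
      using mem_add_PIdl[OF P0.is_ideal a(1)] by blast
    hence pr: "p \<in> P0" "r \<in> carrier R" "p \<oplus> r \<otimes> a \<in> lex_monoid R as" using z(2) by simp_all
    have c: "p \<in> carrier R" using pr P0.Icarr by auto
    have "a [^] (0::nat) \<otimes> ((p \<oplus> r \<otimes> a) \<oplus> a \<otimes> \<ominus> r) \<in> lex_monoid R (a # as)"
      unfolding lex_monoid.simps using pr(2,3) by blast
    moreover have "a [^] (0::nat) \<otimes> ((p \<oplus> r \<otimes> a) \<oplus> a \<otimes> \<ominus> r) = p"
      unfolding nat_pow_0 using c pr(2) a(1) by algebra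
    ultimately show False using P0(3) pr(1) by auto
  qed
  from Cons.IH[OF a(2) ideal_add_PIdl[OF P0.is_ideal a(1)] this]
  obtain Q :: "nat \<Rightarrow> 'a set" where Q: "\<forall>i\<le>length as. primeideal (Q i) R" "\<forall>i<length as. Q i \<subset> Q (Suc i)" "?J \<subseteq> Q 0" by blast
  have "a [^] (1::nat) \<otimes> (\<one> \<oplus> a \<otimes> \<zero>) \<in> lex_monoid R (a # as)"
    unfolding lex_monoid.simps using lex_monoid_one[OF a(2)] by blast
  hence "a \<notin> P0" using P0(3) a by auto
  hence "P0 \<subset> Q 0" using Q(3) add_PIdl_incl[OF P0.is_ideal a(1)] by blast
  thus ?case

  proof (intro exI[of _ "\<lambda>i. case i of 0 \<Rightarrow> P0 | Suc j \<Rightarrow> Q j"] conjI allI impI)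
    show "primeideal (case i of 0 \<Rightarrow> P0 | Suc j \<Rightarrow> Q j) R" if "i \<le> length (a # as)" for i
      using that P0(1) Q(1) by (cases i) auto
    show "(case i of 0 \<Rightarrow> P0 | Suc j \<Rightarrow> Q j) \<subset> (case Suc i of 0 \<Rightarrow> P0 | Suc j \<Rightarrow> Q j)"
      if "i < length (a # as)" for i
      using that \<open>P0 \<subset> Q 0\<close> Q(2) by (cases i) simp_all
  qed (use P0(2) in simp)
qed

lemma krull_dim_ge:
  assumes acc: "ideal_acc R" and as: "set as \<subseteq> carrier R" "\<zero> \<notin> lex_monoid R as"
  shows "enat (length as) \<le> krull_dim R"
  using lex_monoid_prime_chain[OF acc as(1) zeroideal] as(2)
  unfolding krull_dim_def by (intro Sup_upper) blast

end

text \<open>Primes of a ring of fractions are determined by their contractions.\<close>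

lemma (in cring) krull_dim_fractions_le:
  assumes B: "subring B R" and S: "subring S R" and "B \<subseteq> S"
    and frac: "\<And>a. a \<in> S ==> \<exists>s\<in>B. \<exists>t\<in>S. s \<otimes> a \<in> B \<and> t \<otimes> (s \<otimes> a) = a"
  shows "krull_dim (R\<lparr>carrier := S\<rparr>) \<le> krull_dim (R\<lparr>carrier := B\<rparr>)"
  unfolding krull_dim_def
proof (rule Sup_subset_mono, rule subsetI)
  fix d assume "d \<in> {enat l |l. \<exists>P :: nat \<Rightarrow> 'a set. (\<forall>i\<le>l. primeideal (P i) (R\<lparr>carrier := S\<rparr>)) \<and> (\<forall>i<l. P i \<subset> P (Suc i))}"
  then obtain l and P :: "nat \<Rightarrow> 'a set" where l: "d = enat l" "\<And>i. i \<le> l ==> primeideal (P i) (R\<lparr>carrier := S\<rparr>)"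
    "\<And>i. i < l ==> P i \<subset> P (Suc i)" by auto
  have id: "ideal_in R S (P i)" if "i \<le> l" for i
    using primeideal.axioms(1)[OF l(2)[OF that]] ideal_in_iff[OF S] by simp
  have prime: "primeideal (P i \<inter> B) (R\<lparr>carrier := B\<rparr>)" if "i \<le> l" for i
  proof (rule primeidealI)
    note I = id[OF that, unfolded ideal_in_def]
    have "ideal_in R B (P i \<inter> B)"
      unfolding ideal_in_def using I \<open>B \<subseteq> S\<close> subringE(2,6,7)[OF B] by (intro conjI ballI) auto
    thus "ideal (P i \<inter> B) (R\<lparr>carrier := B\<rparr>)" using ideal_in_iff[OF B] by simp
    show "cring (R\<lparr>carrier := B\<rparr>)" by (rule subring_cring[OF B])
    interpret P: primeideal "P i" "R\<lparr>carrier := S\<rparr>" by (rule l(2)[OF that])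
    have "\<one> \<notin> P i" using P.one_imp_carrier P.I_notcarr by auto
    thus "carrier (R\<lparr>carrier := B\<rparr>) \<noteq> P i \<inter> B" using subringE(3)[OF B] by auto
    show "a \<in> P i \<inter> B \<or> b \<in> P i \<inter> B" if "a \<in> carrier (R\<lparr>carrier := B\<rparr>)" "b \<in> carrier (R\<lparr>carrier := B\<rparr>)"
      "a \<otimes>\<^bsub>R\<lparr>carrier := B\<rparr>\<^esub> b \<in> P i \<inter> B" for a b
      using P.I_prime[of a b] that \<open>B \<subseteq> S\<close> by auto
  qed
  have strict: "P i \<inter> B \<subset> P (Suc i) \<inter> B" if i: "i < l" for i
  proof -
    obtain a where a: "a \<in> P (Suc i)" "a \<notin> P i" using l(3)[OF i] by blast
    have I: "ideal_in R S (P i)" "ideal_in R S (P (Suc i))" using id i by auto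
    have "a \<in> S" using a I(2) unfolding ideal_in_def by auto
    then obtain s t where st: "s \<in> B" "t \<in> S" "s \<otimes> a \<in> B" "t \<otimes> (s \<otimes> a) = a" using frac by blast
    have "s \<otimes> a \<in> P (Suc i)" using I(2) st(1) \<open>B \<subseteq> S\<close> a(1) unfolding ideal_in_def by auto
    moreover have "s \<otimes> a \<notin> P i"
    proof
      assume "s \<otimes> a \<in> P i"
      hence "t \<otimes> (s \<otimes> a) \<in> P i" using I(1) st(2) unfolding ideal_in_def by auto
      thus False using st(4) a(2) by simp
    qed
    ultimately show ?thesis using st(3) l(3)[OF i] by blast
  qed
  show "d \<in> {enat l |l. \<exists>P :: nat \<Rightarrow> 'a set. (\<forall>i\<le>l. primeideal (P i) (R\<lparr>carrier := B\<rparr>)) \<and> (\<forall>i<l. P i \<subset> P (Suc i))}"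
    using l(1) prime strict by (intro CollectI exI[of _ l] conjI exI[of _ "\<lambda>i. P i \<inter> B"]) auto
qed

section \<open>Free modules\<close>

lemma free_module_simps [simp]:
  "zero (free_module R S) = (\<lambda>_. \<zero>\<^bsub>R\<^esub>)"
  "add (free_module R S) f g = (\<lambda>s. f s \<oplus>\<^bsub>R\<^esub> g s)"
  "smult (free_module R S) r f = (\<lambda>s. r \<otimes>\<^bsub>R\<^esub> f s)"
  by (simp_all add: free_module_def)

lemma free_mem_iff:
  "f \<in> carrier (free_module R S) \<longleftrightarrow>
    (\<forall>s. f s \<in> carrier R) \<and> (\<forall>s. s \<notin> S \<longrightarrow> f s = \<zero>\<^bsub>R\<^esub>) \<and> finite {s. f s \<noteq> \<zero>\<^bsub>R\<^esub>}"
  by (simp add: free_module_def)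

lemma free_memD:
  assumes "f \<in> carrier (free_module R S)"
  shows "f s \<in> carrier R" "s \<notin> S ==> f s = \<zero>\<^bsub>R\<^esub>" "finite {s. f s \<noteq> \<zero>\<^bsub>R\<^esub>}"
  using assms by (auto simp: free_mem_iff)

context cring
begin

lemma free_gen_carrier [simp, intro]: "s \<in> S ==> free_gen R s \<in> carrier (free_module R S)"
  by (auto simp: free_mem_iff free_gen_def)

lemma free_module_add_closed:
  assumes "f \<in> carrier (free_module R S)" "g \<in> carrier (free_module R S)"
  shows "(\<lambda>s. f s \<oplus> g s) \<in> carrier (free_module R S)"
proof -
  have "{s. f s \<oplus> g s \<noteq> \<zero>} \<subseteq> {s. f s \<noteq> \<zero>} \<union> {s. g s \<noteq> \<zero>}" by auto
  hence "finite {s. f s \<oplus> g s \<noteq> \<zero>}"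
    by (rule finite_subset) (use assms in \<open>simp add: free_mem_iff\<close>)
  thus ?thesis using assms by (simp add: free_mem_iff)
qed

lemma free_module_smult_closed:
  assumes "f \<in> carrier (free_module R S)" "r \<in> carrier R"
  shows "(\<lambda>s. r \<otimes> f s) \<in> carrier (free_module R S)"
proof -
  have "{s. r \<otimes> f s \<noteq> \<zero>} \<subseteq> {s. f s \<noteq> \<zero>}" using assms(2) by auto
  hence "finite {s. r \<otimes> f s \<noteq> \<zero>}"
    by (rule finite_subset) (use assms in \<open>simp add: free_mem_iff\<close>)
  thus ?thesis using assms by (simp add: free_mem_iff)
qed

lemma free_module_module: "module R (free_module R S)"
proof (rule moduleI[OF is_cring])
  let ?F = "free_module R S"
  show "abelian_group ?F"
  proof (rule abelian_groupI)
    fix f assume f: "f \<in> carrier ?F"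
    have "(\<lambda>s. (\<ominus> \<one>) \<otimes> f s) \<in> carrier ?F" by (rule free_module_smult_closed[OF f]) simp
    moreover have "(\<ominus> \<one>) \<otimes> f s \<oplus> f s = \<zero>" for s using free_memD(1)[OF f, of s] by algebra
    ultimately show "\<exists>g\<in>carrier ?F. g \<oplus>\<^bsub>?F\<^esub> f = \<zero>\<^bsub>?F\<^esub>" by (intro bexI) auto
  next
    fix f g h assume "f \<in> carrier ?F" "g \<in> carrier ?F" "h \<in> carrier ?F"
    note c = this[THEN free_memD(1)]
    show "f \<oplus>\<^bsub>?F\<^esub> g \<oplus>\<^bsub>?F\<^esub> h = f \<oplus>\<^bsub>?F\<^esub> (g \<oplus>\<^bsub>?F\<^esub> h)" using c by (simp add: a_assoc)
  next
    fix f g assume "f \<in> carrier ?F" "g \<in> carrier ?F"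
    note c = this[THEN free_memD(1)]
    show "f \<oplus>\<^bsub>?F\<^esub> g = g \<oplus>\<^bsub>?F\<^esub> f" using c by (simp add: a_comm)
  qed (use free_memD(1)[of _ R S] in
      \<open>auto intro: free_module_add_closed simp: free_mem_iff[of "\<lambda>_. \<zero>"]\<close>)
qed (use free_memD(1)[of _ R S] in
    \<open>auto intro: free_module_smult_closed simp: l_distr r_distr m_assoc\<close>)

lemma free_module_a_inv:
  assumes f: "f \<in> carrier (free_module R S)"
  shows "\<ominus>\<^bsub>free_module R S\<^esub> f = (\<lambda>s. \<ominus> f s)"
proof -
  interpret F: module R "free_module R S" by (rule free_module_module)
  have "(\<lambda>s. (\<ominus> \<one>) \<otimes> f s) \<in> carrier (free_module R S)" by (rule free_module_smult_closed[OF f]) simp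
  moreover have "(\<lambda>s. (\<ominus> \<one>) \<otimes> f s) = (\<lambda>s. \<ominus> f s)" using free_memD(1)[OF f] by (auto simp: l_minus)
  ultimately have c: "(\<lambda>s. \<ominus> f s) \<in> carrier (free_module R S)" by simp
  show ?thesis by (rule F.minus_equality[OF _ f c]) (use free_memD(1)[OF f] in \<open>auto simp: l_neg\<close>)
qed

lemma free_module_minus:
  assumes "f \<in> carrier (free_module R S)" "g \<in> carrier (free_module R S)"
  shows "f \<ominus>\<^bsub>free_module R S\<^esub> g = (\<lambda>s. f s \<ominus> g s)"
  unfolding a_minus_def free_module_a_inv[OF assms(2)] by simp

lemma free_module_induct [consumes 1, case_names zero step]:
  assumes f: "f \<in> carrier (free_module R S)" and zero: "P (\<lambda>_. \<zero>)"
    and step: "\<And>f r s. \<lbrakk>f \<in> carrier (free_module R S); P f; r \<in> carrier R; s \<in> S\<rbrakk>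
      \<Longrightarrow> P (\<lambda>t. f t \<oplus> r \<otimes> free_gen R s t)"
  shows "P f"
proof -
  have "P f" if "finite A" "f \<in> carrier (free_module R S)" "{s. f s \<noteq> \<zero>} \<subseteq> A" for A f
    using that
  proof (induction A arbitrary: f)
    case empty
    hence "f = (\<lambda>_. \<zero>)" by auto
    thus ?case using zero by simp
  next
    case (insert a A)
    note fc = free_memD[OF insert.prems(1)]
    show ?case
    proof (cases "a \<in> S")
      case False
      thus ?thesis using insert fc by auto
    next
      case True
      let ?g = "f(a := \<zero>)"
      have "finite {s. ?g s \<noteq> \<zero>}" by (rule finite_subset[OF _ fc(3)]) auto
      hence g: "?g \<in> carrier (free_module R S)" using fc(1,2) unfolding free_mem_iff by simp
      have "P ?g" by (rule insert.IH[OF g]) (use insert.prems in auto)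
      from step[OF g this fc(1) True] have "P (\<lambda>t. ?g t \<oplus> f a \<otimes> free_gen R a t)" .
      moreover have "(\<lambda>t. ?g t \<oplus> f a \<otimes> free_gen R a t) = f" using fc(1) by (auto simp: free_gen_def)
      ultimately show ?thesis by simp
    qed
  qed
  thus ?thesis using f free_memD(3)[OF f] by blast
qed

end

definition lin_ext :: "('r, 'l) ring_scheme \<Rightarrow> ('r, 'm, 'b) module_scheme \<Rightarrow> ('s \<Rightarrow> 'm) \<Rightarrow> ('s \<Rightarrow> 'r) \<Rightarrow> 'm"
  where "lin_ext R M v f = finsum M (\<lambda>s. f s \<odot>\<^bsub>M\<^esub> v s) {s. f s \<noteq> \<zero>\<^bsub>R\<^esub>}"

context module
begin

lemma lin_ext_eq:
  assumes v: "v \<in> S \<rightarrow> carrier M" and f: "f \<in> carrier (free_module R S)"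
    and A: "finite A" "{s. f s \<noteq> \<zero>} \<subseteq> A" "A \<subseteq> S"
  shows "lin_ext R M v f = finsum M (\<lambda>s. f s \<odot>\<^bsub>M\<^esub> v s) A"
  unfolding lin_ext_def
proof (rule M.add.finprod_mono_neutral_cong_left[OF A(1,2)])
  show "f s \<odot>\<^bsub>M\<^esub> v s = \<zero>\<^bsub>M\<^esub>" if "s \<in> A - {s. f s \<noteq> \<zero>}" for s
    using that v A(3) by (auto intro!: smult_l_null)
  show "(\<lambda>s. f s \<odot>\<^bsub>M\<^esub> v s) \<in> A \<rightarrow> carrier M" using v A(3) free_memD(1)[OF f] by auto
qed simp

lemma lin_ext_closed:
  assumes v: "v \<in> S \<rightarrow> carrier M" and f: "f \<in> carrier (free_module R S)"
  shows "lin_ext R M v f \<in> carrier M"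
  unfolding lin_ext_def using v free_memD[OF f] by (intro M.finsum_closed) fastforce

lemma lin_ext_add:
  assumes v: "v \<in> S \<rightarrow> carrier M" and f: "f \<in> carrier (free_module R S)" and g: "g \<in> carrier (free_module R S)"
  shows "lin_ext R M v (\<lambda>s. f s \<oplus> g s) = lin_ext R M v f \<oplus>\<^bsub>M\<^esub> lin_ext R M v g"
proof -
  let ?A = "{s. f s \<noteq> \<zero>} \<union> {s. g s \<noteq> \<zero>}"
  have A: "finite ?A" "?A \<subseteq> S" using free_memD[OF f] free_memD[OF g] by auto
  have c: "(\<lambda>s. f s \<odot>\<^bsub>M\<^esub> v s) \<in> ?A \<rightarrow> carrier M" "(\<lambda>s. g s \<odot>\<^bsub>M\<^esub> v s) \<in> ?A \<rightarrow> carrier M"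
    using v A(2) free_memD(1)[OF f] free_memD(1)[OF g] by (auto intro!: smult_closed)
  have "lin_ext R M v (\<lambda>s. f s \<oplus> g s) = finsum M (\<lambda>s. (f s \<oplus> g s) \<odot>\<^bsub>M\<^esub> v s) ?A"
    by (rule lin_ext_eq[OF v R.free_module_add_closed[OF f g] A(1) _ A(2)]) auto
  also have "\<dots> = finsum M (\<lambda>s. f s \<odot>\<^bsub>M\<^esub> v s \<oplus>\<^bsub>M\<^esub> g s \<odot>\<^bsub>M\<^esub> v s) ?A"
  proof (rule M.finsum_cong'[OF refl])
    fix s assume "s \<in> ?A"
    hence "v s \<in> carrier M" using A(2) v by blast
    thus "(f s \<oplus> g s) \<odot>\<^bsub>M\<^esub> v s = f s \<odot>\<^bsub>M\<^esub> v s \<oplus>\<^bsub>M\<^esub> g s \<odot>\<^bsub>M\<^esub> v s"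
      by (intro smult_l_distr free_memD(1)[OF f] free_memD(1)[OF g])
  next
    show "(\<lambda>s. f s \<odot>\<^bsub>M\<^esub> v s \<oplus>\<^bsub>M\<^esub> g s \<odot>\<^bsub>M\<^esub> v s) \<in> ?A \<rightarrow> carrier M"
      using c by (intro funcsetI M.a_closed) blast+
  qed
  also have "\<dots> = finsum M (\<lambda>s. f s \<odot>\<^bsub>M\<^esub> v s) ?A \<oplus>\<^bsub>M\<^esub> finsum M (\<lambda>s. g s \<odot>\<^bsub>M\<^esub> v s) ?A"
    by (rule M.finsum_addf[OF c])
  also have "\<dots> = lin_ext R M v f \<oplus>\<^bsub>M\<^esub> lin_ext R M v g"
    using lin_ext_eq[OF v f A(1) _ A(2)] lin_ext_eq[OF v g A(1) _ A(2)] by simp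
  finally show ?thesis .
qed

lemma lin_ext_single:
  assumes v: "v \<in> S \<rightarrow> carrier M" and r: "r \<in> carrier R" and s: "s \<in> S"
  shows "lin_ext R M v (\<lambda>t. r \<otimes> free_gen R s t) = r \<odot>\<^bsub>M\<^esub> v s"
proof -
  have vs: "v s \<in> carrier M" using v s by auto
  have "lin_ext R M v (\<lambda>t. r \<otimes> free_gen R s t) = finsum M (\<lambda>t. (r \<otimes> free_gen R s t) \<odot>\<^bsub>M\<^esub> v t) {s}"
    by (rule lin_ext_eq[OF v R.free_module_smult_closed[OF R.free_gen_carrier[OF s] r]])
      (use s r in \<open>auto simp: free_gen_def split: if_splits\<close>)
  also have "\<dots> = (r \<otimes> \<one>) \<odot>\<^bsub>M\<^esub> v s" using vs r by (simp add: free_gen_def)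
  finally show ?thesis using r by simp
qed

lemma lin_ext_gen:
  assumes v: "v \<in> S \<rightarrow> carrier M" and s: "s \<in> S"
  shows "lin_ext R M v (free_gen R s) = v s"
proof -
  have "(\<lambda>t. \<one> \<otimes> free_gen R s t) = free_gen R s" by (auto simp: free_gen_def)
  moreover have "v s \<in> carrier M" using v s by auto
  ultimately show ?thesis using lin_ext_single[OF v R.one_closed s] by simp
qed

lemma lin_ext_zero: "lin_ext R M v (\<lambda>_. \<zero>) = \<zero>\<^bsub>M\<^esub>"
  by (simp add: lin_ext_def)

lemma lin_ext_smult:
  assumes v: "v \<in> S \<rightarrow> carrier M" and r: "r \<in> carrier R" and f: "f \<in> carrier (free_module R S)"
  shows "lin_ext R M v (\<lambda>s. r \<otimes> f s) = r \<odot>\<^bsub>M\<^esub> lin_ext R M v f"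
  using f
proof (induct f rule: R.free_module_induct)
  case zero
  thus ?case using r by (simp add: lin_ext_zero)
next
  case (step f q s)
  have g: "(\<lambda>t. q \<otimes> free_gen R s t) \<in> carrier (free_module R S)" "(\<lambda>t. (r \<otimes> q) \<otimes> free_gen R s t) \<in> carrier (free_module R S)"
    using R.free_module_smult_closed[OF R.free_gen_carrier[OF step(4)]] step(3) r R.m_closed by blast+
  have rf: "(\<lambda>s. r \<otimes> f s) \<in> carrier (free_module R S)" by (rule R.free_module_smult_closed[OF step(1) r])
  have vs: "v s \<in> carrier M" using v step(4) by auto
  have "(\<lambda>t. r \<otimes> (f t \<oplus> q \<otimes> free_gen R s t)) = (\<lambda>t. r \<otimes> f t \<oplus> (r \<otimes> q) \<otimes> free_gen R s t)"
    using free_memD(1)[OF step(1)] step(3) r by (auto simp: free_gen_def R.r_distr)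
  hence "lin_ext R M v (\<lambda>t. r \<otimes> (f t \<oplus> q \<otimes> free_gen R s t)) = r \<odot>\<^bsub>M\<^esub> lin_ext R M v f \<oplus>\<^bsub>M\<^esub> (r \<otimes> q) \<odot>\<^bsub>M\<^esub> v s"
    using lin_ext_add[OF v rf g(2)] step(2) lin_ext_single[OF v _ step(4), of "r \<otimes> q"] r step(3) by simp
  also have "\<dots> = r \<odot>\<^bsub>M\<^esub> (lin_ext R M v f \<oplus>\<^bsub>M\<^esub> q \<odot>\<^bsub>M\<^esub> v s)"
    using lin_ext_closed[OF v step(1)] vs r step(3) by (simp add: smult_r_distr smult_assoc1)
  also have "\<dots> = r \<odot>\<^bsub>M\<^esub> lin_ext R M v (\<lambda>t. f t \<oplus> q \<otimes> free_gen R s t)"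
    using lin_ext_add[OF v step(1) g(1)] lin_ext_single[OF v step(3,4)] by simp
  finally show ?case .
qed

lemma lin_ext_minus:
  assumes v: "v \<in> S \<rightarrow> carrier M" and f: "f \<in> carrier (free_module R S)" and g: "g \<in> carrier (free_module R S)"
  shows "lin_ext R M v (f \<ominus>\<^bsub>free_module R S\<^esub> g) = lin_ext R M v f \<ominus>\<^bsub>M\<^esub> lin_ext R M v g"
proof -
  have mg: "(\<lambda>s. (\<ominus> \<one>) \<otimes> g s) \<in> carrier (free_module R S)" by (rule R.free_module_smult_closed[OF g]) simp
  have "f \<ominus>\<^bsub>free_module R S\<^esub> g = (\<lambda>s. f s \<oplus> (\<ominus> \<one>) \<otimes> g s)"
    unfolding R.free_module_minus[OF f g] using free_memD(1)[OF g] by (auto simp: R.minus_eq R.l_minus)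
  hence "lin_ext R M v (f \<ominus>\<^bsub>free_module R S\<^esub> g) = lin_ext R M v f \<oplus>\<^bsub>M\<^esub> (\<ominus> \<one>) \<odot>\<^bsub>M\<^esub> lin_ext R M v g"
    using lin_ext_add[OF v f mg] lin_ext_smult[OF v _ g, of "\<ominus> \<one>"] by simp
  thus ?thesis using lin_ext_closed[OF v g] by (simp add: smult_l_minus a_minus_def)
qed

text \<open>To define a linear map on a quotient of a free module it is enough to check the relations.\<close>

lemma module_span_lin_ext:
  assumes v: "v \<in> S \<rightarrow> carrier M" and N: "submodule N R M"
    and X: "\<And>f. f \<in> X ==> f \<in> carrier (free_module R S) \<and> lin_ext R M v f \<in> N"
    and f: "f \<in> module_span R (free_module R S) X"
  shows "f \<in> carrier (free_module R S)" "lin_ext R M v f \<in> N"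
proof -
  interpret F: module R "free_module R S" by (rule R.free_module_module)
  interpret N: submodule N R M by (rule N)
  let ?N = "{f \<in> carrier (free_module R S). lin_ext R M v f \<in> N}"
  have zN: "\<zero>\<^bsub>M\<^esub> \<in> N" using N.one_closed by simp
  have aN: "x \<oplus>\<^bsub>M\<^esub> y \<in> N" if "x \<in> N" "y \<in> N" for x y using N.m_closed that by simp
  have "submodule ?N R (free_module R S)"
  proof (rule F.submoduleI)
    show "\<zero>\<^bsub>free_module R S\<^esub> \<in> ?N" using zN F.zero_closed by (simp add: lin_ext_zero)
    fix a assume a: "a \<in> ?N"
    have "\<ominus>\<^bsub>free_module R S\<^esub> a = (\<lambda>s. (\<ominus> \<one>) \<otimes> a s)"
      using R.free_module_a_inv[of a S] a free_memD(1)[of a R S] by (auto simp: R.l_minus)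
    thus "\<ominus>\<^bsub>free_module R S\<^esub> a \<in> ?N"
      using a R.free_module_smult_closed[of a S "\<ominus> \<one>"] lin_ext_smult[OF v _, of "\<ominus> \<one>" a] N.smult_closed[of "\<ominus> \<one>"] by auto
  next
    fix a b assume "a \<in> ?N" "b \<in> ?N"
    thus "a \<oplus>\<^bsub>free_module R S\<^esub> b \<in> ?N" using R.free_module_add_closed lin_ext_add[OF v] aN by auto
  next
    fix r a assume "r \<in> carrier R" "a \<in> ?N"
    thus "r \<odot>\<^bsub>free_module R S\<^esub> a \<in> ?N" using R.free_module_smult_closed lin_ext_smult[OF v] N.smult_closed by auto
  qed auto
  moreover have "X \<subseteq> ?N" using X by auto
  ultimately have "f \<in> ?N" using f unfolding module_span_def by auto
  thus "f \<in> carrier (free_module R S)" "lin_ext R M v f \<in> N" by auto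
qed

end

section \<open>Polynomial algebras\<close>

lemma finite_submultisets: "finite {u. u \<subseteq># (w :: 'v multiset)}"
proof (induction w)
  case (add x w)
  have "{u. u \<subseteq># add_mset x w} \<subseteq> {u. u \<subseteq># w} \<union> add_mset x ` {u. u \<subseteq># w}"
  proof
    fix u assume u: "u \<in> {u. u \<subseteq># add_mset x w}"
    show "u \<in> {u. u \<subseteq># w} \<union> add_mset x ` {u. u \<subseteq># w}"
    proof (cases "x \<in># u")
      case True
      hence "u = add_mset x (u - {#x#})" by simp
      moreover have "u - {#x#} \<subseteq># w" using u by (simp add: subset_eq_diff_conv)
      ultimately show ?thesis by blast
    next
      case False
      have "u \<subseteq># w"
      proof (rule mset_subset_eqI)
        fix a
        have "count u a \<le> count (add_mset x w) a" using mset_subset_eq_count[of u "add_mset x w" a] u by blast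
        thus "count u a \<le> count w a" using False by (cases "a = x") (simp_all add: not_in_iff)
      qed
      thus ?thesis by simp
    qed
  qed
  thus ?case using add finite_subset by blast
qed simp

lemma poly_alg_simps [simp]:
  "carrier (polynomial_algebra R V) = carrier (free_module R {w. set_mset w \<subseteq> V})"
  "zero (polynomial_algebra R V) = (\<lambda>_. \<zero>\<^bsub>R\<^esub>)"
  "add (polynomial_algebra R V) f g = (\<lambda>s. f s \<oplus>\<^bsub>R\<^esub> g s)"
  "smult (polynomial_algebra R V) r f = (\<lambda>s. r \<otimes>\<^bsub>R\<^esub> f s)"
  "one (polynomial_algebra R V) = free_gen R {#}"
  by (simp_all add: polynomial_algebra_def)

lemma polynomial_algebra_mult:
  "mult (polynomial_algebra R V) f g w = finsum R (\<lambda>u. f u \<otimes>\<^bsub>R\<^esub> g (w - u)) {u. u \<subseteq># w}"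
  by (simp add: polynomial_algebra_def)

lemma polynomial_algebra_add_monoid:
  "add_monoid (polynomial_algebra R V) = add_monoid (free_module R {w. set_mset w \<subseteq> V})"
  by (simp add: polynomial_algebra_def)

context cring
begin

context
  fixes V :: "'v set"
begin

abbreviation (input) PA where "PA \<equiv> polynomial_algebra R V"
abbreviation (input) pm (infixl \<open>*p\<close> 70) where "f *p g \<equiv> f \<otimes>\<^bsub>polynomial_algebra R V\<^esub> g"

lemma poly_val: "f \<in> carrier PA ==> f u \<in> carrier R"
  by (simp add: free_mem_iff)

lemma poly_mult_gen:
  assumes g: "\<And>w. g w \<in> carrier R"
  shows "free_gen R u *p g = (\<lambda>w. if u \<subseteq># w then g (w - u) else \<zero>)"
proof
  fix w
  have "(free_gen R u *p g) w = finsum R (\<lambda>j. if u = j then g (w - j) else \<zero>) {u. u \<subseteq># w}"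
    unfolding polynomial_algebra_mult by (rule finsum_cong'[OF refl]) (use g in \<open>auto simp: free_gen_def\<close>)
  also have "\<dots> = (if u \<subseteq># w then g (w - u) else \<zero>)"
  proof (cases "u \<subseteq># w")
    case True
    thus ?thesis
      using add.finprod_singleton[of u "{u. u \<subseteq># w}" "\<lambda>j. g (w - j)"] finite_submultisets g by auto
  next
    case False
    hence "finsum R (\<lambda>j. if u = j then g (w - j) else \<zero>) {u. u \<subseteq># w} = finsum R (\<lambda>j. \<zero>) {u. u \<subseteq># w}"
      by (intro finsum_cong'[OF refl]) auto
    thus ?thesis using False by simp
  qed
  finally show "(free_gen R u *p g) w = (if u \<subseteq># w then g (w - u) else \<zero>)" .
qed

lemma poly_mult_gen_gen: "free_gen R u *p free_gen R v = free_gen R (u + v)"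
  by (subst poly_mult_gen) (auto simp: free_gen_def fun_eq_iff)

lemma poly_mult_add_left:
  assumes "\<And>w. f w \<in> carrier R" "\<And>w. g w \<in> carrier R" "\<And>w. h w \<in> carrier R"
  shows "(\<lambda>w. f w \<oplus> g w) *p h = (\<lambda>w. (f *p h) w \<oplus> (g *p h) w)"
proof
  fix w
  have "((\<lambda>w. f w \<oplus> g w) *p h) w = finsum R (\<lambda>u. f u \<otimes> h (w - u) \<oplus> g u \<otimes> h (w - u)) {u. u \<subseteq># w}"
    unfolding polynomial_algebra_mult by (rule finsum_cong'[OF refl]) (use assms in \<open>auto simp: l_distr\<close>)
  thus "((\<lambda>w. f w \<oplus> g w) *p h) w = (f *p h) w \<oplus> (g *p h) w"
    unfolding polynomial_algebra_mult using assms by (subst finsum_addf[symmetric]) auto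
qed

lemma poly_mult_smult_left:
  assumes "\<And>w. f w \<in> carrier R" "\<And>w. h w \<in> carrier R" "r \<in> carrier R"
  shows "(\<lambda>w. r \<otimes> f w) *p h = (\<lambda>w. r \<otimes> (f *p h) w)"
proof
  fix w
  have "((\<lambda>w. r \<otimes> f w) *p h) w = finsum R (\<lambda>u. r \<otimes> (f u \<otimes> h (w - u))) {u. u \<subseteq># w}"
    unfolding polynomial_algebra_mult by (rule finsum_cong'[OF refl]) (use assms in \<open>auto simp: m_assoc\<close>)
  thus "((\<lambda>w. r \<otimes> f w) *p h) w = r \<otimes> (f *p h) w"
    unfolding polynomial_algebra_mult using assms finite_submultisets by (subst finsum_rdistr) auto
qed

lemma poly_mult_add_right:
  assumes "\<And>w. f w \<in> carrier R" "\<And>w. g w \<in> carrier R" "\<And>w. h w \<in> carrier R"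
  shows "h *p (\<lambda>w. f w \<oplus> g w) = (\<lambda>w. (h *p f) w \<oplus> (h *p g) w)"
proof
  fix w
  have "(h *p (\<lambda>w. f w \<oplus> g w)) w = finsum R (\<lambda>u. h u \<otimes> f (w - u) \<oplus> h u \<otimes> g (w - u)) {u. u \<subseteq># w}"
    unfolding polynomial_algebra_mult by (rule finsum_cong'[OF refl]) (use assms in \<open>auto simp: r_distr\<close>)
  thus "(h *p (\<lambda>w. f w \<oplus> g w)) w = (h *p f) w \<oplus> (h *p g) w"
    unfolding polynomial_algebra_mult using assms by (subst finsum_addf[symmetric]) auto
qed

lemma poly_mult_smult_right:
  assumes "\<And>w. f w \<in> carrier R" "\<And>w. h w \<in> carrier R" "r \<in> carrier R"
  shows "h *p (\<lambda>w. r \<otimes> f w) = (\<lambda>w. r \<otimes> (h *p f) w)"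
proof
  fix w
  have "(h *p (\<lambda>w. r \<otimes> f w)) w = finsum R (\<lambda>u. r \<otimes> (h u \<otimes> f (w - u))) {u. u \<subseteq># w}"
    unfolding polynomial_algebra_mult by (rule finsum_cong'[OF refl]) (use assms in \<open>auto simp: m_lcomm\<close>)
  thus "(h *p (\<lambda>w. r \<otimes> f w)) w = r \<otimes> (h *p f) w"
    unfolding polynomial_algebra_mult using assms finite_submultisets by (subst finsum_rdistr) auto
qed

lemma poly_mult_zero:
  assumes "\<And>w. h w \<in> carrier R"
  shows "(\<lambda>w. \<zero>) *p h = (\<lambda>w. \<zero>)" "h *p (\<lambda>w. \<zero>) = (\<lambda>w. \<zero>)"
  using assms by (auto simp: fun_eq_iff polynomial_algebra_mult)

lemma poly_mult_val:
  assumes "\<And>w. f w \<in> carrier R" "\<And>w. h w \<in> carrier R"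
  shows "(f *p h) w \<in> carrier R"
  unfolding polynomial_algebra_mult using assms by (intro finsum_closed) auto

lemma free_gen_val: "free_gen R s w \<in> carrier R"
  by (simp add: free_gen_def)

lemma poly_mult_zero_gen:
  "(\<lambda>w. \<zero>) *p free_gen R s = (\<lambda>w. \<zero>)" "free_gen R s *p (\<lambda>w. \<zero>) = (\<lambda>w. \<zero>)"
  by (rule poly_mult_zero, simp add: free_gen_def)+

lemma poly_mult_zero_poly:
  assumes "f \<in> carrier PA"
  shows "(\<lambda>w. \<zero>) *p f = (\<lambda>w. \<zero>)" "f *p (\<lambda>w. \<zero>) = (\<lambda>w. \<zero>)"
  by (rule poly_mult_zero, rule poly_val[OF assms])+

lemma poly_mult_lin_left:
  assumes "\<And>w. f w \<in> carrier R" "\<And>w. g w \<in> carrier R" "\<And>w. h w \<in> carrier R" "r \<in> carrier R"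
  shows "(\<lambda>w. f w \<oplus> r \<otimes> g w) *p h = (\<lambda>w. (f *p h) w \<oplus> r \<otimes> (g *p h) w)"
proof -
  have "r \<otimes> g w \<in> carrier R" for w using assms(2,4) by simp
  from poly_mult_add_left[OF assms(1) this assms(3)] show ?thesis
    unfolding poly_mult_smult_left[OF assms(2-4)] .
qed

lemma poly_mult_lin_right:
  assumes "\<And>w. f w \<in> carrier R" "\<And>w. g w \<in> carrier R" "\<And>w. h w \<in> carrier R" "r \<in> carrier R"
  shows "h *p (\<lambda>w. f w \<oplus> r \<otimes> g w) = (\<lambda>w. (h *p f) w \<oplus> r \<otimes> (h *p g) w)"
proof -
  have "r \<otimes> g w \<in> carrier R" for w using assms(2,4) by simp
  from poly_mult_add_right[OF assms(1) this assms(3)] show ?thesis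
    unfolding poly_mult_smult_right[OF assms(2-4)] .
qed

lemma poly_gen_mult_closed:
  assumes s: "set_mset s \<subseteq> V" and "g \<in> carrier PA"
  shows "free_gen R s *p g \<in> carrier PA"
  using assms(2) unfolding poly_alg_simps
proof (induct g rule: free_module_induct)
  case zero
  thus ?case using poly_mult_zero_gen by (simp add: free_mem_iff)
next
  case (step f r t)
  have "free_gen R s *p free_gen R t \<in> carrier (free_module R {w. set_mset w \<subseteq> V})"
    unfolding poly_mult_gen_gen by (rule free_gen_carrier) (use s step(4) in auto)
  thus ?case
    unfolding poly_mult_lin_right[OF free_memD(1)[OF step(1)] free_gen_val free_gen_val step(3)]
    by (intro free_module_add_closed step(2) free_module_smult_closed step(3))
qed

lemma poly_mult_closed:
  assumes "f \<in> carrier PA" and g: "g \<in> carrier PA"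
  shows "f *p g \<in> carrier PA"
  using assms(1) unfolding poly_alg_simps
proof (induct f rule: free_module_induct)
  case zero
  thus ?case using poly_mult_zero_poly[OF g] by (simp add: free_mem_iff)
next
  case (step f r s)
  have "free_gen R s *p g \<in> carrier (free_module R {w. set_mset w \<subseteq> V})"
    using poly_gen_mult_closed[OF _ g] step(4) by simp
  thus ?case
    unfolding poly_mult_lin_left[OF free_memD(1)[OF step(1)] free_gen_val poly_val[OF g] step(3)]
    by (intro free_module_add_closed step(2) free_module_smult_closed step(3))
qed

lemma poly_mult_comm:
  assumes "f \<in> carrier PA" and g: "g \<in> carrier PA"
  shows "f *p g = g *p f"
  using assms(1) unfolding poly_alg_simps
proof (induct f rule: free_module_induct)
  case zero
  thus ?case using poly_mult_zero_poly[OF g] by simp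
next
  case (step f r s)
  have "free_gen R s *p g = g *p free_gen R s"
    using g unfolding poly_alg_simps
  proof (induct g rule: free_module_induct)
    case zero
    thus ?case using poly_mult_zero_gen by simp
  next
    case (step f r t)
    thus ?case
      unfolding poly_mult_lin_left[OF free_memD(1)[OF step(1)] free_gen_val free_gen_val step(3)]
        poly_mult_lin_right[OF free_memD(1)[OF step(1)] free_gen_val free_gen_val step(3)]
      by (simp add: poly_mult_gen_gen add.commute)
  qed
  thus ?case
    unfolding poly_mult_lin_left[OF free_memD(1)[OF step(1)] free_gen_val poly_val[OF g] step(3)]
      poly_mult_lin_right[OF free_memD(1)[OF step(1)] free_gen_val poly_val[OF g] step(3)] using step(2) by simp
qed

lemma poly_mult_assoc:
  assumes "f \<in> carrier PA" and g: "g \<in> carrier PA" and h: "h \<in> carrier PA"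
  shows "(f *p g) *p h = f *p (g *p h)"
  using assms(1) unfolding poly_alg_simps
proof (induct f rule: free_module_induct)
  case zero
  note gh = poly_val[OF poly_mult_closed[OF g h]]
  show ?case using poly_mult_zero_poly(1)[OF g] poly_mult_zero_poly(1)[OF h] poly_mult_zero_poly(1)[OF poly_mult_closed[OF g h]] by simp
next
  case (step f r s)
  note gv = poly_val[OF g] and hv = poly_val[OF h] and gh = poly_val[OF poly_mult_closed[OF g h]]
  note fv = free_memD(1)[OF step(1)]
  have gen: "(free_gen R s *p g) *p h = free_gen R s *p (g *p h)"
    using g unfolding poly_alg_simps
  proof (induct g rule: free_module_induct)
    case zero
    show ?case using poly_mult_zero_gen(2) poly_mult_zero_poly(1)[OF h] by simp
  next
    case (step g q t)
    note gv = free_memD(1)[OF step(1)]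
    have "(free_gen R s *p free_gen R t) *p h = free_gen R s *p (free_gen R t *p h)"
      unfolding poly_mult_gen_gen
      by (subst (1 2 3) poly_mult_gen) (use hv in \<open>auto simp: fun_eq_iff poly_mult_gen subset_mset.le_diff_conv2 add.commute mset_subset_eq_add_left intro: subset_mset.order_trans dest: subset_mset.order_trans[OF mset_subset_eq_add_left]\<close>)
    moreover have "free_gen R s *p g *p h = free_gen R s *p (g *p h)" by (rule step(2))
    ultimately show ?case
      unfolding poly_mult_lin_right[OF gv free_gen_val free_gen_val step(3)]
        poly_mult_lin_left[OF gv free_gen_val hv step(3)]
        poly_mult_lin_left[OF poly_mult_val[OF free_gen_val gv] poly_mult_val[OF free_gen_val free_gen_val] hv step(3)]
        poly_mult_lin_right[OF poly_mult_val[OF gv hv] poly_mult_val[OF free_gen_val hv] free_gen_val step(3)]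
      by simp
  qed
  show ?case
    unfolding poly_mult_lin_left[OF fv free_gen_val gv step(3)] poly_mult_lin_left[OF fv free_gen_val gh step(3)]
      poly_mult_lin_left[OF poly_mult_val[OF fv gv] poly_mult_val[OF free_gen_val gv] hv step(3)]
    using step(2) gen by simp
qed

lemma polynomial_algebra_algebra: "algebra R PA"
proof -
  let ?F = "free_module R {w. set_mset w \<subseteq> V}"
  interpret F: module R ?F by (rule free_module_module)
  have ab: "abelian_group PA"
    using F.a_comm_group comm_group_abelian_groupI unfolding polynomial_algebra_add_monoid[symmetric] by blast
  have one: "free_gen R {#} *p f = f" if "f \<in> carrier PA" for f
    by (subst poly_mult_gen) (use poly_val[OF that] in auto)
  have "cring PA"
  proof (rule cringI[OF ab])
    show "comm_monoid PA"
    proof (rule comm_monoidI)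
      show "\<one>\<^bsub>PA\<^esub> \<in> carrier PA" by auto
      show "\<one>\<^bsub>PA\<^esub> *p f = f" if "f \<in> carrier PA" for f using one[OF that] by simp
    qed (rule poly_mult_closed poly_mult_assoc poly_mult_comm; assumption)+
    show "(f \<oplus>\<^bsub>PA\<^esub> g) *p h = f *p h \<oplus>\<^bsub>PA\<^esub> g *p h" if "f \<in> carrier PA" "g \<in> carrier PA" "h \<in> carrier PA" for f g h
      using poly_mult_add_left poly_val that by simp
  qed
  thus ?thesis
  proof (rule algebraI[OF is_cring])
    fix a f g assume "a \<in> carrier R" "f \<in> carrier PA" "g \<in> carrier PA"
    thus "(a \<odot>\<^bsub>PA\<^esub> f) *p g = a \<odot>\<^bsub>PA\<^esub> (f *p g)"
      using poly_mult_smult_left[of f g a] poly_val by simp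
  qed (use F.smult_closed F.smult_l_distr F.smult_r_distr F.smult_assoc1 F.smult_one in \<open>simp_all\<close>)
qed

end

end

text \<open>A multiset is a monomial, and \<open>lin_ext\<close> then evaluates polynomials.\<close>

definition monom_value :: "('m, 'b) ring_scheme \<Rightarrow> ('v \<Rightarrow> 'm) \<Rightarrow> 'v multiset \<Rightarrow> 'm"
  where "monom_value M x w = finprod M (\<lambda>v. x v [^]\<^bsub>M\<^esub> count w v) (set_mset w)"

abbreviation poly_eval where "poly_eval R M x \<equiv> lin_ext R M (monom_value M x)"

context cring
begin

lemma monom_value_closed: "x \<in> V \<rightarrow> carrier R ==> set_mset w \<subseteq> V ==> monom_value R x w \<in> carrier R"
  unfolding monom_value_def by (intro finprod_closed) auto

lemma monom_value_empty [simp]: "monom_value R x {#} = \<one>"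
  by (simp add: monom_value_def)

lemma monom_value_1: "x v \<in> carrier R ==> monom_value R x {#v#} = x v"
  by (simp add: monom_value_def)

lemma monom_value_add:
  assumes x: "x \<in> V \<rightarrow> carrier R" and w: "set_mset u \<subseteq> V" "set_mset w \<subseteq> V"
  shows "monom_value R x (u + w) = monom_value R x u \<otimes> monom_value R x w"
proof -
  let ?A = "set_mset (u + w)"
  have xc: "x v \<in> carrier R" if "v \<in> ?A" for v using that x w by auto
  have ext: "monom_value R x z = finprod R (\<lambda>v. x v [^] count z v) ?A" if "set_mset z \<subseteq> ?A" for z
    unfolding monom_value_def
    by (rule finprod_mono_neutral_cong_left) (use that xc in \<open>auto simp: not_in_iff\<close>)
  have "monom_value R x (u + w) = finprod R (\<lambda>v. x v [^] count u v \<otimes> x v [^] count w v) ?A"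
    unfolding monom_value_def by (rule finprod_cong'[OF refl]) (use xc in \<open>auto simp: nat_pow_mult\<close>)
  also have "\<dots> = finprod R (\<lambda>v. x v [^] count u v) ?A \<otimes> finprod R (\<lambda>v. x v [^] count w v) ?A"
    by (rule finprod_multf) (use xc in auto)
  finally show ?thesis using ext[of u] ext[of w] by simp
qed

end

context algebra
begin

context
  fixes V :: "'v set" and x
  assumes x: "x \<in> V \<rightarrow> carrier M"
begin

lemma monom_value_map: "monom_value M x \<in> {w. set_mset w \<subseteq> V} \<rightarrow> carrier M"
  using monom_value_closed[OF x] by auto

lemma poly_eval_closed: "f \<in> carrier (polynomial_algebra R V) ==> poly_eval R M x f \<in> carrier M"
  using lin_ext_closed[OF monom_value_map] by simp

lemma poly_eval_mult:
  assumes "f \<in> carrier (polynomial_algebra R V)" and g: "g \<in> carrier (polynomial_algebra R V)"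
  shows "poly_eval R M x (f \<otimes>\<^bsub>polynomial_algebra R V\<^esub> g) = poly_eval R M x f \<otimes>\<^bsub>M\<^esub> poly_eval R M x g"
proof -
  let ?P = "polynomial_algebra R V" and ?e = "poly_eval R M x"
  interpret P: algebra R ?P by (rule R.polynomial_algebra_algebra)
  have PF: "h \<in> carrier (free_module R {w. set_mset w \<subseteq> V}) \<longleftrightarrow> h \<in> carrier ?P" for h by simp
  have genP: "free_gen R s \<in> carrier ?P" if "set_mset s \<subseteq> V" for s using that by auto
  note cl = poly_eval_closed
  have step_eval: "?e (\<lambda>t. f t \<oplus> q \<otimes> h t) = ?e f \<oplus>\<^bsub>M\<^esub> q \<odot>\<^bsub>M\<^esub> ?e h" if "f \<in> carrier ?P" "h \<in> carrier ?P" "q \<in> carrier R" for f q h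
    using that lin_ext_add[OF monom_value_map, of f "\<lambda>t. q \<otimes> h t"] lin_ext_smult[OF monom_value_map, of q h]
      R.free_module_smult_closed[of h _ q] by simp
  have gen: "?e (free_gen R s \<otimes>\<^bsub>?P\<^esub> g) = monom_value M x s \<otimes>\<^bsub>M\<^esub> ?e g" if s: "set_mset s \<subseteq> V" for s
    using g unfolding poly_alg_simps
  proof (induct g rule: R.free_module_induct)
    case zero
    thus ?case using monom_value_closed[OF x s] by (simp add: lin_ext_zero R.poly_mult_zero_gen)
  next
    case (step f q t)
    have t: "set_mset t \<subseteq> V" using step(4) by simp
    have f: "f \<in> carrier ?P" using step(1) by simp
    have m: "monom_value M x s \<in> carrier M" "monom_value M x t \<in> carrier M" using monom_value_closed[OF x] s t by auto
    have "?e (free_gen R s \<otimes>\<^bsub>?P\<^esub> (\<lambda>u. f u \<oplus> q \<otimes> free_gen R t u)) =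
      ?e (free_gen R s \<otimes>\<^bsub>?P\<^esub> f) \<oplus>\<^bsub>M\<^esub> q \<odot>\<^bsub>M\<^esub> ?e (free_gen R (s + t))"
      unfolding R.poly_mult_lin_right[OF free_memD(1)[OF step(1)] R.free_gen_val R.free_gen_val step(3)] R.poly_mult_gen_gen
      by (rule step_eval[OF R.poly_gen_mult_closed[OF s f] genP step(3)]) (use s t in simp)
    also have "?e (free_gen R (s + t)) = monom_value M x s \<otimes>\<^bsub>M\<^esub> monom_value M x t"
      using lin_ext_gen[OF monom_value_map, of "s + t"] monom_value_add[OF x s t] s t by simp
    also have "?e (free_gen R s \<otimes>\<^bsub>?P\<^esub> f) \<oplus>\<^bsub>M\<^esub> q \<odot>\<^bsub>M\<^esub> (monom_value M x s \<otimes>\<^bsub>M\<^esub> monom_value M x t)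
      = monom_value M x s \<otimes>\<^bsub>M\<^esub> (?e f \<oplus>\<^bsub>M\<^esub> q \<odot>\<^bsub>M\<^esub> monom_value M x t)"
      unfolding step(2) using m cl[OF f] step(3) smult_assoc2[of q "monom_value M x t" "monom_value M x s"]
      by (simp add: r_distr m_comm[of "monom_value M x s"])
    also have "?e f \<oplus>\<^bsub>M\<^esub> q \<odot>\<^bsub>M\<^esub> monom_value M x t = ?e (\<lambda>u. f u \<oplus> q \<otimes> free_gen R t u)"
      using step_eval[OF f genP[OF t] step(3)] lin_ext_gen[OF monom_value_map, of t] t by simp
    finally show ?case .
  qed
  show ?thesis
    using assms(1) unfolding poly_alg_simps
  proof (induct f rule: R.free_module_induct)
    case zero
    thus ?case using R.poly_mult_zero_poly[OF g] cl[OF g] by (simp add: lin_ext_zero)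
  next
    case (step f q t)
    have t: "set_mset t \<subseteq> V" using step(4) by simp
    have f: "f \<in> carrier ?P" using step(1) by simp
    have m: "monom_value M x t \<in> carrier M" using monom_value_closed[OF x] t by auto
    have "?e ((\<lambda>u. f u \<oplus> q \<otimes> free_gen R t u) \<otimes>\<^bsub>?P\<^esub> g) = ?e (f \<otimes>\<^bsub>?P\<^esub> g) \<oplus>\<^bsub>M\<^esub> q \<odot>\<^bsub>M\<^esub> ?e (free_gen R t \<otimes>\<^bsub>?P\<^esub> g)"
      unfolding R.poly_mult_lin_left[OF free_memD(1)[OF step(1)] R.free_gen_val R.poly_val[OF g] step(3)]
      by (rule step_eval[OF R.poly_mult_closed[OF f g] R.poly_gen_mult_closed[OF t g] step(3)])
    also have "\<dots> = (?e f \<oplus>\<^bsub>M\<^esub> q \<odot>\<^bsub>M\<^esub> monom_value M x t) \<otimes>\<^bsub>M\<^esub> ?e g"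
      unfolding step(2) gen[OF t] using m cl[OF f] cl[OF g] step(3) smult_assoc2[of q "monom_value M x t" "?e g"]
      by (simp add: l_distr)
    also have "?e f \<oplus>\<^bsub>M\<^esub> q \<odot>\<^bsub>M\<^esub> monom_value M x t = ?e (\<lambda>u. f u \<oplus> q \<otimes> free_gen R t u)"
      using step_eval[OF f genP[OF t] step(3)] lin_ext_gen[OF monom_value_map, of t] t by simp
    finally show ?case .
  qed
qed

lemma poly_eval_add:
  "f \<in> carrier (polynomial_algebra R V) ==> g \<in> carrier (polynomial_algebra R V) ==>
    poly_eval R M x (f \<oplus>\<^bsub>polynomial_algebra R V\<^esub> g) = poly_eval R M x f \<oplus>\<^bsub>M\<^esub> poly_eval R M x g"
  using lin_ext_add[OF monom_value_map] by simp

lemma poly_eval_gen: "set_mset w \<subseteq> V ==> poly_eval R M x (free_gen R w) = monom_value M x w"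
  using lin_ext_gen[OF monom_value_map] by simp

lemma poly_eval_smult:
  "r \<in> carrier R ==> f \<in> carrier (polynomial_algebra R V) ==>
    poly_eval R M x (r \<odot>\<^bsub>polynomial_algebra R V\<^esub> f) = r \<odot>\<^bsub>M\<^esub> poly_eval R M x f"
  using lin_ext_smult[OF monom_value_map] by simp

lemma poly_eval_ring_hom: "poly_eval R M x \<in> ring_hom (polynomial_algebra R V) M"
  by (rule ring_hom_memI) (use poly_eval_closed poly_eval_mult poly_eval_add poly_eval_gen[of "{#}"] in auto)

end

end

section \<open>Quotients\<close>

lemma (in abelian_subgroup) coset_eq_iff:
  assumes "x \<in> carrier G" "y \<in> carrier G"
  shows "H +> x = H +> y \<longleftrightarrow> x \<ominus> y \<in> H"
  using a_rcos_module[OF assms(2,1)] a_rcos_self[OF assms(1)] a_repr_independence'[OF _ assms(2), of x]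
  unfolding a_minus_def by auto

context algebra
begin

lemma ring_M: "ring M"
  by (rule cring.axioms(1)[OF M_cring])

lemma smult_eq_mult:
  assumes "r \<in> carrier R" "u \<in> carrier M"
  shows "r \<odot>\<^bsub>M\<^esub> u = (r \<odot>\<^bsub>M\<^esub> \<one>\<^bsub>M\<^esub>) \<otimes>\<^bsub>M\<^esub> u"
  using smult_assoc2[OF assms(1) one_closed assms(2)] assms by simp

lemma ideal_smult_closed:
  assumes "ideal I M" "r \<in> carrier R" "u \<in> I"
  shows "r \<odot>\<^bsub>M\<^esub> u \<in> I"
proof -
  interpret I: ideal I M by (rule assms(1))
  show ?thesis using smult_eq_mult[OF assms(2), of u] I.I_l_closed[OF assms(3)] assms(2,3) I.Icarr by auto
qed

lemma quot_smult:
  assumes I: "ideal I M" and r: "r \<in> carrier R" and u: "u \<in> carrier M"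
  shows "(\<Union>v\<in>I +>\<^bsub>M\<^esub> u. I +>\<^bsub>M\<^esub> (r \<odot>\<^bsub>M\<^esub> v)) = I +>\<^bsub>M\<^esub> (r \<odot>\<^bsub>M\<^esub> u)"
proof -
  interpret I: ideal I M by (rule I)
  have "I +>\<^bsub>M\<^esub> (r \<odot>\<^bsub>M\<^esub> v) = I +>\<^bsub>M\<^esub> (r \<odot>\<^bsub>M\<^esub> u)" if v: "v \<in> I +>\<^bsub>M\<^esub> u" for v
  proof -
    have vc: "v \<in> carrier M" using v u I.a_elemrcos_carrier by blast
    have "v \<ominus>\<^bsub>M\<^esub> u \<in> I" using v I.a_rcos_module_minus[OF ring_M u vc] by blast
    hence "r \<odot>\<^bsub>M\<^esub> (v \<ominus>\<^bsub>M\<^esub> u) \<in> I" by (rule ideal_smult_closed[OF I r])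
    moreover have "r \<odot>\<^bsub>M\<^esub> (v \<ominus>\<^bsub>M\<^esub> u) = r \<odot>\<^bsub>M\<^esub> v \<ominus>\<^bsub>M\<^esub> r \<odot>\<^bsub>M\<^esub> u"
      using r u vc by (simp add: M.minus_eq smult_r_distr smult_r_minus)
    ultimately show ?thesis using ring.quotient_eq_iff_same_a_r_cos[OF ring_M I, of "r \<odot>\<^bsub>M\<^esub> v" "r \<odot>\<^bsub>M\<^esub> u"] r u vc by simp
  qed
  moreover have "u \<in> I +>\<^bsub>M\<^esub> u" using I.a_rcos_self u by blast
  ultimately show ?thesis by blast
qed

lemma quot_module_ops:
  assumes I: "ideal I M" and r: "r \<in> carrier R" and uv: "u \<in> carrier M" "v \<in> carrier M"
  shows "I +>\<^bsub>M\<^esub> u \<in> carrier (quot_module M I)"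
    and "(I +>\<^bsub>M\<^esub> u) \<otimes>\<^bsub>quot_module M I\<^esub> (I +>\<^bsub>M\<^esub> v) = I +>\<^bsub>M\<^esub> (u \<otimes>\<^bsub>M\<^esub> v)"
    and "(I +>\<^bsub>M\<^esub> u) \<oplus>\<^bsub>quot_module M I\<^esub> (I +>\<^bsub>M\<^esub> v) = I +>\<^bsub>M\<^esub> (u \<oplus>\<^bsub>M\<^esub> v)"
    and "r \<odot>\<^bsub>quot_module M I\<^esub> (I +>\<^bsub>M\<^esub> u) = I +>\<^bsub>M\<^esub> (r \<odot>\<^bsub>M\<^esub> u)"
    and "\<one>\<^bsub>quot_module M I\<^esub> = I +>\<^bsub>M\<^esub> \<one>\<^bsub>M\<^esub>"
    and "\<zero>\<^bsub>quot_module M I\<^esub> = I +>\<^bsub>M\<^esub> \<zero>\<^bsub>M\<^esub>"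
proof -
  interpret I: ideal I M by (rule I)
  show "I +>\<^bsub>M\<^esub> u \<in> carrier (quot_module M I)"
    using uv(1) M.a_rcosetsI[OF I.a_subset] by (simp add: quot_module_def FactRing_def)
  show "(I +>\<^bsub>M\<^esub> u) \<otimes>\<^bsub>quot_module M I\<^esub> (I +>\<^bsub>M\<^esub> v) = I +>\<^bsub>M\<^esub> (u \<otimes>\<^bsub>M\<^esub> v)"
    using I.rcoset_mult_add[OF uv] by (simp add: quot_module_def FactRing_def)
  show "(I +>\<^bsub>M\<^esub> u) \<oplus>\<^bsub>quot_module M I\<^esub> (I +>\<^bsub>M\<^esub> v) = I +>\<^bsub>M\<^esub> (u \<oplus>\<^bsub>M\<^esub> v)"
    using I.a_rcos_sum[OF uv] by (simp add: quot_module_def FactRing_def)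
  show "r \<odot>\<^bsub>quot_module M I\<^esub> (I +>\<^bsub>M\<^esub> u) = I +>\<^bsub>M\<^esub> (r \<odot>\<^bsub>M\<^esub> u)"
    using quot_smult[OF I r uv(1)] by (simp add: quot_module_def)
  show "\<one>\<^bsub>quot_module M I\<^esub> = I +>\<^bsub>M\<^esub> \<one>\<^bsub>M\<^esub>" by (simp add: quot_module_def FactRing_def)
  show "\<zero>\<^bsub>quot_module M I\<^esub> = I +>\<^bsub>M\<^esub> \<zero>\<^bsub>M\<^esub>"
    using ring.a_rcos_zero[OF ring_M I I.zero_closed] by (simp add: quot_module_def FactRing_def)
qed

end

section \<open>Linear functionals\<close>

text \<open>A submodule that contains \<open>W0\<close> and is maximal without \<open>y\<close> is a hyperplane.\<close>

lemma (in module) exists_functional: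
  assumes K: "field R" and W0: "submodule W0 R M" and y: "y \<in> carrier M" "y \<notin> W0"
  shows "\<exists>l\<in>carrier M \<rightarrow> carrier R. (\<forall>u\<in>carrier M. \<forall>v\<in>carrier M. l (u \<oplus>\<^bsub>M\<^esub> v) = l u \<oplus> l v) \<and>
    (\<forall>c\<in>carrier R. \<forall>u\<in>carrier M. l (c \<odot>\<^bsub>M\<^esub> u) = c \<otimes> l u) \<and> (\<forall>w\<in>W0. l w = \<zero>) \<and> l y = \<one>"
proof -
  interpret K: field R by (rule K)
  have mz: "\<ominus>\<^bsub>M\<^esub> \<zero>\<^bsub>M\<^esub> = \<zero>\<^bsub>M\<^esub>"
    using M.r_neg[OF M.zero_closed] M.l_zero[OF M.a_inv_closed[OF M.zero_closed]] by simp
  have subE: "W \<subseteq> carrier M" "\<zero>\<^bsub>M\<^esub> \<in> W" "\<And>u v. u \<in> W ==> v \<in> W ==> u \<oplus>\<^bsub>M\<^esub> v \<in> W"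
    "\<And>c u. c \<in> carrier R ==> u \<in> W ==> c \<odot>\<^bsub>M\<^esub> u \<in> W" if "submodule W R M" for W
  proof -
    interpret W: submodule W R M by (rule that)
    show "W \<subseteq> carrier M" "\<zero>\<^bsub>M\<^esub> \<in> W" "\<And>u v. u \<in> W ==> v \<in> W ==> u \<oplus>\<^bsub>M\<^esub> v \<in> W"
      "\<And>c u. c \<in> carrier R ==> u \<in> W ==> c \<odot>\<^bsub>M\<^esub> u \<in> W"
      using W.subset W.one_closed W.m_closed W.smult_closed by auto
  qed
  have subI: "submodule W R M" if "W \<subseteq> carrier M" "\<zero>\<^bsub>M\<^esub> \<in> W" "\<And>u v. u \<in> W ==> v \<in> W ==> u \<oplus>\<^bsub>M\<^esub> v \<in> W"
    "\<And>c u. c \<in> carrier R ==> u \<in> W ==> c \<odot>\<^bsub>M\<^esub> u \<in> W" for W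
  proof (rule submoduleI[OF that(1,2) _ that(3,4)])
    fix a assume "a \<in> W"
    moreover from this have "\<ominus>\<^bsub>M\<^esub> a = (\<ominus> \<one>) \<odot>\<^bsub>M\<^esub> a" using that(1) by (auto simp: smult_l_minus)
    ultimately show "\<ominus>\<^bsub>M\<^esub> a \<in> W" using that(4) by simp
  qed
  let ?A = "{W. submodule W R M \<and> W0 \<subseteq> W \<and> y \<notin> W}"
  have "\<exists>W\<in>?A. \<forall>X\<in>?A. W \<subseteq> X \<longrightarrow> X = W"
  proof (rule subset_Zorn_nonempty)
    show "?A \<noteq> {}" using W0 y by blast
    fix \<C> assume ne: "\<C> \<noteq> {}" and ch: "subset.chain ?A \<C>"
    have mem: "submodule W R M" "W0 \<subseteq> W" "y \<notin> W" if "W \<in> \<C>" for W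
      using ch that unfolding subset_chain_def by blast+
    have "submodule (\<Union>\<C>) R M"
    proof (rule subI)
      show "\<Union>\<C> \<subseteq> carrier M" using subE(1)[OF mem(1)] by blast
      show "\<zero>\<^bsub>M\<^esub> \<in> \<Union>\<C>" using ne subE(2)[OF mem(1)] by blast
      show "c \<odot>\<^bsub>M\<^esub> u \<in> \<Union>\<C>" if "c \<in> carrier R" "u \<in> \<Union>\<C>" for c u
        using that subE(4)[OF mem(1)] by blast
      fix u v assume "u \<in> \<Union>\<C>" "v \<in> \<Union>\<C>"
      then obtain U V where U: "U \<in> \<C>" "u \<in> U" "V \<in> \<C>" "v \<in> V" by blast
      hence "U \<subseteq> V \<or> V \<subseteq> U" using ch unfolding subset_chain_def by blast
      thus "u \<oplus>\<^bsub>M\<^esub> v \<in> \<Union>\<C>"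
      proof
        assume "U \<subseteq> V"
        hence "u \<oplus>\<^bsub>M\<^esub> v \<in> V" using subE(3)[OF mem(1)[OF U(3)]] U by blast
        thus ?thesis using U(3) by blast
      next
        assume "V \<subseteq> U"
        hence "u \<oplus>\<^bsub>M\<^esub> v \<in> U" using subE(3)[OF mem(1)[OF U(1)]] U by blast
        thus ?thesis using U(1) by blast
      qed
    qed
    moreover have "W0 \<subseteq> \<Union>\<C>" using ne mem(2) by blast
    moreover have "y \<notin> \<Union>\<C>" using mem(3) by blast
    ultimately show "\<Union>\<C> \<in> ?A" by blast
  qed
  then obtain W where W: "submodule W R M" "W0 \<subseteq> W" "y \<notin> W" and
    max: "\<forall>X\<in>?A. W \<subseteq> X \<longrightarrow> X = W" by blast
  note WE = subE[OF W(1)]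
  have ex: "\<exists>c\<in>carrier R. v \<ominus>\<^bsub>M\<^esub> c \<odot>\<^bsub>M\<^esub> y \<in> W" if v: "v \<in> carrier M" for v
  proof (cases "v \<in> W")
    case True
    moreover have "v \<ominus>\<^bsub>M\<^esub> \<zero> \<odot>\<^bsub>M\<^esub> y = v" unfolding smult_l_null[OF y(1)] a_minus_def mz by (rule M.r_zero[OF v])
    ultimately have "v \<ominus>\<^bsub>M\<^esub> \<zero> \<odot>\<^bsub>M\<^esub> y \<in> W" by simp
    thus ?thesis by blast
  next
    case False
    let ?X = "{w \<oplus>\<^bsub>M\<^esub> c \<odot>\<^bsub>M\<^esub> v |w c. w \<in> W \<and> c \<in> carrier R}"
    have X: "submodule ?X R M"
    proof (rule subI)
      show "?X \<subseteq> carrier M" using WE(1) v by auto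
      have "\<zero>\<^bsub>M\<^esub> = \<zero>\<^bsub>M\<^esub> \<oplus>\<^bsub>M\<^esub> \<zero> \<odot>\<^bsub>M\<^esub> v" using v by simp
      thus "\<zero>\<^bsub>M\<^esub> \<in> ?X" using WE(2) by blast
    next
      fix a b assume "a \<in> ?X" "b \<in> ?X"
      then obtain w c w' c' where e: "a = w \<oplus>\<^bsub>M\<^esub> c \<odot>\<^bsub>M\<^esub> v" "w \<in> W" "c \<in> carrier R"
        "b = w' \<oplus>\<^bsub>M\<^esub> c' \<odot>\<^bsub>M\<^esub> v" "w' \<in> W" "c' \<in> carrier R" by blast
      have "w \<in> carrier M" "w' \<in> carrier M" using e WE(1) by auto
      hence "a \<oplus>\<^bsub>M\<^esub> b = (w \<oplus>\<^bsub>M\<^esub> w') \<oplus>\<^bsub>M\<^esub> (c \<oplus> c') \<odot>\<^bsub>M\<^esub> v"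
        unfolding e(1,4) using v e(3,6) by (simp add: smult_l_distr M.a_ac)
      thus "a \<oplus>\<^bsub>M\<^esub> b \<in> ?X" using WE(3)[OF e(2,5)] R.a_closed[OF e(3,6)] by blast
    next
      fix r a assume r: "r \<in> carrier R" and "a \<in> ?X"
      then obtain w c where e: "a = w \<oplus>\<^bsub>M\<^esub> c \<odot>\<^bsub>M\<^esub> v" "w \<in> W" "c \<in> carrier R" by blast
      have "w \<in> carrier M" using e WE(1) by auto
      hence "r \<odot>\<^bsub>M\<^esub> a = r \<odot>\<^bsub>M\<^esub> w \<oplus>\<^bsub>M\<^esub> (r \<otimes> c) \<odot>\<^bsub>M\<^esub> v"
        unfolding e(1) using v r e(3) by (simp add: smult_r_distr smult_assoc1)
      thus "r \<odot>\<^bsub>M\<^esub> a \<in> ?X" using WE(4)[OF r e(2)] R.m_closed[OF r e(3)] by blast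
    qed
    have WX: "W \<subseteq> ?X"
    proof
      fix w assume w: "w \<in> W"
      hence "w = w \<oplus>\<^bsub>M\<^esub> \<zero> \<odot>\<^bsub>M\<^esub> v" using v WE(1) by auto
      thus "w \<in> ?X" using w by blast
    qed
    have "v = \<zero>\<^bsub>M\<^esub> \<oplus>\<^bsub>M\<^esub> \<one> \<odot>\<^bsub>M\<^esub> v" using v by simp
    hence "v \<in> ?X" using WE(2) by blast
    hence "?X \<noteq> W" using False by blast
    hence "y \<in> ?X" using max X W(2) WX by blast
    then obtain w c where wc: "y = w \<oplus>\<^bsub>M\<^esub> c \<odot>\<^bsub>M\<^esub> v" "w \<in> W" "c \<in> carrier R" by blast
    have wM: "w \<in> carrier M" using wc WE(1) by auto
    have "c \<noteq> \<zero>" using wc W(3) v wM by auto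
    hence cU: "c \<in> Units R" using wc(3) K.field_Units by blast
    have "inv c \<odot>\<^bsub>M\<^esub> (c \<odot>\<^bsub>M\<^esub> v) = v"
      using smult_assoc1[of "inv c" c v] cU wc(3) v by simp
    hence "v \<ominus>\<^bsub>M\<^esub> inv c \<odot>\<^bsub>M\<^esub> y = v \<oplus>\<^bsub>M\<^esub> \<ominus>\<^bsub>M\<^esub> (inv c \<odot>\<^bsub>M\<^esub> w \<oplus>\<^bsub>M\<^esub> v)"
      unfolding wc(1) M.minus_eq using cU wc(3) v wM by (simp add: smult_r_distr)
    also have "\<dots> = (\<ominus> (inv c)) \<odot>\<^bsub>M\<^esub> w"
      using cU v wM by (simp add: smult_l_minus M.minus_add M.a_ac M.r_neg M.r_neg1 M.r_neg2)
    finally have "v \<ominus>\<^bsub>M\<^esub> inv c \<odot>\<^bsub>M\<^esub> y \<in> W" using WE(4)[OF _ wc(2), of "\<ominus> (inv c)"] cU by simp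
    thus ?thesis using cU by blast
  qed
  have uniq: "c = c'" if c: "c \<in> carrier R" "c' \<in> carrier R" "v \<in> carrier M"
    "v \<ominus>\<^bsub>M\<^esub> c \<odot>\<^bsub>M\<^esub> y \<in> W" "v \<ominus>\<^bsub>M\<^esub> c' \<odot>\<^bsub>M\<^esub> y \<in> W" for c c' v
  proof (rule ccontr)
    assume ne: "c \<noteq> c'"
    let ?d = "c \<ominus> c'"
    have d: "?d \<in> carrier R" "?d \<noteq> \<zero>" using c ne by auto
    hence dU: "?d \<in> Units R" using K.field_Units by blast
    have "(\<ominus> \<one>) \<odot>\<^bsub>M\<^esub> (v \<ominus>\<^bsub>M\<^esub> c \<odot>\<^bsub>M\<^esub> y) \<in> W" using WE(4)[OF _ c(4)] by simp
    hence "(v \<ominus>\<^bsub>M\<^esub> c' \<odot>\<^bsub>M\<^esub> y) \<oplus>\<^bsub>M\<^esub> (\<ominus> \<one>) \<odot>\<^bsub>M\<^esub> (v \<ominus>\<^bsub>M\<^esub> c \<odot>\<^bsub>M\<^esub> y) \<in> W" using WE(3)[OF c(5)] by simp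
    moreover have "(v \<ominus>\<^bsub>M\<^esub> c' \<odot>\<^bsub>M\<^esub> y) \<oplus>\<^bsub>M\<^esub> (\<ominus> \<one>) \<odot>\<^bsub>M\<^esub> (v \<ominus>\<^bsub>M\<^esub> c \<odot>\<^bsub>M\<^esub> y) = ?d \<odot>\<^bsub>M\<^esub> y"
    proof -
      have "(\<ominus> \<one>) \<odot>\<^bsub>M\<^esub> (v \<ominus>\<^bsub>M\<^esub> c \<odot>\<^bsub>M\<^esub> y) = \<ominus>\<^bsub>M\<^esub> v \<oplus>\<^bsub>M\<^esub> c \<odot>\<^bsub>M\<^esub> y"
        using c y by (simp add: smult_l_minus M.minus_add M.minus_eq)
      moreover have "?d \<odot>\<^bsub>M\<^esub> y = c \<odot>\<^bsub>M\<^esub> y \<oplus>\<^bsub>M\<^esub> \<ominus>\<^bsub>M\<^esub> (c' \<odot>\<^bsub>M\<^esub> y)"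
        using c y by (simp add: R.minus_eq smult_l_distr smult_l_minus)
      ultimately show ?thesis using c y by (simp add: M.minus_eq M.a_ac M.r_neg1 M.r_neg2)
    qed
    ultimately have "inv ?d \<odot>\<^bsub>M\<^esub> (?d \<odot>\<^bsub>M\<^esub> y) \<in> W" using WE(4) dU by simp
    hence "y \<in> W" using dU d(1) y by (simp add: smult_assoc1[symmetric])
    thus False using W(3) by simp
  qed
  define l where "l v = (SOME c. c \<in> carrier R \<and> v \<ominus>\<^bsub>M\<^esub> c \<odot>\<^bsub>M\<^esub> y \<in> W)" for v
  have l: "l v \<in> carrier R" "v \<ominus>\<^bsub>M\<^esub> l v \<odot>\<^bsub>M\<^esub> y \<in> W" if "v \<in> carrier M" for v
    using someI_ex[of "\<lambda>c. c \<in> carrier R \<and> v \<ominus>\<^bsub>M\<^esub> c \<odot>\<^bsub>M\<^esub> y \<in> W"] ex[OF that] unfolding l_def by auto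
  have leq: "l v = c" if "v \<in> carrier M" "c \<in> carrier R" "v \<ominus>\<^bsub>M\<^esub> c \<odot>\<^bsub>M\<^esub> y \<in> W" for v c
    using uniq[OF l(1)[OF that(1)] that(2,1) l(2)[OF that(1)] that(3)] .
  show ?thesis
  proof (intro bexI[of _ l] conjI ballI)
    fix u v assume uv: "u \<in> carrier M" "v \<in> carrier M"
    have "(u \<oplus>\<^bsub>M\<^esub> v) \<ominus>\<^bsub>M\<^esub> (l u \<oplus> l v) \<odot>\<^bsub>M\<^esub> y = (u \<ominus>\<^bsub>M\<^esub> l u \<odot>\<^bsub>M\<^esub> y) \<oplus>\<^bsub>M\<^esub> (v \<ominus>\<^bsub>M\<^esub> l v \<odot>\<^bsub>M\<^esub> y)"
      using uv l(1) y by (simp add: smult_l_distr M.minus_eq M.minus_add M.a_ac)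
    thus "l (u \<oplus>\<^bsub>M\<^esub> v) = l u \<oplus> l v" using leq l WE(3) uv by simp
  next
    fix c u assume cu: "c \<in> carrier R" "u \<in> carrier M"
    have "c \<odot>\<^bsub>M\<^esub> u \<ominus>\<^bsub>M\<^esub> (c \<otimes> l u) \<odot>\<^bsub>M\<^esub> y = c \<odot>\<^bsub>M\<^esub> (u \<ominus>\<^bsub>M\<^esub> l u \<odot>\<^bsub>M\<^esub> y)"
      using cu l(1) y by (simp add: smult_assoc1 M.minus_eq smult_r_distr smult_r_minus)
    thus "l (c \<odot>\<^bsub>M\<^esub> u) = c \<otimes> l u" using leq l WE(4) cu by simp
  next
    fix w assume "w \<in> W0"
    hence "w \<in> W" "w \<in> carrier M" using W(2) WE(1) by auto
    thus "l w = \<zero>" using leq[of w \<zero>] y by (simp add: M.minus_eq mz)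
  next
    show "l y = \<one>" using leq[of y \<one>] y WE(2) by (simp add: M.minus_eq M.r_neg)
  qed (use l in auto)
qed

section \<open>The associated graded algebra\<close>

declare ideal_power.simps(2) [simp del]

text \<open>The isomorphism from the symmetric algebra of \<open>m/m\<^sup>2\<close> to the associated graded algebra.\<close>

locale graded_symmetric = algebra K A + K: field K for K and A (structure) +
  fixes m \<tau>
  assumes maximal: "maximalideal m A"
    and tau_hom: "\<tau> \<in> algebra_homs K (symmetric_algebra K (cotangent A m)) (associated_graded A m)"
    and tau_incl: "\<forall>v\<in>carrier (cotangent A m). \<tau> (symmetric_incl K (cotangent A m) v) = in_degree_one A m v"
    and tau_bij: "bij_betw \<tau> (carrier (symmetric_algebra K (cotangent A m))) (carrier (associated_graded A m))"
begin

abbreviation J where "J \<equiv> ideal_power A m"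
abbreviation cl where "cl d a \<equiv> J (Suc d) +> a"
abbreviation GP where "GP d \<equiv> graded_piece A m d"
abbreviation Cot where "Cot \<equiv> cotangent A m"
abbreviation PP where "PP \<equiv> polynomial_algebra K (carrier Cot)"
abbreviation Rel where "Rel \<equiv> Idl\<^bsub>PP\<^esub> (symmetric_relations K Cot)"
abbreviation cls where "cls f \<equiv> Rel +>\<^bsub>PP\<^esub> f"

lemma m_ideal: "ideal m A"
  using maximal maximalideal.axioms(1) by blast

lemma J_ideal: "ideal (J d) A"
  by (rule ideal_power_ideal[OF m_ideal])

lemma J_1: "J (Suc 0) = m" "J 1 = m"
  using ideal_prod_one[OF m_ideal] by (simp_all add: ideal_power.simps(2))

lemma J_sub: "J d \<subseteq> carrier A"
  using ideal.Icarr[OF J_ideal] by blast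

lemma J_zero: "\<zero> \<in> J d"
  using additive_subgroup.zero_closed[OF ideal.axioms(1)[OF J_ideal]] .

lemma J_add: "a \<in> J d ==> b \<in> J d ==> a \<oplus> b \<in> J d"
  using additive_subgroup.a_closed[OF ideal.axioms(1)[OF J_ideal]] .

lemma J_smult: "r \<in> carrier K ==> a \<in> J d ==> r \<odot> a \<in> J d"
  by (rule ideal_smult_closed[OF J_ideal])

lemma J_mult: "a \<in> J i ==> b \<in> J j ==> a \<otimes> b \<in> J (i + j)"
  unfolding ideal_power_add[OF m_ideal] by (rule ideal_prod.prod)

lemma J_mono: "i \<le> j ==> J j \<subseteq> J i"
  by (rule ideal_power_decreasing[OF m_ideal])

lemma cl_eq_iff:
  assumes "a \<in> carrier A" "b \<in> carrier A"
  shows "cl d a = cl d b \<longleftrightarrow> a \<ominus> b \<in> J (Suc d)"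
  using quotient_eq_iff_same_a_r_cos[OF J_ideal assms] by simp

lemma cl_zero: "cl d \<zero> = J (Suc d)"
  by (rule a_rcos_zero[OF J_ideal J_zero])

lemma cl_add: "a \<in> carrier A ==> b \<in> carrier A ==> set_add A (cl d a) (cl d b) = cl d (a \<oplus> b)"
  by (rule ideal.a_rcos_sum[OF J_ideal])

lemma GP_simps:
  "carrier (GP d) = cl d ` J d" "zero (GP d) = J (Suc d)" "add (GP d) = set_add A"
  "smult (GP d) r C = (\<Union>u\<in>C. cl d (r \<odot> u))"
  by (auto simp: graded_piece_def quot_module_def FactRing_def A_RCOSETS_def RCOSETS_def a_r_coset_def
      r_coset_def set_add_def set_mult_def fun_eq_iff)

lemma GP_smult: "r \<in> carrier K ==> a \<in> carrier A ==> r \<odot>\<^bsub>GP d\<^esub> cl d a = cl d (r \<odot> a)"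
  unfolding GP_simps by (rule quot_smult[OF J_ideal])

lemma GP_abelian_monoid: "abelian_monoid (GP d)"
proof (rule abelian_monoidI)
  note sub = J_sub[THEN subsetD, of _ d]
  show "\<zero>\<^bsub>GP d\<^esub> \<in> carrier (GP d)" unfolding GP_simps using cl_zero[of d] J_zero by blast
  fix x y assume "x \<in> carrier (GP d)" "y \<in> carrier (GP d)"
  then obtain a b where ab: "a \<in> J d" "b \<in> J d" "x = cl d a" "y = cl d b" unfolding GP_simps by blast
  show "x \<oplus>\<^bsub>GP d\<^esub> y \<in> carrier (GP d)"
    unfolding ab GP_simps using cl_add[OF sub sub] J_add ab by simp
  show "x \<oplus>\<^bsub>GP d\<^esub> y = y \<oplus>\<^bsub>GP d\<^esub> x"
    unfolding ab GP_simps using ab cl_add[OF sub sub] sub by (simp add: a_comm)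
  show "\<zero>\<^bsub>GP d\<^esub> \<oplus>\<^bsub>GP d\<^esub> x = x"
  proof -
    have z: "\<zero>\<^bsub>GP d\<^esub> = cl d \<zero>" using cl_zero GP_simps(2) by simp
    show ?thesis unfolding z ab GP_simps(3) using ab cl_add[of "\<zero>" a] sub by simp
  qed
  fix z assume "z \<in> carrier (GP d)"
  then obtain c where c: "c \<in> J d" "z = cl d c" unfolding GP_simps by blast
  show "(x \<oplus>\<^bsub>GP d\<^esub> y) \<oplus>\<^bsub>GP d\<^esub> z = x \<oplus>\<^bsub>GP d\<^esub> (y \<oplus>\<^bsub>GP d\<^esub> z)"
    unfolding ab c GP_simps using ab c cl_add sub by (simp add: a_assoc)
qed

lemma rcoset_mult_cl:
  assumes a: "a \<in> J i" and b: "b \<in> J j"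
  shows "rcoset_mult A (J (Suc (i + j))) (cl i a) (cl j b) = cl (i + j) (a \<otimes> b)"
proof -
  have c: "a \<in> carrier A" "b \<in> carrier A" using a b J_sub by auto
  have "cl (i + j) (a' \<otimes> b') = cl (i + j) (a \<otimes> b)" if ab: "a' \<in> cl i a" "b' \<in> cl j b" for a' b'
  proof -
    obtain p q where pq: "p \<in> J (Suc i)" "a' = p \<oplus> a" "q \<in> J (Suc j)" "b' = q \<oplus> b"
      using ab unfolding a_r_coset_def' by blast
    have pc: "p \<in> carrier A" "q \<in> carrier A" using pq J_sub[of "Suc i"] J_sub[of "Suc j"] by auto
    have "a' \<otimes> b' \<ominus> a \<otimes> b = p \<otimes> q \<oplus> (p \<otimes> b \<oplus> a \<otimes> q)"
      unfolding pq(2,4) using pc c by algebra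
    moreover have "p \<otimes> q \<in> J (Suc (i + j))" using J_mult[OF pq(1,3)] J_mono[of "Suc (i + j)" "Suc i + Suc j"] by auto
    moreover have "p \<otimes> b \<in> J (Suc (i + j))" "a \<otimes> q \<in> J (Suc (i + j))"
      using J_mult[OF pq(1) b] J_mult[OF a pq(3)] by simp_all
    ultimately have "a' \<otimes> b' \<ominus> a \<otimes> b \<in> J (Suc (i + j))" using J_add by metis
    thus ?thesis using cl_eq_iff[of "a' \<otimes> b'" "a \<otimes> b"] c pc pq by simp
  qed
  moreover have "a \<in> cl i a" "b \<in> cl j b"
    using abelian_subgroup.a_rcos_self[OF ideal.axioms(1)[THEN abelian_subgroupI3[OF _ is_abelian_group]]] c
      J_ideal by blast+
  ultimately show ?thesis unfolding rcoset_mult_def by blast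
qed

text \<open>The element of the associated graded algebra with the class of \<open>a\<close> in degree \<open>k\<close>.\<close>

definition homog :: "nat \<Rightarrow> 'c \<Rightarrow> nat \<Rightarrow> 'c set"
  where "homog k a = (\<lambda>d. if d = k then cl k a else J (Suc d))"

lemma homog_apply: "homog k a d = cl d (if d = k then a else \<zero>)"
  by (simp add: homog_def cl_zero)

lemma homog_carrier: "a \<in> J k ==> homog k a \<in> carrier (associated_graded A m)"
proof -
  have "homog k a d \<in> carrier (GP d)" if "a \<in> J k" for d
    unfolding homog_apply GP_simps using that J_zero by auto
  moreover have "finite {d. homog k a d \<noteq> J (Suc d)}"
    by (rule finite_subset[of _ "{k}"]) (auto simp: homog_def)
  ultimately show "a \<in> J k ==> homog k a \<in> carrier (associated_graded A m)"
    unfolding associated_graded_def by (simp add: GP_simps(2))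
qed

lemma graded_mult_homog:
  assumes a: "a \<in> J j" and b: "b \<in> J k"
  shows "homog j a \<otimes>\<^bsub>associated_graded A m\<^esub> homog k b = homog (j + k) (a \<otimes> b)"
proof
  fix d
  interpret G: abelian_monoid "GP d" by (rule GP_abelian_monoid)
  let ?a = "\<lambda>i. if i = j then a else \<zero>" and ?b = "\<lambda>i. if i = k then b else \<zero>"
  have c: "a \<in> carrier A" "b \<in> carrier A" using a b J_sub by auto
  have term_eq: "rcoset_mult A (J (Suc d)) (homog j a i) (homog k b (d - i)) = cl d (?a i \<otimes> ?b (d - i))"
    "cl d (?a i \<otimes> ?b (d - i)) \<in> carrier (GP d)"
    if "i \<le> d" for i
  proof -
    have ab: "?a i \<in> J i" "?b (d - i) \<in> J (d - i)" using a b J_zero by auto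
    show "rcoset_mult A (J (Suc d)) (homog j a i) (homog k b (d - i)) = cl d (?a i \<otimes> ?b (d - i))"
      unfolding homog_apply using rcoset_mult_cl[OF ab] that by simp
    show "cl d (?a i \<otimes> ?b (d - i)) \<in> carrier (GP d)"
      unfolding GP_simps using J_mult[OF ab] that by simp
  qed
  have "(homog j a \<otimes>\<^bsub>associated_graded A m\<^esub> homog k b) d =
      finsum (GP d) (\<lambda>i. cl d (?a i \<otimes> ?b (d - i))) {..d}"
    unfolding associated_graded_def monoid.simps
    by (rule G.finsum_cong'[OF refl]) (use term_eq in auto)
  also have "\<dots> = finsum (GP d) (\<lambda>i. if j = i then (if d = j + k then cl d (a \<otimes> b) else \<zero>\<^bsub>GP d\<^esub>) else \<zero>\<^bsub>GP d\<^esub>) {..d}"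
  proof (rule G.finsum_cong'[OF refl])
    show "(\<lambda>i. if j = i then (if d = j + k then cl d (a \<otimes> b) else \<zero>\<^bsub>GP d\<^esub>) else \<zero>\<^bsub>GP d\<^esub>) \<in> {..d} \<rightarrow> carrier (GP d)"
      using J_mult[OF a b] G.zero_closed by (auto simp: GP_simps(1))
    fix i assume "i \<in> {..d}"
    hence id: "i \<le> d" by simp
    show "cl d (?a i \<otimes> ?b (d - i)) = (if j = i then (if d = j + k then cl d (a \<otimes> b) else \<zero>\<^bsub>GP d\<^esub>) else \<zero>\<^bsub>GP d\<^esub>)"
    proof (cases "i = j \<and> d = j + k")
      case True
      thus ?thesis by simp
    next
      case False
      hence "\<not> (i = j \<and> d - i = k)" using id by auto
      hence "?a i \<otimes> ?b (d - i) = \<zero>" using c by auto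
      thus ?thesis using False by (auto simp: GP_simps cl_zero)
    qed
  qed
  also have "\<dots> = homog (j + k) (a \<otimes> b) d"
  proof (cases "d = j + k")
    case True
    have "cl d (a \<otimes> b) \<in> carrier (GP d)" unfolding GP_simps True using J_mult[OF a b] by blast
    thus ?thesis
      using G.add.finprod_singleton[of j "{..d}" "\<lambda>_. cl d (a \<otimes> b)"] True unfolding homog_def by simp
  next
    case False
    hence "finsum (GP d) (\<lambda>i. if j = i then (if d = j + k then cl d (a \<otimes> b) else \<zero>\<^bsub>GP d\<^esub>) else \<zero>\<^bsub>GP d\<^esub>) {..d} = \<zero>\<^bsub>GP d\<^esub>"
      by (intro G.add.finprod_one_eqI) auto
    thus ?thesis unfolding homog_def using False by (simp add: GP_simps)
  qed
  finally show "(homog j a \<otimes>\<^bsub>associated_graded A m\<^esub> homog k b) d = homog (j + k) (a \<otimes> b) d" .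
qed

subsection \<open>The symmetric algebra\<close>

lemma Cot_carrier: "carrier Cot = (\<lambda>a. J 2 +> a) ` m"
  using GP_simps(1)[of 1] J_1 by (simp add: numeral_2_eq_2)

lemma Cot_add: "a \<in> carrier A ==> b \<in> carrier A ==>
    (J 2 +> a) \<oplus>\<^bsub>Cot\<^esub> (J 2 +> b) = J 2 +> (a \<oplus> b)"
  using cl_add[of a b 1] by (simp add: GP_simps numeral_2_eq_2)

lemma Cot_smult: "r \<in> carrier K ==> a \<in> carrier A ==>
    r \<odot>\<^bsub>Cot\<^esub> (J 2 +> a) = J 2 +> (r \<odot> a)"
  using GP_smult[of r a 1] by (simp add: numeral_2_eq_2)

lemma m_sub: "m \<subseteq> carrier A" using J_sub[of 1] J_1 by simp

lemma m_closed: "a \<in> m ==> b \<in> m ==> a \<oplus> b \<in> m" "r \<in> carrier K ==> a \<in> m ==> r \<odot> a \<in> m"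
  using J_add[of a 1 b] J_smult[of r a 1] unfolding J_1 by auto

lemma Cot_closed:
  assumes "u \<in> carrier Cot" "v \<in> carrier Cot" "r \<in> carrier K"
  shows "u \<oplus>\<^bsub>Cot\<^esub> v \<in> carrier Cot" "r \<odot>\<^bsub>Cot\<^esub> u \<in> carrier Cot"
proof -
  obtain a b where ab: "a \<in> m" "b \<in> m" "u = J 2 +> a" "v = J 2 +> b"
    using assms unfolding Cot_carrier by blast
  have c: "a \<in> carrier A" "b \<in> carrier A" using ab m_sub by auto
  show "u \<oplus>\<^bsub>Cot\<^esub> v \<in> carrier Cot" "r \<odot>\<^bsub>Cot\<^esub> u \<in> carrier Cot"
    unfolding ab Cot_add[OF c] Cot_smult[OF assms(3) c(1)] unfolding Cot_carrier
    using m_closed(1)[OF ab(1,2)] m_closed(2)[OF assms(3) ab(1)] by blast+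
qed

lemma PP_algebra: "algebra K PP"
  by (rule R.polynomial_algebra_algebra)

lemma PP_ring: "ring PP"
  using algebra.M_cring[OF PP_algebra] cring.axioms(1) by blast

lemma X_carrier: "v \<in> carrier Cot ==> free_gen K {#v#} \<in> carrier PP"
  by auto

lemma X_image:
  assumes "\<And>j. j \<in> I ==> c j \<in> carrier Cot" "set_mset w \<subseteq> I"
  shows "free_gen K (image_mset c w) \<in> carrier PP"
  unfolding poly_alg_simps by (rule R.free_gen_carrier) (use assms in \<open>auto simp del: One_nat_def\<close>)

lemma Rel_ideal: "ideal Rel PP"
proof (rule ring.genideal_ideal[OF PP_ring])
  interpret PP: algebra K PP by (rule PP_algebra)
  note ab = ring.is_abelian_group[OF PP_ring]
  note mc = abelian_group.minus_closed[OF ab] and ac = abelian_monoid.a_closed[OF abelian_group.axioms(1)[OF ab]]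
  show "symmetric_relations K Cot \<subseteq> carrier PP"
    unfolding symmetric_relations_def Let_def
    by (auto simp del: poly_alg_simps One_nat_def intro!: mc ac PP.smult_closed X_carrier Cot_closed)
qed

lemma Sym_eq: "symmetric_algebra K Cot = quot_module PP Rel"
  by (simp add: symmetric_algebra_def)

lemma tau_props:
  assumes "f \<in> carrier PP" "g \<in> carrier PP" "r \<in> carrier K"
  shows "\<tau> (cls (f \<otimes>\<^bsub>PP\<^esub> g)) = \<tau> (cls f) \<otimes>\<^bsub>associated_graded A m\<^esub> \<tau> (cls g)"
    and "\<tau> (cls (f \<oplus>\<^bsub>PP\<^esub> g)) d = set_add A (\<tau> (cls f) d) (\<tau> (cls g) d)"
    and "\<tau> (cls (r \<odot>\<^bsub>PP\<^esub> f)) d = r \<odot>\<^bsub>GP d\<^esub> \<tau> (cls f) d"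
    and "\<tau> (cls \<one>\<^bsub>PP\<^esub>) = homog 0 \<one>"
    and "cls f \<in> carrier (symmetric_algebra K Cot)"
proof -
  note ops = algebra.quot_module_ops[OF PP_algebra Rel_ideal assms(3,1,2)]
  have h: "\<tau> \<in> ring_hom (quot_module PP Rel) (associated_graded A m)"
    and s: "\<tau> \<in> module_homs K (quot_module PP Rel) (associated_graded A m)"
    using tau_hom unfolding Sym_eq algebra_homs_def by auto
  note g1 = algebra.quot_module_ops(1)[OF PP_algebra Rel_ideal assms(3,2,1)]
  show "\<tau> (cls (f \<otimes>\<^bsub>PP\<^esub> g)) = \<tau> (cls f) \<otimes>\<^bsub>associated_graded A m\<^esub> \<tau> (cls g)"
    using ring_hom_mult[OF h ops(1) g1] unfolding ops(2) .
  show "\<tau> (cls (f \<oplus>\<^bsub>PP\<^esub> g)) d = set_add A (\<tau> (cls f) d) (\<tau> (cls g) d)"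
    using ring_hom_add[OF h ops(1) g1] unfolding ops(3) by (simp add: associated_graded_def GP_simps)
  have "\<tau> (r \<odot>\<^bsub>quot_module PP Rel\<^esub> cls f) = r \<odot>\<^bsub>associated_graded A m\<^esub> \<tau> (cls f)"
    using s ops(1) assms(3) unfolding module_homs_def by auto
  thus "\<tau> (cls (r \<odot>\<^bsub>PP\<^esub> f)) d = r \<odot>\<^bsub>GP d\<^esub> \<tau> (cls f) d"
    unfolding ops(4) by (simp add: associated_graded_def)
  show "\<tau> (cls \<one>\<^bsub>PP\<^esub>) = homog 0 \<one>"
    using ring_hom_one[OF h] unfolding ops(5)
    by (auto simp: associated_graded_def homog_def GP_simps fun_eq_iff simp del: poly_alg_simps)
  show "cls f \<in> carrier (symmetric_algebra K Cot)" using ops(1) unfolding Sym_eq .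
qed

lemma tau_X:
  assumes "a \<in> m"
  shows "\<tau> (cls (free_gen K {#J 2 +> a#})) = homog 1 a"
proof -
  have "J 2 +> a \<in> carrier Cot" unfolding Cot_carrier using assms by blast
  from bspec[OF tau_incl this] show ?thesis
    unfolding symmetric_incl_def in_degree_one_def homog_def
    by (auto simp: GP_simps fun_eq_iff numeral_2_eq_2)
qed

lemma monom_value_J:
  assumes y: "y \<in> I \<rightarrow> m"
  shows "set_mset w \<subseteq> I ==> monom_value A y w \<in> J (size w)"
proof (induction w)
  case (add i w)
  have yA: "y \<in> I \<rightarrow> carrier A" using y m_sub by blast
  have i: "i \<in> I" "y i \<in> carrier A" using add.prems yA by auto
  have "monom_value A y (add_mset i w) = y i \<otimes> monom_value A y w"
    using monom_value_add[OF yA, of "{#i#}" w] add.prems monom_value_1[of y i] i by simp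
  thus ?case using J_mult[of "y i" 1 "monom_value A y w" "size w"] add y J_1(2) by auto
qed simp

lemma tau_monomial:
  assumes y: "y \<in> I \<rightarrow> m"
  shows "set_mset w \<subseteq> I ==>
    \<tau> (cls (free_gen K (image_mset (\<lambda>i. J 2 +> y i) w))) = homog (size w) (monom_value A y w)"
proof (induction w)
  case empty
  thus ?case using tau_props(4)[of "free_gen K {#}" "free_gen K {#}" "\<one>\<^bsub>K\<^esub>"] by simp
next
  case (add i w)
  let ?c = "\<lambda>i. J 2 +> y i"
  have yA: "y \<in> I \<rightarrow> carrier A" using y m_sub by blast
  have i: "i \<in> I" "y i \<in> m" "y i \<in> carrier A" using add.prems yA y by auto
  have cI: "?c j \<in> carrier Cot" if "j \<in> I" for j unfolding Cot_carrier using y that by blast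
  have w: "free_gen K (image_mset ?c w) \<in> carrier PP" "free_gen K {#?c i#} \<in> carrier PP"
  proof -
    show "free_gen K (image_mset ?c w) \<in> carrier PP" by (rule X_image[OF cI]) (use add.prems in auto)
    show "free_gen K {#?c i#} \<in> carrier PP" by (rule X_carrier[OF cI[OF i(1)]])
  qed
  have "free_gen K (image_mset ?c (add_mset i w)) = free_gen K {#?c i#} \<otimes>\<^bsub>PP\<^esub> free_gen K (image_mset ?c w)"
    by (simp add: R.poly_mult_gen_gen)
  hence "\<tau> (cls (free_gen K (image_mset ?c (add_mset i w)))) =
      homog 1 (y i) \<otimes>\<^bsub>associated_graded A m\<^esub> homog (size w) (monom_value A y w)"
    using tau_props(1)[OF w(2,1) R.one_closed] tau_X[OF i(2)] add by simp
  also have "\<dots> = homog (1 + size w) (y i \<otimes> monom_value A y w)"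
    by (rule graded_mult_homog) (use i J_1(2) monom_value_J[OF y, of w] add.prems in auto)
  also have "y i \<otimes> monom_value A y w = monom_value A y (add_mset i w)"
    using monom_value_add[OF yA, of "{#i#}" w] add.prems monom_value_1[of y i] i by simp
  finally show ?case by simp
qed

end

definition homogeneous_part :: "('k, 'l) ring_scheme \<Rightarrow> nat \<Rightarrow> ('v multiset \<Rightarrow> 'k) \<Rightarrow> 'v multiset \<Rightarrow> 'k"
  where "homogeneous_part R d f = (\<lambda>w. if size w = d then f w else \<zero>\<^bsub>R\<^esub>)"

lemma homogeneous_part_carrier:
  assumes "f \<in> carrier (free_module R S)" "\<zero>\<^bsub>R\<^esub> \<in> carrier R"
  shows "homogeneous_part R d f \<in> carrier (free_module R S)"
proof -
  have "{w. homogeneous_part R d f w \<noteq> \<zero>\<^bsub>R\<^esub>} \<subseteq> {w. f w \<noteq> \<zero>\<^bsub>R\<^esub>}" by (auto simp: homogeneous_part_def)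
  hence "finite {w. homogeneous_part R d f w \<noteq> \<zero>\<^bsub>R\<^esub>}"
    by (rule finite_subset) (rule free_memD(3)[OF assms(1)])
  thus ?thesis using free_memD[OF assms(1)] assms(2)
    unfolding free_mem_iff by (simp add: homogeneous_part_def)
qed

context graded_symmetric
begin

text \<open>On a polynomial in classes of degree 1, \<open>\<tau>\<close> is evaluation followed by taking classes, degree by degree.\<close>

lemma tau_polynomial:
  assumes y: "y \<in> I \<rightarrow> m" and F: "F \<in> carrier (polynomial_algebra K I)"
  defines "\<Phi> \<equiv> lin_ext K PP (\<lambda>w. free_gen K (image_mset (\<lambda>i. J 2 +> y i) w))"
  shows "\<Phi> F \<in> carrier PP" "\<tau> (cls (\<Phi> F)) d = cl d (poly_eval K A y (homogeneous_part K d F))"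
proof -
  interpret PP: algebra K PP by (rule PP_algebra)
  let ?c = "\<lambda>i. J 2 +> y i"
  let ?S = "{w. set_mset w \<subseteq> I}"
  have yA: "y \<in> I \<rightarrow> carrier A" using y m_sub by blast
  have cI: "?c j \<in> carrier Cot" if "j \<in> I" for j unfolding Cot_carrier using y that by blast
  have v: "(\<lambda>w. free_gen K (image_mset ?c w)) \<in> ?S \<rightarrow> carrier PP"
  proof
    fix w assume "w \<in> ?S"
    thus "free_gen K (image_mset ?c w) \<in> carrier PP" by (intro X_image[OF cI]) simp_all
  qed
  have mv: "monom_value A y \<in> ?S \<rightarrow> carrier A" by (rule monom_value_map[OF yA])
  have FS: "F \<in> carrier (free_module K ?S)" using F by simp
  show \<Phi>: "\<Phi> F \<in> carrier PP" unfolding \<Phi>_def by (rule PP.lin_ext_closed[OF v FS])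
  show "\<tau> (cls (\<Phi> F)) d = cl d (poly_eval K A y (homogeneous_part K d F))"
    using FS
  proof (induct F rule: R.free_module_induct)
    case zero
    have h1: "homogeneous_part K d (\<lambda>_. \<zero>\<^bsub>K\<^esub>) = (\<lambda>_. \<zero>\<^bsub>K\<^esub>)" by (auto simp: homogeneous_part_def)
    have h2: "\<Phi> (\<lambda>_. \<zero>\<^bsub>K\<^esub>) = \<zero>\<^bsub>K\<^esub> \<odot>\<^bsub>PP\<^esub> \<one>\<^bsub>PP\<^esub>"
    proof -
      have "\<one>\<^bsub>PP\<^esub> \<in> carrier PP" by (simp add: R.free_gen_carrier)
      thus ?thesis unfolding \<Phi>_def PP.lin_ext_zero by (rule PP.smult_l_null[symmetric])
    qed
    have h3: "\<tau> (cls (\<zero>\<^bsub>K\<^esub> \<odot>\<^bsub>PP\<^esub> \<one>\<^bsub>PP\<^esub>)) d = \<zero>\<^bsub>K\<^esub> \<odot>\<^bsub>GP d\<^esub> homog 0 \<one> d"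
    proof -
      have o: "\<one>\<^bsub>PP\<^esub> \<in> carrier PP" by (simp add: R.free_gen_carrier)
      show ?thesis unfolding tau_props(3)[OF o o R.zero_closed] tau_props(4)[OF o o R.zero_closed] ..
    qed
    have h4: "\<zero>\<^bsub>K\<^esub> \<odot>\<^bsub>GP d\<^esub> homog 0 \<one> d = cl d \<zero>"
      unfolding homog_apply using GP_smult[of "\<zero>\<^bsub>K\<^esub>" "if d = 0 then \<one> else \<zero>" d] by simp
    show ?case unfolding h1 h2 h3 h4 lin_ext_zero ..
  next
    case (step F r w)
    have w: "set_mset w \<subseteq> I" using step(4) by simp
    let ?g = "free_gen K (image_mset ?c w)"
    have g: "?g \<in> carrier PP" using v step(4) by blast
    have F1: "\<Phi> F \<in> carrier PP" unfolding \<Phi>_def by (rule PP.lin_ext_closed[OF v step(1)])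
    have rg: "(\<lambda>t. r \<otimes>\<^bsub>K\<^esub> free_gen K w t) \<in> carrier (free_module K ?S)"
      by (rule R.free_module_smult_closed[OF R.free_gen_carrier[OF step(4)] step(3)])
    have e: "\<Phi> (\<lambda>t. F t \<oplus>\<^bsub>K\<^esub> r \<otimes>\<^bsub>K\<^esub> free_gen K w t) = \<Phi> F \<oplus>\<^bsub>PP\<^esub> r \<odot>\<^bsub>PP\<^esub> ?g"
      unfolding \<Phi>_def PP.lin_ext_add[OF v step(1) rg] PP.lin_ext_single[OF v step(3,4)] ..
    have mw: "monom_value A y w \<in> carrier A" using mv step(4) by blast
    let ?h = "homogeneous_part K d F"
    have h: "?h \<in> carrier (free_module K ?S)" by (rule homogeneous_part_carrier[OF step(1) R.zero_closed])
    have hc: "poly_eval K A y ?h \<in> carrier A" by (rule lin_ext_closed[OF mv h])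
    let ?mw = "if size w = d then monom_value A y w else \<zero>"
    have "\<tau> (cls (\<Phi> F \<oplus>\<^bsub>PP\<^esub> r \<odot>\<^bsub>PP\<^esub> ?g)) d = set_add A (\<tau> (cls (\<Phi> F)) d) (r \<odot>\<^bsub>GP d\<^esub> \<tau> (cls ?g) d)"
      using tau_props(2)[OF F1 PP.smult_closed[OF step(3) g] step(3)] tau_props(3)[OF g g step(3)] by simp
    also have "\<dots> = set_add A (cl d (poly_eval K A y ?h)) (r \<odot>\<^bsub>GP d\<^esub> cl d ?mw)"
      unfolding step(2) tau_monomial[OF y w] homog_apply by (simp add: eq_commute)
    also have "\<dots> = cl d (poly_eval K A y ?h \<oplus> r \<odot> ?mw)"
      using GP_smult[OF step(3), of ?mw d] cl_add[OF hc, of "r \<odot> ?mw" d] mw step(3) by simp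
    also have "poly_eval K A y ?h \<oplus> r \<odot> ?mw =
        poly_eval K A y (homogeneous_part K d (\<lambda>t. F t \<oplus>\<^bsub>K\<^esub> r \<otimes>\<^bsub>K\<^esub> free_gen K w t))"
    proof (cases "size w = d")
      case True
      hence "homogeneous_part K d (\<lambda>t. F t \<oplus>\<^bsub>K\<^esub> r \<otimes>\<^bsub>K\<^esub> free_gen K w t) = (\<lambda>t. ?h t \<oplus>\<^bsub>K\<^esub> r \<otimes>\<^bsub>K\<^esub> free_gen K w t)"
        using step(3) by (auto simp: homogeneous_part_def fun_eq_iff free_gen_def)
      thus ?thesis using lin_ext_add[OF mv h rg] lin_ext_single[OF mv step(3,4)] True by simp
    next
      case False
      hence "homogeneous_part K d (\<lambda>t. F t \<oplus>\<^bsub>K\<^esub> r \<otimes>\<^bsub>K\<^esub> free_gen K w t) = ?h"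
        using step(3) free_memD(1)[OF step(1)] by (auto simp: homogeneous_part_def fun_eq_iff free_gen_def)
      thus ?thesis using False hc step(3) by (simp add: smult_r_null)
    qed
    finally show ?case unfolding e .
  qed
qed

text \<open>Surjectivity of \<open>\<tau>\<close> in degree 0.\<close>

lemma residue_field:
  assumes a: "a \<in> carrier A"
  shows "\<exists>c\<in>carrier K. a \<ominus> c \<odot> \<one> \<in> m"
proof -
  interpret PP: algebra K PP by (rule PP_algebra)
  have "homog 0 a \<in> carrier (associated_graded A m)" by (rule homog_carrier) (use a in simp)
  hence "homog 0 a \<in> \<tau> ` carrier (symmetric_algebra K Cot)"
    using tau_bij unfolding bij_betw_def by (simp del: One_nat_def)
  then obtain X where X: "X \<in> carrier (symmetric_algebra K Cot)" "\<tau> X = homog 0 a"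
    by (auto simp del: One_nat_def elim!: imageE)
  then obtain F where F: "F \<in> carrier PP" "X = cls F"
    unfolding Sym_eq quot_module_def FactRing_def A_RCOSETS_def RCOSETS_def a_r_coset_def[symmetric] by auto
  define y where "y v = (SOME a. a \<in> m \<and> v = J 2 +> a)" for v
  have y: "y v \<in> m \<and> v = J 2 +> y v" if "v \<in> carrier Cot" for v
    unfolding y_def by (rule someI_ex) (use that in \<open>auto simp: Cot_carrier simp del: One_nat_def\<close>)
  have ym: "y \<in> carrier Cot \<rightarrow> m" using y by blast
  let ?v = "\<lambda>w. free_gen K (image_mset (\<lambda>i. J 2 +> y i) w)"
  let ?S = "{w. set_mset w \<subseteq> carrier Cot}"
  have img: "image_mset (\<lambda>i. J 2 +> y i) w = w" if "set_mset w \<subseteq> carrier Cot" for w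
  proof -
    have "image_mset (\<lambda>i. J 2 +> y i) w = image_mset id w"
      by (rule image_mset_cong) (use y that in auto)
    thus ?thesis by simp
  qed
  have v: "?v \<in> ?S \<rightarrow> carrier PP" using img by auto
  have FS: "F \<in> carrier (free_module K ?S)" using F by simp
  have "lin_ext K PP ?v F = F"
    using FS
  proof (induct F rule: R.free_module_induct)
    case zero
    thus ?case using PP.lin_ext_zero by simp
  next
    case (step F r w)
    have rg: "(\<lambda>t. r \<otimes>\<^bsub>K\<^esub> free_gen K w t) \<in> carrier (free_module K ?S)"
      by (rule R.free_module_smult_closed[OF R.free_gen_carrier[OF step(4)] step(3)])
    show ?case
      unfolding PP.lin_ext_add[OF v step(1) rg] PP.lin_ext_single[OF v step(3,4)] step(2) using img step(4) by simp
  qed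
  hence "homog 0 a 0 = cl 0 (poly_eval K A y (homogeneous_part K 0 F))"
    using tau_polynomial(2)[OF ym F(1), of 0] X(2) F(2) by simp
  moreover have "homogeneous_part K 0 F = (\<lambda>w. F {#} \<otimes>\<^bsub>K\<^esub> free_gen K {#} w)"
    using free_memD(1)[OF FS] by (auto simp: homogeneous_part_def free_gen_def fun_eq_iff)
  moreover have "poly_eval K A y (\<lambda>w. F {#} \<otimes>\<^bsub>K\<^esub> free_gen K {#} w) = F {#} \<odot> \<one>"
    using lin_ext_single[OF monom_value_map[of y "carrier Cot"] free_memD(1)[OF FS], of "{#}"] ym m_sub by auto
  ultimately have "cl 0 a = cl 0 (F {#} \<odot> \<one>)" by (simp add: homog_def)
  hence "a \<ominus> F {#} \<odot> \<one> \<in> J (Suc 0)"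
    using cl_eq_iff[OF a, of "F {#} \<odot> \<one>" 0] free_memD(1)[OF FS] by simp
  thus ?thesis using J_1 free_memD(1)[OF FS] by auto
qed

end

section \<open>Independence of forms\<close>

lemma (in module) lin_ext_mem:
  assumes v: "v \<in> S \<rightarrow> carrier M" and f: "f \<in> carrier (free_module R S)"
    and zero: "\<zero>\<^bsub>M\<^esub> \<in> N" and add: "\<And>a b. a \<in> N ==> b \<in> N ==> a \<oplus>\<^bsub>M\<^esub> b \<in> N"
    and terms: "\<And>s. s \<in> S ==> f s \<noteq> \<zero> ==> f s \<odot>\<^bsub>M\<^esub> v s \<in> N"
  shows "lin_ext R M v f \<in> N"
proof -
  note fc = free_memD[OF f]
  have "finsum M (\<lambda>s. f s \<odot>\<^bsub>M\<^esub> v s) A \<in> N" if "finite A" "A \<subseteq> {s. f s \<noteq> \<zero>}" for A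
    using that
  proof (induction A)
    case (insert a A)
    have "(\<lambda>s. f s \<odot>\<^bsub>M\<^esub> v s) \<in> insert a A \<rightarrow> carrier M"
      using v fc insert.prems by (intro funcsetI smult_closed) auto
    moreover have "f a \<odot>\<^bsub>M\<^esub> v a \<in> N" using terms[of a] fc(2)[of a] insert.prems by auto
    ultimately show ?case using insert add by (subst M.finsum_insert) auto
  qed (simp add: zero)
  thus ?thesis unfolding lin_ext_def using fc(3) by blast
qed

lemma polynomial_algebra_minus:
  "f \<ominus>\<^bsub>polynomial_algebra R V\<^esub> g = f \<ominus>\<^bsub>free_module R {w. set_mset w \<subseteq> V}\<^esub> g"
  unfolding a_minus_def a_inv_def polynomial_algebra_add_monoid by simp

context graded_symmetric
begin

text \<open>Injectivity of \<open>\<tau>\<close>.\<close>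

lemma tau_zero_class:
  assumes F: "f \<in> carrier PP" and t: "\<And>d. \<tau> (cls f) d = J (Suc d)"
  shows "f \<in> Rel"
proof -
  interpret PP: algebra K PP by (rule PP_algebra)
  have z: "\<zero>\<^bsub>PP\<^esub> \<in> carrier PP" using additive_subgroup.zero_closed[OF ideal.axioms(1)[OF Rel_ideal]]
      ideal.Icarr[OF Rel_ideal] by blast
  have o: "\<one>\<^bsub>PP\<^esub> \<in> carrier PP" by (simp add: R.free_gen_carrier)
  have zs: "\<zero>\<^bsub>K\<^esub> \<odot>\<^bsub>PP\<^esub> \<one>\<^bsub>PP\<^esub> = \<zero>\<^bsub>PP\<^esub>" by (rule PP.smult_l_null[OF o])
  have "\<tau> (cls \<zero>\<^bsub>PP\<^esub>) d = J (Suc d)" for d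
  proof -
    have "\<tau> (cls \<zero>\<^bsub>PP\<^esub>) d = \<zero>\<^bsub>K\<^esub> \<odot>\<^bsub>GP d\<^esub> homog 0 \<one> d"
      using tau_props(3)[OF o o R.zero_closed, of d] tau_props(4)[OF o o R.zero_closed] unfolding zs by simp
    also have "\<dots> = cl d \<zero>"
      unfolding homog_apply using GP_smult[of "\<zero>\<^bsub>K\<^esub>" "if d = 0 then \<one> else \<zero>" d] by simp
    finally show ?thesis by (simp add: cl_zero)
  qed
  hence "\<tau> (cls f) = \<tau> (cls \<zero>\<^bsub>PP\<^esub>)" using t by (simp add: fun_eq_iff)
  hence "cls f = cls \<zero>\<^bsub>PP\<^esub>"
    using tau_bij tau_props(5)[OF F F R.zero_closed] tau_props(5)[OF z z R.zero_closed]
    unfolding bij_betw_def inj_on_def by blast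
  hence "f \<ominus>\<^bsub>PP\<^esub> \<zero>\<^bsub>PP\<^esub> \<in> Rel" using ring.quotient_eq_iff_same_a_r_cos[OF PP_ring Rel_ideal F z] by simp
  moreover have "f \<ominus>\<^bsub>PP\<^esub> \<zero>\<^bsub>PP\<^esub> = f"
    using F ring.minus_zero[OF PP_ring] abelian_monoid.r_zero[OF abelian_group.axioms(1)[OF ring.is_abelian_group[OF PP_ring]] F]
    by (simp add: a_minus_def del: poly_alg_simps)
  ultimately show ?thesis by simp
qed

end

text \<open>Linear independence in the quotient by \<open>N\<close>.\<close>

definition independent_mod :: "('k, 'l) ring_scheme \<Rightarrow> ('k, 'a, 'b) module_scheme \<Rightarrow> 'a set \<Rightarrow> nat \<Rightarrow> (nat \<Rightarrow> 'a) \<Rightarrow> bool"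
  where "independent_mod K A N e y \<longleftrightarrow> (\<forall>c. (\<forall>i<e. c i \<in> carrier K) \<and>
    finsum A (\<lambda>i. c i \<odot>\<^bsub>A\<^esub> y i) {..<e} \<in> N \<longrightarrow> (\<forall>i<e. c i = \<zero>\<^bsub>K\<^esub>))"

lemma (in module) dual_functionals:
  assumes K: "field R" and N: "submodule N R M" and y: "y \<in> {..<e} \<rightarrow> carrier M"
    and ind: "independent_mod R M N e y" and i: "i < e"
  shows "\<exists>l\<in>carrier M \<rightarrow> carrier R. (\<forall>u\<in>carrier M. \<forall>v\<in>carrier M. l (u \<oplus>\<^bsub>M\<^esub> v) = l u \<oplus> l v) \<and>
    (\<forall>c\<in>carrier R. \<forall>u\<in>carrier M. l (c \<odot>\<^bsub>M\<^esub> u) = c \<otimes> l u) \<and> (\<forall>w\<in>N. l w = \<zero>) \<and>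
    (\<forall>j<e. l (y j) = (if i = j then \<one> else \<zero>))"
proof -
  interpret K: field R by (rule K)
  interpret N: submodule N R M by (rule N)
  have Nz: "\<zero>\<^bsub>M\<^esub> \<in> N" and Na: "\<And>a b. a \<in> N ==> b \<in> N ==> a \<oplus>\<^bsub>M\<^esub> b \<in> N" and Nc: "N \<subseteq> carrier M"
    using N.one_closed N.m_closed N.subset by auto
  have Nm: "\<ominus>\<^bsub>M\<^esub> a \<in> N" if "a \<in> N" for a using N.m_inv_closed[OF that] by (simp add: a_inv_def)
  let ?s = "\<lambda>c. finsum M (\<lambda>j. c j \<odot>\<^bsub>M\<^esub> y j) {..<e}"
  have tc: "(\<lambda>j. c j \<odot>\<^bsub>M\<^esub> y j) \<in> {..<e} \<rightarrow> carrier M" if "\<forall>j<e. c j \<in> carrier R" for c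
    using that y by (auto intro!: smult_closed)
  note sc = M.finsum_closed[OF tc]
  have s_add: "?s (\<lambda>j. c j \<oplus> c' j) = ?s c \<oplus>\<^bsub>M\<^esub> ?s c'" if c: "\<forall>j<e. c j \<in> carrier R" "\<forall>j<e. c' j \<in> carrier R" for c c'
  proof -
    have "?s (\<lambda>j. c j \<oplus> c' j) = finsum M (\<lambda>j. c j \<odot>\<^bsub>M\<^esub> y j \<oplus>\<^bsub>M\<^esub> c' j \<odot>\<^bsub>M\<^esub> y j) {..<e}"
      by (rule M.finsum_cong'[OF refl]) (use c y tc[OF c(1)] tc[OF c(2)] in \<open>auto intro!: smult_l_distr M.a_closed smult_closed\<close>)
    also have "\<dots> = ?s c \<oplus>\<^bsub>M\<^esub> ?s c'" by (rule M.finsum_addf[OF tc[OF c(1)] tc[OF c(2)]])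
    finally show ?thesis .
  qed
  have s_smult: "?s (\<lambda>j. r \<otimes> c j) = r \<odot>\<^bsub>M\<^esub> ?s c" if r: "r \<in> carrier R" and c: "\<forall>j<e. c j \<in> carrier R" for r c
  proof -
    have "finsum M (\<lambda>j. (r \<otimes> c j) \<odot>\<^bsub>M\<^esub> y j) A = r \<odot>\<^bsub>M\<^esub> finsum M (\<lambda>j. c j \<odot>\<^bsub>M\<^esub> y j) A" if "finite A" "A \<subseteq> {..<e}" for A
      using that
    proof (induction A)
      case empty
      thus ?case using r by (simp add: smult_r_null)
    next
      case (insert a A)
      have "c j \<in> carrier R \<and> y j \<in> carrier M" if "j \<in> insert a A" for j using that insert.prems c y by auto
      hence f: "(\<lambda>j. c j \<odot>\<^bsub>M\<^esub> y j) \<in> A \<rightarrow> carrier M" "(\<lambda>j. (r \<otimes> c j) \<odot>\<^bsub>M\<^esub> y j) \<in> A \<rightarrow> carrier M"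
        "c a \<in> carrier R" "y a \<in> carrier M" using r by auto
      show ?case using insert f r by (simp add: smult_r_distr smult_assoc1 M.finsum_closed)
    qed
    thus ?thesis by auto
  qed
  have s_single: "?s (\<lambda>j. if j = k then r else \<zero>) = r \<odot>\<^bsub>M\<^esub> y k" if "k < e" "r \<in> carrier R" for k r
  proof -
    have "?s (\<lambda>j. if j = k then r else \<zero>) = finsum M (\<lambda>j. if k = j then r \<odot>\<^bsub>M\<^esub> y j else \<zero>\<^bsub>M\<^esub>) {..<e}"
      by (rule M.finsum_cong'[OF refl]) (use that y in \<open>auto intro!: smult_l_null smult_closed\<close>)
    also have "\<dots> = r \<odot>\<^bsub>M\<^esub> y k"
    proof (rule M.add.finprod_singleton)
      show "(\<lambda>j. r \<odot>\<^bsub>M\<^esub> y j) \<in> {..<e} \<rightarrow> carrier M" using that(2) y by (auto intro!: smult_closed)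
    qed (use that in auto)
    finally show ?thesis .
  qed
  have yi: "y i \<in> carrier M" using i y by auto
  have s0: "?s (\<lambda>j. if j = i then \<zero> else \<zero>) = \<zero>\<^bsub>M\<^esub>"
    unfolding s_single[OF i R.zero_closed] by (rule smult_l_null[OF yi])
  let ?W = "{n \<oplus>\<^bsub>M\<^esub> ?s c |n c. n \<in> N \<and> (\<forall>j<e. c j \<in> carrier R) \<and> c i = \<zero>}"
  have W: "submodule ?W R M"
  proof (rule submoduleI)
    show "?W \<subseteq> carrier M" using Nc sc by auto
    have "\<zero>\<^bsub>M\<^esub> = \<zero>\<^bsub>M\<^esub> \<oplus>\<^bsub>M\<^esub> ?s (\<lambda>j. if j = i then \<zero> else \<zero>)"
      unfolding s0 by (rule M.l_zero[OF M.zero_closed, symmetric])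
    thus "\<zero>\<^bsub>M\<^esub> \<in> ?W" using Nz by (intro CollectI exI[of _ "\<zero>\<^bsub>M\<^esub>"] exI[of _ "\<lambda>j. if j = i then \<zero> else \<zero>"]) simp
  next
    fix a b assume "a \<in> ?W" "b \<in> ?W"
    then obtain n c n' c' where e: "a = n \<oplus>\<^bsub>M\<^esub> ?s c" "n \<in> N" "\<forall>j<e. c j \<in> carrier R" "c i = \<zero>"
      "b = n' \<oplus>\<^bsub>M\<^esub> ?s c'" "n' \<in> N" "\<forall>j<e. c' j \<in> carrier R" "c' i = \<zero>" by auto
    have "a \<oplus>\<^bsub>M\<^esub> b = (n \<oplus>\<^bsub>M\<^esub> n') \<oplus>\<^bsub>M\<^esub> ?s (\<lambda>j. c j \<oplus> c' j)"
      unfolding e(1,5) s_add[OF e(3,7)] using e Nc sc by (simp add: M.a_ac subset_iff)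
    thus "a \<oplus>\<^bsub>M\<^esub> b \<in> ?W" using Na[OF e(2,6)] e
      by (intro CollectI exI[of _ "n \<oplus>\<^bsub>M\<^esub> n'"] exI[of _ "\<lambda>j. c j \<oplus> c' j"]) simp
  next
    fix r a assume r: "r \<in> carrier R" and "a \<in> ?W"
    then obtain n c where e: "a = n \<oplus>\<^bsub>M\<^esub> ?s c" "n \<in> N" "\<forall>j<e. c j \<in> carrier R" "c i = \<zero>" by auto
    have "r \<odot>\<^bsub>M\<^esub> a = r \<odot>\<^bsub>M\<^esub> n \<oplus>\<^bsub>M\<^esub> ?s (\<lambda>j. r \<otimes> c j)"
      unfolding e(1) s_smult[OF r e(3)] using e(2,3) Nc sc r by (simp add: smult_r_distr subset_iff)
    thus "r \<odot>\<^bsub>M\<^esub> a \<in> ?W" using N.smult_closed[OF r e(2)] e r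
      by (intro CollectI exI[of _ "r \<odot>\<^bsub>M\<^esub> n"] exI[of _ "\<lambda>j. r \<otimes> c j"]) simp
  next
    fix a assume "a \<in> ?W"
    then obtain n c where e: "a = n \<oplus>\<^bsub>M\<^esub> ?s c" "n \<in> N" "\<forall>j<e. c j \<in> carrier R" "c i = \<zero>" by auto
    have "\<ominus>\<^bsub>M\<^esub> a = \<ominus>\<^bsub>M\<^esub> n \<oplus>\<^bsub>M\<^esub> ?s (\<lambda>j. \<ominus> \<one> \<otimes> c j)"
      unfolding e(1) s_smult[OF R.a_inv_closed[OF R.one_closed] e(3)] using e(2,3) Nc sc
      by (simp add: smult_l_minus M.minus_add subset_iff)
    thus "\<ominus>\<^bsub>M\<^esub> a \<in> ?W" using Nm[OF e(2)] e
      by (intro CollectI exI[of _ "\<ominus>\<^bsub>M\<^esub> n"] exI[of _ "\<lambda>j. \<ominus> \<one> \<otimes> c j"]) simp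
  qed
  have "y i \<notin> ?W"
  proof
    assume "y i \<in> ?W"
    then obtain n c where e: "y i = n \<oplus>\<^bsub>M\<^esub> ?s c" "n \<in> N" "\<forall>j<e. c j \<in> carrier R" "c i = \<zero>" by auto
    let ?d = "\<lambda>j. (if j = i then \<one> else \<zero>) \<oplus> \<ominus> \<one> \<otimes> c j"
    have d1: "\<forall>j<e. (if j = i then \<one> else \<zero>) \<in> carrier R" "\<forall>j<e. \<ominus> \<one> \<otimes> c j \<in> carrier R" using e(3) by auto
    have "?s ?d = y i \<oplus>\<^bsub>M\<^esub> \<ominus>\<^bsub>M\<^esub> ?s c"
      unfolding s_add[OF d1] s_single[OF i R.one_closed] s_smult[OF R.a_inv_closed[OF R.one_closed] e(3)]
      using yi sc[OF e(3)] by (simp add: smult_l_minus)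
    also have "\<dots> = n"
    proof -
      have nc: "n \<in> carrier M" using e(2) Nc by auto
      note scc = sc[OF e(3)]
      show ?thesis
        by (simp only: e(1) M.a_assoc[OF nc scc M.a_inv_closed[OF scc]] M.r_neg[OF scc] M.r_zero[OF nc])
    qed
    finally have "?s ?d \<in> N" using e(2) by simp
    moreover have "\<forall>j<e. ?d j \<in> carrier R" using d1 by auto
    ultimately have "(\<forall>j<e. ?d j \<in> carrier R) \<and> ?s ?d \<in> N" by (intro conjI)
    hence "\<forall>i<e. ?d i = \<zero>" by (rule ind[unfolded independent_mod_def, THEN spec[of _ ?d], THEN mp])
    from this[THEN spec, THEN mp, OF i] have "?d i = \<zero>" .
    thus False using e(4) by simp
  qed
  note ex = exists_functional[OF K W yi this]
  obtain l where l: "l \<in> carrier M \<rightarrow> carrier R" "\<forall>u\<in>carrier M. \<forall>v\<in>carrier M. l (u \<oplus>\<^bsub>M\<^esub> v) = l u \<oplus> l v"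
    "\<forall>c\<in>carrier R. \<forall>u\<in>carrier M. l (c \<odot>\<^bsub>M\<^esub> u) = c \<otimes> l u" "\<forall>w\<in>?W. l w = \<zero>" "l (y i) = \<one>" by (rule bexE[OF ex]) (elim conjE, rule that)
  have lN: "l w = \<zero>" if "w \<in> N" for w
  proof -
    have "w = w \<oplus>\<^bsub>M\<^esub> ?s (\<lambda>j. if j = i then \<zero> else \<zero>)"
      unfolding s0 using that Nc by (intro M.r_zero[symmetric]) auto
    hence "w \<in> ?W" using that by (intro CollectI exI[of _ w] exI[of _ "\<lambda>j. if j = i then \<zero> else \<zero>"]) simp
    thus ?thesis using l(4) by blast
  qed
  have ly: "l (y j) = (if i = j then \<one> else \<zero>)" if j: "j < e" for j
  proof (cases "i = j")
    case False
    have eq: "y j = \<zero>\<^bsub>M\<^esub> \<oplus>\<^bsub>M\<^esub> ?s (\<lambda>k. if k = j then \<one> else \<zero>)"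
      unfolding s_single[OF j R.one_closed] using funcset_mem[OF y, of j] j by simp
    have "\<zero>\<^bsub>M\<^esub> \<oplus>\<^bsub>M\<^esub> ?s (\<lambda>k. if k = j then \<one> else \<zero>) \<in> ?W" using Nz False
      by (intro CollectI exI[of _ "\<zero>\<^bsub>M\<^esub>"] exI[of _ "\<lambda>k. if k = j then \<one> else \<zero>"]) simp
    hence "y j \<in> ?W" by (rule ssubst[OF eq, of "\<lambda>z. z \<in> ?W"])
    thus ?thesis using l(4) False by auto
  qed (use l(5) in simp)
  show ?thesis
    by (intro bexI[OF _ l(1)] conjI l(2,3)) (intro ballI allI impI, (rule lN ly; assumption))+
qed

context graded_symmetric
begin

text \<open>Injectivity of \<open>\<tau>\<close> puts the polynomial in the classes of the \<open>y i\<close> into the ideal of relations of the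
  symmetric algebra.  Substituting for each class its coordinates, given by functionals dual to the \<open>y i\<close>,
  kills these relations and recovers \<open>F\<close>.\<close>

lemma forms_independent:
  assumes y: "y \<in> {..<e::nat} \<rightarrow> m" and ind: "independent_mod K A (J 2) e y"
    and F: "F \<in> carrier (polynomial_algebra K {..<e})" and homog: "\<And>w. size w \<noteq> k ==> F w = \<zero>\<^bsub>K\<^esub>"
    and ev: "poly_eval K A y F \<in> J (Suc k)"
  shows "F = (\<lambda>_. \<zero>\<^bsub>K\<^esub>)"
proof -
  let ?Q = "polynomial_algebra K {..<e}" and ?S = "{w. set_mset w \<subseteq> {..<e}}" and ?c = "\<lambda>i. J 2 +> y i"
  interpret PP: algebra K PP by (rule PP_algebra)
  interpret Q: algebra K ?Q by (rule R.polynomial_algebra_algebra)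
  have yA: "y \<in> {..<e} \<rightarrow> carrier A" using y m_sub by blast
  have cI: "?c j \<in> carrier Cot" if "j < e" for j unfolding Cot_carrier using y that by blast
  let ?v = "\<lambda>w. free_gen K (image_mset ?c w)"
  have v: "?v \<in> ?S \<rightarrow> carrier PP"
  proof
    fix w assume "w \<in> ?S"
    thus "free_gen K (image_mset ?c w) \<in> carrier PP" by (intro X_image[of "{..<e}"] cI) auto
  qed
  define \<Phi> where "\<Phi> = lin_ext K PP ?v"
  have FS: "F \<in> carrier (free_module K ?S)" using F by simp
  have \<Phi>c: "\<Phi> F \<in> carrier PP" unfolding \<Phi>_def by (rule tau_polynomial(1)[OF y F])
  have "\<tau> (cls (\<Phi> F)) d = J (Suc d)" for d
  proof -
    have t: "\<tau> (cls (\<Phi> F)) d = cl d (poly_eval K A y (homogeneous_part K d F))"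
      unfolding \<Phi>_def by (rule tau_polynomial(2)[OF y F])
    show ?thesis
    proof (cases "d = k")
      case True
      hence "homogeneous_part K d F = F" using homog by (auto simp: homogeneous_part_def fun_eq_iff)
      thus ?thesis using t ev True a_rcos_zero[OF J_ideal] by simp
    next
      case False
      hence "homogeneous_part K d F = (\<lambda>_. \<zero>\<^bsub>K\<^esub>)" using homog by (auto simp: homogeneous_part_def fun_eq_iff)
      thus ?thesis using t cl_zero by (simp add: lin_ext_zero)
    qed
  qed
  hence rel: "\<Phi> F \<in> Rel" by (rule tau_zero_class[OF \<Phi>c])
  have "submodule (J 2) K A"
  proof (rule submoduleI)
    show "\<ominus> a \<in> J 2" if "a \<in> J 2" for a
      using additive_subgroup.a_inv_closed[OF ideal.axioms(1)[OF J_ideal] that] .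
  qed (use J_sub J_zero J_add J_smult in auto)
  note dual = dual_functionals[OF K.field_axioms this yA ind]
  define l where "l i = (SOME l. l \<in> carrier A \<rightarrow> carrier K \<and> (\<forall>u\<in>carrier A. \<forall>v\<in>carrier A. l (u \<oplus> v) = l u \<oplus>\<^bsub>K\<^esub> l v) \<and>
    (\<forall>c\<in>carrier K. \<forall>u\<in>carrier A. l (c \<odot> u) = c \<otimes>\<^bsub>K\<^esub> l u) \<and> (\<forall>w\<in>J 2. l w = \<zero>\<^bsub>K\<^esub>) \<and>
    (\<forall>j<e. l (y j) = (if i = j then \<one>\<^bsub>K\<^esub> else \<zero>\<^bsub>K\<^esub>)))" for i
  have l': "l i \<in> carrier A \<rightarrow> carrier K \<and> (\<forall>u\<in>carrier A. \<forall>v\<in>carrier A. l i (u \<oplus> v) = l i u \<oplus>\<^bsub>K\<^esub> l i v) \<and>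
    (\<forall>c\<in>carrier K. \<forall>u\<in>carrier A. l i (c \<odot> u) = c \<otimes>\<^bsub>K\<^esub> l i u) \<and> (\<forall>w\<in>J 2. l i w = \<zero>\<^bsub>K\<^esub>) \<and>
    (\<forall>j<e. l i (y j) = (if i = j then \<one>\<^bsub>K\<^esub> else \<zero>\<^bsub>K\<^esub>))" if i: "i < e" for i
    using someI_ex[OF dual[OF i, unfolded Bex_def]] unfolding l_def .
  have l: "u \<in> carrier A ==> l i u \<in> carrier K"
    "u \<in> carrier A ==> v \<in> carrier A ==> l i (u \<oplus> v) = l i u \<oplus>\<^bsub>K\<^esub> l i v"
    "c \<in> carrier K ==> u \<in> carrier A ==> l i (c \<odot> u) = c \<otimes>\<^bsub>K\<^esub> l i u"
    "w \<in> J 2 ==> l i w = \<zero>\<^bsub>K\<^esub>"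
    "j < e ==> l i (y j) = (if i = j then \<one>\<^bsub>K\<^esub> else \<zero>\<^bsub>K\<^esub>)" if i: "i < e" for i u v c w j
    using l'[OF i] by blast+
  define rep where "rep v = (SOME a. a \<in> m \<and> v = J 2 +> a)" for v
  have rep: "rep v \<in> m" "v = J 2 +> rep v" if "v \<in> carrier Cot" for v
    using someI_ex[of "\<lambda>a. a \<in> m \<and> v = J 2 +> a"] that unfolding rep_def Cot_carrier by blast+
  have lrep: "l i (rep (J 2 +> a)) = l i a" if i: "i < e" and a: "a \<in> m" for i a
  proof -
    have ac: "a \<in> carrier A" using a m_sub by auto
    have r: "rep (J 2 +> a) \<in> carrier A" "J 2 +> a = J 2 +> rep (J 2 +> a)"
      using rep[of "J 2 +> a"] a m_sub unfolding Cot_carrier by auto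
    have "rep (J 2 +> a) \<ominus> a \<in> J 2"
      using quotient_eq_iff_same_a_r_cos[OF J_ideal r(1) ac] r(2) by simp
    from l(4)[OF i this] l(2)[OF i minus_closed[OF r(1) ac] ac]
    have "l i ((rep (J 2 +> a) \<ominus> a) \<oplus> a) = l i a" using l(1)[OF i ac] by simp
    moreover have "(rep (J 2 +> a) \<ominus> a) \<oplus> a = rep (J 2 +> a)" using r(1) ac by algebra
    ultimately show ?thesis by simp
  qed
  \<comment> \<open>the linear form dual to the \<open>y i\<close>; the index of the variable is the sum of the singleton multiset\<close>
  define lf where "lf v = (\<lambda>w. if size w = 1 \<and> set_mset w \<subseteq> {..<e} then l (sum_mset w) (rep v) else \<zero>\<^bsub>K\<^esub>)" for v
  have sing: "size w = 1 \<and> set_mset w \<subseteq> {..<e} \<longleftrightarrow> (\<exists>i<e. w = {#i#})" for w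
  proof
    assume w: "size w = 1 \<and> set_mset w \<subseteq> {..<e}"
    then obtain i where "w = {#i#}" using size_1_singleton_mset by blast
    thus "\<exists>i<e. w = {#i#}" using w by auto
  qed auto
  have lc: "lf v \<in> carrier ?Q" if v: "v \<in> carrier Cot" for v
  proof -
    have rc: "rep v \<in> carrier A" using rep(1)[OF v] m_sub by auto
    have "{w. lf v w \<noteq> \<zero>\<^bsub>K\<^esub>} \<subseteq> (\<lambda>i. {#i#}) ` {..<e}" unfolding lf_def sing by auto
    hence "finite {w. lf v w \<noteq> \<zero>\<^bsub>K\<^esub>}" by (rule finite_subset) simp
    moreover have "lf v w \<in> carrier K" for w unfolding lf_def sing using l(1)[OF _ rc] by auto
    ultimately show ?thesis unfolding poly_alg_simps free_mem_iff by (simp add: lf_def)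
  qed
  have ladd: "lf (u \<oplus>\<^bsub>Cot\<^esub> v) = lf u \<oplus>\<^bsub>?Q\<^esub> lf v" and lsm: "c \<in> carrier K ==> lf (c \<odot>\<^bsub>Cot\<^esub> u) = c \<odot>\<^bsub>?Q\<^esub> lf u"
    if uv: "u \<in> carrier Cot" "v \<in> carrier Cot" for u v c
  proof -
    obtain a b where ab: "a \<in> m" "b \<in> m" "u = J 2 +> a" "v = J 2 +> b"
      using uv unfolding Cot_carrier by blast
    have c: "a \<in> carrier A" "b \<in> carrier A" using ab m_sub by auto
    show "lf (u \<oplus>\<^bsub>Cot\<^esub> v) = lf u \<oplus>\<^bsub>?Q\<^esub> lf v"
      unfolding ab Cot_add[OF c] lf_def sing fun_eq_iff poly_alg_simps
      using lrep ab l(2)[OF _ c] m_closed(1)[OF ab(1,2)] by auto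
    show "lf (c \<odot>\<^bsub>Cot\<^esub> u) = c \<odot>\<^bsub>?Q\<^esub> lf u" if cK: "c \<in> carrier K" for c
      unfolding ab Cot_smult[OF cK c(1)] lf_def sing fun_eq_iff poly_alg_simps
      using lrep ab l(3)[OF _ cK c(1)] m_closed(2)[OF cK ab(1)] cK by auto
  qed
  have ly: "lf (?c i) = free_gen K {#i#}" if i: "i < e" for i
    unfolding lf_def sing fun_eq_iff free_gen_def using lrep[of _ "y i"] l(5)[OF _ i] i funcset_mem[OF y, of i] by (auto split: if_splits)
  let ?\<psi> = "poly_eval K ?Q lf"
  have lmap: "lf \<in> carrier Cot \<rightarrow> carrier ?Q" using lc by blast
  note mvm = Q.monom_value_map[OF lmap]
  have hom: "?\<psi> \<in> ring_hom PP ?Q" by (rule Q.poly_eval_ring_hom[OF lmap])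
  have Qring: "ring ?Q" using cring.axioms(1)[OF Q.M_cring] .
  have Xval: "?\<psi> (free_gen K {#v#}) = lf v" if "v \<in> carrier Cot" for v
    using Q.poly_eval_gen[OF lmap, of "{#v#}"] cring.monom_value_1[OF Q.M_cring, of lf v] that lc by simp
  have "Rel \<subseteq> a_kernel PP ?Q ?\<psi>"
  proof (rule ring.genideal_minimal[OF PP_ring])
    interpret h: ring_hom_ring PP ?Q ?\<psi> by (rule ring_hom_ringI2[OF PP_ring Qring hom])
    show "ideal (a_kernel PP ?Q ?\<psi>) PP" by (rule h.kernel_is_ideal)
    have diff: "f \<ominus>\<^bsub>PP\<^esub> g \<in> a_kernel PP ?Q ?\<psi>" if fg: "f \<in> carrier PP" "g \<in> carrier PP" "?\<psi> f = ?\<psi> g" for f g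
    proof -
      have "?\<psi> (f \<ominus>\<^bsub>PP\<^esub> g) = ?\<psi> f \<ominus>\<^bsub>?Q\<^esub> ?\<psi> g"
        unfolding polynomial_algebra_minus[where V = "carrier Cot"] by (rule Q.lin_ext_minus[OF mvm]) (use fg in simp_all)
      hence "?\<psi> (f \<ominus>\<^bsub>PP\<^esub> g) = \<zero>\<^bsub>?Q\<^esub>"
        using fg abelian_group.r_neg[OF ring.is_abelian_group[OF Qring] h.hom_closed[OF fg(2)]] by (simp add: a_minus_def del: poly_alg_simps)
      moreover have "f \<ominus>\<^bsub>PP\<^esub> g \<in> carrier PP" using abelian_group.minus_closed[OF ring.is_abelian_group[OF PP_ring] fg(1,2)] .
      ultimately show ?thesis unfolding a_kernel_def' by blast
    qed
    show "symmetric_relations K Cot \<subseteq> a_kernel PP ?Q ?\<psi>"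
    proof
      fix r assume "r \<in> symmetric_relations K Cot"
      then consider u v where "u \<in> carrier Cot" "v \<in> carrier Cot"
          "r = free_gen K {#u \<oplus>\<^bsub>Cot\<^esub> v#} \<ominus>\<^bsub>PP\<^esub> (free_gen K {#u#} \<oplus>\<^bsub>PP\<^esub> free_gen K {#v#})"
        | c v where "c \<in> carrier K" "v \<in> carrier Cot" "r = free_gen K {#c \<odot>\<^bsub>Cot\<^esub> v#} \<ominus>\<^bsub>PP\<^esub> (c \<odot>\<^bsub>PP\<^esub> free_gen K {#v#})"
        unfolding symmetric_relations_def Let_def by blast
      thus "r \<in> a_kernel PP ?Q ?\<psi>"
      proof cases
        case 1
        have car: "free_gen K {#u \<oplus>\<^bsub>Cot\<^esub> v#} \<in> carrier PP" "free_gen K {#u#} \<in> carrier PP" "free_gen K {#v#} \<in> carrier PP"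
          using X_carrier Cot_closed(1)[OF 1(1,2) R.zero_closed] 1 by blast+
        have "?\<psi> (free_gen K {#u#} \<oplus>\<^bsub>PP\<^esub> free_gen K {#v#}) = lf u \<oplus>\<^bsub>?Q\<^esub> lf v"
          using Q.poly_eval_add[OF lmap car(2,3)] Xval[OF 1(1)] Xval[OF 1(2)] by simp
        thus ?thesis unfolding 1(3)
          using Xval[OF Cot_closed(1)[OF 1(1,2) R.zero_closed]] ladd[OF 1(1,2)]
            abelian_monoid.a_closed[OF abelian_group.axioms(1)[OF ring.is_abelian_group[OF PP_ring]] car(2,3)]
          by (intro diff[OF car(1)]) simp_all
      next
        case 2
        have car: "free_gen K {#c \<odot>\<^bsub>Cot\<^esub> v#} \<in> carrier PP" "free_gen K {#v#} \<in> carrier PP"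
          using X_carrier Cot_closed(2)[OF 2(2,2,1)] 2 by blast+
        have "?\<psi> (c \<odot>\<^bsub>PP\<^esub> free_gen K {#v#}) = c \<odot>\<^bsub>?Q\<^esub> lf v"
          using Q.poly_eval_smult[OF lmap 2(1) car(2)] Xval[OF 2(2)] by simp
        thus ?thesis unfolding 2(3)
          using Xval[OF Cot_closed(2)[OF 2(2,2,1)]] lsm[OF 2(2,2,1)] PP.smult_closed[OF 2(1) car(2)]
          by (intro diff[OF car(1)]) simp_all
      qed
    qed
  qed
  hence ker: "?\<psi> (\<Phi> F) = \<zero>\<^bsub>?Q\<^esub>" using rel unfolding a_kernel_def' by blast
  have mon: "set_mset w \<subseteq> {..<e} ==> monom_value ?Q lf (image_mset ?c w) = free_gen K w" for w
  proof (induction w)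
    case empty
    thus ?case using cring.monom_value_empty[OF Q.M_cring] by simp
  next
    case (add i w)
    have i: "i < e" and w: "set_mset w \<subseteq> {..<e}" using add.prems by auto
    have s: "set_mset {#?c i#} \<subseteq> carrier Cot" "set_mset (image_mset ?c w) \<subseteq> carrier Cot"
      using cI i w by (auto simp del: One_nat_def)
    have "monom_value ?Q lf (image_mset ?c (add_mset i w)) = monom_value ?Q lf ({#?c i#} + image_mset ?c w)" by simp
    also have "\<dots> = monom_value ?Q lf {#?c i#} \<otimes>\<^bsub>?Q\<^esub> monom_value ?Q lf (image_mset ?c w)"
      by (rule cring.monom_value_add[OF Q.M_cring lmap s])
    also have "\<dots> = free_gen K {#i#} \<otimes>\<^bsub>?Q\<^esub> free_gen K w"
      using cring.monom_value_1[OF Q.M_cring, of lf "?c i"] lc[OF cI[OF i]] ly[OF i] add.IH[OF w] by simp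
    finally show ?case by (simp add: R.poly_mult_gen_gen)
  qed
  have "?\<psi> (\<Phi> F) = F"
    using FS
  proof (induct F rule: R.free_module_induct)
    case zero
    have "\<Phi> (\<lambda>_. \<zero>\<^bsub>K\<^esub>) = (\<lambda>_. \<zero>\<^bsub>K\<^esub>)" unfolding \<Phi>_def PP.lin_ext_zero by simp
    thus ?case using Q.lin_ext_zero by simp
  next
    case (step F r w)
    have w: "set_mset w \<subseteq> {..<e}" using step(4) by simp
    have g: "?v w \<in> carrier PP" using v step(4) by blast
    have F1: "\<Phi> F \<in> carrier PP" unfolding \<Phi>_def by (rule PP.lin_ext_closed[OF v step(1)])
    have rg: "(\<lambda>t. r \<otimes>\<^bsub>K\<^esub> free_gen K w t) \<in> carrier (free_module K ?S)"
      by (rule R.free_module_smult_closed[OF R.free_gen_carrier[OF step(4)] step(3)])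
    have "\<Phi> (\<lambda>t. F t \<oplus>\<^bsub>K\<^esub> r \<otimes>\<^bsub>K\<^esub> free_gen K w t) = \<Phi> F \<oplus>\<^bsub>PP\<^esub> r \<odot>\<^bsub>PP\<^esub> ?v w"
      unfolding \<Phi>_def PP.lin_ext_add[OF v step(1) rg] PP.lin_ext_single[OF v step(3,4)] ..
    moreover have "?\<psi> (\<Phi> F \<oplus>\<^bsub>PP\<^esub> r \<odot>\<^bsub>PP\<^esub> ?v w) = F \<oplus>\<^bsub>?Q\<^esub> r \<odot>\<^bsub>?Q\<^esub> free_gen K w"
    proof -
      have "set_mset (image_mset ?c w) \<subseteq> carrier Cot" using cI w by (auto simp del: One_nat_def)
      from Q.poly_eval_gen[OF lmap this] have gw: "?\<psi> (?v w) = free_gen K w" unfolding mon[OF w] .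
      show ?thesis
        unfolding Q.poly_eval_add[OF lmap F1 PP.smult_closed[OF step(3) g]] Q.poly_eval_smult[OF lmap step(3) g] gw step(2) ..
    qed
    ultimately show ?case by simp
  qed
  thus ?thesis using ker by simp
qed

lemma poly_eval_high:
  assumes y: "y \<in> I \<rightarrow> m" and F: "F \<in> carrier (polynomial_algebra K I)" and low: "\<And>w. size w < k ==> F w = \<zero>\<^bsub>K\<^esub>"
  shows "poly_eval K A y F \<in> J k"
proof (rule lin_ext_mem[OF monom_value_map])
  show "y \<in> I \<rightarrow> carrier A" using y m_sub by blast
  show "F \<in> carrier (free_module K {w. set_mset w \<subseteq> I})" using F by simp
  fix w assume w: "w \<in> {w. set_mset w \<subseteq> I}" "F w \<noteq> \<zero>\<^bsub>K\<^esub>"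
  hence "k \<le> size w" using low[of w] by (meson not_le)
  hence "monom_value A y w \<in> J k" using monom_value_J[OF y, of w] J_mono w by blast
  thus "F w \<odot> monom_value A y w \<in> J k" using J_smult R.poly_val[OF F] by blast
qed (use J_zero J_add in auto)

text \<open>By induction on \<open>k\<close>: the terms of least degree form a form to which the previous lemma applies.\<close>

lemma poly_eval_low_zero:
  assumes y: "y \<in> {..<e::nat} \<rightarrow> m" and ind: "independent_mod K A (J 2) e y"
    and F: "F \<in> carrier (polynomial_algebra K {..<e})"
  shows "poly_eval K A y F \<in> J k ==> size w < k ==> F w = \<zero>\<^bsub>K\<^esub>"
proof (induction k arbitrary: w)
  case (Suc k)
  have low: "F w = \<zero>\<^bsub>K\<^esub>" if "size w < k" for w
    using Suc.IH[OF _ that] Suc.prems(1) J_mono[of k "Suc k"] by auto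
  let ?S = "{w. set_mset w \<subseteq> {..<e}}"
  have FS: "F \<in> carrier (free_module K ?S)" using F by simp
  let ?h = "homogeneous_part K k F"
  have h: "?h \<in> carrier (free_module K ?S)" by (rule homogeneous_part_carrier[OF FS R.zero_closed])
  define G where "G = (\<lambda>w. \<ominus>\<^bsub>K\<^esub> \<one>\<^bsub>K\<^esub> \<otimes>\<^bsub>K\<^esub> F w)"
  have G: "G \<in> carrier (free_module K ?S)" unfolding G_def by (rule R.free_module_smult_closed[OF FS]) simp
  have hG: "(\<lambda>w. ?h w \<oplus>\<^bsub>K\<^esub> G w) \<in> carrier (free_module K ?S)" by (rule R.free_module_add_closed[OF h G])
  have yA: "y \<in> {..<e} \<rightarrow> carrier A" using y m_sub by blast
  note mv = monom_value_map[OF yA]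
  have z: "?h w \<oplus>\<^bsub>K\<^esub> G w = \<zero>\<^bsub>K\<^esub>" if "size w < Suc k" for w
    using low[of w] that R.poly_val[OF F, of w] by (auto simp: homogeneous_part_def G_def less_Suc_eq R.l_minus R.r_neg)
  have "poly_eval K A y (\<lambda>w. ?h w \<oplus>\<^bsub>K\<^esub> G w) \<in> J (Suc k)"
    by (rule poly_eval_high[OF y]) (use hG z in auto)
  moreover have "poly_eval K A y (\<lambda>w. ?h w \<oplus>\<^bsub>K\<^esub> G w) = poly_eval K A y ?h \<oplus> \<ominus> poly_eval K A y F"
    unfolding lin_ext_add[OF mv h G] unfolding G_def lin_ext_smult[OF mv R.a_inv_closed[OF R.one_closed] FS]
    using lin_ext_closed[OF mv FS] by (simp add: smult_l_minus)
  ultimately have "(poly_eval K A y ?h \<oplus> \<ominus> poly_eval K A y F) \<oplus> poly_eval K A y F \<in> J (Suc k)"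
    using J_add Suc.prems(1) by simp
  moreover have "(poly_eval K A y ?h \<oplus> \<ominus> poly_eval K A y F) \<oplus> poly_eval K A y F = poly_eval K A y ?h"
    using lin_ext_closed[OF mv FS] lin_ext_closed[OF mv h] by algebra
  ultimately have "?h = (\<lambda>_. \<zero>\<^bsub>K\<^esub>)"
    by (intro forms_independent[OF y ind, of ?h k]) (use h in \<open>auto simp: homogeneous_part_def\<close>)
  hence "?h w = \<zero>\<^bsub>K\<^esub>" by simp
  thus ?case using low[of w] Suc.prems(2) by (auto simp: homogeneous_part_def less_Suc_eq split: if_splits)
qed simp

end

section \<open>Initial forms in local subrings\<close>

context graded_symmetric
begin

lemma one_notin_m: "\<one> \<notin> m"
proof
  assume "\<one> \<in> m"
  hence "m = carrier A" by (rule ideal.one_imp_carrier[OF m_ideal])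
  thus False using maximalideal.I_notcarr[OF maximal] by simp
qed

lemma unit_notin_m: "u \<in> Units A ==> u \<notin> m"
proof
  assume u: "u \<in> Units A" "u \<in> m"
  have "inv u \<otimes> u \<in> m" by (rule ideal.I_l_closed[OF m_ideal u(2)]) (use u in simp)
  thus False using u(1) one_notin_m by simp
qed

lemma scalars_subfield: "subfield (scalars K A) A"
proof -
  have "ring_hom_ring K A (\<lambda>c. c \<odot> \<one>)"
  proof (rule ring_hom_ringI)
    show "ring K" "ring A" using R.ring_axioms ring_M by auto
    show "(a \<otimes>\<^bsub>K\<^esub> b) \<odot> \<one> = (a \<odot> \<one>) \<otimes> (b \<odot> \<one>)"
      if "a \<in> carrier K" "b \<in> carrier K" for a b
      using that smult_eq_mult[of a "b \<odot> \<one>"] by (simp add: smult_assoc1)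
  qed (auto intro: smult_l_distr)
  hence "subfield ((\<lambda>c. c \<odot> \<one>) ` carrier K) A"
    by (rule ring_hom_ring.img_is_subfield(2)[OF _ K.carrier_is_subfield]) (use one_notin_m J_zero[of 1] J_1(2) in metis)
  thus ?thesis by (simp add: scalars_def)
qed

lemma scalars_ring: "subring (scalars K A) A"
  by (rule subfieldE(1)[OF scalars_subfield])

lemma scalars_sub: "scalars K A \<subseteq> carrier A"
  using subfieldE(3)[OF scalars_subfield] .

end

text \<open>A local subring \<open>S\<close> of finite type whose maximal ideal is generated, modulo its own square, by elements that
  are independent modulo the square of \<open>m\<close>.\<close>

locale regular_core = graded_symmetric K A m \<tau> for K and A (structure) and m \<tau> +
  fixes B S Z e y
  assumes char0: "\<And>k::nat. 0 < k ==> add_pow A k \<one> \<in> Units A"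
    and Z: "finite Z" "Z \<subseteq> carrier A" and B_def: "B = generate_ring A (scalars K A \<union> Z)"
    and S_ring: "subring S A" and S_def: "S = fractions_in A B (B - m)"
    and B_units: "B - m \<subseteq> Units A"
    and y: "y \<in> {..<e::nat} \<rightarrow> B \<inter> m" and ind: "independent_mod K A (J 2) e y"
    and spanning: "\<And>a. a \<in> S \<inter> m ==> \<exists>c. (\<forall>i<e. c i \<in> carrier K) \<and>
      a \<ominus> finsum A (\<lambda>i. c i \<odot> y i) {..<e} \<in> ideal_prod (A\<lparr>carrier := S\<rparr>) (S \<inter> m) (S \<inter> m)"
begin

abbreviation AS where "AS \<equiv> A\<lparr>carrier := S\<rparr>"
abbreviation AB where "AB \<equiv> A\<lparr>carrier := B\<rparr>"
abbreviation mS where "mS \<equiv> S \<inter> m"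
abbreviation JS where "JS \<equiv> ideal_power AS mS"
abbreviation poly where "poly \<equiv> carrier (polynomial_algebra K {..<e})"
abbreviation ev where "ev \<equiv> poly_eval K A y"

lemma B_ring: "subring B A"
  unfolding B_def by (rule generate_ring_is_subring) (use scalars_sub Z in auto)

lemma scalars_B: "scalars K A \<subseteq> B"
  unfolding B_def by (auto intro: generate_ring.incl)

lemma scalar_B: "c \<in> carrier K ==> c \<odot> \<one> \<in> B"
  using scalars_B unfolding scalars_def by auto

lemma B_smult:
  assumes "c \<in> carrier K" "b \<in> B"
  shows "c \<odot> b \<in> B"
proof -
  have "b \<in> carrier A" using assms(2) subringE(1)[OF B_ring] by auto
  thus ?thesis using smult_eq_mult[OF assms(1), of b] subringE(6)[OF B_ring scalar_B[OF assms(1)] assms(2)] by simp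
qed

lemma B_sub_S: "B \<subseteq> S"
proof
  fix b assume b: "b \<in> B"
  have "\<one> \<in> B - m" using subringE(3)[OF B_ring] one_notin_m by auto
  moreover have "b = b \<otimes> inv \<one>" using b subringE(1)[OF B_ring] by auto
  ultimately show "b \<in> S" unfolding S_def fractions_in_def using b by blast
qed

lemma S_sub: "S \<subseteq> carrier A" using subringE(1)[OF S_ring] .

lemma S_smult:
  assumes "c \<in> carrier K" "s \<in> S"
  shows "c \<odot> s \<in> S"
proof -
  have "s \<in> carrier A" using assms(2) S_sub by auto
  thus ?thesis
    using smult_eq_mult[OF assms(1), of s] subringE(6)[OF S_ring subsetD[OF B_sub_S scalar_B[OF assms(1)]] assms(2)] by simp
qed

lemma inv_B_in_S: "s \<in> B - m ==> inv s \<in> S"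
proof -
  assume s: "s \<in> B - m"
  hence "inv s = \<one> \<otimes> inv s" using B_units by auto
  thus ?thesis unfolding S_def fractions_in_def using s subringE(3)[OF B_ring] by blast
qed

lemma S_frac: "a \<in> S ==> \<exists>s\<in>B - m. s \<otimes> a \<in> B \<and> inv s \<otimes> (s \<otimes> a) = a"
proof -
  assume a: "a \<in> S"
  then obtain b s where bs: "b \<in> B" "s \<in> B - m" "a = b \<otimes> inv s" unfolding S_def fractions_in_def by blast
  have u: "s \<in> Units A" "b \<in> carrier A" "a \<in> carrier A" using bs B_units subringE(1)[OF B_ring] a S_sub by auto
  have "s \<otimes> a = b \<otimes> (s \<otimes> inv s)" unfolding bs(3) by (rule m_lcomm) (use u in auto)
  hence "s \<otimes> a = b" using u by simp
  moreover have "inv s \<otimes> (s \<otimes> a) = a" using m_assoc[of "inv s" s a] u by auto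
  moreover have "s \<otimes> a \<in> B" using \<open>s \<otimes> a = b\<close> bs(1) by (rule ssubst)
  ultimately show ?thesis using bs(2) by blast
qed

lemma AS_cring: "cring AS" by (rule subring_cring[OF S_ring])
lemma AB_cring: "cring AB" by (rule subring_cring[OF B_ring])

lemma S_unit:
  assumes "a \<in> S" "a \<notin> m"
  shows "a \<in> Units AS" "inv a \<in> S" "a \<in> Units A"
proof -
  obtain s where s: "s \<in> B - m" "s \<otimes> a \<in> B" "inv s \<otimes> (s \<otimes> a) = a" using S_frac[OF assms(1)] by blast
  have "s \<otimes> a \<notin> m"
  proof
    assume "s \<otimes> a \<in> m"
    hence "inv s \<otimes> (s \<otimes> a) \<in> m" using ideal.I_l_closed[OF m_ideal] s(1) B_units by auto
    thus False using s(3) assms(2) by simp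
  qed
  hence t: "s \<otimes> a \<in> B - m" "s \<otimes> a \<in> Units A" using s(2) B_units by auto
  have sU: "s \<in> Units A" "s \<in> carrier A" using s(1) B_units by auto
  have ac: "a \<in> carrier A" using assms S_sub by auto
  let ?b = "s \<otimes> inv (s \<otimes> a)"
  have bS: "?b \<in> S" using subringE(6)[OF S_ring _ inv_B_in_S[OF t(1)], of s] s(1) B_sub_S by auto
  have ab: "a \<otimes> ?b = \<one>" "?b \<otimes> a = \<one>"
  proof -
    have ic: "inv (s \<otimes> a) \<in> carrier A" using t(2) by simp
    have "a \<otimes> ?b = (s \<otimes> a) \<otimes> inv (s \<otimes> a)" using ac sU(2) ic by (simp add: m_ac)
    thus "a \<otimes> ?b = \<one>" using t(2) by simp
    thus "?b \<otimes> a = \<one>" using ac sU(2) ic by (simp add: m_comm)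
  qed
  show "a \<in> Units AS" unfolding Units_def using assms(1) bS ab by auto
  show "a \<in> Units A" unfolding Units_def using ac bS S_sub ab by auto
  have "inv a = ?b" using comm_inv_char[OF ac _ ab(1)] bS S_sub by auto
  thus "inv a \<in> S" using bS by simp
qed

lemma mS_ideal: "ideal mS AS"
proof -
  have "ideal_in A S mS"
    unfolding ideal_in_def using J_zero[of 1] J_add[of _ 1] ideal.I_l_closed[OF m_ideal] S_sub subringE(2,6,7)[OF S_ring]
    unfolding J_1 by auto
  thus ?thesis using ideal_in_iff[OF S_ring] by simp
qed

lemma AS_acc: "ideal_acc AS"
proof (rule ideal_acc_fractions[OF B_ring S_ring B_sub_S])
  show "ideal_acc AB" unfolding B_def by (rule ideal_acc_generate[OF scalars_subfield Z])
  show "\<exists>s\<in>B. \<exists>t\<in>S. s \<otimes> a \<in> B \<and> t \<otimes> (s \<otimes> a) = a" if "a \<in> S" for a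
    using S_frac[OF that] inv_B_in_S by blast
qed

lemma AS_local: "a \<in> mS ==> \<one>\<^bsub>AS\<^esub> \<ominus>\<^bsub>AS\<^esub> a \<in> Units AS"
proof -
  assume a: "a \<in> mS"
  interpret AS: cring AS by (rule AS_cring)
  have c: "\<one>\<^bsub>AS\<^esub> \<ominus>\<^bsub>AS\<^esub> a \<in> S" using AS.minus_closed[OF AS.one_closed, of a] a by simp
  have "\<one>\<^bsub>AS\<^esub> \<ominus>\<^bsub>AS\<^esub> a \<notin> m"
  proof
    assume "\<one>\<^bsub>AS\<^esub> \<ominus>\<^bsub>AS\<^esub> a \<in> m"
    hence "(\<one>\<^bsub>AS\<^esub> \<ominus>\<^bsub>AS\<^esub> a) \<oplus> a \<in> m" using a J_add[of _ 1 a] J_1 by auto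
    moreover have "(\<one>\<^bsub>AS\<^esub> \<ominus>\<^bsub>AS\<^esub> a) \<oplus>\<^bsub>AS\<^esub> a = \<one>\<^bsub>AS\<^esub>"
    proof -
      have ac: "a \<in> carrier AS" using a by simp
      show ?thesis
        by (simp only: a_minus_def AS.a_assoc[OF AS.one_closed AS.a_inv_closed[OF ac] ac] AS.l_neg[OF ac] AS.r_zero[OF AS.one_closed])
    qed
    ultimately show False using one_notin_m by simp
  qed
  thus ?thesis by (rule S_unit(1)[OF c])
qed

lemma JS_ideal: "ideal (JS k) AS"
  by (rule cring.ideal_power_ideal[OF AS_cring mS_ideal])

lemma JS_in: "ideal_in A S (JS k)"
  using JS_ideal ideal_in_iff[OF S_ring] by simp

lemma JS_props:
  "JS k \<subseteq> S" "\<zero> \<in> JS k" "a \<in> JS k ==> b \<in> JS k ==> a \<oplus> b \<in> JS k" "s \<in> S ==> a \<in> JS k ==> s \<otimes> a \<in> JS k"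
  using JS_in[where k = k] unfolding ideal_in_def by auto

lemma JS_smult:
  assumes "c \<in> carrier K" "a \<in> JS k"
  shows "c \<odot> a \<in> JS k"
proof -
  have "a \<in> carrier A" using assms(2) JS_props(1) S_sub by blast
  thus ?thesis
    using smult_eq_mult[OF assms(1), of a] JS_props(4)[OF subsetD[OF B_sub_S scalar_B[OF assms(1)]] assms(2)] by simp
qed

lemma JS_minus: "a \<in> JS k ==> b \<in> JS k ==> a \<ominus> b \<in> JS k"
proof -
  assume ab: "a \<in> JS k" "b \<in> JS k"
  hence "b \<in> carrier A" using JS_props(1) S_sub by auto
  hence "\<ominus> b = (\<ominus> \<one>) \<otimes> b" by (simp add: l_minus)
  hence "\<ominus> b \<in> JS k" using JS_props(4)[OF _ ab(2)] subringE(3,5)[OF S_ring] by simp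
  thus ?thesis unfolding a_minus_def using JS_props(3) ab by simp
qed

lemma JS_mult: "a \<in> JS i ==> b \<in> JS j ==> a \<otimes> b \<in> JS (i + j)"
  using ideal_prod.prod[of a "JS i" b "JS j" AS] unfolding cring.ideal_power_add[OF AS_cring mS_ideal] by simp

lemma JS_mono: "i \<le> j ==> JS j \<subseteq> JS i"
  by (rule cring.ideal_power_decreasing[OF AS_cring mS_ideal])

lemma JS_1: "JS 1 = mS" "JS (Suc 0) = mS"
  using ring.ideal_prod_one[OF cring.axioms(1)[OF AS_cring] mS_ideal] by (simp_all add: ideal_power.simps(2))

lemma JS_sub_J: "JS k \<subseteq> J k"
proof (induction k)
  case (Suc k)
  show ?case
  proof
    fix a assume "a \<in> JS (Suc k)"
    hence "a \<in> ideal_prod AS mS (JS k)" by (simp add: ideal_power.simps(2))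
    thus "a \<in> J (Suc k)"
    proof (induction rule: ideal_prod.induct)
      case (prod i j)
      thus ?case using J_mult[of i 1 j k] J_1 Suc by auto
    next
      case (sum s1 s2)
      thus ?case using J_add by simp
    qed
  qed
qed (use S_sub in simp)

lemma ym: "y \<in> {..<e} \<rightarrow> m" and yB: "y \<in> {..<e} \<rightarrow> B" and yA: "y \<in> {..<e} \<rightarrow> carrier A"
  using y m_sub by auto

lemma ev_mem:
  assumes F: "F \<in> poly" and low: "\<And>w. size w < k ==> F w = \<zero>\<^bsub>K\<^esub>"
  shows "ev F \<in> JS k"
proof (rule lin_ext_mem[OF monom_value_map[OF yA]])
  show "F \<in> carrier (free_module K {w. set_mset w \<subseteq> {..<e}})" using F by simp
  fix w assume w: "w \<in> {w. set_mset w \<subseteq> {..<e}}" "F w \<noteq> \<zero>\<^bsub>K\<^esub>"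
  have mJ: "set_mset w \<subseteq> {..<e} ==> monom_value A y w \<in> JS (size w)" for w
  proof (induction w)
    case empty
    thus ?case using subringE(3)[OF S_ring] by simp
  next
    case (add i w)
    have i: "y i \<in> carrier A" "y i \<in> JS 1" using add.prems y m_sub B_sub_S unfolding JS_1 by auto
    have "monom_value A y (add_mset i w) = y i \<otimes> monom_value A y w"
      using monom_value_add[OF yA, of "{#i#}" w] add.prems monom_value_1[of y i] i by simp
    thus ?case using JS_mult[OF i(2), of "monom_value A y w" "size w"] add by simp
  qed
  have "k \<le> size w" using low[of w] w(2) by (meson not_le)
  moreover have "monom_value A y w \<in> JS (size w)" using mJ w(1) by simp
  ultimately have "monom_value A y w \<in> JS k" using JS_mono by blast
  thus "F w \<odot> monom_value A y w \<in> JS k" using JS_smult R.poly_val[OF F] by blast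
qed (use JS_props in auto)

lemma ev_closed: "F \<in> poly ==> ev F \<in> carrier A"
  by (rule poly_eval_closed[OF yA])

lemma low_zero: "F \<in> poly ==> ev F \<in> J k ==> size w < k ==> F w = \<zero>\<^bsub>K\<^esub>"
  by (rule poly_eval_low_zero[OF ym ind])

lemma poly_ops:
  assumes "F \<in> poly" "G \<in> poly"
  shows "F \<otimes>\<^bsub>polynomial_algebra K {..<e}\<^esub> G \<in> poly" "F \<oplus>\<^bsub>polynomial_algebra K {..<e}\<^esub> G \<in> poly"
    "ev (F \<otimes>\<^bsub>polynomial_algebra K {..<e}\<^esub> G) = ev F \<otimes> ev G"
    "ev (F \<oplus>\<^bsub>polynomial_algebra K {..<e}\<^esub> G) = ev F \<oplus> ev G"
proof -
  interpret Q: algebra K "polynomial_algebra K {..<e}" by (rule R.polynomial_algebra_algebra)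
  show "F \<otimes>\<^bsub>polynomial_algebra K {..<e}\<^esub> G \<in> poly" using R.poly_mult_closed[OF assms] .
  show "F \<oplus>\<^bsub>polynomial_algebra K {..<e}\<^esub> G \<in> poly" using R.free_module_add_closed[of F _ G] assms by simp
qed (rule poly_eval_mult[OF yA assms] poly_eval_add[OF yA assms])+

lemma scalar_poly:
  assumes c: "c \<in> carrier K"
  shows "(\<lambda>w. c \<otimes>\<^bsub>K\<^esub> free_gen K {#} w) \<in> poly" "ev (\<lambda>w. c \<otimes>\<^bsub>K\<^esub> free_gen K {#} w) = c \<odot> \<one>"
proof -
  show "(\<lambda>w. c \<otimes>\<^bsub>K\<^esub> free_gen K {#} w) \<in> poly"
    unfolding poly_alg_simps by (rule R.free_module_smult_closed[OF R.free_gen_carrier c]) simp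
  show "ev (\<lambda>w. c \<otimes>\<^bsub>K\<^esub> free_gen K {#} w) = c \<odot> \<one>"
    using lin_ext_single[OF monom_value_map[OF yA] c, of "{#}"] by simp
qed

lemma linear_poly:
  assumes c: "\<forall>i<e. c i \<in> carrier K"
  shows "\<exists>F\<in>poly. ev F = finsum A (\<lambda>i. c i \<odot> y i) {..<e}"
proof -
  have "\<exists>F\<in>poly. ev F = finsum A (\<lambda>i. c i \<odot> y i) {..<n}" if "n \<le> e" for n
    using that
  proof (induction n)
    case 0
    show ?case using scalar_poly[OF R.zero_closed] by (intro bexI[of _ "\<lambda>w. \<zero>\<^bsub>K\<^esub> \<otimes>\<^bsub>K\<^esub> free_gen K {#} w"]) simp_all
  next
    case (Suc n)
    then obtain F where F: "F \<in> poly" "ev F = finsum A (\<lambda>i. c i \<odot> y i) {..<n}" by auto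
    have n: "c n \<in> carrier K" "y n \<in> carrier A" "{#n#} \<in> {w. set_mset w \<subseteq> {..<e}}" using c yA Suc by auto
    let ?G = "\<lambda>w. c n \<otimes>\<^bsub>K\<^esub> free_gen K {#n#} w"
    have G: "?G \<in> poly" unfolding poly_alg_simps
      by (rule R.free_module_smult_closed[OF R.free_gen_carrier[OF n(3)] n(1)])
    have "ev ?G = c n \<odot> y n"
      using lin_ext_single[OF monom_value_map[OF yA] n(1,3)] monom_value_1[of y n] n(2) by simp
    hence "ev (F \<oplus>\<^bsub>polynomial_algebra K {..<e}\<^esub> ?G) = finsum A (\<lambda>i. c i \<odot> y i) {..<n} \<oplus> c n \<odot> y n"
      using poly_ops(4)[OF F(1) G] F(2) by simp
    also have "\<dots> = finsum A (\<lambda>i. c i \<odot> y i) (insert n {..<n})"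
    proof -
      have "(\<lambda>i. c i \<odot> y i) \<in> {..<n} \<rightarrow> carrier A" using c yA Suc.prems by (auto intro!: smult_closed)
      thus ?thesis using n finsum_closed[of "\<lambda>i. c i \<odot> y i" "{..<n}"]
        by (subst finsum_insert) (auto simp: a_comm)
    qed
    finally show ?case using poly_ops(2)[OF F(1) G] by (intro bexI) (auto simp: lessThan_Suc simp del: poly_alg_simps)
  qed
  thus ?thesis by blast
qed

text \<open>A product of \<open>k\<close> elements of the maximal ideal is a form in the \<open>y i\<close> up to a product of \<open>k + 1\<close> elements.\<close>

lemma expansion_step: "a \<in> JS k ==> \<exists>F\<in>poly. a \<ominus> ev F \<in> JS (Suc k)"
proof (induction k arbitrary: a)
  case 0
  hence a: "a \<in> S" "a \<in> carrier A" using S_sub by auto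
  obtain c where c: "c \<in> carrier K" "a \<ominus> c \<odot> \<one> \<in> m" using residue_field[OF a(2)] by blast
  have "a \<ominus> c \<odot> \<one> \<in> S"
    unfolding a_minus_def using a c S_smult subringE(3,5,7)[OF S_ring] by simp
  thus ?case using scalar_poly[OF c(1)] c(2) JS_1
    by (intro bexI[OF _ scalar_poly(1)[OF c(1)]]) simp
next
  case (Suc k)
  show ?case
  proof (cases "k = 0")
    case True
    hence "a \<in> mS" using Suc.prems JS_1 by simp
    then obtain c where c: "\<forall>i<e. c i \<in> carrier K"
      "a \<ominus> finsum A (\<lambda>i. c i \<odot> y i) {..<e} \<in> ideal_prod AS mS mS" using spanning by blast
    obtain F where "F \<in> poly" "ev F = finsum A (\<lambda>i. c i \<odot> y i) {..<e}" using linear_poly[OF c(1)] by blast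
    moreover have "ideal_prod AS mS mS = JS (Suc (Suc 0))" using JS_1 by (simp add: ideal_power.simps(2)[of _ _ "Suc 0"])
    ultimately show ?thesis using c(2) True by (intro bexI[of _ F]) simp_all
  next
    case False
    have "a \<in> ideal_prod AS mS (JS k)" using Suc.prems by (simp add: ideal_power.simps(2))
    thus ?thesis
    proof (induction rule: ideal_prod.induct)
      case (prod i j)
      have i1: "i \<in> JS 1" using prod JS_1 by simp
      have "i \<in> JS (Suc k) \<or> True" by simp
      obtain F where F: "F \<in> poly" "i \<ominus> ev F \<in> JS 2"
      proof -
        obtain c where c: "\<forall>i<e. c i \<in> carrier K"
          "i \<ominus> finsum A (\<lambda>i. c i \<odot> y i) {..<e} \<in> ideal_prod AS mS mS" using spanning prod by blast
        obtain F where "F \<in> poly" "ev F = finsum A (\<lambda>i. c i \<odot> y i) {..<e}" using linear_poly[OF c(1)] by blast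
        moreover have "ideal_prod AS mS mS = JS 2" using JS_1 by (simp add: ideal_power.simps(2)[of _ _ "Suc 0"] numeral_2_eq_2)
        ultimately show ?thesis using c(2) that by simp
      qed
      obtain G where G: "G \<in> poly" "j \<ominus> ev G \<in> JS (Suc k)" using Suc.IH prod by blast
      have c: "i \<in> carrier A" "j \<in> carrier A" "ev F \<in> carrier A" "ev G \<in> carrier A"
        using prod JS_props(1) S_sub ev_closed F G by auto
      have jk: "j \<in> JS k" using prod by simp
      have Fm: "ev F \<in> JS 1"
      proof -
        have "i \<ominus> (i \<ominus> ev F) \<in> JS 1" using JS_minus[OF i1] F(2) JS_mono[of 1 2] by auto
        moreover have "i \<ominus> (i \<ominus> ev F) = ev F" using c by algebra
        ultimately show ?thesis by simp
      qed
      have "i \<otimes> j \<ominus> ev F \<otimes> ev G = (i \<ominus> ev F) \<otimes> j \<oplus> ev F \<otimes> (j \<ominus> ev G)"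
        using c by algebra
      moreover have "(i \<ominus> ev F) \<otimes> j \<in> JS (Suc (Suc k))" using JS_mult[OF F(2) jk] by simp
      moreover have "ev F \<otimes> (j \<ominus> ev G) \<in> JS (Suc (Suc k))" using JS_mult[OF Fm G(2)] by simp
      ultimately have "i \<otimes> j \<ominus> ev F \<otimes> ev G \<in> JS (Suc (Suc k))" using JS_props(3) by simp
      thus ?case using poly_ops(1,3)[OF F(1) G(1)] by (intro bexI[OF _ poly_ops(1)[OF F(1) G(1)]]) simp
    next
      case (sum s1 s2)
      obtain F G where FG: "F \<in> poly" "s1 \<ominus> ev F \<in> JS (Suc (Suc k))" "G \<in> poly" "s2 \<ominus> ev G \<in> JS (Suc (Suc k))"
        using sum.IH by blast
      have "s1 \<in> JS (Suc k)" "s2 \<in> JS (Suc k)" using sum.hyps by (simp_all add: ideal_power.simps(2))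
      hence c: "s1 \<in> carrier A" "s2 \<in> carrier A" "ev F \<in> carrier A" "ev G \<in> carrier A"
        using JS_props(1) S_sub ev_closed FG by auto
      have "s1 \<oplus> s2 \<ominus> (ev F \<oplus> ev G) = (s1 \<ominus> ev F) \<oplus> (s2 \<ominus> ev G)" using c by algebra
      hence "s1 \<oplus> s2 \<ominus> (ev F \<oplus> ev G) \<in> JS (Suc (Suc k))" using JS_props(3)[OF FG(2,4)] by simp
      thus ?case using poly_ops(2,4)[OF FG(1,3)] by (intro bexI[OF _ poly_ops(2)[OF FG(1,3)]]) (simp del: poly_alg_simps)
    qed
  qed
qed

lemma expansion: "a \<in> S ==> \<exists>F\<in>poly. a \<ominus> ev F \<in> JS k"
proof (induction k)
  case 0
  thus ?case using scalar_poly[OF R.zero_closed] S_sub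
    by (intro bexI[OF _ scalar_poly(1)[OF R.zero_closed]]) (auto simp: a_minus_def)
next
  case (Suc k)
  then obtain F where F: "F \<in> poly" "a \<ominus> ev F \<in> JS k" by blast
  obtain G where G: "G \<in> poly" "(a \<ominus> ev F) \<ominus> ev G \<in> JS (Suc k)" using expansion_step[OF F(2)] by blast
  have c: "a \<in> carrier A" "ev F \<in> carrier A" "ev G \<in> carrier A" using Suc.prems S_sub ev_closed F G by auto
  have "(a \<ominus> ev F) \<ominus> ev G = a \<ominus> (ev F \<oplus> ev G)" using c by algebra
  thus ?case using G(2) poly_ops(4)[OF F(1) G(1)]
    by (intro bexI[OF _ poly_ops(2)[OF F(1) G(1)]]) (simp del: poly_alg_simps)
qed

text \<open>Krull's intersection theorem and Nakayama's lemma.\<close>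

lemma JS_separated:
  assumes "\<And>k. a \<in> JS k"
  shows "a = \<zero>"
proof -
  let ?N = "\<Inter>k. JS k"
  have N: "ideal ?N AS"
    unfolding ideal_in_iff[OF S_ring] ideal_in_def
  proof (intro conjI ballI)
    show "?N \<subseteq> S" using JS_props(1)[of 0] by blast
    show "\<zero> \<in> ?N" using JS_props(2) by blast
    show "a \<oplus> b \<in> ?N" if "a \<in> ?N" "b \<in> ?N" for a b using JS_props(3) that by blast
    show "s \<otimes> a \<in> ?N" if "s \<in> S" "a \<in> ?N" for s a using JS_props(4) that by blast
  qed
  have "?N \<subseteq> ideal_prod AS mS ?N"
    by (rule cring.krull_intersection[OF AS_cring AS_acc mS_ideal N]) blast
  hence "?N = {\<zero>\<^bsub>AS\<^esub>}"
    using cring.nakayama[OF AS_cring AS_acc mS_ideal AS_local N] by blast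
  thus ?thesis using assms by auto
qed

text \<open>The expansion is taken one order beyond the order of \<open>a\<close>; if all its terms of that degree vanished, the order
  of \<open>a\<close> would be higher.\<close>

lemma initial_form:
  assumes a: "a \<in> S" "a \<noteq> \<zero>"
  shows "\<exists>k F w. F \<in> poly \<and> a \<ominus> ev F \<in> JS (Suc k) \<and> ev F \<in> JS k \<and> (\<forall>v. size v < k \<longrightarrow> F v = \<zero>\<^bsub>K\<^esub>) \<and>
    size w = k \<and> F w \<noteq> \<zero>\<^bsub>K\<^esub>"
proof -
  obtain n where "a \<notin> JS n" using JS_separated a(2) by blast
  define l where "l = (LEAST n. a \<notin> JS n)"
  have l: "a \<notin> JS l" "\<And>j. j < l ==> a \<in> JS j"
    unfolding l_def using \<open>a \<notin> JS n\<close> by (rule LeastI) (use not_less_Least in blast)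
  have "l \<noteq> 0"
  proof
    assume "l = 0"
    thus False using l(1) a(1) by simp
  qed
  then obtain k where k: "l = Suc k" by (cases l) auto
  have ak: "a \<in> JS k" using l(2) k by simp
  obtain F where F: "F \<in> poly" "a \<ominus> ev F \<in> JS (Suc k)" using expansion[OF a(1)] by blast
  have c: "a \<in> carrier A" "ev F \<in> carrier A" using a S_sub ev_closed F by auto
  have "a \<ominus> (a \<ominus> ev F) \<in> JS k" using JS_minus[OF ak] F(2) JS_mono[of k "Suc k"] by auto
  moreover have "a \<ominus> (a \<ominus> ev F) = ev F" using c by algebra
  ultimately have ek: "ev F \<in> JS k" by simp
  hence low: "F v = \<zero>\<^bsub>K\<^esub>" if "size v < k" for v using low_zero[OF F(1) _ that] JS_sub_J by blast
  have "\<exists>w. size w = k \<and> F w \<noteq> \<zero>\<^bsub>K\<^esub>"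
  proof (rule ccontr)
    assume "\<not> ?thesis"
    hence "F v = \<zero>\<^bsub>K\<^esub>" if "size v < Suc k" for v using low[of v] that by (cases "size v = k") auto
    hence "ev F \<in> JS (Suc k)" by (rule ev_mem[OF F(1)])
    hence "(a \<ominus> ev F) \<oplus> ev F \<in> JS (Suc k)" using JS_props(3) F(2) by simp
    moreover have "(a \<ominus> ev F) \<oplus> ev F = a" using c by algebra
    ultimately show False using l(1) k by simp
  qed
  thus ?thesis using F ek low by blast
qed

text \<open>Initial forms multiply without cancellation.\<close>

lemma S_integral:
  assumes a: "a \<in> S" "a \<noteq> \<zero>" and b: "b \<in> S" "b \<noteq> \<zero>"
  shows "a \<otimes> b \<noteq> \<zero>"
proof
  assume ab: "a \<otimes> b = \<zero>"
  let ?Q = "polynomial_algebra K {..<e}"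
  obtain k F w where F: "F \<in> poly" "a \<ominus> ev F \<in> JS (Suc k)" "ev F \<in> JS k" "\<And>v. size v < k ==> F v = \<zero>\<^bsub>K\<^esub>"
    "size w = k" "F w \<noteq> \<zero>\<^bsub>K\<^esub>" using initial_form[OF a] by blast
  obtain l G w' where G: "G \<in> poly" "b \<ominus> ev G \<in> JS (Suc l)" "ev G \<in> JS l" "\<And>v. size v < l ==> G v = \<zero>\<^bsub>K\<^esub>"
    "size w' = l" "G w' \<noteq> \<zero>\<^bsub>K\<^esub>" using initial_form[OF b] by blast
  have c: "a \<in> carrier A" "b \<in> carrier A" "ev F \<in> carrier A" "ev G \<in> carrier A" using a b S_sub ev_closed F G by auto
  have "a \<in> JS k"
  proof -
    have "(a \<ominus> ev F) \<oplus> ev F \<in> JS k" using JS_props(3) F(2,3) JS_mono[of k "Suc k"] by auto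
    moreover have "(a \<ominus> ev F) \<oplus> ev F = a" using c by algebra
    ultimately show ?thesis by simp
  qed
  hence "a \<otimes> (b \<ominus> ev G) \<in> JS (Suc (k + l))" using JS_mult[OF _ G(2), of a k] by simp
  moreover have "(a \<ominus> ev F) \<otimes> ev G \<in> JS (Suc (k + l))" using JS_mult[OF F(2) G(3)] by simp
  ultimately have "(a \<ominus> ev F) \<otimes> ev G \<oplus> a \<otimes> (b \<ominus> ev G) \<in> JS (Suc (k + l))" using JS_props(3) by simp
  hence "\<zero> \<ominus> ((a \<ominus> ev F) \<otimes> ev G \<oplus> a \<otimes> (b \<ominus> ev G)) \<in> JS (Suc (k + l))"
    using JS_minus[OF JS_props(2)] by simp
  moreover have "\<zero> \<ominus> ((a \<ominus> ev F) \<otimes> ev G \<oplus> a \<otimes> (b \<ominus> ev G)) = ev F \<otimes> ev G \<ominus> a \<otimes> b"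
    using c by algebra
  ultimately have "ev F \<otimes> ev G \<in> JS (Suc (k + l))" unfolding ab using c by (simp add: a_minus_def)
  hence "ev (F \<otimes>\<^bsub>?Q\<^esub> G) \<in> J (Suc (k + l))" using poly_ops(3)[OF F(1) G(1)] JS_sub_J by auto
  hence z: "(F \<otimes>\<^bsub>?Q\<^esub> G) v = \<zero>\<^bsub>K\<^esub>" if "size v = k + l" for v
    using low_zero[OF poly_ops(1)[OF F(1) G(1)], of "Suc (k + l)" v] that by simp
  define U where "U = {v. size v = k \<and> F v \<noteq> \<zero>\<^bsub>K\<^esub>}"
  define V where "V = {v. size v = l \<and> G v \<noteq> \<zero>\<^bsub>K\<^esub>}"
  have finU: "finite U" "U \<noteq> {}" "finite V" "V \<noteq> {}"
    using free_memD(3)[of F K "{w. set_mset w \<subseteq> {..<e}}"] free_memD(3)[of G K "{w. set_mset w \<subseteq> {..<e}}"]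
      F G unfolding U_def V_def by (auto intro: finite_subset[rotated])
  define u where "u = Min U"
  define v where "v = Min V"
  have uv: "u \<in> U" "v \<in> V" using finU unfolding u_def v_def by auto
  \<comment> \<open>the least monomials of the two initial forms multiply to a monomial that cannot cancel\<close>
  have "(F \<otimes>\<^bsub>?Q\<^esub> G) (u + v) = finsum K (\<lambda>j. if u = j then F j \<otimes>\<^bsub>K\<^esub> G (u + v - j) else \<zero>\<^bsub>K\<^esub>) {j. j \<subseteq># u + v}"
    unfolding polynomial_algebra_mult
  proof (rule R.finsum_cong'[OF refl])
    show "(\<lambda>j. if u = j then F j \<otimes>\<^bsub>K\<^esub> G (u + v - j) else \<zero>\<^bsub>K\<^esub>) \<in> {j. j \<subseteq># u + v} \<rightarrow> carrier K"
      using R.poly_val[OF F(1)] R.poly_val[OF G(1)] by auto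
    fix j assume j: "j \<in> {j. j \<subseteq># u + v}"
    show "F j \<otimes>\<^bsub>K\<^esub> G (u + v - j) = (if u = j then F j \<otimes>\<^bsub>K\<^esub> G (u + v - j) else \<zero>\<^bsub>K\<^esub>)"
    proof (cases "F j = \<zero>\<^bsub>K\<^esub> \<or> G (u + v - j) = \<zero>\<^bsub>K\<^esub> \<or> u = j")
      case True
      thus ?thesis using R.poly_val[OF F(1)] R.poly_val[OF G(1)] by auto
    next
      case False
      let ?i = "u + v - j"
      have sum: "j + ?i = u + v" using j by simp
      hence "size j + size ?i = k + l" using uv unfolding U_def V_def by (metis (mono_tags, lifting) mem_Collect_eq size_union)
      moreover have "k \<le> size j" "l \<le> size ?i" using F(4)[of j] G(4)[of ?i] False by (meson not_le)+
      ultimately have "j \<in> U" "?i \<in> V" using False unfolding U_def V_def by auto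
      hence "u \<le> j" "v \<le> ?i" using finU unfolding u_def v_def by auto
      hence "u < j" using False by (intro le_neq_trans) simp_all
      hence "u + v < j + ?i" using \<open>v \<le> ?i\<close> by (rule add_less_le_mono)
      thus ?thesis using sum by simp
    qed
  qed
  also have "\<dots> = F u \<otimes>\<^bsub>K\<^esub> G v"
    using R.add.finprod_singleton[of u "{j. j \<subseteq># u + v}" "\<lambda>j. F j \<otimes>\<^bsub>K\<^esub> G (u + v - j)"] finite_submultisets[of "u + v"]
      R.poly_val[OF F(1)] R.poly_val[OF G(1)] by simp
  finally have "F u \<otimes>\<^bsub>K\<^esub> G v = \<zero>\<^bsub>K\<^esub>" using z[of "u + v"] uv unfolding U_def V_def by simp
  thus False using uv K.integral[OF _ R.poly_val[OF F(1)] R.poly_val[OF G(1)]] unfolding U_def V_def by auto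
qed

end

section \<open>The dimension of local subrings\<close>

context regular_core
begin

lemma zero_m: "\<zero> \<in> m"
  using J_zero[of 1] unfolding J_1 .

lemma variable_mult:
  assumes F: "F \<in> poly" and i: "i < e"
  shows "free_gen K {#i#} \<otimes>\<^bsub>polynomial_algebra K {..<e}\<^esub> F \<in> poly"
    "ev (free_gen K {#i#} \<otimes>\<^bsub>polynomial_algebra K {..<e}\<^esub> F) = y i \<otimes> ev F"
    "(free_gen K {#i#} \<otimes>\<^bsub>polynomial_algebra K {..<e}\<^esub> F) w = (if i \<in># w then F (w - {#i#}) else \<zero>\<^bsub>K\<^esub>)"
proof -
  have g: "free_gen K {#i#} \<in> poly" using i by auto
  have yi: "y i \<in> carrier A" using yA i by auto
  have "ev (free_gen K {#i#}) = y i"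
    using poly_eval_gen[OF yA, of "{#i#}"] monom_value_1[of y i] yi i by simp
  thus "ev (free_gen K {#i#} \<otimes>\<^bsub>polynomial_algebra K {..<e}\<^esub> F) = y i \<otimes> ev F"
    using poly_ops(3)[OF g F] by simp
  show "free_gen K {#i#} \<otimes>\<^bsub>polynomial_algebra K {..<e}\<^esub> F \<in> poly" by (rule poly_ops(1)[OF g F])
  show "(free_gen K {#i#} \<otimes>\<^bsub>polynomial_algebra K {..<e}\<^esub> F) w = (if i \<in># w then F (w - {#i#}) else \<zero>\<^bsub>K\<^esub>)"
    by (subst R.poly_mult_gen[OF R.poly_val[OF F]]) simp
qed

text \<open>The monomial \<open>w\<close> collects the powers that are factored out.  All other terms contain a further variable
  to a higher power, so its coefficient stays 1 to every order of approximation.\<close>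

lemma lex_monoid_expansion:
  assumes "j \<le> e" "s \<in> lex_monoid AS (map y [j..<e])"
  shows "\<exists>w. set_mset w \<subseteq> {j..<e} \<and> (\<forall>N. \<exists>F\<in>poly. s \<ominus> ev F \<in> JS N \<and> F w = \<one>\<^bsub>K\<^esub>)"
  using assms
proof (induction j arbitrary: s rule: inc_induct)
  case base
  hence s: "s = \<one>" by simp
  have "s \<ominus> ev (\<lambda>w. \<one>\<^bsub>K\<^esub> \<otimes>\<^bsub>K\<^esub> free_gen K {#} w) = \<zero>"
    unfolding s scalar_poly(2)[OF R.one_closed] by (simp add: a_minus_def r_neg)
  thus ?case using scalar_poly(1)[OF R.one_closed] JS_props(2)
    by (intro exI[of _ "{#}"] conjI allI bexI[OF _ scalar_poly(1)[OF R.one_closed]]) (simp_all add: free_gen_def)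
next
  case (step j)
  have j: "j < e" "[j..<e] = j # [Suc j..<e]" using step.hyps by (simp_all add: upt_conv_Cons)
  have yj: "y j \<in> carrier A" "y j \<in> S" using yA yB B_sub_S j(1) by auto
  obtain k t c where k: "s = y j [^]\<^bsub>AS\<^esub> (k::nat) \<otimes> (t \<oplus> y j \<otimes> c)"
    "t \<in> lex_monoid AS (map y [Suc j..<e])" "c \<in> S"
    using step.prems unfolding j(2) by auto
  have "y j [^]\<^bsub>AS\<^esub> k = y j [^] k" by (simp add: nat_pow_def)
  hence s: "s = y j [^] k \<otimes> (t \<oplus> y j \<otimes> c)" using k(1) by simp
  have tS: "t \<in> S"
  proof -
    have "set (map y [Suc j..<e]) \<subseteq> carrier AS" using yB B_sub_S by (auto simp: Pi_iff)
    from cring.lex_monoid_carrier[OF AS_cring this] show ?thesis using k(2) by auto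
  qed
  obtain w where w: "set_mset w \<subseteq> {Suc j..<e}" "\<And>N. \<exists>F\<in>poly. t \<ominus> ev F \<in> JS N \<and> F w = \<one>\<^bsub>K\<^esub>"
    using step.IH[OF k(2)] by blast
  have jw: "j \<notin># w" using w(1) by auto
  have main: "\<exists>F\<in>poly. y j [^] k \<otimes> (t \<oplus> y j \<otimes> c) \<ominus> ev F \<in> JS N \<and> F (replicate_mset k j + w) = \<one>\<^bsub>K\<^esub>" for N
  proof (induction k)
    case 0
    obtain F where F: "F \<in> poly" "t \<ominus> ev F \<in> JS N" "F w = \<one>\<^bsub>K\<^esub>" using w(2) by blast
    obtain G where G: "G \<in> poly" "c \<ominus> ev G \<in> JS N" using expansion[OF k(3)] by blast
    note v = variable_mult[OF G(1) j(1)]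
    have car: "t \<in> carrier A" "c \<in> carrier A" "ev F \<in> carrier A" "ev G \<in> carrier A"
      using tS k(3) S_sub ev_closed F G by auto
    let ?H = "F \<oplus>\<^bsub>polynomial_algebra K {..<e}\<^esub> (free_gen K {#j#} \<otimes>\<^bsub>polynomial_algebra K {..<e}\<^esub> G)"
    have "\<one> \<otimes> (t \<oplus> y j \<otimes> c) \<ominus> (ev F \<oplus> y j \<otimes> ev G)
        = (t \<ominus> ev F) \<oplus> y j \<otimes> (c \<ominus> ev G)"
      using car yj(1) by algebra
    also have "\<dots> \<in> JS N" using JS_props(3)[OF F(2)] JS_props(4)[OF yj(2) G(2)] by blast
    finally have "\<one> \<otimes> (t \<oplus> y j \<otimes> c) \<ominus> ev ?H \<in> JS N"
      unfolding poly_ops(4)[OF F(1) v(1)] v(2) .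
    moreover have "?H w = \<one>\<^bsub>K\<^esub>" using F(3) v(3)[of w] jw by simp
    ultimately show ?case by (intro bexI[OF _ poly_ops(2)[OF F(1) v(1)]]) simp
  next
    case (Suc k)
    then obtain F where F: "F \<in> poly" "y j [^] k \<otimes> (t \<oplus> y j \<otimes> c) \<ominus> ev F \<in> JS N"
      "F (replicate_mset k j + w) = \<one>\<^bsub>K\<^esub>" by blast
    note v = variable_mult[OF F(1) j(1)]
    have car: "t \<in> carrier A" "c \<in> carrier A" "ev F \<in> carrier A" "y j [^] k \<in> carrier A"
      using tS k(3) S_sub ev_closed F yj by auto
    have "(y j [^] k \<otimes> y j) \<otimes> (t \<oplus> y j \<otimes> c) \<ominus> y j \<otimes> ev F
      = y j \<otimes> (y j [^] k \<otimes> (t \<oplus> y j \<otimes> c) \<ominus> ev F)"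
      using car yj(1) by algebra
    hence "(y j [^] Suc k) \<otimes> (t \<oplus> y j \<otimes> c) \<ominus> y j \<otimes> ev F \<in> JS N"
      using JS_props(4)[OF yj(2) F(2)] by simp
    moreover have "(free_gen K {#j#} \<otimes>\<^bsub>polynomial_algebra K {..<e}\<^esub> F) (replicate_mset (Suc k) j + w) = \<one>\<^bsub>K\<^esub>"
      unfolding v(3) using F(3) by simp
    ultimately show ?case unfolding v(2)[symmetric] by (intro bexI[OF _ v(1)] conjI)
  qed
  have "set_mset (replicate_mset k j + w) \<subseteq> {j..<e}" using w(1) j(1) by (auto simp: set_mset_replicate_mset_subset)
  thus ?case unfolding s using main by blast
qed

lemma krull_dim_S_ge: "enat e \<le> krull_dim AS"
proof -
  have "\<zero>\<^bsub>AS\<^esub> \<notin> lex_monoid AS (map y [0..<e])"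
  proof
    assume "\<zero>\<^bsub>AS\<^esub> \<in> lex_monoid AS (map y [0..<e])"
    from lex_monoid_expansion[OF le0 this]
    obtain w where w: "\<forall>N. \<exists>F\<in>poly. \<zero>\<^bsub>AS\<^esub> \<ominus> ev F \<in> JS N \<and> F w = \<one>\<^bsub>K\<^esub>" by (elim exE conjE)
    from w[THEN spec, of "Suc (size w)"]
    obtain F where F: "F \<in> poly" "\<zero>\<^bsub>AS\<^esub> \<ominus> ev F \<in> JS (Suc (size w))" "F w = \<one>\<^bsub>K\<^esub>" by (elim bexE conjE)
    from F(2) have F2: "\<zero> \<ominus> ev F \<in> JS (Suc (size w))" by simp
    have "ev F = \<zero> \<ominus> (\<zero> \<ominus> ev F)" using ev_closed[OF F(1)] by algebra
    hence "ev F \<in> JS (Suc (size w))" using JS_minus[OF JS_props(2) F2] by simp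
    hence "F w = \<zero>\<^bsub>K\<^esub>" using low_zero[OF F(1), of "Suc (size w)" w] JS_sub_J by auto
    thus False using F(3) by simp
  qed
  moreover have "set (map y [0..<e]) \<subseteq> carrier AS" using yB B_sub_S by auto
  ultimately show ?thesis using cring.krull_dim_ge[OF AS_cring AS_acc, of "map y [0..<e]"] by simp
qed

lemma krull_dim_S_le_B: "krull_dim AS \<le> krull_dim AB"
  by (rule krull_dim_fractions_le[OF B_ring S_ring B_sub_S]) (use S_frac inv_B_in_S in blast)

lemma B_domain: "domain AB"
proof -
  interpret AB: cring AB by (rule AB_cring)
  show ?thesis
  proof
    show "\<one>\<^bsub>AB\<^esub> \<noteq> \<zero>\<^bsub>AB\<^esub>" using one_notin_m zero_m by fastforce
    show "a = \<zero>\<^bsub>AB\<^esub> \<or> b = \<zero>\<^bsub>AB\<^esub>" if "a \<otimes>\<^bsub>AB\<^esub> b = \<zero>\<^bsub>AB\<^esub>" "a \<in> carrier AB" "b \<in> carrier AB" for a b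
    proof (rule ccontr)
      assume "\<not> ?thesis"
      hence "a \<otimes> b \<noteq> \<zero>" using that(2,3) B_sub_S by (intro S_integral) auto
      thus False using that(1) by simp
    qed
  qed
qed

text \<open>Let \<open>p = B \<inter> m\<close>, and let \<open>N\<close> be generated by the values of \<open>D\<close>.  The product rule maps \<open>p\<^sup>2\<close> into
  \<open>m N\<close>.  Up to a denominator, an element of \<open>B\<close> is a combination of 1 and the \<open>y i\<close>, all killed by \<open>D\<close>,
  plus an element of \<open>p\<^sup>2\<close>.  Hence \<open>N \<subseteq> m N\<close>.\<close>

lemma derivation_determined:
  assumes der: "ring.derivation_on AB (carrier AB) D" and kill: "D ` (scalars K A \<union> y ` {..<e}) \<subseteq> {\<zero>}"
    and a: "a \<in> B"
  shows "D a = \<zero>"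
proof -
  interpret AS: cring AS by (rule AS_cring)
  interpret AB: cring AB by (rule AB_cring)
  note BR = subringE[OF B_ring]
  have Bc: "b \<in> B ==> b \<in> carrier A" for b using BR(1) by auto
  have D: "D b \<in> B" if "b \<in> B" for b using AB.derivation_onD(1)[OF der] that by simp
  have Dadd: "D (b \<oplus> c) = D b \<oplus> D c" if "b \<in> B" "c \<in> B" for b c
    using AB.derivation_onD(2)[OF der, of b c] that by simp
  have Dmult: "D (b \<otimes> c) = D b \<otimes> c \<oplus> b \<otimes> D c" if "b \<in> B" "c \<in> B" for b c
    using AB.derivation_onD(3)[OF der, of b c] that by simp
  define N where "N = genideal AS (D ` B)"
  have DBS: "D ` B \<subseteq> carrier AS" using D B_sub_S by auto
  have N: "ideal N AS" unfolding N_def by (rule AS.genideal_ideal[OF DBS])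
  have DN: "D b \<in> N" if "b \<in> B" for b unfolding N_def using AS.genideal_self[OF DBS] that by auto
  let ?mN = "ideal_prod AS mS N"
  have mN: "ideal ?mN AS" by (rule AS.ideal_prod_is_ideal[OF mS_ideal N])
  hence mNin: "ideal_in A S ?mN" using ideal_in_iff[OF S_ring] by simp
  have mNadd: "u \<oplus> v \<in> ?mN" if "u \<in> ?mN" "v \<in> ?mN" for u v using mNin that unfolding ideal_in_def by auto
  have mNmult: "s \<otimes> v \<in> ?mN" if "s \<in> S" "v \<in> ?mN" for s v using mNin that unfolding ideal_in_def by auto
  have mNprod: "i \<otimes> n \<in> ?mN" if "i \<in> mS" "n \<in> N" for i n using ideal_prod.prod[OF that, of AS] by simp
  have mNsub: "?mN \<subseteq> carrier A" using mNin S_sub unfolding ideal_in_def by auto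
  let ?p = "B \<inter> m"
  have pp: "u \<in> B \<and> D u \<in> ?mN" if "u \<in> ideal_prod AB ?p ?p" for u
    using that
  proof (induction rule: ideal_prod.induct)
    case (prod i j)
    have ij: "i \<in> B" "j \<in> B" "i \<in> mS" "j \<in> mS" using prod B_sub_S by auto
    have "D (i \<otimes> j) = j \<otimes> D i \<oplus> i \<otimes> D j"
      unfolding Dmult[OF ij(1,2)] using m_comm[OF Bc[OF ij(2)] Bc[OF D[OF ij(1)]]] by simp
    thus ?case using mNadd[OF mNprod[OF ij(4) DN[OF ij(1)]] mNprod[OF ij(3) DN[OF ij(2)]]] BR(6)[OF ij(1,2)] by simp
  next
    case (sum s1 s2)
    thus ?case using Dadd[of s1 s2] mNadd BR(7)[of s1 s2] by simp
  qed
  have clear: "\<exists>s\<in>B - m. s \<otimes> u \<in> ideal_prod AB ?p ?p" if "u \<in> ideal_prod AS mS mS" for u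
    using that
  proof (induction rule: ideal_prod.induct)
    case (prod i j)
    obtain s where s: "s \<in> B - m" "s \<otimes> i \<in> B" using S_frac[of i] prod by blast
    obtain t where t: "t \<in> B - m" "t \<otimes> j \<in> B" using S_frac[of j] prod by blast
    have c: "s \<in> carrier A" "t \<in> carrier A" "i \<in> carrier A" "j \<in> carrier A" using s t Bc prod S_sub by auto
    have "s \<otimes> i \<in> ?p" "t \<otimes> j \<in> ?p" using s t prod c ideal.I_l_closed[OF m_ideal] by auto
    hence "(s \<otimes> i) \<otimes> (t \<otimes> j) \<in> ideal_prod AB ?p ?p" using ideal_prod.prod[of _ ?p _ ?p AB] by simp
    moreover have "(s \<otimes> i) \<otimes> (t \<otimes> j) = (s \<otimes> t) \<otimes> (i \<otimes> j)" using c by algebra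
    moreover have "s \<otimes> t \<in> B - m" using BR(6) s(1) t(1) unit_notin_m[of "s \<otimes> t"] B_units by auto
    ultimately show ?case by auto
  next
    case (sum u v)
    then obtain s t where st: "s \<in> B - m" "s \<otimes> u \<in> ideal_prod AB ?p ?p" "t \<in> B - m" "t \<otimes> v \<in> ideal_prod AB ?p ?p" by blast
    have "ideal_in A B ?p"
      unfolding ideal_in_def using J_zero[of 1] J_add[of _ 1] ideal.I_l_closed[OF m_ideal] BR(1,2,6,7) unfolding J_1 by auto
    hence "ideal ?p AB" using ideal_in_iff[OF B_ring] by simp
    hence "ideal_in A B (ideal_prod AB ?p ?p)" using AB.ideal_prod_is_ideal ideal_in_iff[OF B_ring] by simp
    hence "t \<otimes> (s \<otimes> u) \<oplus> s \<otimes> (t \<otimes> v) \<in> ideal_prod AB ?p ?p" using st unfolding ideal_in_def by auto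
    moreover have "u \<in> carrier A" "v \<in> carrier A"
      using sum.hyps AS.ideal_prod_in_carrier[OF mS_ideal mS_ideal] S_sub by auto
    hence "t \<otimes> (s \<otimes> u) \<oplus> s \<otimes> (t \<otimes> v) = (s \<otimes> t) \<otimes> (u \<oplus> v)"
    proof -
      assume uv: "u \<in> carrier A" "v \<in> carrier A"
      have c: "s \<in> carrier A" "t \<in> carrier A" using st Bc by auto
      show ?thesis using c uv by algebra
    qed
    moreover have "s \<otimes> t \<in> B - m" using BR(6) st(1,3) unit_notin_m[of "s \<otimes> t"] B_units by auto
    ultimately show ?case by auto
  qed
  have Dscalar: "D (c \<odot> \<one>) = \<zero>" if "c \<in> carrier K" for c
    using kill that unfolding scalars_def by auto
  have Dlin: "finsum A (\<lambda>i. d i \<odot> y i) {..<n} \<in> B \<and> D (finsum A (\<lambda>i. d i \<odot> y i) {..<n}) = \<zero>"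
    if d: "\<forall>i<e. d i \<in> carrier K" "n \<le> e" for d n
    using d(2)
  proof (induction n)
    case 0
    have "D \<zero> = \<zero>" using Dscalar[OF R.zero_closed] by simp
    thus ?case using BR(2) by simp
  next
    case (Suc n)
    have n: "d n \<in> carrier K" "y n \<in> B" using d(1) yB Suc.prems by auto
    have dB: "d n \<odot> y n \<in> B" by (rule B_smult[OF n])
    have "d n \<odot> y n = (d n \<odot> \<one>) \<otimes> y n" by (rule smult_eq_mult[OF n(1) Bc[OF n(2)]])
    moreover have "D (y n) \<in> D ` (scalars K A \<union> y ` {..<e})" using Suc.prems by (intro imageI) auto
    hence "D (y n) = \<zero>" using kill by blast
    ultimately have D0: "D (d n \<odot> y n) = \<zero>"
      using Dmult[OF scalar_B[OF n(1)] n(2)] Dscalar[OF n(1)] Bc[OF n(2)] n(1) by simp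
    have f: "(\<lambda>i. d i \<odot> y i) \<in> {..<n} \<rightarrow> carrier A" using d(1) yA Suc.prems by (auto intro!: smult_closed)
    have eq: "finsum A (\<lambda>i. d i \<odot> y i) {..<Suc n} = d n \<odot> y n \<oplus> finsum A (\<lambda>i. d i \<odot> y i) {..<n}"
      unfolding lessThan_Suc by (rule finsum_insert) (use f Bc[OF dB] in auto)
    show ?case unfolding eq using Suc dB D0 Dadd[OF dB] BR(7)[OF dB] Bc[OF BR(2)] by simp
  qed
  have main: "D b \<in> ?mN" if b: "b \<in> B" for b
  proof -
    obtain c where c: "c \<in> carrier K" "b \<ominus> c \<odot> \<one> \<in> m" using residue_field[OF Bc[OF b]] by blast
    let ?c = "c \<odot> \<one>"
    have cB: "?c \<in> B" by (rule scalar_B[OF c(1)])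
    have "b \<ominus> ?c \<in> B" unfolding a_minus_def using BR(5)[OF cB] BR(7)[OF b] by blast
    hence "b \<ominus> ?c \<in> S \<inter> m" using c(2) B_sub_S by auto
    then obtain d where d: "\<forall>i<e. d i \<in> carrier K"
      "(b \<ominus> ?c) \<ominus> finsum A (\<lambda>i. d i \<odot> y i) {..<e} \<in> ideal_prod AS mS mS" using spanning by blast
    define f where "f = finsum A (\<lambda>i. d i \<odot> y i) {..<e}"
    define u where "u = (b \<ominus> ?c) \<ominus> f"
    have f: "f \<in> B" "D f = \<zero>" using Dlin[OF d(1) order_refl] unfolding f_def by auto
    have u2: "u \<in> ideal_prod AS mS mS" using d(2) unfolding u_def f_def .
    have uB: "u \<in> B" unfolding u_def using \<open>b \<ominus> ?c \<in> B\<close> BR(5)[OF f(1)] BR(7) unfolding a_minus_def by blast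
    have car: "b \<in> carrier A" "?c \<in> carrier A" "f \<in> carrier A" "u \<in> carrier A" using b cB f uB Bc by auto
    have "b = u \<oplus> (?c \<oplus> f)" unfolding u_def using car by algebra
    hence "D b = D u \<oplus> (D ?c \<oplus> D f)"
      using Dadd[OF uB BR(7)[OF cB f(1)]] Dadd[OF cB f(1)] by simp
    hence Db: "D b = D u" using Dscalar[OF c(1)] f(2) Bc[OF D[OF uB]] by simp
    obtain s where s: "s \<in> B - m" "s \<otimes> u \<in> ideal_prod AB ?p ?p" using clear[OF u2] by blast
    have sB: "s \<in> B" "s \<in> Units A" using s(1) B_units by auto
    have "D s \<otimes> u \<oplus> s \<otimes> D u \<in> ?mN" using pp[OF s(2)] Dmult[OF sB(1) uB] by simp
    moreover have "u \<in> mS" using u2 AS.ideal_prod_inter[OF mS_ideal mS_ideal] by auto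
    hence "u \<otimes> D s \<in> ?mN" using mNprod DN[OF sB(1)] by blast
    hence "(\<ominus> \<one>) \<otimes> (u \<otimes> D s) \<in> ?mN" using mNmult subringE(3,5)[OF S_ring] by blast
    ultimately have "(D s \<otimes> u \<oplus> s \<otimes> D u) \<oplus> (\<ominus> \<one>) \<otimes> (u \<otimes> D s) \<in> ?mN" by (rule mNadd)
    moreover have "(D s \<otimes> u \<oplus> s \<otimes> D u) \<oplus> (\<ominus> \<one>) \<otimes> (u \<otimes> D s) = s \<otimes> D u"
    proof -
      have "D s \<in> carrier A" "D u \<in> carrier A" "s \<in> carrier A" using D sB uB Bc by auto
      thus ?thesis using car(4) by algebra
    qed
    ultimately have "inv s \<otimes> (s \<otimes> D u) \<in> ?mN" using mNmult inv_B_in_S[OF s(1)] by simp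
    moreover have "inv s \<otimes> (s \<otimes> D u) = D u"
      using m_assoc[of "inv s" s "D u"] sB Bc[OF D[OF uB]] Bc[OF sB(1)] by simp
    ultimately show ?thesis using Db by simp
  qed
  have "D ` B \<subseteq> ?mN" using main by (rule image_subsetI)
  hence "N \<subseteq> ?mN" using AS.genideal_minimal[OF mN] unfolding N_def by blast
  hence "N = {\<zero>\<^bsub>AS\<^esub>}" using AS.nakayama[OF AS_acc mS_ideal AS_local N] by blast
  thus ?thesis using DN[OF a] by simp
qed

lemma krull_dim_B_le: "krull_dim AB \<le> enat e"
proof -
  interpret AB: "domain" AB by (rule B_domain)
  have sf: "subfield (scalars K A) AB"
  proof (rule AB.subfield_iff(1))
    show "field (AB\<lparr>carrier := scalars K A\<rparr>)"
      using ring.subfield_iff(2)[OF ring_M scalars_subfield] by simp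
    show "scalars K A \<subseteq> carrier AB" using scalars_B by simp
  qed
  have ZB: "Z \<subseteq> B" unfolding B_def by (auto intro: generate_ring.incl)
  have gen: "carrier AB = generate_ring AB (scalars K A \<union> Z)"
    using ring.subring_gen_equality[OF ring_M B_ring, of "scalars K A \<union> Z"] scalars_B ZB B_def by simp
  have "krull_dim AB \<le> enat (length (map y [0..<e]))"
  proof (rule AB.krull_dim_le[OF _ sf Z(1) _ gen])
    fix k :: nat assume "0 < k"
    hence "add_pow A k \<one> \<noteq> \<zero>" using unit_notin_m[OF char0] zero_m by metis
    thus "add_pow AB k \<one>\<^bsub>AB\<^esub> \<noteq> \<zero>\<^bsub>AB\<^esub>" by (simp add: add_pow_def nat_pow_def)
  next
    fix D a assume "AB.derivation_on (carrier AB) D" "D ` (scalars K A \<union> set (map y [0..<e])) \<subseteq> {\<zero>\<^bsub>AB\<^esub>}" "a \<in> carrier AB"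
    thus "D a = \<zero>\<^bsub>AB\<^esub>" using derivation_determined[of D a] by (simp add: lessThan_atLeast0)
  qed (use ZB yB in auto)
  thus ?thesis by simp
qed

theorem krull_dims: "krull_dim AB = enat e" "krull_dim AS = enat e"
  using krull_dim_S_ge krull_dim_S_le_B krull_dim_B_le by auto

end

section \<open>Quotients and tensor products of modules\<close>

context module
begin

lemma submodule_abelian_subgroup: "submodule N R M ==> abelian_subgroup N M"
  by (rule abelian_subgroupI3[OF additive_subgroup.intro M.abelian_group_axioms]) (rule submodule.axioms(1))

lemma quot_submodule:
  assumes N: "submodule N R M"
  shows "carrier (quot_module M N) = (\<lambda>u. N +>\<^bsub>M\<^esub> u) ` carrier M"
    and "\<lbrakk>u \<in> carrier M; v \<in> carrier M\<rbrakk>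
      \<Longrightarrow> (N +>\<^bsub>M\<^esub> u) \<oplus>\<^bsub>quot_module M N\<^esub> (N +>\<^bsub>M\<^esub> v) = N +>\<^bsub>M\<^esub> (u \<oplus>\<^bsub>M\<^esub> v)"
    and "\<lbrakk>r \<in> carrier R; u \<in> carrier M\<rbrakk>
      \<Longrightarrow> r \<odot>\<^bsub>quot_module M N\<^esub> (N +>\<^bsub>M\<^esub> u) = N +>\<^bsub>M\<^esub> (r \<odot>\<^bsub>M\<^esub> u)"
    and "\<lbrakk>u \<in> carrier M; v \<in> carrier M\<rbrakk> \<Longrightarrow> N +>\<^bsub>M\<^esub> u = N +>\<^bsub>M\<^esub> v \<longleftrightarrow> u \<ominus>\<^bsub>M\<^esub> v \<in> N"
    and "u \<in> carrier M ==> u \<in> N +>\<^bsub>M\<^esub> u"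
    and "\<lbrakk>u \<in> carrier M; v \<in> N +>\<^bsub>M\<^esub> u\<rbrakk> \<Longrightarrow> v \<in> carrier M \<and> N +>\<^bsub>M\<^esub> v = N +>\<^bsub>M\<^esub> u"
proof -
  interpret N: abelian_subgroup N M by (rule submodule_abelian_subgroup[OF N])
  show c: "carrier (quot_module M N) = (\<lambda>u. N +>\<^bsub>M\<^esub> u) ` carrier M"
    unfolding quot_module_def FactRing_def A_RCOSETS_def RCOSETS_def a_r_coset_def by auto
  show "(N +>\<^bsub>M\<^esub> u) \<oplus>\<^bsub>quot_module M N\<^esub> (N +>\<^bsub>M\<^esub> v) = N +>\<^bsub>M\<^esub> (u \<oplus>\<^bsub>M\<^esub> v)"
    if "u \<in> carrier M" "v \<in> carrier M" for u v
    unfolding quot_module_def FactRing_def using N.a_rcos_sum[OF that] by simp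
  show eq: "N +>\<^bsub>M\<^esub> u = N +>\<^bsub>M\<^esub> v \<longleftrightarrow> u \<ominus>\<^bsub>M\<^esub> v \<in> N" if "u \<in> carrier M" "v \<in> carrier M" for u v
    by (rule N.coset_eq_iff[OF that])
  show self: "u \<in> N +>\<^bsub>M\<^esub> u" if "u \<in> carrier M" for u by (rule N.a_rcos_self[OF that])
  show rep: "v \<in> carrier M \<and> N +>\<^bsub>M\<^esub> v = N +>\<^bsub>M\<^esub> u" if "u \<in> carrier M" "v \<in> N +>\<^bsub>M\<^esub> u" for u v
    using N.a_repr_independence'[OF that(2,1)] N.a_elemrcos_carrier[OF that] by simp
  show "r \<odot>\<^bsub>quot_module M N\<^esub> (N +>\<^bsub>M\<^esub> u) = N +>\<^bsub>M\<^esub> (r \<odot>\<^bsub>M\<^esub> u)" if r: "r \<in> carrier R" and u: "u \<in> carrier M" for r u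
  proof -
    have "N +>\<^bsub>M\<^esub> (r \<odot>\<^bsub>M\<^esub> v) = N +>\<^bsub>M\<^esub> (r \<odot>\<^bsub>M\<^esub> u)" if v: "v \<in> N +>\<^bsub>M\<^esub> u" for v
    proof -
      have vc: "v \<in> carrier M" "v \<ominus>\<^bsub>M\<^esub> u \<in> N" using rep[OF u v] eq[of v u] u by auto
      have "r \<odot>\<^bsub>M\<^esub> (v \<ominus>\<^bsub>M\<^esub> u) = r \<odot>\<^bsub>M\<^esub> v \<ominus>\<^bsub>M\<^esub> r \<odot>\<^bsub>M\<^esub> u"
        using r u vc by (simp add: a_minus_def smult_r_distr smult_r_minus)
      thus ?thesis using submodule.smult_closed[OF N r vc(2)] eq[of "r \<odot>\<^bsub>M\<^esub> v" "r \<odot>\<^bsub>M\<^esub> u"] r u vc by simp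
    qed
    hence "(\<Union>v\<in>N +>\<^bsub>M\<^esub> u. N +>\<^bsub>M\<^esub> (r \<odot>\<^bsub>M\<^esub> v)) = (\<Union>v\<in>N +>\<^bsub>M\<^esub> u. N +>\<^bsub>M\<^esub> (r \<odot>\<^bsub>M\<^esub> u))"
      by (rule SUP_cong[OF refl])
    moreover have "N +>\<^bsub>M\<^esub> u \<noteq> {}" using self[OF u] by blast
    ultimately show ?thesis unfolding quot_module_def by simp
  qed
qed

lemma module_span_submodule:
  assumes "X \<subseteq> carrier M"
  shows "submodule (module_span R M X) R M" "X \<subseteq> module_span R M X"
proof -
  have c: "carrier M \<in> {N. submodule N R M \<and> X \<subseteq> N}" using assms carrier_is_submodule by simp
  show "submodule (module_span R M X) R M"
    unfolding module_span_def
  proof (rule submoduleI)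
    show "\<Inter> {N. submodule N R M \<and> X \<subseteq> N} \<subseteq> carrier M" using c by blast
    show "\<zero>\<^bsub>M\<^esub> \<in> \<Inter> {N. submodule N R M \<and> X \<subseteq> N}"
      using subgroup.one_closed[OF submodule.axioms(1)] by fastforce
  qed (use submoduleE(3-5) in blast)+
qed (auto simp: module_span_def)

end

lemma (in cring) tensor_pure:
  assumes M': "\<forall>u\<in>carrier M. \<forall>v\<in>carrier M. u \<oplus>\<^bsub>M\<^esub> v \<in> carrier M"
      "\<forall>r\<in>carrier R. \<forall>u\<in>carrier M. r \<odot>\<^bsub>M\<^esub> u \<in> carrier M"
    and N': "\<forall>u\<in>carrier N. \<forall>v\<in>carrier N. u \<oplus>\<^bsub>N\<^esub> v \<in> carrier N"
      "\<forall>r\<in>carrier R. \<forall>u\<in>carrier N. r \<odot>\<^bsub>N\<^esub> u \<in> carrier N"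
  defines "F \<equiv> free_module R (carrier M \<times> carrier N)"
  shows "tensor_relations R M N \<subseteq> carrier F"
    and "submodule (tensor_null R M N) R F"
    and "\<lbrakk>u \<in> carrier M; v \<in> carrier N; v' \<in> carrier N\<rbrakk> \<Longrightarrow>
      pure_tensor R M N u (v \<oplus>\<^bsub>N\<^esub> v') = pure_tensor R M N u v \<oplus>\<^bsub>tensor R M N\<^esub> pure_tensor R M N u v'"
    and "\<lbrakk>r \<in> carrier R; u \<in> carrier M; v \<in> carrier N\<rbrakk> \<Longrightarrow>
      pure_tensor R M N (r \<odot>\<^bsub>M\<^esub> u) v = r \<odot>\<^bsub>tensor R M N\<^esub> pure_tensor R M N u v"
    and "\<lbrakk>r \<in> carrier R; u \<in> carrier M; v \<in> carrier N\<rbrakk> \<Longrightarrow>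
      pure_tensor R M N u (r \<odot>\<^bsub>N\<^esub> v) = r \<odot>\<^bsub>tensor R M N\<^esub> pure_tensor R M N u v"
proof -
  interpret F: module R F unfolding F_def by (rule free_module_module)
  note M = M'[rule_format] and N = N'[rule_format]
  let ?e = "free_gen R" and ?X = "tensor_null R M N"
  have e: "?e (u, v) \<in> carrier F" if "u \<in> carrier M" "v \<in> carrier N" for u v
    unfolding F_def using that by auto
  show sub: "tensor_relations R M N \<subseteq> carrier F"
    unfolding tensor_relations_def Let_def F_def[symmetric]
    by (auto intro!: F.minus_closed F.a_closed F.smult_closed e M N)
  show X: "submodule ?X R F" unfolding tensor_null_def F_def[symmetric] by (rule F.module_span_submodule(1)[OF sub])
  have rel: "tensor_relations R M N \<subseteq> ?X" unfolding tensor_null_def F_def[symmetric] by (rule F.module_span_submodule(2)[OF sub])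
  note q = F.quot_submodule[OF X]
  have T: "tensor R M N = quot_module F ?X" by (simp add: tensor_def F_def)
  have P: "pure_tensor R M N u v = ?X +>\<^bsub>F\<^esub> ?e (u, v)" for u v by (simp add: pure_tensor_def F_def)
  show "pure_tensor R M N u (v \<oplus>\<^bsub>N\<^esub> v') = pure_tensor R M N u v \<oplus>\<^bsub>tensor R M N\<^esub> pure_tensor R M N u v'"
    if u: "u \<in> carrier M" and v: "v \<in> carrier N" "v' \<in> carrier N" for u v v'
    unfolding P T q(2)[OF e[OF u v(1)] e[OF u v(2)]] q(4)[OF e[OF u N(1)[OF v]] F.a_closed[OF e[OF u v(1)] e[OF u v(2)]]]
    by (rule subsetD[OF rel]) (use u v in \<open>auto simp: tensor_relations_def Let_def F_def[symmetric]\<close>)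
  show "pure_tensor R M N (r \<odot>\<^bsub>M\<^esub> u) v = r \<odot>\<^bsub>tensor R M N\<^esub> pure_tensor R M N u v"
    if r: "r \<in> carrier R" and u: "u \<in> carrier M" and v: "v \<in> carrier N" for r u v
    unfolding P T q(3)[OF r e[OF u v]] q(4)[OF e[OF M(2)[OF r u] v] F.smult_closed[OF r e[OF u v]]]
    by (rule subsetD[OF rel]) (use r u v in \<open>auto simp: tensor_relations_def Let_def F_def[symmetric]\<close>)
  show "pure_tensor R M N u (r \<odot>\<^bsub>N\<^esub> v) = r \<odot>\<^bsub>tensor R M N\<^esub> pure_tensor R M N u v"
    if r: "r \<in> carrier R" and u: "u \<in> carrier M" and v: "v \<in> carrier N" for r u v
    unfolding P T q(3)[OF r e[OF u v]] q(4)[OF e[OF u N(2)[OF r v]] F.smult_closed[OF r e[OF u v]]]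
    by (rule subsetD[OF rel]) (use r u v in \<open>auto simp: tensor_relations_def Let_def F_def[symmetric]\<close>)
qed

lemma (in cring) self_module_module: "module R (self_module R)"
proof (rule moduleI[OF is_cring])
  show "abelian_group (self_module R)"
    by (rule abelian_groupI) (auto simp: self_module_def a_ac intro: bexI[of _ "\<ominus> x" for x] l_neg)
qed (auto simp: self_module_def l_distr r_distr m_assoc)

lemma (in cring) self_module_minus: "a \<ominus>\<^bsub>self_module R\<^esub> b = a \<ominus> b"
  by (simp add: a_minus_def a_inv_def self_module_def m_inv_def)

lemma (in cring) ideal_submodule:
  assumes "ideal I R" shows "submodule I R (self_module R)"
proof -
  interpret I: ideal I R by (rule assms)
  have "\<ominus>\<^bsub>self_module R\<^esub> a = \<ominus> a" for a by (simp add: a_inv_def self_module_def m_inv_def)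
  thus ?thesis
    by (intro module.submoduleI[OF self_module_module])
      (use I.Icarr I.I_l_closed in \<open>auto simp: self_module_def\<close>)
qed

context graded_symmetric
begin

text \<open>The augmentation \<open>A \<rightarrow> A/m = K\<close>, with values in the copy of \<open>K\<close> inside \<open>A\<close>.\<close>

definition eps :: "'c \<Rightarrow> 'c"
  where "eps a = (SOME x. x \<in> scalars K A \<and> a \<ominus> x \<in> m)"

text \<open>The component in \<open>m\<close> of the decomposition \<open>A = K + m\<close>; modulo \<open>m\<^sup>2\<close> it is the universal
  \<open>K\<close>-derivation into vector spaces over \<open>A/m\<close>.\<close>

definition dm :: "'c \<Rightarrow> 'c"
  where "dm a = a \<ominus> eps a"

lemma eps:
  assumes "a \<in> carrier A"
  shows "eps a \<in> scalars K A" "dm a \<in> m" "eps a \<in> carrier A" "dm a \<in> carrier A"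
proof -
  have "eps a \<in> scalars K A \<and> a \<ominus> eps a \<in> m"
    unfolding eps_def by (rule someI_ex) (use residue_field[OF assms] in \<open>auto simp: scalars_def\<close>)
  thus "eps a \<in> scalars K A" "dm a \<in> m" "eps a \<in> carrier A" "dm a \<in> carrier A"
    unfolding dm_def using scalars_sub m_sub by auto
qed

lemma minus_m: "a \<in> m ==> b \<in> m ==> a \<ominus> b \<in> m"
  unfolding a_minus_def using m_closed(1) additive_subgroup.a_inv_closed[OF ideal.axioms(1)[OF m_ideal]] by blast

lemma scalar_m:
  assumes "x \<in> scalars K A" "x \<in> m" shows "x = \<zero>"
proof (rule ccontr)
  assume "x \<noteq> \<zero>"
  hence "x \<in> Units A"
    using ring.subfield_m_inv[OF ring_M scalars_subfield, of x] assms(1) scalars_sub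
    unfolding Units_def by auto
  thus False using unit_notin_m assms(2) by blast
qed

lemma eps_unique:
  assumes a: "a \<in> carrier A" and x: "x \<in> scalars K A" "a \<ominus> x \<in> m"
  shows "eps a = x"
proof -
  have c: "x \<in> carrier A" using x scalars_sub by auto
  note e = eps[OF a]
  have "(a \<ominus> x) \<ominus> dm a \<in> m" by (rule minus_m[OF x(2) e(2)])
  moreover have "(a \<ominus> x) \<ominus> dm a = eps a \<ominus> x" unfolding dm_def using a c e(3) by algebra
  moreover have "eps a \<ominus> x \<in> scalars K A"
    unfolding a_minus_def using subringE(5,7)[OF scalars_ring] e(1) x(1) by simp
  ultimately have "eps a \<ominus> x = \<zero>" using scalar_m by simp
  thus ?thesis using e(3) c by simp
qed

end

section \<open>Differentials of subalgebras\<close>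

context graded_symmetric
begin

lemma eps_scalar: "x \<in> scalars K A ==> eps x = x"
  using scalars_sub J_zero[of 1] unfolding J_1 by (intro eps_unique) (auto simp: r_neg a_minus_def)

lemma eps_m: "a \<in> m ==> eps a = \<zero>"
  using m_sub subringE(2)[OF scalars_ring] by (intro eps_unique) (auto simp: a_minus_def)

lemma dm_m: "a \<in> m ==> dm a = a"
  unfolding dm_def using eps_m m_sub by (auto simp: a_minus_def)

lemma dm_scalar: "x \<in> scalars K A ==> dm x = \<zero>"
  unfolding dm_def eps_scalar using scalars_sub by (auto simp: r_neg a_minus_def)

lemma eps_add_mult:
  assumes a: "a \<in> carrier A" and b: "b \<in> carrier A"
  shows "eps (a \<oplus> b) = eps a \<oplus> eps b" "eps (a \<otimes> b) = eps a \<otimes> eps b"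
    and "dm (a \<oplus> b) = dm a \<oplus> dm b"
    and "dm (a \<otimes> b) = (a \<otimes> dm b \<oplus> b \<otimes> dm a) \<ominus> dm a \<otimes> dm b"
proof -
  note ea = eps[OF a] and eb = eps[OF b] and k = subringE[OF scalars_ring]
  have "a \<oplus> b \<ominus> (eps a \<oplus> eps b) = dm a \<oplus> dm b" unfolding dm_def using a b ea(3) eb(3) by algebra
  also have "\<dots> \<in> m" using m_closed(1) ea(2) eb(2) by blast
  finally show 1: "eps (a \<oplus> b) = eps a \<oplus> eps b" using k(7) ea(1) eb(1) a b by (intro eps_unique) auto
  have "a \<otimes> b \<ominus> (eps a \<otimes> eps b) = a \<otimes> dm b \<oplus> eps b \<otimes> dm a" unfolding dm_def using a b ea(3) eb(3) by algebra
  also have "\<dots> \<in> m" using m_closed(1) ideal.I_l_closed[OF m_ideal] ea(2) eb(2,3) a by blast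
  finally show 2: "eps (a \<otimes> b) = eps a \<otimes> eps b" using k(6) ea(1) eb(1) a b by (intro eps_unique) auto
  show "dm (a \<oplus> b) = dm a \<oplus> dm b" unfolding dm_def 1 using a b ea(3) eb(3) by algebra
  show "dm (a \<otimes> b) = (a \<otimes> dm b \<oplus> b \<otimes> dm a) \<ominus> dm a \<otimes> dm b" unfolding dm_def 2 using a b ea(3) eb(3) by algebra
qed

lemma eps_coset:
  assumes a: "a \<in> carrier A" and b: "b \<in> carrier A" "a \<ominus> b \<in> m"
  shows "eps a = eps b"
proof (rule eps_unique[OF a eps(1)[OF b(1)]])
  have "a \<ominus> eps b = (a \<ominus> b) \<oplus> dm b" unfolding dm_def using a b(1) eps(3)[OF b(1)] by algebra
  thus "a \<ominus> eps b \<in> m" using m_closed(1) b(2) eps(2)[OF b(1)] by simp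
qed

abbreviation RM where "RM \<equiv> residue_module A m"
text \<open>The scalar in a coset of \<open>m\<close>.\<close>

definition eps' :: "'c set \<Rightarrow> 'c" where "eps' u = eps (SOME a. a \<in> u)"

lemma residue_module:
  shows "carrier RM = (\<lambda>a. m +> a) ` carrier A"
    and "\<one>\<^bsub>RM\<^esub> = m +> \<one>"
    and "\<lbrakk>a \<in> carrier A; b \<in> carrier A\<rbrakk> \<Longrightarrow> (m +> a) \<oplus>\<^bsub>RM\<^esub> (m +> b) = m +> (a \<oplus> b)"
    and "\<lbrakk>a \<in> carrier A; b \<in> carrier A\<rbrakk> \<Longrightarrow> a \<odot>\<^bsub>RM\<^esub> (m +> b) = m +> (a \<otimes> b)"
    and "\<lbrakk>a \<in> carrier A; b \<in> carrier A\<rbrakk> \<Longrightarrow> m +> a = m +> b \<longleftrightarrow> a \<ominus> b \<in> m"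
    and "a \<in> carrier A ==> eps' (m +> a) = eps a"
proof -
  note q = module.quot_submodule[OF self_module_module ideal_submodule[OF m_ideal], unfolded self_module_minus]
  have c: "m +>\<^bsub>self_module A\<^esub> x = m +> x" for x
    by (simp add: a_r_coset_def' self_module_def)
  have s: "carrier (self_module A) = carrier A" "add (self_module A) = add A" "smult (self_module A) = mult A"
    by (simp_all add: self_module_def)
  note q = q[unfolded c s]
  show "carrier RM = (\<lambda>a. m +> a) ` carrier A" by (rule q(1))
  show "\<one>\<^bsub>RM\<^esub> = m +> \<one>" unfolding quot_module_def FactRing_def using c by (simp add: self_module_def)
  show "\<lbrakk>a \<in> carrier A; b \<in> carrier A\<rbrakk> \<Longrightarrow> (m +> a) \<oplus>\<^bsub>RM\<^esub> (m +> b) = m +> (a \<oplus> b)" by (rule q(2))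
  show "\<lbrakk>a \<in> carrier A; b \<in> carrier A\<rbrakk> \<Longrightarrow> a \<odot>\<^bsub>RM\<^esub> (m +> b) = m +> (a \<otimes> b)" by (rule q(3))
  show "\<lbrakk>a \<in> carrier A; b \<in> carrier A\<rbrakk> \<Longrightarrow> m +> a = m +> b \<longleftrightarrow> a \<ominus> b \<in> m" by (rule q(4))
  show "a \<in> carrier A ==> eps' (m +> a) = eps a"
  proof -
    assume a: "a \<in> carrier A"
    have "(SOME b. b \<in> m +> a) \<in> m +> a" by (rule someI) (rule q(5)[OF a])
    note b = q(6)[OF a this]
    thus ?thesis unfolding eps'_def using q(4)[OF _ a] a by (intro eps_coset) auto
  qed
qed

end

text \<open>The algebra \<open>A\<close> itself and its subalgebras of bounded order are treated together.\<close>

locale graded_subring = graded_symmetric K A m \<tau> for K and A (structure) and m \<tau> +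
  fixes S assumes S_ring: "subring S A" and scalars_S: "scalars K A \<subseteq> S"
begin

abbreviation AS where "AS \<equiv> A\<lparr>carrier := S\<rparr>"
abbreviation mS where "mS \<equiv> S \<inter> m"
abbreviation mS2 where "mS2 \<equiv> ideal_prod AS mS mS"
abbreviation Om where "Om \<equiv> kaehler K AS"
abbreviation kd where "kd \<equiv> kaehler_d K AS"
abbreviation kn where "kn \<equiv> kaehler_null K AS"
abbreviation FS where "FS \<equiv> free_module AS S"

lemma S_sub: "S \<subseteq> carrier A" using subringE(1)[OF S_ring] .
lemma AS_cring: "cring AS" by (rule subring_cring[OF S_ring])

lemma AS_minus:
  assumes "a \<in> S" "b \<in> S"
  shows "a \<ominus>\<^bsub>AS\<^esub> b = a \<ominus> b"
proof -
  interpret AS: cring AS by (rule AS_cring)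
  have "\<ominus>\<^bsub>AS\<^esub> b = \<ominus> b"
    by (rule AS.minus_equality) (use assms(2) subringE(1,5)[OF S_ring] l_neg in auto)
  thus ?thesis by (simp add: a_minus_def)
qed

lemma scalars_AS: "scalars K AS = scalars K A"
  by (simp add: scalars_def)

lemma AS_module: "module AS (self_module AS)"
  by (rule cring.self_module_module[OF AS_cring])

lemma self_AS: "carrier (self_module AS) = S" "zero (self_module AS) = \<zero>" "add (self_module AS) = add A"
  "smult (self_module AS) = mult A"
  by (simp_all add: self_module_def)

lemma mS_ideal: "ideal mS AS"
  unfolding ideal_in_iff[OF S_ring] ideal_in_def
  using J_zero[of 1] m_closed(1) ideal.I_l_closed[OF m_ideal] S_sub subringE(2,6,7)[OF S_ring] unfolding J_1 by auto

lemma mS2: "\<zero> \<in> mS2" "\<lbrakk>a \<in> mS2; b \<in> mS2\<rbrakk> \<Longrightarrow> a \<oplus> b \<in> mS2" "\<lbrakk>s \<in> S; a \<in> mS2\<rbrakk> \<Longrightarrow> s \<otimes> a \<in> mS2"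
  "\<lbrakk>a \<in> mS; b \<in> mS\<rbrakk> \<Longrightarrow> a \<otimes> b \<in> mS2" "a \<in> mS2 ==> \<ominus> a \<in> mS2" "mS2 \<subseteq> S"
  "\<lbrakk>a \<in> mS2; b \<in> mS2\<rbrakk> \<Longrightarrow> a \<ominus> b \<in> mS2"
proof -
  interpret AS: cring AS by (rule AS_cring)
  have "ideal mS2 AS" by (rule AS.ideal_prod_is_ideal[OF mS_ideal mS_ideal])
  hence i: "ideal_in A S mS2" using ideal_in_iff[OF S_ring] by simp
  thus z: "\<zero> \<in> mS2" and add: "\<lbrakk>a \<in> mS2; b \<in> mS2\<rbrakk> \<Longrightarrow> a \<oplus> b \<in> mS2" and mult: "\<lbrakk>s \<in> S; a \<in> mS2\<rbrakk> \<Longrightarrow> s \<otimes> a \<in> mS2"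
    and sub: "mS2 \<subseteq> S" for a b s unfolding ideal_in_def by auto
  show "\<lbrakk>a \<in> mS; b \<in> mS\<rbrakk> \<Longrightarrow> a \<otimes> b \<in> mS2" using ideal_prod.prod[of a mS b mS AS] by simp
  show neg: "a \<in> mS2 ==> \<ominus> a \<in> mS2" for a
    using mult[of "\<ominus> \<one>" a] subringE(3,5)[OF S_ring] sub S_sub by (auto simp: l_minus)
  show "\<lbrakk>a \<in> mS2; b \<in> mS2\<rbrakk> \<Longrightarrow> a \<ominus> b \<in> mS2" unfolding a_minus_def using add neg by blast
qed

lemma FS_module: "module AS FS"
  by (rule cring.free_module_module[OF AS_cring])

lemma FS_closed:
  shows "s \<in> S ==> free_gen AS s \<in> carrier FS"
    and "f \<in> carrier FS ==> g \<in> carrier FS ==> f \<oplus>\<^bsub>FS\<^esub> g \<in> carrier FS"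
    and "f \<in> carrier FS ==> g \<in> carrier FS ==> f \<ominus>\<^bsub>FS\<^esub> g \<in> carrier FS"
    and "r \<in> S ==> f \<in> carrier FS ==> r \<odot>\<^bsub>FS\<^esub> f \<in> carrier FS"
proof -
  interpret F: module AS FS by (rule FS_module)
  show "s \<in> S ==> free_gen AS s \<in> carrier FS" by (rule cring.free_gen_carrier[OF AS_cring])
  show "f \<in> carrier FS ==> g \<in> carrier FS ==> f \<oplus>\<^bsub>FS\<^esub> g \<in> carrier FS" by (rule F.M.a_closed)
  show "f \<in> carrier FS ==> g \<in> carrier FS ==> f \<ominus>\<^bsub>FS\<^esub> g \<in> carrier FS" by (rule F.M.minus_closed)
  show "r \<in> S ==> f \<in> carrier FS ==> r \<odot>\<^bsub>FS\<^esub> f \<in> carrier FS" using F.smult_closed[of r f] by simp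
qed

lemma kn: "kaehler_relations K AS \<subseteq> carrier FS" "submodule kn AS FS" "kaehler_relations K AS \<subseteq> kn"
proof -
  interpret F: module AS FS by (rule FS_module)
  show sub: "kaehler_relations K AS \<subseteq> carrier FS"
    unfolding kaehler_relations_def Let_def scalars_AS
    using scalars_S subringE(6,7)[OF S_ring]
    by (auto intro!: FS_closed simp del: free_module_simps)
  thus "submodule kn AS FS" "kaehler_relations K AS \<subseteq> kn"
    unfolding kaehler_null_def using F.module_span_submodule[OF sub] by simp_all
qed

lemma Om_eq: "Om = quot_module FS kn" by (simp add: kaehler_def)

lemmas Om_quot = module.quot_submodule[OF FS_module kn(2), folded Om_eq]

lemma Om_closed:
  shows "a \<in> S ==> kd a \<in> carrier Om"
    and "\<lbrakk>u \<in> carrier Om; v \<in> carrier Om\<rbrakk> \<Longrightarrow> u \<oplus>\<^bsub>Om\<^esub> v \<in> carrier Om"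
    and "\<lbrakk>r \<in> carrier AS; u \<in> carrier Om\<rbrakk> \<Longrightarrow> r \<odot>\<^bsub>Om\<^esub> u \<in> carrier Om"
proof -
  show "a \<in> S ==> kd a \<in> carrier Om" unfolding Om_quot(1) kaehler_d_def using FS_closed(1) by simp
  show "\<lbrakk>u \<in> carrier Om; v \<in> carrier Om\<rbrakk> \<Longrightarrow> u \<oplus>\<^bsub>Om\<^esub> v \<in> carrier Om"
    unfolding Om_quot(1) using Om_quot(2) FS_closed(2) by (auto simp del: free_module_simps)
  show "\<lbrakk>r \<in> carrier AS; u \<in> carrier Om\<rbrakk> \<Longrightarrow> r \<odot>\<^bsub>Om\<^esub> u \<in> carrier Om"
    unfolding Om_quot(1) using Om_quot(3) FS_closed(4) by (auto simp del: free_module_simps)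
qed

text \<open>The last rule says that \<open>kd c\<close> is zero, in a form that does not mention the zero coset.\<close>

lemma kd_rules:
  shows "\<lbrakk>a \<in> S; b \<in> S\<rbrakk> \<Longrightarrow> kd (a \<oplus> b) = kd a \<oplus>\<^bsub>Om\<^esub> kd b"
    and "\<lbrakk>a \<in> S; b \<in> S\<rbrakk> \<Longrightarrow> kd (a \<otimes> b) = (a \<odot>\<^bsub>Om\<^esub> kd b) \<oplus>\<^bsub>Om\<^esub> (b \<odot>\<^bsub>Om\<^esub> kd a)"
    and "c \<in> scalars K A ==> kd c = \<zero> \<odot>\<^bsub>Om\<^esub> kd c"
proof -
  interpret F: module AS FS by (rule FS_module)
  have kd: "kd x = kn +>\<^bsub>FS\<^esub> free_gen AS x" for x by (simp add: kaehler_d_def)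
  note rel = subsetD[OF kn(3)] and cl = FS_closed subringE(2,6,7)[OF S_ring] and op = Om_quot(2,3)[unfolded partial_object.simps]
  show "\<lbrakk>a \<in> S; b \<in> S\<rbrakk> \<Longrightarrow> kd (a \<oplus> b) = kd a \<oplus>\<^bsub>Om\<^esub> kd b"
    unfolding kd by (subst op(1)) (auto simp: Om_quot(4) kaehler_relations_def Let_def cl simp del: free_module_simps intro!: rel)
  show "\<lbrakk>a \<in> S; b \<in> S\<rbrakk> \<Longrightarrow> kd (a \<otimes> b) = (a \<odot>\<^bsub>Om\<^esub> kd b) \<oplus>\<^bsub>Om\<^esub> (b \<odot>\<^bsub>Om\<^esub> kd a)"
    unfolding kd by (simp add: op cl Om_quot(4) del: free_module_simps)
      (intro rel, simp add: kaehler_relations_def Let_def del: free_module_simps, blast)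
  show "kd c = \<zero> \<odot>\<^bsub>Om\<^esub> kd c" if c: "c \<in> scalars K A"
  proof -
    have cS: "c \<in> S" using c scalars_S by auto
    have r: "free_gen AS c \<in> kn" using c by (intro rel) (auto simp: kaehler_relations_def Let_def scalars_AS)
    moreover have "\<zero> \<odot>\<^bsub>FS\<^esub> free_gen AS c \<in> kn" using submodule.smult_closed[OF kn(2) _ r, of \<zero>] cl(5) by simp
    ultimately have "free_gen AS c \<ominus>\<^bsub>FS\<^esub> (\<zero> \<odot>\<^bsub>FS\<^esub> free_gen AS c) \<in> kn"
      unfolding a_minus_def using F.submoduleE(3,5)[OF kn(2)] by blast
    thus ?thesis unfolding kd using cS by (simp add: op cl Om_quot(4) del: free_module_simps)
  qed
qed

text \<open>The map \<open>da \<mapsto> dm a\<close> before passing to the quotient.\<close>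

definition rho :: "('c \<Rightarrow> 'c) \<Rightarrow> 'c"
  where "rho f = lin_ext AS (self_module AS) dm f"

lemma dm_map: "dm \<in> S \<rightarrow> carrier (self_module AS)" and dm_mS: "a \<in> S ==> dm a \<in> mS"
proof -
  have "dm a \<in> mS" if a: "a \<in> S" for a
  proof -
    have "eps a \<in> S" "dm a \<in> m" using eps[of a] a S_sub scalars_S by auto
    thus ?thesis unfolding dm_def a_minus_def using subringE(5,7)[OF S_ring] a by auto
  qed
  thus "dm \<in> S \<rightarrow> carrier (self_module AS)" "a \<in> S ==> dm a \<in> mS" by (auto simp: self_AS)
qed

lemma rho:
  shows "a \<in> S ==> rho (free_gen AS a) = dm a"
    and "\<lbrakk>f \<in> carrier FS; g \<in> carrier FS\<rbrakk> \<Longrightarrow> rho (f \<oplus>\<^bsub>FS\<^esub> g) = rho f \<oplus> rho g"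
    and "\<lbrakk>f \<in> carrier FS; g \<in> carrier FS\<rbrakk> \<Longrightarrow> rho (f \<ominus>\<^bsub>FS\<^esub> g) = rho f \<ominus> rho g"
    and "\<lbrakk>r \<in> S; f \<in> carrier FS\<rbrakk> \<Longrightarrow> rho (r \<odot>\<^bsub>FS\<^esub> f) = r \<otimes> rho f"
    and "f \<in> carrier FS ==> rho f \<in> mS"
proof -
  interpret SM: module AS "self_module AS" by (rule AS_module)
  note v = dm_map
  show "a \<in> S ==> rho (free_gen AS a) = dm a" unfolding rho_def by (rule SM.lin_ext_gen[OF v])
  show "\<lbrakk>f \<in> carrier FS; g \<in> carrier FS\<rbrakk> \<Longrightarrow> rho (f \<oplus>\<^bsub>FS\<^esub> g) = rho f \<oplus> rho g"
    unfolding rho_def free_module_simps using SM.lin_ext_add[OF v, of f g] by (simp add: self_AS)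
  show mem: "rho f \<in> mS" if "f \<in> carrier FS" for f
    unfolding rho_def
  proof (rule SM.lin_ext_mem[OF v that])
    show "\<zero>\<^bsub>self_module AS\<^esub> \<in> mS" using J_zero[of 1] subringE(2)[OF S_ring] by (simp add: self_AS J_1)
    show "a \<oplus>\<^bsub>self_module AS\<^esub> b \<in> mS" if "a \<in> mS" "b \<in> mS" for a b
      using that m_closed(1) subringE(7)[OF S_ring] by (simp add: self_AS)
    show "f s \<odot>\<^bsub>self_module AS\<^esub> dm s \<in> mS" if "s \<in> S" for s
      using dm_mS[OF that] free_memD(1)[OF \<open>f \<in> carrier FS\<close>, of s] S_sub ideal.I_l_closed[OF m_ideal]
        subringE(6)[OF S_ring] by (auto simp: self_AS)
  qed
  show "\<lbrakk>f \<in> carrier FS; g \<in> carrier FS\<rbrakk> \<Longrightarrow> rho (f \<ominus>\<^bsub>FS\<^esub> g) = rho f \<ominus> rho g"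
    using SM.lin_ext_minus[OF v, of f g] mem[of f] mem[of g] AS_minus cring.self_module_minus[OF AS_cring]
    unfolding rho_def by simp
  show "\<lbrakk>r \<in> S; f \<in> carrier FS\<rbrakk> \<Longrightarrow> rho (r \<odot>\<^bsub>FS\<^esub> f) = r \<otimes> rho f"
    unfolding rho_def free_module_simps using SM.lin_ext_smult[OF v, of r f] by (simp add: self_AS)
qed

lemma mS2_submodule: "submodule mS2 AS (self_module AS)"
proof -
  interpret AS: cring AS by (rule AS_cring)
  show ?thesis by (rule AS.ideal_submodule[OF AS.ideal_prod_is_ideal[OF mS_ideal mS_ideal]])
qed

text \<open>The product rule holds up to \<open>dm a \<cdot> dm b\<close>, which lies in the square of the maximal ideal.\<close>

lemma rho_kn:
  assumes "f \<in> kn" shows "f \<in> carrier FS" "rho f \<in> mS2"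
proof -
  interpret SM: module AS "self_module AS" by (rule AS_module)
  have rel: "g \<in> carrier FS \<and> lin_ext AS (self_module AS) dm g \<in> mS2" if g: "g \<in> kaehler_relations K AS" for g
    unfolding rho_def[symmetric]
  proof
    show "g \<in> carrier FS" using g kn(1) by blast
    consider (add) a b where "a \<in> S" "b \<in> S" "g = free_gen AS (a \<oplus> b) \<ominus>\<^bsub>FS\<^esub> (free_gen AS a \<oplus>\<^bsub>FS\<^esub> free_gen AS b)"
      | (mult) a b where "a \<in> S" "b \<in> S"
        "g = free_gen AS (a \<otimes> b) \<ominus>\<^bsub>FS\<^esub> (a \<odot>\<^bsub>FS\<^esub> free_gen AS b \<oplus>\<^bsub>FS\<^esub> b \<odot>\<^bsub>FS\<^esub> free_gen AS a)"
      | (scal) c where "c \<in> scalars K A" "g = free_gen AS c"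
      using g unfolding kaehler_relations_def Let_def scalars_AS by (auto simp del: free_module_simps)
    thus "rho g \<in> mS2"
    proof cases
      case add
      have c: "a \<in> carrier A" "b \<in> carrier A" "dm a \<in> carrier A" "dm b \<in> carrier A"
        using add S_sub eps(4) by auto
      have "rho g = (dm a \<oplus> dm b) \<ominus> (dm a \<oplus> dm b)"
        unfolding add(3) using add(1,2) subringE(7)[OF S_ring] c
        by (simp add: rho FS_closed eps_add_mult(3) del: free_module_simps)
      thus ?thesis using c mS2(1) by (simp add: a_minus_def r_neg)
    next
      case mult
      have c: "a \<in> carrier A" "b \<in> carrier A" "dm a \<in> carrier A" "dm b \<in> carrier A"
        using mult S_sub eps(4) by auto
      have "rho g = ((a \<otimes> dm b \<oplus> b \<otimes> dm a) \<ominus> dm a \<otimes> dm b) \<ominus> (a \<otimes> dm b \<oplus> b \<otimes> dm a)"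
        unfolding mult(3) using mult(1,2) subringE(6)[OF S_ring] c
        by (simp add: rho FS_closed eps_add_mult(4) del: free_module_simps)
      also have "\<dots> = \<ominus> (dm a \<otimes> dm b)" using c by algebra
      finally show ?thesis using mS2(4)[OF dm_mS[OF mult(1)] dm_mS[OF mult(2)]] mS2(5) by simp
    next
      case scal
      thus ?thesis using rho(1)[of c] scalars_S dm_scalar mS2(1) by auto
    qed
  qed
  have f: "f \<in> module_span AS FS (kaehler_relations K AS)" using assms by (simp add: kaehler_null_def)
  show "f \<in> carrier FS" by (rule SM.module_span_lin_ext(1)[OF dm_map mS2_submodule rel f])
  show "rho f \<in> mS2" unfolding rho_def by (rule SM.module_span_lin_ext(2)[OF dm_map mS2_submodule rel f])
qed

text \<open>The same map on \<open>\<Omega>\<close>, by a choice of representatives; it is linear only modulo \<open>mS2\<close>.\<close>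

definition rho' :: "('c \<Rightarrow> 'c) set \<Rightarrow> 'c"
  where "rho' w = rho (SOME f. f \<in> w)"

lemma rho':
  assumes f: "f \<in> carrier FS"
  shows "rho' (kn +>\<^bsub>FS\<^esub> f) \<in> mS" "rho' (kn +>\<^bsub>FS\<^esub> f) \<ominus> rho f \<in> mS2"
proof -
  have "(SOME g. g \<in> kn +>\<^bsub>FS\<^esub> f) \<in> kn +>\<^bsub>FS\<^esub> f" using Om_quot(5)[OF f] by (rule someI[of "\<lambda>g. g \<in> kn +>\<^bsub>FS\<^esub> f"])
  note g = Om_quot(6)[OF f this]
  have gc: "(SOME g. g \<in> kn +>\<^bsub>FS\<^esub> f) \<in> carrier FS" using g by blast
  thus "rho' (kn +>\<^bsub>FS\<^esub> f) \<in> mS" unfolding rho'_def by (rule rho(5))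
  have "(SOME g. g \<in> kn +>\<^bsub>FS\<^esub> f) \<ominus>\<^bsub>FS\<^esub> f \<in> kn" using g Om_quot(4)[OF gc f] by blast
  from rho_kn(2)[OF this] show "rho' (kn +>\<^bsub>FS\<^esub> f) \<ominus> rho f \<in> mS2"
    unfolding rho'_def rho(3)[OF gc f] .
qed

end

section \<open>Differentials over the residue field\<close>

context graded_subring
begin

abbreviation F2 where "F2 \<equiv> free_module AS (carrier RM \<times> carrier Om)"
abbreviation tn where "tn \<equiv> tensor_null AS RM Om"
abbreviation TT where "TT \<equiv> tensor AS RM Om"
abbreviation pt where "pt \<equiv> pure_tensor AS RM Om"

lemma RM_closed:
  shows "\<lbrakk>u \<in> carrier RM; v \<in> carrier RM\<rbrakk> \<Longrightarrow> u \<oplus>\<^bsub>RM\<^esub> v \<in> carrier RM"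
    and "\<lbrakk>r \<in> carrier AS; u \<in> carrier RM\<rbrakk> \<Longrightarrow> r \<odot>\<^bsub>RM\<^esub> u \<in> carrier RM"
  using residue_module(3,4) S_sub unfolding residue_module(1) by auto

lemma RM_Om_closed:
  "\<forall>u\<in>carrier RM. \<forall>v\<in>carrier RM. u \<oplus>\<^bsub>RM\<^esub> v \<in> carrier RM"
  "\<forall>r\<in>carrier AS. \<forall>u\<in>carrier RM. r \<odot>\<^bsub>RM\<^esub> u \<in> carrier RM"
  "\<forall>u\<in>carrier Om. \<forall>v\<in>carrier Om. u \<oplus>\<^bsub>Om\<^esub> v \<in> carrier Om"
  "\<forall>r\<in>carrier AS. \<forall>u\<in>carrier Om. r \<odot>\<^bsub>Om\<^esub> u \<in> carrier Om"
  by (intro ballI RM_closed Om_closed(2,3); assumption)+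

lemmas tensor_facts = cring.tensor_pure[OF AS_cring, where M = RM and N = Om, OF RM_Om_closed]

lemma F2_module: "module AS F2"
  by (rule cring.free_module_module[OF AS_cring])

lemmas TT_quot = module.quot_submodule[OF F2_module tensor_facts(2), folded tensor_def]

text \<open>The map \<open>u \<otimes> w \<mapsto> eps'(u) rho'(w)\<close> before passing to the tensor product.\<close>

definition lam :: "('c set \<times> ('c \<Rightarrow> 'c) set \<Rightarrow> 'c) \<Rightarrow> 'c"
  where "lam = lin_ext AS (self_module AS) (\<lambda>(u, w). eps' u \<otimes> rho' w)"

lemma eps'_S: "u \<in> carrier RM ==> eps' u \<in> S"
  unfolding residue_module(1) using residue_module(6) eps(1) scalars_S by auto

lemma rho'_mS: "w \<in> carrier Om ==> rho' w \<in> mS"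
  unfolding Om_quot(1) using rho'(1) by auto

lemma lam:
  shows "\<lbrakk>u \<in> carrier RM; w \<in> carrier Om\<rbrakk> \<Longrightarrow> lam (free_gen AS (u, w)) = eps' u \<otimes> rho' w"
    and "\<lbrakk>f \<in> carrier F2; g \<in> carrier F2\<rbrakk> \<Longrightarrow> lam (f \<oplus>\<^bsub>F2\<^esub> g) = lam f \<oplus> lam g"
    and "\<lbrakk>f \<in> carrier F2; g \<in> carrier F2\<rbrakk> \<Longrightarrow> lam (f \<ominus>\<^bsub>F2\<^esub> g) = lam f \<ominus> lam g"
    and "\<lbrakk>r \<in> S; f \<in> carrier F2\<rbrakk> \<Longrightarrow> lam (r \<odot>\<^bsub>F2\<^esub> f) = r \<otimes> lam f"
    and "(\<lambda>(u, w). eps' u \<otimes> rho' w) \<in> carrier RM \<times> carrier Om \<rightarrow> carrier (self_module AS)"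
proof -
  interpret SM: module AS "self_module AS" by (rule AS_module)
  show v: "(\<lambda>(u, w). eps' u \<otimes> rho' w) \<in> carrier RM \<times> carrier Om \<rightarrow> carrier (self_module AS)"
    using eps'_S rho'_mS subringE(6)[OF S_ring] by (auto simp: self_AS)
  have mem: "lam f \<in> S" if "f \<in> carrier F2" for f
    unfolding lam_def using SM.lin_ext_closed[OF v that] by (simp add: self_AS)
  show "lam (free_gen AS (u, w)) = eps' u \<otimes> rho' w" if "u \<in> carrier RM" "w \<in> carrier Om"
    using SM.lin_ext_gen[OF v, of "(u, w)"] that unfolding lam_def by simp
  show "\<lbrakk>f \<in> carrier F2; g \<in> carrier F2\<rbrakk> \<Longrightarrow> lam (f \<oplus>\<^bsub>F2\<^esub> g) = lam f \<oplus> lam g"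
    unfolding lam_def free_module_simps using SM.lin_ext_add[OF v, of f g] by (simp add: self_AS)
  show "\<lbrakk>f \<in> carrier F2; g \<in> carrier F2\<rbrakk> \<Longrightarrow> lam (f \<ominus>\<^bsub>F2\<^esub> g) = lam f \<ominus> lam g"
    using SM.lin_ext_minus[OF v, of f g] mem[of f] mem[of g] AS_minus cring.self_module_minus[OF AS_cring]
    unfolding lam_def by simp
  show "\<lbrakk>r \<in> S; f \<in> carrier F2\<rbrakk> \<Longrightarrow> lam (r \<odot>\<^bsub>F2\<^esub> f) = r \<otimes> lam f"
    unfolding lam_def free_module_simps using SM.lin_ext_smult[OF v, of r f] by (simp add: self_AS)
qed

lemma F2_closed:
  shows "\<lbrakk>u \<in> carrier RM; w \<in> carrier Om\<rbrakk> \<Longrightarrow> free_gen AS (u, w) \<in> carrier F2"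
    and "f \<in> carrier F2 ==> g \<in> carrier F2 ==> f \<oplus>\<^bsub>F2\<^esub> g \<in> carrier F2"
    and "r \<in> S ==> f \<in> carrier F2 ==> r \<odot>\<^bsub>F2\<^esub> f \<in> carrier F2"
proof -
  interpret F: module AS F2 by (rule F2_module)
  show "\<lbrakk>u \<in> carrier RM; w \<in> carrier Om\<rbrakk> \<Longrightarrow> free_gen AS (u, w) \<in> carrier F2"
    by (rule cring.free_gen_carrier[OF AS_cring]) simp
  show "f \<in> carrier F2 ==> g \<in> carrier F2 ==> f \<oplus>\<^bsub>F2\<^esub> g \<in> carrier F2" by (rule F.M.a_closed)
  show "r \<in> S ==> f \<in> carrier F2 ==> r \<odot>\<^bsub>F2\<^esub> f \<in> carrier F2" using F.smult_closed[of r f] by simp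
qed

text \<open>All relations of the tensor product go to \<open>mS2\<close>; for the multiplication of \<open>u\<close> by \<open>r\<close> the error is a
  multiple of \<open>dm r\<close> times a value of \<open>rho'\<close>, both in the maximal ideal.\<close>

lemma lam_tn:
  assumes "f \<in> tn" shows "lam f \<in> mS2"
proof -
  interpret SM: module AS "self_module AS" by (rule AS_module)
  note cl = F2_closed RM_closed Om_closed
  have id1: "p \<otimes> v \<ominus> (p \<otimes> w \<oplus> p \<otimes> w') = p \<otimes> ((v \<ominus> (x \<oplus> y)) \<ominus> ((w \<ominus> x) \<oplus> (w' \<ominus> y)))"
    if "p \<in> carrier A" "w \<in> carrier A" "w' \<in> carrier A" "v \<in> carrier A" "x \<in> carrier A" "y \<in> carrier A" for p v w w' x y
    using that by algebra
  have id2: "p \<otimes> v \<ominus> r \<otimes> (p \<otimes> w) = p \<otimes> ((v \<ominus> r \<otimes> x) \<ominus> r \<otimes> (w \<ominus> x))"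
    if "p \<in> carrier A" "w \<in> carrier A" "v \<in> carrier A" "x \<in> carrier A" "r \<in> carrier A" for p v w x r
    using that by algebra
  have id3: "(q \<otimes> p) \<otimes> w \<ominus> r \<otimes> (p \<otimes> w) = \<ominus> (p \<otimes> ((r \<ominus> q) \<otimes> w))"
    if "w \<in> carrier A" "p \<in> carrier A" "q \<in> carrier A" "r \<in> carrier A" for p q r w
    using that by algebra
  have rel: "g \<in> carrier F2 \<and> lin_ext AS (self_module AS) (\<lambda>(u, w). eps' u \<otimes> rho' w) g \<in> mS2"
    if g: "g \<in> tensor_relations AS RM Om" for g
    unfolding lam_def[symmetric]
  proof
    show "g \<in> carrier F2" using g tensor_facts(1) by blast
    consider (addl) a b w where "a \<in> carrier A" "b \<in> carrier A" "w \<in> carrier Om"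
        "g = free_gen AS ((m +> a) \<oplus>\<^bsub>RM\<^esub> (m +> b), w) \<ominus>\<^bsub>F2\<^esub> (free_gen AS (m +> a, w) \<oplus>\<^bsub>F2\<^esub> free_gen AS (m +> b, w))"
      | (addr) u f h where "u \<in> carrier RM" "f \<in> carrier FS" "h \<in> carrier FS"
        "g = free_gen AS (u, (kn +>\<^bsub>FS\<^esub> f) \<oplus>\<^bsub>Om\<^esub> (kn +>\<^bsub>FS\<^esub> h)) \<ominus>\<^bsub>F2\<^esub>
          (free_gen AS (u, kn +>\<^bsub>FS\<^esub> f) \<oplus>\<^bsub>F2\<^esub> free_gen AS (u, kn +>\<^bsub>FS\<^esub> h))"
      | (smultl) r a w where "r \<in> S" "a \<in> carrier A" "w \<in> carrier Om"
        "g = free_gen AS (r \<odot>\<^bsub>RM\<^esub> (m +> a), w) \<ominus>\<^bsub>F2\<^esub> (r \<odot>\<^bsub>F2\<^esub> free_gen AS (m +> a, w))"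
      | (smultr) r u f where "r \<in> S" "u \<in> carrier RM" "f \<in> carrier FS"
        "g = free_gen AS (u, r \<odot>\<^bsub>Om\<^esub> (kn +>\<^bsub>FS\<^esub> f)) \<ominus>\<^bsub>F2\<^esub> (r \<odot>\<^bsub>F2\<^esub> free_gen AS (u, kn +>\<^bsub>FS\<^esub> f))"
    proof -
      have RMc: "\<exists>a\<in>carrier A. u = m +> a" if "u \<in> carrier RM" for u
        using that unfolding residue_module(1) by blast
      have Omc: "\<exists>f\<in>carrier FS. w = kn +>\<^bsub>FS\<^esub> f" if "w \<in> carrier Om" for w
        using that unfolding Om_quot(1) by blast
      have rc: "carrier AS = S" by simp
      show ?thesis
        using g[unfolded tensor_relations_def Let_def Un_iff mem_Collect_eq rc]
      proof (elim disjE exE conjE)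
        fix u u' w assume g: "g = free_gen AS (u \<oplus>\<^bsub>RM\<^esub> u', w) \<ominus>\<^bsub>F2\<^esub> (free_gen AS (u, w) \<oplus>\<^bsub>F2\<^esub> free_gen AS (u', w))"
          and h: "u \<in> carrier RM" "u' \<in> carrier RM" "w \<in> carrier Om"
        obtain a b where ab: "a \<in> carrier A" "u = m +> a" "b \<in> carrier A" "u' = m +> b" using RMc h by meson
        show ?thesis by (rule addl[OF ab(1,3) h(3) g[unfolded ab(2,4)]])
      next
        fix u w w' assume g: "g = free_gen AS (u, w \<oplus>\<^bsub>Om\<^esub> w') \<ominus>\<^bsub>F2\<^esub> (free_gen AS (u, w) \<oplus>\<^bsub>F2\<^esub> free_gen AS (u, w'))"
          and h: "u \<in> carrier RM" "w \<in> carrier Om" "w' \<in> carrier Om"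
        obtain a b where ab: "a \<in> carrier FS" "w = kn +>\<^bsub>FS\<^esub> a" "b \<in> carrier FS" "w' = kn +>\<^bsub>FS\<^esub> b" using Omc h by meson
        show ?thesis by (rule addr[OF h(1) ab(1,3) g[unfolded ab(2,4)]])
      next
        fix r u w assume g: "g = free_gen AS (r \<odot>\<^bsub>RM\<^esub> u, w) \<ominus>\<^bsub>F2\<^esub> (r \<odot>\<^bsub>F2\<^esub> free_gen AS (u, w))"
          and h: "r \<in> S" "u \<in> carrier RM" "w \<in> carrier Om"
        obtain a where ab: "a \<in> carrier A" "u = m +> a" using RMc h by meson
        show ?thesis by (rule smultl[OF h(1) ab(1) h(3) g[unfolded ab(2)]])
      next
        fix r u w assume g: "g = free_gen AS (u, r \<odot>\<^bsub>Om\<^esub> w) \<ominus>\<^bsub>F2\<^esub> (r \<odot>\<^bsub>F2\<^esub> free_gen AS (u, w))"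
          and h: "r \<in> S" "u \<in> carrier RM" "w \<in> carrier Om"
        obtain a where ab: "a \<in> carrier FS" "w = kn +>\<^bsub>FS\<^esub> a" using Omc h by meson
        show ?thesis by (rule smultr[OF h(1,2) ab(1) g[unfolded ab(2)]])
      qed
    qed
    thus "lam g \<in> mS2"
    proof cases
      case addl
      hence RM: "m +> a \<in> carrier RM" "m +> b \<in> carrier RM" "m +> (a \<oplus> b) \<in> carrier RM"
        unfolding residue_module(1) by auto
      have c: "rho' w \<in> carrier A" "eps a \<in> carrier A" "eps b \<in> carrier A"
        using rho'_mS[OF addl(3)] S_sub eps addl(1,2) by auto
      have "lam g = (eps a \<oplus> eps b) \<otimes> rho' w \<ominus> (eps a \<otimes> rho' w \<oplus> eps b \<otimes> rho' w)"
        unfolding addl(4) using addl(1-3) RM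
        by (simp add: lam cl residue_module(3,6) eps_add_mult(1) del: free_module_simps)
      also have "\<dots> = \<zero>" using c by (simp add: l_distr a_minus_def r_neg)
      finally show ?thesis using mS2(1) by simp
    next
      case addr
      let ?w = "kn +>\<^bsub>FS\<^esub> f" and ?w' = "kn +>\<^bsub>FS\<^esub> h" and ?v = "kn +>\<^bsub>FS\<^esub> (f \<oplus>\<^bsub>FS\<^esub> h)"
      have fh: "f \<oplus>\<^bsub>FS\<^esub> h \<in> carrier FS" by (rule FS_closed(2)[OF addr(2,3)])
      have Om: "?w \<in> carrier Om" "?w' \<in> carrier Om" "?v \<in> carrier Om"
        unfolding Om_quot(1) using addr(2,3) fh by blast+
      note r = rho'(2)[OF addr(2)] rho'(2)[OF addr(3)] rho'(2)[OF fh]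
      have e: "eps' u \<in> S" by (rule eps'_S[OF addr(1)])
      have c: "eps' u \<in> carrier A" "rho' ?w \<in> carrier A" "rho' ?w' \<in> carrier A" "rho' ?v \<in> carrier A"
        "rho f \<in> carrier A" "rho h \<in> carrier A"
        using e rho'_mS[OF Om(1)] rho'_mS[OF Om(2)] rho'_mS[OF Om(3)] rho(5)[OF addr(2)] rho(5)[OF addr(3)] S_sub by auto
      have "lam g = eps' u \<otimes> rho' ?v \<ominus> (eps' u \<otimes> rho' ?w \<oplus> eps' u \<otimes> rho' ?w')"
        unfolding addr(4) Om_quot(2)[OF addr(2,3)] using addr(1) Om by (simp add: lam cl del: free_module_simps)
      also have "\<dots> = eps' u \<otimes> ((rho' ?v \<ominus> (rho f \<oplus> rho h)) \<ominus> ((rho' ?w \<ominus> rho f) \<oplus> (rho' ?w' \<ominus> rho h)))"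
        by (rule id1[OF c])
      also have "\<dots> \<in> mS2"
        using mS2(3)[OF e mS2(7)[OF r(3) mS2(2)[OF r(1,2)]]] unfolding rho(2)[OF addr(2,3)] .
      finally show ?thesis .
    next
      case smultl
      have ra: "r \<in> carrier A" "m +> a \<in> carrier RM" "m +> (r \<otimes> a) \<in> carrier RM" "dm r \<in> carrier A"
        using smultl S_sub eps(4)[of r] unfolding residue_module(1) by auto
      have x: "rho' w \<in> mS" "dm r \<in> mS" "eps a \<in> S" using rho'_mS[OF smultl(3)] dm_mS[OF smultl(1)] eps(1)[OF smultl(2)] scalars_S by auto
      have c: "rho' w \<in> carrier A" "eps a \<in> carrier A" "eps r \<in> carrier A" using x S_sub eps ra by auto
      have "lam g = (eps r \<otimes> eps a) \<otimes> rho' w \<ominus> r \<otimes> (eps a \<otimes> rho' w)"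
        unfolding smultl(4) residue_module(4)[OF ra(1) smultl(2)] using smultl(1-3) ra
        by (simp add: lam cl residue_module(6) eps_add_mult(2) del: free_module_simps)
      also have "\<dots> = \<ominus> (eps a \<otimes> (dm r \<otimes> rho' w))" unfolding dm_def by (rule id3[OF c ra(1)])
      also have "\<dots> \<in> mS2" by (rule mS2(5)[OF mS2(3)[OF x(3) mS2(4)[OF x(2,1)]]])
      finally show ?thesis .
    next
      case smultr
      let ?w = "kn +>\<^bsub>FS\<^esub> f" and ?v = "kn +>\<^bsub>FS\<^esub> (r \<odot>\<^bsub>FS\<^esub> f)"
      have rf: "r \<odot>\<^bsub>FS\<^esub> f \<in> carrier FS" by (rule FS_closed(4)[OF smultr(1,3)])
      have Om: "?w \<in> carrier Om" "?v \<in> carrier Om"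
        unfolding Om_quot(1) using smultr(3) rf by blast+
      note s = rho'(2)[OF smultr(3)] rho'(2)[OF rf]
      have e: "eps' u \<in> S" by (rule eps'_S[OF smultr(2)])
      have c: "eps' u \<in> carrier A" "rho' ?w \<in> carrier A" "rho' ?v \<in> carrier A" "rho f \<in> carrier A" "r \<in> carrier A"
        using e rho'_mS[OF Om(1)] rho'_mS[OF Om(2)] rho(5)[OF smultr(3)] smultr(1) S_sub by auto
      have sm: "r \<odot>\<^bsub>Om\<^esub> ?w = ?v" using Om_quot(3)[OF _ smultr(3), of r] smultr(1) by simp
      have "lam g = eps' u \<otimes> rho' ?v \<ominus> r \<otimes> (eps' u \<otimes> rho' ?w)"
        unfolding smultr(4) sm using smultr(1,2) Om by (simp add: lam cl del: free_module_simps)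
      also have "\<dots> = eps' u \<otimes> ((rho' ?v \<ominus> r \<otimes> rho f) \<ominus> r \<otimes> (rho' ?w \<ominus> rho f))"
        by (rule id2[OF c])
      also have "\<dots> \<in> mS2"
        using mS2(3)[OF e mS2(7)[OF s(2) mS2(3)[OF smultr(1) s(1)]]] unfolding rho(4)[OF smultr(1,3)] .
      finally show ?thesis .
    qed
  qed
  have f: "f \<in> module_span AS F2 (tensor_relations AS RM Om)" using assms by (simp add: tensor_null_def)
  show ?thesis unfolding lam_def by (rule SM.module_span_lin_ext(2)[OF lam(5) mS2_submodule rel f])
qed

abbreviation dd where "dd a \<equiv> pt (m +> \<one>) (kd a)"
abbreviation zT where "zT \<equiv> tn +>\<^bsub>F2\<^esub> (\<lambda>_. \<zero>)"

lemma residue_d_eq: "residue_d K A m S \<one>\<^bsub>RM\<^esub> a = dd a"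
  unfolding residue_d_def residue_module(2) ..

lemma one_RM: "m +> \<one> \<in> carrier RM"
  unfolding residue_module(1) by blast

lemma pt_eq: "pt u w = tn +>\<^bsub>F2\<^esub> free_gen AS (u, w)"
  by (simp add: pure_tensor_def)

lemma pt_closed: "\<lbrakk>u \<in> carrier RM; w \<in> carrier Om\<rbrakk> \<Longrightarrow> pt u w \<in> carrier TT"
  unfolding pt_eq TT_quot(1) using F2_closed(1) by blast

text \<open>Hence \<open>1 \<otimes> da\<close> determines the class of \<open>a\<close> modulo the scalars and the square of the
  maximal ideal.\<close>

lemma dd_eqD:
  assumes ab: "a \<in> S" "b \<in> S" "dd a = dd b"
  shows "dm a \<ominus> dm b \<in> mS2"
proof -
  have kd: "kd a \<in> carrier Om" "kd b \<in> carrier Om" using Om_closed(1) ab by auto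
  note g = F2_closed(1)[OF one_RM kd(1)] F2_closed(1)[OF one_RM kd(2)]
  have "free_gen AS (m +> \<one>, kd a) \<ominus>\<^bsub>F2\<^esub> free_gen AS (m +> \<one>, kd b) \<in> tn"
    using ab(3) TT_quot(4)[OF g] unfolding pt_eq by simp
  from lam_tn[OF this] have l: "eps' (m +> \<one>) \<otimes> rho' (kd a) \<ominus> eps' (m +> \<one>) \<otimes> rho' (kd b) \<in> mS2"
    unfolding lam(3)[OF g] lam(1)[OF one_RM kd(1)] lam(1)[OF one_RM kd(2)] .
  have e: "eps' (m +> \<one>) = \<one>"
    using residue_module(6)[OF one_closed] eps_scalar[OF subringE(3)[OF scalars_ring]] by simp
  have r: "rho' (kd x) \<ominus> dm x \<in> mS2" if "x \<in> S" for x
    using rho'(2)[OF FS_closed(1)[OF that]] unfolding kaehler_d_def rho(1)[OF that] by simp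
  have c: "rho' (kd a) \<in> carrier A" "rho' (kd b) \<in> carrier A" "dm a \<in> carrier A" "dm b \<in> carrier A"
    using rho'_mS[OF kd(1)] rho'_mS[OF kd(2)] eps(4) ab S_sub by auto
  have id: "x \<ominus> y = ((\<one> \<otimes> v \<ominus> \<one> \<otimes> w) \<ominus> (v \<ominus> x)) \<oplus> (w \<ominus> y)"
    if "v \<in> carrier A" "w \<in> carrier A" "x \<in> carrier A" "y \<in> carrier A" for v w x y
    using that by algebra
  have "dm a \<ominus> dm b = ((\<one> \<otimes> rho' (kd a) \<ominus> \<one> \<otimes> rho' (kd b)) \<ominus> (rho' (kd a) \<ominus> dm a)) \<oplus> (rho' (kd b) \<ominus> dm b)"
    by (rule id[OF c])
  also have "\<dots> \<in> mS2" using mS2(2)[OF mS2(7)[OF l[unfolded e] r[OF ab(1)]] r[OF ab(2)]] .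
  finally show ?thesis .
qed

lemma zT:
  shows "\<lbrakk>u \<in> carrier RM; w \<in> carrier Om\<rbrakk> \<Longrightarrow> \<zero> \<odot>\<^bsub>TT\<^esub> pt u w = zT"
    and "X \<in> carrier TT ==> X \<oplus>\<^bsub>TT\<^esub> zT = X" "zT \<in> carrier TT" "r \<in> S ==> r \<odot>\<^bsub>TT\<^esub> zT = zT"
proof -
  interpret F: module AS F2 by (rule F2_module)
  have z: "(\<lambda>_. \<zero>) = \<zero>\<^bsub>F2\<^esub>" "(\<lambda>_. \<zero>) \<in> carrier F2" using F.zero_closed by simp_all
  have zS: "\<zero> \<in> S" using subringE(2)[OF S_ring] .
  show "\<zero> \<odot>\<^bsub>TT\<^esub> pt u w = zT" if "u \<in> carrier RM" "w \<in> carrier Om" for u w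
    using TT_quot(3)[OF _ F2_closed(1)[OF that], of \<zero>] F.smult_l_null[OF F2_closed(1)[OF that]] zS
    unfolding pt_eq z(1) by simp
  show "zT \<in> carrier TT" unfolding TT_quot(1) using z(2) by blast
  show "X \<oplus>\<^bsub>TT\<^esub> zT = X" if "X \<in> carrier TT" for X
    using that TT_quot(2)[OF _ z(2)] F.r_zero unfolding TT_quot(1) z(1) by (auto simp del: free_module_simps)
  show "r \<odot>\<^bsub>TT\<^esub> zT = zT" if "r \<in> S" for r
    using TT_quot(3)[OF _ z(2), of r] F.smult_r_null[of r] that unfolding z(1) by (simp del: free_module_simps)
qed

lemma pt_add: "\<lbrakk>w \<in> carrier Om; w' \<in> carrier Om\<rbrakk> \<Longrightarrow> pt (m +> \<one>) (w \<oplus>\<^bsub>Om\<^esub> w') = pt (m +> \<one>) w \<oplus>\<^bsub>TT\<^esub> pt (m +> \<one>) w'"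
  by (rule tensor_facts(3)[OF one_RM])

text \<open>Only the residue of a coefficient matters.\<close>

lemma pt_coeff:
  assumes "r \<in> S" "r' \<in> S" "r \<ominus> r' \<in> m" and w: "w \<in> carrier Om"
  shows "pt (m +> \<one>) (r \<odot>\<^bsub>Om\<^esub> w) = pt (m +> \<one>) (r' \<odot>\<^bsub>Om\<^esub> w)"
proof -
  have *: "pt (m +> \<one>) (s \<odot>\<^bsub>Om\<^esub> w) = pt (m +> s) w" if "s \<in> S" for s
    using tensor_facts(4,5)[OF _ one_RM w, of s] residue_module(4)[OF _ one_closed, of s] that S_sub by auto
  have "m +> r = m +> r'" using residue_module(5)[of r r'] assms S_sub by auto
  thus ?thesis using *[OF assms(1)] *[OF assms(2)] by simp
qed

lemma pt_m:
  assumes "r \<in> mS" and w: "w \<in> carrier Om"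
  shows "pt (m +> \<one>) (r \<odot>\<^bsub>Om\<^esub> w) = zT"
proof -
  have zS: "\<zero> \<in> S" using subringE(2)[OF S_ring] .
  have "pt (m +> \<one>) (r \<odot>\<^bsub>Om\<^esub> w) = pt (m +> \<one>) (\<zero> \<odot>\<^bsub>Om\<^esub> w)"
    by (rule pt_coeff[OF _ zS _ w]) (use assms m_sub in \<open>auto simp: a_minus_def\<close>)
  also have "\<dots> = zT" using tensor_facts(5)[OF _ one_RM w, of \<zero>] zT(1)[OF one_RM w] zS by simp
  finally show ?thesis .
qed

lemma dd_rules:
  shows "\<lbrakk>a \<in> S; b \<in> S\<rbrakk> \<Longrightarrow> dd (a \<oplus> b) = dd a \<oplus>\<^bsub>TT\<^esub> dd b"
    and "c \<in> scalars K A ==> dd c = zT"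
    and "\<lbrakk>c \<in> scalars K A; a \<in> S\<rbrakk> \<Longrightarrow> dd (c \<otimes> a) = pt (m +> \<one>) (c \<odot>\<^bsub>Om\<^esub> kd a)"
    and "a \<in> S ==> dd (dm a) = dd a"
    and "a \<in> mS2 ==> dd a = zT"
proof -
  show add: "dd (a \<oplus> b) = dd a \<oplus>\<^bsub>TT\<^esub> dd b" if "a \<in> S" "b \<in> S" for a b
    unfolding kd_rules(1)[OF that] by (rule pt_add[OF Om_closed(1)[OF that(1)] Om_closed(1)[OF that(2)]])
  show scal: "dd c = zT" if c: "c \<in> scalars K A" for c
  proof -
    have k: "kd c \<in> carrier Om" using c scalars_S Om_closed(1) by auto
    have "dd c = pt (m +> \<one>) (\<zero> \<odot>\<^bsub>Om\<^esub> kd c)" by (subst kd_rules(3)[OF c]) (rule refl)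
    also have "\<dots> = zT" by (rule pt_m[OF _ k]) (use J_zero[of 1] subringE(2)[OF S_ring] in \<open>simp add: J_1\<close>)
    finally show ?thesis .
  qed
  show "dd (c \<otimes> a) = pt (m +> \<one>) (c \<odot>\<^bsub>Om\<^esub> kd a)" if c: "c \<in> scalars K A" and a: "a \<in> S" for c a
  proof -
    have cS: "c \<in> S" using c scalars_S by auto
    have k: "kd c \<in> carrier Om" "kd a \<in> carrier Om" using cS a Om_closed(1) by auto
    have ck: "c \<odot>\<^bsub>Om\<^esub> kd a \<in> carrier Om" "a \<odot>\<^bsub>Om\<^esub> kd c \<in> carrier Om" using Om_closed(3) k cS a by auto
    have "pt (m +> \<one>) (a \<odot>\<^bsub>Om\<^esub> kd c) = a \<odot>\<^bsub>TT\<^esub> dd c" using tensor_facts(5)[OF _ one_RM k(1), of a] a by simp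
    also have "\<dots> = zT" unfolding scal[OF c] by (rule zT(4)[OF a])
    finally show ?thesis
      unfolding kd_rules(2)[OF cS a] pt_add[OF ck] using zT(2)[OF pt_closed[OF one_RM ck(1)]] by simp
  qed
  show "dd (dm a) = dd a" if a: "a \<in> S" for a
  proof -
    have c: "a \<in> carrier A" "dm a \<in> S" "eps a \<in> S" "eps a \<in> scalars K A" "dm a \<in> carrier A" "eps a \<in> carrier A"
      using a S_sub dm_mS[OF a] eps(1,3,4)[of a] scalars_S by auto
    have "a = dm a \<oplus> eps a" unfolding dm_def using c(1,6) by algebra
    hence "dd a = dd (dm a) \<oplus>\<^bsub>TT\<^esub> dd (eps a)" using add[OF c(2,3)] by simp
    thus ?thesis unfolding scal[OF c(4)] zT(2)[OF pt_closed[OF one_RM Om_closed(1)[OF c(2)]]] by simp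
  qed
  have "a \<in> S \<and> dd a = zT" if "a \<in> mS2" for a
    using that
  proof (induct rule: ideal_prod.induct)
    case (prod i j)
    hence ij: "i \<in> S" "j \<in> S" "kd i \<in> carrier Om" "kd j \<in> carrier Om" using Om_closed(1) by auto
    have ck: "i \<odot>\<^bsub>Om\<^esub> kd j \<in> carrier Om" "j \<odot>\<^bsub>Om\<^esub> kd i \<in> carrier Om" using Om_closed(3) ij by auto
    have "dd (i \<otimes> j) = zT"
      unfolding kd_rules(2)[OF ij(1,2)] pt_add[OF ck] pt_m[OF prod(1) ij(4)] pt_m[OF prod(2) ij(3)]
      by (rule zT(2)[OF zT(3)])
    thus ?case using subringE(6)[OF S_ring ij(1,2)] by simp
  next
    case (sum s1 s2)
    thus ?case using add[of s1 s2] zT(2)[OF zT(3)] subringE(7)[OF S_ring] by simp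
  qed
  thus "a \<in> mS2 ==> dd a = zT" by blast
qed

text \<open>Every element of the module is \<open>1 \<otimes> da\<close> with \<open>a\<close> in the maximal ideal, as all scalars can be
  moved into \<open>a\<close>.\<close>

lemma pt_dd:
  assumes "w \<in> carrier Om"
  shows "\<exists>a\<in>mS. pt (m +> \<one>) w = dd a"
proof -
  interpret F: module AS FS by (rule FS_module)
  have zS: "\<zero> \<in> mS" "\<zero> \<in> scalars K A" using J_zero[of 1] subringE(2)[OF S_ring] subringE(2)[OF scalars_ring]
    by (auto simp: J_1)
  obtain f where f: "f \<in> carrier FS" "w = kn +>\<^bsub>FS\<^esub> f" using assms unfolding Om_quot(1) by blast
  have "\<exists>a\<in>mS. pt (m +> \<one>) (kn +>\<^bsub>FS\<^esub> f) = dd a"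
    using f(1)
  proof (induct f rule: cring.free_module_induct[OF AS_cring, consumes 1])
    case 1
    have k: "kd \<zero> \<in> carrier Om" using Om_closed(1) zS by auto
    have "\<zero> \<odot>\<^bsub>Om\<^esub> kd \<zero> = kn +>\<^bsub>FS\<^esub> (\<lambda>_. \<zero>)"
      unfolding kaehler_d_def using Om_quot(3)[OF _ FS_closed(1), of \<zero> \<zero>] F.smult_l_null[OF FS_closed(1), of \<zero>] zS by simp
    hence "pt (m +> \<one>) (kn +>\<^bsub>FS\<^esub> (\<lambda>_. \<zero>\<^bsub>AS\<^esub>)) = dd \<zero>" using pt_m[OF zS(1) k] dd_rules(2)[OF zS(2)] by simp
    thus ?case using zS(1) by blast
  next
    case (2 f r s)
    then obtain a where a: "a \<in> mS" "pt (m +> \<one>) (kn +>\<^bsub>FS\<^esub> f) = dd a" by blast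
    have rs: "r \<in> S" "s \<in> S" "eps r \<in> S" "eps r \<in> scalars K A" "r \<ominus> eps r \<in> m"
      using 2(3,4) eps[of r] scalars_S S_sub unfolding dm_def by auto
    have g: "free_gen AS s \<in> carrier FS" "kd s \<in> carrier Om" by (rule FS_closed(1)[OF rs(2)], rule Om_closed(1)[OF rs(2)])
    have es: "eps r \<otimes> s \<in> S" by (rule subringE(6)[OF S_ring rs(3,2)])
    have wo: "kn +>\<^bsub>FS\<^esub> f \<in> carrier Om" "r \<odot>\<^bsub>Om\<^esub> kd s \<in> carrier Om"
      using 2(1) Om_closed(3)[OF _ g(2)] rs(1) unfolding Om_quot(1) by auto
    have "kn +>\<^bsub>FS\<^esub> (\<lambda>t. f t \<oplus>\<^bsub>AS\<^esub> r \<otimes>\<^bsub>AS\<^esub> free_gen AS s t) = (kn +>\<^bsub>FS\<^esub> f) \<oplus>\<^bsub>Om\<^esub> r \<odot>\<^bsub>Om\<^esub> kd s"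
      unfolding kaehler_d_def using Om_quot(2)[OF 2(1) FS_closed(4)[OF rs(1) g(1)]] Om_quot(3)[OF 2(3) g(1)] by simp
    hence "pt (m +> \<one>) (kn +>\<^bsub>FS\<^esub> (\<lambda>t. f t \<oplus>\<^bsub>AS\<^esub> r \<otimes>\<^bsub>AS\<^esub> free_gen AS s t)) = dd a \<oplus>\<^bsub>TT\<^esub> pt (m +> \<one>) (r \<odot>\<^bsub>Om\<^esub> kd s)"
      using pt_add[OF wo] a(2) by simp
    also have "\<dots> = dd a \<oplus>\<^bsub>TT\<^esub> dd (dm (eps r \<otimes> s))"
      using pt_coeff[OF rs(1,3,5) g(2)] dd_rules(3)[OF rs(4,2)] dd_rules(4)[OF es] by simp
    also have "\<dots> = dd (a \<oplus> dm (eps r \<otimes> s))" using dd_rules(1)[of a] a(1) dm_mS[OF es] by simp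
    finally show ?case using a(1) dm_mS[OF es] m_closed(1) subringE(7)[OF S_ring] by blast
  qed
  thus ?thesis using f(2) by simp
qed

text \<open>All coefficients, also those in \<open>A/m\<close>, can be replaced by scalars and moved into \<open>\<Omega>\<close>.\<close>

lemma TT_dd:
  assumes "X \<in> carrier TT"
  shows "\<exists>a\<in>mS. X = dd a"
proof -
  have zS: "\<zero> \<in> mS" "\<zero> \<in> scalars K A" using J_zero[of 1] subringE(2)[OF S_ring] subringE(2)[OF scalars_ring]
    by (auto simp: J_1)
  obtain f where f: "f \<in> carrier F2" "X = tn +>\<^bsub>F2\<^esub> f" using assms unfolding TT_quot(1) by blast
  have "\<exists>a\<in>mS. tn +>\<^bsub>F2\<^esub> f = dd a"
    using f(1)
  proof (induct f rule: cring.free_module_induct[OF AS_cring, consumes 1])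
    case 1
    thus ?case using zS dd_rules(2)[OF zS(2)] by auto
  next
    case (2 f r s)
    then obtain a where a: "a \<in> mS" "tn +>\<^bsub>F2\<^esub> f = dd a" by blast
    obtain b w where s: "s = (m +> b, w)" "b \<in> carrier A" "w \<in> carrier Om" using 2(4) unfolding residue_module(1) by blast
    have c: "r \<in> carrier AS" "eps b \<in> carrier AS" "eps b \<in> carrier A" using 2(3) eps(1,3)[OF s(2)] scalars_S by auto
    have u: "m +> b = eps b \<odot>\<^bsub>RM\<^esub> (m +> \<one>)" "m +> b \<in> carrier RM"
      using residue_module(4)[OF c(3) one_closed] residue_module(5)[OF s(2) c(3)] eps(2)[OF s(2)] c(3) s(2)
      unfolding residue_module(1) dm_def by auto
    have g: "free_gen AS s \<in> carrier F2" unfolding s(1) by (rule F2_closed(1)[OF u(2) s(3)])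
    have w: "eps b \<odot>\<^bsub>Om\<^esub> w \<in> carrier Om" "r \<odot>\<^bsub>Om\<^esub> (eps b \<odot>\<^bsub>Om\<^esub> w) \<in> carrier Om"
      by (rule Om_closed(3)[OF c(2) s(3)], rule Om_closed(3)[OF c(1) Om_closed(3)[OF c(2) s(3)]])
    obtain a' where a': "a' \<in> mS" "pt (m +> \<one>) (r \<odot>\<^bsub>Om\<^esub> (eps b \<odot>\<^bsub>Om\<^esub> w)) = dd a'" using pt_dd[OF w(2)] by blast
    have "r \<odot>\<^bsub>TT\<^esub> (tn +>\<^bsub>F2\<^esub> free_gen AS s) = dd a'"
      unfolding s(1) pt_eq[symmetric] u(1) tensor_facts(4)[OF c(2) one_RM s(3)] tensor_facts(5)[OF c(2) one_RM s(3), symmetric]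
        tensor_facts(5)[OF c(1) one_RM w(1), symmetric] by (rule a'(2))
    hence "tn +>\<^bsub>F2\<^esub> (\<lambda>t. f t \<oplus>\<^bsub>AS\<^esub> r \<otimes>\<^bsub>AS\<^esub> free_gen AS s t) = dd a \<oplus>\<^bsub>TT\<^esub> dd a'"
      using TT_quot(2)[OF 2(1) F2_closed(3)[OF _ g, of r]] TT_quot(3)[OF 2(3) g] a(2) c(1) by simp
    also have "\<dots> = dd (a \<oplus> a')" using dd_rules(1)[of a a'] a(1) a'(1) by simp
    finally show ?case using a(1) a'(1) m_closed(1) subringE(7)[OF S_ring] by blast
  qed
  thus ?thesis using f(2) by simp
qed

end

context graded_symmetric
begin

lemma full_subring: "graded_subring K A m \<tau> (carrier A)"
  by unfold_locales (use ring.carrier_is_subring[OF ring_M] scalars_sub in auto)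

lemma cotangent_map_class:
  assumes a: "a \<in> m"
  shows "cotangent_map K A m (J 2 +> a) = residue_d K A m (carrier A) \<one>\<^bsub>RM\<^esub> a"
proof -
  interpret F: graded_subring K A m \<tau> "carrier A" by (rule full_subring)
  have ac: "a \<in> carrier A" using a m_sub by auto
  have J2: "F.mS2 = J 2" using m_sub ideal_prod_one[OF m_ideal] by (simp add: ideal_power.simps(2) numeral_2_eq_2 Int_absorb1)
  have "F.dd u = F.dd a" if u: "u \<in> J 2 +> a" for u
  proof -
    obtain h where h: "h \<in> J 2" "u = h \<oplus> a" using u unfolding a_r_coset_def' by blast
    have hc: "h \<in> carrier A" using h J_sub by blast
    have "F.dd u = F.zT \<oplus>\<^bsub>F.TT\<^esub> F.dd a"
      unfolding h(2) F.dd_rules(1)[OF hc ac] using F.dd_rules(5)[of h] h(1) J2 by simp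
    also have "F.zT = F.dd \<zero>" using F.dd_rules(2)[of \<zero>] subringE(2)[OF scalars_ring] by simp
    also have "F.dd \<zero> \<oplus>\<^bsub>F.TT\<^esub> F.dd a = F.dd a" using F.dd_rules(1)[OF zero_closed ac] ac by simp
    finally show ?thesis .
  qed
  hence "(\<Union>u\<in>J 2 +> a. F.dd u) = (\<Union>u\<in>J 2 +> a. F.dd a)" by (rule SUP_cong[OF refl])
  moreover have "a \<in> J 2 +> a"
    using J_zero[of 2] ac unfolding a_r_coset_def' by force
  ultimately show ?thesis unfolding cotangent_map_def F.residue_d_eq by auto
qed

text \<open>Surjective as every tensor is some \<open>1 \<otimes> da\<close>, injective as \<open>1 \<otimes> da\<close> determines \<open>a\<close> modulo \<open>m\<^sup>2\<close>.\<close>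

lemma cotangent_map_bij:
  "bij_betw (cotangent_map K A m) (carrier Cot) (carrier (residue_kaehler K A m (carrier A)))"
proof -
  interpret F: graded_subring K A m \<tau> "carrier A" by (rule full_subring)
  have J2: "F.mS2 = J 2" using m_sub ideal_prod_one[OF m_ideal] by (simp add: ideal_power.simps(2) numeral_2_eq_2 Int_absorb1)
  have T: "residue_kaehler K A m (carrier A) = F.TT" by (simp add: residue_kaehler_def)
  show ?thesis
    unfolding bij_betw_def inj_on_def T
  proof (intro conjI, intro ballI impI)
    fix X Y assume "X \<in> carrier Cot" "Y \<in> carrier Cot" and eq: "cotangent_map K A m X = cotangent_map K A m Y"
    then obtain a b where ab: "a \<in> m" "X = J 2 +> a" "b \<in> m" "Y = J 2 +> b" unfolding Cot_carrier by blast
    have c: "a \<in> carrier A" "b \<in> carrier A" using ab m_sub by auto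
    have "F.dd a = F.dd b" using eq unfolding ab(2,4) cotangent_map_class[OF ab(1)] cotangent_map_class[OF ab(3)] F.residue_d_eq .
    from F.dd_eqD[OF c this] have "a \<ominus> b \<in> J 2" unfolding dm_m[OF ab(1)] dm_m[OF ab(3)] J2 .
    thus "X = Y" unfolding ab using cl_eq_iff[OF c, of 1] by (simp add: numeral_2_eq_2)
  next
   show "cotangent_map K A m ` carrier Cot = carrier F.TT"
   proof (intro equalityI subsetI)
    fix T assume "T \<in> cotangent_map K A m ` carrier Cot"
    then obtain a where a: "a \<in> m" "T = F.dd a"
      unfolding Cot_carrier using cotangent_map_class F.residue_d_eq by auto
    thus "T \<in> carrier F.TT" using F.pt_closed[OF F.one_RM F.Om_closed(1)] m_sub by auto
  next
    fix T assume "T \<in> carrier F.TT"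
    from F.TT_dd[OF this] obtain a where a: "a \<in> m" "T = F.dd a" by blast
    hence "T = cotangent_map K A m (J 2 +> a)" using cotangent_map_class F.residue_d_eq by auto
    thus "T \<in> cotangent_map K A m ` carrier Cot" unfolding Cot_carrier using a(1) by blast
   qed
  qed
qed

lemma dx_bar_class:
  assumes a: "a \<in> carrier A"
  shows "dx_bar K A m a = J 2 +> dm a"
proof -
  interpret F: graded_subring K A m \<tau> "carrier A" by (rule full_subring)
  have C: "J 2 +> dm a \<in> carrier Cot" unfolding Cot_carrier using eps(2)[OF a] by blast
  have "residue_d K A m (carrier A) \<one>\<^bsub>RM\<^esub> a = cotangent_map K A m (J 2 +> dm a)"
    unfolding cotangent_map_class[OF eps(2)[OF a]] F.residue_d_eq F.dd_rules(4)[OF a] ..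
  thus ?thesis unfolding dx_bar_def using inv_into_f_f[OF bij_betw_imp_inj_on[OF cotangent_map_bij] C] by simp
qed

end

context graded_subring
begin

text \<open>Injectivity of the natural map: an element of \<open>S\<close> whose differential vanishes in
  \<open>A/m \<otimes> \<Omega>\<^bsub>A/K\<^esub>\<close> already has a vanishing differential over \<open>S\<close>.\<close>

lemma natural_map_injective:
  assumes nat: "is_natural_map K A m S \<phi>" and inj: "inj_on \<phi> (carrier (residue_kaehler K A m S))"
    and a: "a \<in> S" "a \<in> J 2"
  shows "a \<in> mS2"
proof -
  interpret F: graded_subring K A m \<tau> "carrier A" by (rule full_subring)
  have J2: "F.mS2 = J 2" using m_sub ideal_prod_one[OF m_ideal] by (simp add: ideal_power.simps(2) numeral_2_eq_2 Int_absorb1)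
  have zS: "\<zero> \<in> S" "\<zero> \<in> scalars K A" using subringE(2)[OF S_ring] subringE(2)[OF scalars_ring] .
  have am: "a \<in> m" using a(2) J_mono[of 1 2] J_1 by auto
  have one: "\<one>\<^bsub>RM\<^esub> \<in> carrier RM" unfolding residue_module(2) by (rule one_RM)
  have \<phi>: "\<phi> (dd x) = F.dd x" if "x \<in> S" for x
    using nat one that unfolding is_natural_map_def residue_d_eq[symmetric] F.residue_d_eq[symmetric] by blast
  have "F.dd a = F.dd \<zero>" using F.dd_rules(5)[of a] F.dd_rules(2)[OF zS(2)] a(2) J2 by simp
  hence "\<phi> (dd a) = \<phi> (dd \<zero>)" using \<phi> a(1) zS(1) by simp
  hence "dd a = dd \<zero>"
    using inj pt_closed[OF one_RM Om_closed(1)] a(1) zS(1) unfolding inj_on_def residue_kaehler_def by blast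
  from dd_eqD[OF a(1) zS(1) this] have "a \<ominus> \<zero> \<in> mS2" unfolding dm_m[OF am] dm_scalar[OF zS(2)] .
  thus ?thesis using am m_sub by (auto simp: a_minus_def)
qed

end

section \<open>Coordinates in the cotangent space\<close>

lemma (in ring) exists_independent_sublist:
  assumes K: "subfield K R"
  shows "set Us \<subseteq> carrier R ==> \<exists>Vs. set Vs \<subseteq> set Us \<and> independent K Vs \<and> set Us \<subseteq> Span K Vs"
proof (induction Us)
  case Nil
  thus ?case using li_Nil by (intro exI[of _ "[]"]) simp
next
  case (Cons u Us)
  then obtain Vs where Vs: "set Vs \<subseteq> set Us" "independent K Vs" "set Us \<subseteq> Span K Vs" by auto
  have c: "set Vs \<subseteq> carrier R" "u \<in> carrier R" using Vs(1) Cons.prems by auto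
  show ?case
  proof (cases "u \<in> Span K Vs")
    case True
    thus ?thesis using Vs by (intro exI[of _ Vs]) auto
  next
    case False
    have i: "independent K (u # Vs)" by (rule li_Cons[OF c(2) False Vs(2)])
    have "Span K Vs \<subseteq> Span K (u # Vs)" "u \<in> Span K (u # Vs)"
      using mono_Span[OF K c] Span_base_incl[OF K, of "u # Vs"] c by auto
    thus ?thesis using Vs i by (intro exI[of _ "u # Vs"]) (auto simp del: Span.simps)
  qed
qed

lemma (in ring) Span_subset:
  assumes "\<zero> \<in> V" "\<And>u v. u \<in> V ==> v \<in> V ==> u \<oplus> v \<in> V" "\<And>k u. k \<in> K ==> u \<in> set Us ==> k \<otimes> u \<in> V"
  shows "Span K Us \<subseteq> V"
  using assms(3)
proof (induction Us)
  case (Cons u Us)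
  hence V: "Span K Us \<subseteq> V" "\<And>k. k \<in> K ==> k \<otimes> u \<in> V" by auto
  show ?case
  proof
    fix w assume "w \<in> Span K (u # Us)"
    then obtain k v where "k \<in> K" "v \<in> Span K Us" "w = k \<otimes> u \<oplus> v"
      using line_extension_mem_iff[of w K u "Span K Us"] by auto
    thus "w \<in> V" using assms(2) V by blast
  qed
qed (simp add: assms(1))

lemma (in ring) subring_fractions:
  assumes R: "cring R" and S: "subring S R" and T: "T \<subseteq> S" "T \<subseteq> Units R" "\<one> \<in> T" "\<And>s t. s \<in> T ==> t \<in> T ==> s \<otimes> t \<in> T"
  shows "subring (fractions_in R S T) R"
proof -
  interpret R: cring R by (rule R)
  note SE = subringE[OF S]
  have c: "b \<in> S ==> b \<in> carrier R" "s \<in> T ==> s \<in> carrier R" "s \<in> T ==> s \<in> Units R" "s \<in> T ==> inv s \<in> carrier R" for b s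
    using SE(1) T(1,2) by auto
  have I: "b \<otimes> inv s \<in> fractions_in R S T" if "b \<in> S" "s \<in> T" for b s
    using that unfolding fractions_in_def by blast
  have E: "\<exists>b\<in>S. \<exists>s\<in>T. x = b \<otimes> inv s" if "x \<in> fractions_in R S T" for x
    using that unfolding fractions_in_def by blast
  have inv: "inv (s \<otimes> t) = inv s \<otimes> inv t" if "s \<in> T" "t \<in> T" for s t
  proof (rule R.comm_inv_char)
    have "(s \<otimes> t) \<otimes> (inv s \<otimes> inv t) = (s \<otimes> inv s) \<otimes> (t \<otimes> inv t)"
      using that c(2,4) by (simp add: R.m_ac)
    thus "(s \<otimes> t) \<otimes> (inv s \<otimes> inv t) = \<one>" using c(3)[OF that(1)] c(3)[OF that(2)] by simp
  qed (use that c(2,4) in auto)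
  show ?thesis
  proof (rule subringI)
    show "fractions_in R S T \<subseteq> carrier R" using E c by fastforce
    have "\<one> = \<one> \<otimes> inv \<one>" by simp
    thus "\<one> \<in> fractions_in R S T" using I[OF SE(3) T(3)] by simp
  next
    fix x assume "x \<in> fractions_in R S T"
    then obtain b s where b: "b \<in> S" "s \<in> T" "x = b \<otimes> inv s" using E by blast
    hence "\<ominus> x = (\<ominus> b) \<otimes> inv s" using c by (simp add: l_minus)
    thus "\<ominus> x \<in> fractions_in R S T" using I[OF SE(5)[OF b(1)] b(2)] by simp
  next
    fix x x' assume "x \<in> fractions_in R S T" "x' \<in> fractions_in R S T"
    then obtain b s b' s' where b: "b \<in> S" "s \<in> T" "x = b \<otimes> inv s" "b' \<in> S" "s' \<in> T" "x' = b' \<otimes> inv s'" using E by meson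
    have cc: "b \<in> carrier R" "s \<in> carrier R" "b' \<in> carrier R" "s' \<in> carrier R" "inv s \<in> carrier R" "inv s' \<in> carrier R"
      using c b by auto
    note i = inv[OF b(2,5)] and U = c(3)[OF b(2)] c(3)[OF b(5)]
    have "x \<otimes> x' = (b \<otimes> b') \<otimes> inv (s \<otimes> s')" unfolding b i using cc by (simp add: R.m_ac)
    thus "x \<otimes> x' \<in> fractions_in R S T" using I[OF SE(6)[OF b(1,4)] T(4)[OF b(2,5)]] by simp
    have "(b \<otimes> s' \<oplus> b' \<otimes> s) \<otimes> inv (s \<otimes> s') = (s' \<otimes> inv s') \<otimes> (b \<otimes> inv s) \<oplus> (s \<otimes> inv s) \<otimes> (b' \<otimes> inv s')"
      unfolding i using cc by (simp add: R.m_ac l_distr r_distr)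
    hence "x \<oplus> x' = (b \<otimes> s' \<oplus> b' \<otimes> s) \<otimes> inv (s \<otimes> s')" unfolding b using U cc by simp
    thus "x \<oplus> x' \<in> fractions_in R S T"
      using I[OF SE(7)[OF SE(6)[OF b(1)] SE(6)[OF b(4)]] T(4)[OF b(2,5)]] b T(1) by auto
  qed
qed

context graded_symmetric
begin

lemma scalar_inj: "c \<in> carrier K ==> c \<odot> \<one> = \<zero> ==> c = \<zero>\<^bsub>K\<^esub>"
proof (rule ccontr)
  assume c: "c \<in> carrier K" "c \<odot> \<one> = \<zero>" "c \<noteq> \<zero>\<^bsub>K\<^esub>"
  hence "c \<in> Units K" using K.field_Units by simp
  hence "\<one> = inv\<^bsub>K\<^esub> c \<odot> (c \<odot> \<one>)" using smult_assoc1[of "inv\<^bsub>K\<^esub> c" c \<one>] c(1) by simp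
  also have "\<dots> = \<zero>" unfolding c(2) using \<open>c \<in> Units K\<close> by (simp add: smult_r_null)
  finally show False using one_notin_m J_zero[of 1] unfolding J_1 by simp
qed

lemma combine_finsum:
  assumes "y \<in> {..<n} \<rightarrow> carrier A" "\<forall>i<n. c i \<in> carrier K"
  shows "combine (map (\<lambda>i. c i \<odot> \<one>) [0..<n]) (map y [0..<n]) = finsum A (\<lambda>i. c i \<odot> y i) {..<n}"
  using assms
proof (induction n)
  case (Suc n)
  have cy: "c i \<odot> \<one> \<in> carrier A" "y i \<in> carrier A" "c i \<odot> y i \<in> carrier A" if "i < Suc n" for i
    using Suc.prems that by auto
  have "combine (map (\<lambda>i. c i \<odot> \<one>) [0..<n] @ [c n \<odot> \<one>]) (map y [0..<n] @ [y n]) =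
      combine (map (\<lambda>i. c i \<odot> \<one>) [0..<n]) (map y [0..<n]) \<oplus> combine [c n \<odot> \<one>] [y n]"
    by (rule combine_append[symmetric]) (use cy in auto)
  also have "\<dots> = finsum A (\<lambda>i. c i \<odot> y i) {..<n} \<oplus> c n \<odot> y n"
  proof -
    have "combine (map (\<lambda>i. c i \<odot> \<one>) [0..<n]) (map y [0..<n]) = finsum A (\<lambda>i. c i \<odot> y i) {..<n}"
      by (rule Suc.IH) (use Suc.prems in auto)
    thus ?thesis using smult_eq_mult[of "c n" "y n"] cy[of n] Suc.prems(2) by simp
  qed
  also have "\<dots> = finsum A (\<lambda>i. c i \<odot> y i) {..<Suc n}"
  proof -
    have "finsum A (\<lambda>i. c i \<odot> y i) {..<n} \<in> carrier A" by (rule finsum_closed) (use cy in auto)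
    moreover have "finsum A (\<lambda>i. c i \<odot> y i) {..<Suc n} = c n \<odot> y n \<oplus> finsum A (\<lambda>i. c i \<odot> y i) {..<n}"
      unfolding lessThan_Suc by (rule finsum_insert) (use cy in auto)
    ultimately show ?thesis using a_comm cy(3)[of n] by simp
  qed
  finally show ?case by simp
qed simp

abbreviation QQ where "QQ \<equiv> quot_module A (J 2)"
abbreviation cc where "cc a \<equiv> J 2 +> a"

lemma cc_eq: "a \<in> carrier A ==> b \<in> carrier A ==> cc a = cc b \<longleftrightarrow> a \<ominus> b \<in> J 2"
  using cl_eq_iff[of a b 1] by (simp add: numeral_2_eq_2)

lemma QQ_ring: "ring QQ"
proof -
  have "ring (A Quot J 2)" by (rule ideal.quotient_is_ring[OF J_ideal])
  moreover have "ring QQ = ring (A Quot J 2)"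
    unfolding ring_def abelian_group_def abelian_monoid_def abelian_group_axioms_def ring_axioms_def monoid_def
      comm_group_def comm_monoid_def group_def comm_monoid_axioms_def group_axioms_def Units_def
    by (simp add: quot_module_def)
  ultimately show ?thesis by simp
qed

lemma QQ_hom: "ring_hom_ring A QQ cc"
  by (rule ring_hom_ringI[OF ring_M QQ_ring])
    (simp_all add: quot_module_ops(1-3)[OF J_ideal R.zero_closed] quot_module_ops(5)[OF J_ideal R.zero_closed one_closed one_closed])

lemma QQ_scalars: "scalars K QQ = cc ` scalars K A"
proof -
  have "c \<odot>\<^bsub>QQ\<^esub> \<one>\<^bsub>QQ\<^esub> = cc (c \<odot> \<one>)" if "c \<in> carrier K" for c
    using quot_module_ops(4,5)[OF J_ideal that one_closed one_closed] by simp
  thus ?thesis unfolding scalars_def image_image by (rule image_cong[OF refl])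
qed

lemma QQ_subfield: "subfield (scalars K QQ) QQ"
proof -
  have "\<one>\<^bsub>QQ\<^esub> \<noteq> \<zero>\<^bsub>QQ\<^esub>"
  proof
    assume "\<one>\<^bsub>QQ\<^esub> = \<zero>\<^bsub>QQ\<^esub>"
    hence "cc \<one> = cc \<zero>" using quot_module_ops(5,6)[OF J_ideal R.zero_closed one_closed one_closed] by simp
    hence "\<one> \<in> J 2" using cc_eq[of \<one> \<zero>] by (simp add: a_minus_def)
    thus False using one_notin_m J_mono[of 1 2] J_1 by auto
  qed
  thus ?thesis unfolding QQ_scalars by (rule ring_hom_ring.img_is_subfield(2)[OF QQ_hom scalars_subfield])
qed

text \<open>The span in the cotangent space, defined by submodules, is the span of cosets in the algebra \<open>A/m\<^sup>2\<close>, in which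
  dimension is measured.\<close>

lemma module_span_Cot:
  assumes us: "set us \<subseteq> m" and X: "cc ` set us \<subseteq> X" "X \<subseteq> ring.Span QQ (scalars K QQ) (map cc us)"
  shows "module_span K Cot X = ring.Span QQ (scalars K QQ) (map cc us)"
proof -
  interpret Q: ring QQ by (rule QQ_ring)
  interpret h: ring_hom_ring A QQ cc by (rule QQ_hom)
  note kf = scalars_subfield
  have uc: "set us \<subseteq> carrier A" using us m_sub by auto
  let ?W = "Span (scalars K A) us"
  have W: "Q.Span (scalars K QQ) (map cc us) = cc ` ?W"
    unfolding QQ_scalars by (rule h.Span_hom[OF scalars_sub uc])
  have "?W \<subseteq> m"
  proof (rule Span_subset)
    show "k \<otimes> u \<in> m" if "k \<in> scalars K A" "u \<in> set us" for k u
      by (rule ideal.I_l_closed[OF m_ideal]) (use that us scalars_sub in blast)+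
  qed (use J_zero[of 1] m_closed(1) J_1 in auto)
  hence Wm: "w \<in> m" if "w \<in> ?W" for w using that by blast
  note Wc = Span_subgroup_props[OF kf uc] and Ws = Span_smult_closed[OF kf uc]
  have sc: "c \<odot> w \<in> ?W" if "c \<in> carrier K" "w \<in> ?W" for c w
  proof -
    have "w \<in> carrier A" using that(2) Wc(1) by blast
    thus ?thesis using Ws[OF _ that(2), of "c \<odot> \<one>"] smult_eq_mult[OF that(1), of w] that(1) by (simp add: scalars_def)
  qed
  show ?thesis
    unfolding W
  proof (rule equalityI)
    have ops: "cc a \<oplus>\<^bsub>Cot\<^esub> cc b = cc (a \<oplus> b)" "r \<in> carrier K ==> r \<odot>\<^bsub>Cot\<^esub> cc a = cc (r \<odot> a)"
      if "a \<in> carrier A" "b \<in> carrier A" for a b r using Cot_add[OF that] Cot_smult[OF _ that(1)] by auto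
    have Cot0: "\<zero>\<^bsub>Cot\<^esub> = cc \<zero>" using GP_simps(2)[of 1] cl_zero[of 1] by (simp add: numeral_2_eq_2)
    have C1: "cc w \<in> carrier Cot" if "w \<in> m" for w unfolding Cot_carrier using that by blast
    have CM: "abelian_monoid Cot" by (rule GP_abelian_monoid)
    have "submodule (cc ` ?W) K Cot"
    proof (rule submodule.intro)
      show "subgroup (cc ` ?W) (add_monoid Cot)"
      proof (rule subgroup.intro)
        show "cc ` ?W \<subseteq> carrier (add_monoid Cot)" using C1 Wm by auto
        show "x \<otimes>\<^bsub>add_monoid Cot\<^esub> y \<in> cc ` ?W" if xy: "x \<in> cc ` ?W" "y \<in> cc ` ?W" for x y
        proof -
          obtain a b where ab: "a \<in> ?W" "b \<in> ?W" "x = cc a" "y = cc b" using xy by blast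
          have "x \<otimes>\<^bsub>add_monoid Cot\<^esub> y = cc (a \<oplus> b)" unfolding ab(3,4) monoid.simps by (rule ops(1)) (use ab Wc(1) in auto)
          thus ?thesis using Wc(3)[OF ab(1,2)] by blast
        qed
        have "cc \<zero> \<in> cc ` ?W" using Wc(2) by blast
        thus "\<one>\<^bsub>add_monoid Cot\<^esub> \<in> cc ` ?W" using Cot0 by (simp del: Span.simps One_nat_def)
        fix x assume "x \<in> cc ` ?W"
        then obtain w where w: "w \<in> ?W" "x = cc w" by blast
        have wc: "w \<in> carrier A" "\<ominus> w \<in> ?W" using w Wc(1,4) by auto
        have "inv\<^bsub>add_monoid Cot\<^esub> x = cc (\<ominus> w)"
        proof (rule monoid.inv_unique'[symmetric])
          show "monoid (add_monoid Cot)" using CM unfolding abelian_monoid_def comm_monoid_def by blast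
          show "x \<in> carrier (add_monoid Cot)" "cc (\<ominus> w) \<in> carrier (add_monoid Cot)" using C1[OF Wm[OF w(1)]] C1[OF Wm[OF wc(2)]] w(2) by simp_all
          show "x \<otimes>\<^bsub>add_monoid Cot\<^esub> cc (\<ominus> w) = \<one>\<^bsub>add_monoid Cot\<^esub>" "cc (\<ominus> w) \<otimes>\<^bsub>add_monoid Cot\<^esub> x = \<one>\<^bsub>add_monoid Cot\<^esub>"
            using ops(1)[of w "\<ominus> w"] ops(1)[of "\<ominus> w" w] wc(1) Cot0 w(2) by (simp_all add: r_neg l_neg del: One_nat_def)
        qed
        thus "inv\<^bsub>add_monoid Cot\<^esub> x \<in> cc ` ?W" using wc(2) by blast
      qed
      show "submodule_axioms (cc ` ?W) K Cot"
      proof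
        fix a x assume a: "a \<in> carrier K" and "x \<in> cc ` ?W"
        then obtain w where w: "w \<in> ?W" "x = cc w" by blast
        hence "a \<odot>\<^bsub>Cot\<^esub> x = cc (a \<odot> w)" using ops(2)[of w \<zero> a] a Wc(1) by auto
        thus "a \<odot>\<^bsub>Cot\<^esub> x \<in> cc ` ?W" using sc[OF a w(1)] by blast
      qed
    qed
    thus "module_span K Cot X \<subseteq> cc ` ?W" using X(2) unfolding module_span_def W by blast
    show "cc ` ?W \<subseteq> module_span K Cot X"
    proof -
      have "cc w \<in> N" if N: "submodule N K Cot" and "X \<subseteq> N" and "w \<in> ?W" for N w
      proof -
        interpret N: submodule N K Cot by (rule N)
        have "set vs \<subseteq> set us ==> w \<in> Span (scalars K A) vs ==> cc w \<in> N" for vs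
        proof (induction vs arbitrary: w)
          case Nil
          thus ?case using N.one_closed Cot0 by (simp del: One_nat_def)
        next
          case (Cons v vs)
          then obtain k u where ku: "k \<in> scalars K A" "u \<in> Span (scalars K A) vs" "w = k \<otimes> v \<oplus> u"
            using line_extension_mem_iff by auto
          obtain c where c: "c \<in> carrier K" "k = c \<odot> \<one>" using ku(1) unfolding scalars_def by blast
          have v: "v \<in> carrier A" "cc v \<in> N" using Cons.prems X(1) that(2) uc by auto
          have "set vs \<subseteq> carrier A" using Cons.prems uc by auto
          hence u: "u \<in> carrier A" using Span_subgroup_props(1)[OF kf] ku(2) by blast
          have "cc w = (c \<odot>\<^bsub>Cot\<^esub> cc v) \<oplus>\<^bsub>Cot\<^esub> cc u"
            unfolding ku(3) c(2) using ops(1)[of "c \<odot> v" u] ops(2)[OF v(1) v(1) c(1)] smult_eq_mult[OF c(1) v(1)] u v(1) c(1) by simp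
          moreover have "cc u \<in> N" using Cons.IH[OF _ ku(2)] Cons.prems by auto
          ultimately show ?case using N.smult_closed[OF c(1) v(2)] N.m_closed[of "c \<odot>\<^bsub>Cot\<^esub> cc v" "cc u"] by simp
        qed
        thus ?thesis using that by blast
      qed
      thus ?thesis unfolding module_span_def by blast
    qed
  qed
qed

text \<open>A basis is chosen among the given elements themselves.\<close>

lemma exists_coordinates:
  assumes X: "finite X" "X \<subseteq> m"
  shows "\<exists>e y. y \<in> {..<e} \<rightarrow> X \<and> independent_mod K A (J 2) e y \<and>
    (\<forall>x\<in>X. \<exists>l\<in>Span (scalars K A) (map y [0..<e]). x \<ominus> l \<in> J 2) \<and>
    ring.dim QQ (scalars K QQ) (module_span K Cot (cc ` X)) = e"
proof -
  interpret Q: ring QQ by (rule QQ_ring)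
  interpret h: ring_hom_ring A QQ cc by (rule QQ_hom)
  obtain xs where xs: "set xs = X" using finite_list[OF X(1)] by blast
  have Xc: "X \<subseteq> carrier A" using X(2) m_sub by auto
  have "set (map cc xs) \<subseteq> carrier QQ" using Xc xs by auto
  from Q.exists_independent_sublist[OF QQ_subfield this]
  obtain Vs where Vs: "set Vs \<subseteq> cc ` X" "Q.independent (scalars K QQ) Vs" "cc ` X \<subseteq> Q.Span (scalars K QQ) Vs"
    using xs by auto
  have "Vs \<in> lists (cc ` X)" using Vs(1) by blast
  then obtain ys where ys: "ys \<in> lists X" "Vs = map cc ys" unfolding lists_image by blast
  let ?e = "length ys" and ?y = "\<lambda>i. ys ! i"
  have yX: "set ys \<subseteq> X" using ys(1) by auto
  have my: "map ?y [0..<?e] = ys" by (rule map_nth)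
  have yc: "?y \<in> {..<?e} \<rightarrow> carrier A" using yX Xc by (auto dest: nth_mem)
  have "independent_mod K A (J 2) ?e ?y"
    unfolding independent_mod_def
  proof (intro allI impI, elim conjE)
    fix c i assume c: "\<forall>i<?e. c i \<in> carrier K" and s: "finsum A (\<lambda>i. c i \<odot> ?y i) {..<?e} \<in> J 2" and i: "i < ?e"
    let ?Ks = "map (\<lambda>i. c i \<odot> \<one>) [0..<?e]"
    have Ks: "set ?Ks \<subseteq> scalars K A" using c by (auto simp: scalars_def)
    have "cc (combine ?Ks ys) = cc \<zero>"
    proof -
      have "combine ?Ks ys \<in> J 2" using s combine_finsum[OF yc c] unfolding my by simp
      moreover from this have "combine ?Ks ys \<in> carrier A" using J_sub by blast
      ultimately show ?thesis using cc_eq[of "combine ?Ks ys" \<zero>] by (simp add: a_minus_def)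
    qed
    hence "Q.combine (map cc ?Ks) (map cc ys) = \<zero>\<^bsub>QQ\<^esub>"
      using h.combine_hom[of ?Ks ys] Ks scalars_sub yX Xc h.hom_zero by auto
    hence "set (take (length (map cc ys)) (map cc ?Ks)) \<subseteq> {\<zero>\<^bsub>QQ\<^esub>}"
      using Q.independent_imp_trivial_combine[OF QQ_subfield Vs(2)[unfolded ys(2)], of "map cc ?Ks"] Ks unfolding QQ_scalars by auto
    hence "cc (c i \<odot> \<one>) = \<zero>\<^bsub>QQ\<^esub>" using i by (simp add: image_subset_iff)
    hence "c i \<odot> \<one> \<ominus> \<zero> \<in> J 2" using cc_eq[of "c i \<odot> \<one>" \<zero>] h.hom_zero c i by simp
    hence "c i \<odot> \<one> \<in> m" using J_mono[of 1 2] J_1 c i by (auto simp: a_minus_def)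
    moreover have "c i \<odot> \<one> \<in> scalars K A" using c i by (auto simp: scalars_def)
    ultimately have "c i \<odot> \<one> = \<zero>" using scalar_m by blast
    thus "c i = \<zero>\<^bsub>K\<^esub>" using scalar_inj c i by blast
  qed
  moreover have sp: "\<exists>l\<in>Span (scalars K A) ys. x \<ominus> l \<in> J 2" if x: "x \<in> X" for x
  proof -
    have "cc x \<in> cc ` Span (scalars K A) ys"
      using Vs(3) x h.Span_hom[OF scalars_sub, of ys] yX Xc unfolding ys(2) QQ_scalars by (auto simp del: Span.simps Q.Span.simps)
    then obtain l where l: "l \<in> Span (scalars K A) ys" "cc x = cc l" by blast
    have "l \<in> carrier A" using l(1) Span_subgroup_props(1)[OF scalars_subfield, of ys] yX Xc by auto
    thus ?thesis using cc_eq[of x l] l x Xc by (intro bexI[of _ l]) auto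
  qed
  moreover have dim: "ring.dim QQ (scalars K QQ) (module_span K Cot (cc ` X)) = ?e"
  proof -
    have "module_span K Cot (cc ` X) = Q.Span (scalars K QQ) (map cc ys)"
      by (rule module_span_Cot) (use yX X(2) Vs(3) ys(2) in auto)
    moreover have "Q.dimension ?e (scalars K QQ) (Q.Span (scalars K QQ) (map cc ys))"
      using Q.dimension_independent[OF Vs(2)] unfolding ys(2) by simp
    ultimately show ?thesis using Q.dimI[OF QQ_subfield] unfolding over_def by simp
  qed
  moreover have "?y \<in> {..<?e} \<rightarrow> X" using yX by (auto dest: nth_mem)
  ultimately show ?thesis
    by (intro exI[of _ ?e] exI[of _ ?y] conjI ballI) ((unfold my)?, (assumption | (rule sp, assumption)))+
qed

end

context graded_subring
begin

text \<open>The elements whose part in \<open>m\<close> lies in a given subspace plus the square of the maximal ideal of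
  \<open>S\<close> form a subring that is closed under the inversion of units.\<close>

lemma generators_span:
  assumes Z: "Z \<subseteq> carrier A" and B: "B = generate_ring A (scalars K A \<union> Z)"
    and S: "S = fractions_in A B (B - m)" "B \<subseteq> S" "B - m \<subseteq> Units A" and inj: "S \<inter> J 2 \<subseteq> mS2"
    and ys: "set ys \<subseteq> mS" and gen: "\<And>z. z \<in> Z ==> \<exists>l\<in>Span (scalars K A) ys. dm z \<ominus> l \<in> J 2"
    and a: "a \<in> mS"
  shows "\<exists>l\<in>Span (scalars K A) ys. a \<ominus> l \<in> mS2"
proof -
  let ?k = "scalars K A" and ?L = "Span (scalars K A) ys"
  note kf = scalars_subfield and k = subringE[OF scalars_ring]
  have yc: "set ys \<subseteq> carrier A" using ys m_sub by auto
  have LS: "?L \<subseteq> S"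
  proof (rule Span_subset)
    show "x \<otimes> u \<in> S" if "x \<in> ?k" "u \<in> set ys" for x u
      by (rule subringE(6)[OF S_ring]) (use that ys scalars_S in blast)+
  qed (use subringE(2,7)[OF S_ring] in auto)
  note L = Span_subgroup_props[OF kf yc] Span_smult_closed[OF kf yc]
  define W where "W = {w \<in> S. \<exists>l\<in>?L. w \<ominus> l \<in> mS2}"
  have WI: "w \<in> W" if "w \<in> S" "l \<in> ?L" "w \<ominus> l \<in> mS2" for w l using that unfolding W_def by blast
  have Wadd: "v \<oplus> w \<in> W" if vw: "v \<in> W" "w \<in> W" for v w
  proof -
    obtain l l' where l: "v \<in> S" "w \<in> S" "l \<in> ?L" "v \<ominus> l \<in> mS2" "l' \<in> ?L" "w \<ominus> l' \<in> mS2" using vw unfolding W_def by blast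
    have c: "v \<in> carrier A" "w \<in> carrier A" "l \<in> carrier A" "l' \<in> carrier A" using l S_sub L(1) by auto
    have "v \<oplus> w \<ominus> (l \<oplus> l') = (v \<ominus> l) \<oplus> (w \<ominus> l')" using c by algebra
    thus ?thesis using mS2(2)[OF l(4,6)] by (intro WI[OF subringE(7)[OF S_ring l(1,2)] L(3)[OF l(3,5)]]) simp
  qed
  have Wmult: "x \<otimes> w \<in> W" if x: "x \<in> ?k" and w: "w \<in> W" for x w
  proof -
    obtain l where l: "w \<in> S" "l \<in> ?L" "w \<ominus> l \<in> mS2" using w unfolding W_def by blast
    have xS: "x \<in> S" using x scalars_S by auto
    have c: "x \<in> carrier A" "w \<in> carrier A" "l \<in> carrier A" using l xS S_sub L(1) by auto
    have "x \<otimes> w \<ominus> x \<otimes> l = x \<otimes> (w \<ominus> l)" using c by algebra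
    thus ?thesis using mS2(3)[OF xS l(3)] by (intro WI[OF subringE(6)[OF S_ring xS l(1)] L(5)[OF x l(2)]]) simp
  qed
  have W2: "w \<in> W" if "w \<in> mS2" for w
    using that mS2(6) S_sub by (intro WI[OF _ L(2)]) (auto simp: a_minus_def)
  have dprod: "dm (u \<otimes> v) = (eps u \<otimes> dm v \<oplus> eps v \<otimes> dm u) \<oplus> dm u \<otimes> dm v" if "u \<in> carrier A" "v \<in> carrier A" for u v
    unfolding dm_def eps_add_mult(2)[OF that] using that eps(3)[OF that(1)] eps(3)[OF that(2)] by algebra
  have neg1: "\<ominus> \<one> \<in> ?k" using k(3,5) by simp
  have dB: "dm b \<in> W" if "b \<in> B" for b
    using that unfolding B
  proof (induct rule: generate_ring.induct)
    case one
    thus ?case using dm_scalar[OF k(3)] W2[OF mS2(1)] by simp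
  next
    case (incl h)
    thus ?case
    proof
      assume "h \<in> ?k"
      thus ?thesis using dm_scalar[of h] W2[OF mS2(1)] by simp
    next
      assume h: "h \<in> Z"
      hence "h \<in> B" unfolding B by (auto intro: generate_ring.incl)
      hence hS: "dm h \<in> S" using dm_mS S(2) by blast
      obtain l where l: "l \<in> ?L" "dm h \<ominus> l \<in> J 2" using gen[OF h] by blast
      have "dm h \<ominus> l \<in> S" unfolding a_minus_def using subringE(5,7)[OF S_ring] hS l(1) LS by blast
      thus ?thesis using inj l hS by (intro WI) auto
    qed
  next
    case (a_inv h)
    hence h: "h \<in> carrier A" using B S(2) S_sub by auto
    have "dm (\<ominus> h) = dm ((\<ominus> \<one>) \<otimes> h)" using h by (simp add: l_minus)
    also have "\<dots> = (\<ominus> \<one>) \<otimes> dm h"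
      unfolding dprod[OF subsetD[OF scalars_sub neg1] h] eps_scalar[OF neg1] dm_scalar[OF neg1]
      using eps(3,4)[OF h] by (simp add: l_minus)
    finally show ?case using Wmult[OF neg1 a_inv(2)] by simp
  next
    case (eng_add h h')
    hence "h \<in> carrier A" "h' \<in> carrier A" using B S(2) S_sub by auto
    thus ?case using Wadd eng_add by (simp add: eps_add_mult(3))
  next
    case (eng_mult h h')
    hence h: "h \<in> S" "h' \<in> S" using B S(2) by auto
    hence c: "h \<in> carrier A" "h' \<in> carrier A" using S_sub by auto
    show ?case
      unfolding dprod[OF c]
      by (rule Wadd[OF Wadd[OF Wmult[OF eps(1)[OF c(1)] eng_mult(4)] Wmult[OF eps(1)[OF c(2)] eng_mult(2)]]
            W2[OF mS2(4)[OF dm_mS[OF h(1)] dm_mS[OF h(2)]]]])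
  qed
  obtain b s where bs: "b \<in> B" "s \<in> B" "s \<notin> m" "a = b \<otimes> inv s"
    using a unfolding S(1) fractions_in_def by blast
  have sU: "s \<in> Units A" using bs S(3) by auto
  have c: "a \<in> carrier A" "s \<in> carrier A" "b \<in> carrier A" "dm a = a" "eps s \<in> carrier A" "dm s \<in> carrier A"
    using a bs S(2) S_sub m_sub dm_m eps by auto
  have "b = s \<otimes> a" unfolding bs(4) using m_lcomm[of s b "inv s"] sU c by simp
  hence "dm b = (eps s \<otimes> a \<oplus> eps a \<otimes> dm s) \<oplus> dm s \<otimes> a" using dprod[OF c(2,1)] c(4) by simp
  moreover have "eps a = \<zero>" using eps_m a by blast
  ultimately have e: "eps s \<otimes> a = dm b \<oplus> (\<ominus> \<one>) \<otimes> (dm s \<otimes> a)"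
    using c by (simp add: l_minus a_assoc r_neg)
  have "dm s \<otimes> a \<in> mS2" using mS2(4)[OF dm_mS a] bs(2) S(2) by blast
  hence esa: "eps s \<otimes> a \<in> W" unfolding e by (intro Wadd dB bs(1) Wmult[OF neg1] W2)
  have "eps s \<noteq> \<zero>"
  proof
    assume "eps s = \<zero>"
    hence "dm s = s" unfolding dm_def using c by (simp add: a_minus_def)
    thus False using eps(2)[OF c(2)] bs(3) by simp
  qed
  hence i: "inv (eps s) \<in> ?k" "inv (eps s) \<otimes> eps s = \<one>"
    using ring.subfield_m_inv[OF ring_M kf, of "eps s"] eps(1)[OF c(2)] by auto
  have "inv (eps s) \<otimes> (eps s \<otimes> a) = a"
    using m_assoc[of "inv (eps s)" "eps s" a] i c scalars_sub by auto
  hence "a \<in> W" using Wmult[OF i(1) esa] by simp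
  thus ?thesis unfolding W_def by blast
qed

end

section \<open>Rings of bounded order\<close>

lemma (in ring) quot_der_coset:
  assumes I: "ideal I R" and closed: "\<And>a. a \<in> carrier R ==> der i a \<in> carrier R"
    and add: "\<And>a b. a \<in> carrier R ==> b \<in> carrier R ==> der i (a \<oplus> b) = der i a \<oplus> der i b"
    and stable: "\<And>a. a \<in> I ==> der i a \<in> I" and a: "a \<in> carrier R"
  shows "quot_der R I der i (I +> a) = I +> der i a"
proof -
  interpret I: ideal I R by (rule I)
  have "I +> der i u = I +> der i a" if u: "u \<in> I +> a" for u
  proof -
    obtain h where h: "h \<in> I" "u = h \<oplus> a" using u unfolding a_r_coset_def' by blast
    have c: "h \<in> carrier R" "der i h \<in> carrier R" "der i a \<in> carrier R" using h I.Icarr closed a by auto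
    have "der i u \<ominus> der i a = der i h" unfolding h(2) add[OF c(1) a] a_minus_def using c(2,3) by (simp add: a_assoc r_neg)
    thus ?thesis
      using quotient_eq_iff_same_a_r_cos[OF I, of "der i u" "der i a"] stable[OF h(1)] h(2) c a closed by simp
  qed
  hence "(\<Union>u\<in>I +> a. I +> der i u) = (\<Union>u\<in>I +> a. I +> der i a)" by (rule SUP_cong[OF refl])
  moreover have "a \<in> I +> a" by (rule I.a_rcos_self[OF a])
  ultimately show ?thesis unfolding quot_der_def by auto
qed

locale regular_generators = graded_symmetric K A m \<tau> for K and A (structure) and m \<tau> +
  fixes \<Delta> :: "'i set" and dK dA xs p
  assumes fin: "finite \<Delta>" and dA: "differential_ring A \<Delta> dA"
    and dK: "\<And>i c. \<lbrakk>i \<in> \<Delta>; c \<in> carrier K\<rbrakk> \<Longrightarrow> dK i c \<in> carrier K \<and> dA i (c \<odot> \<one>) = dK i c \<odot> \<one>"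
    and gens: "local_generators K A \<Delta> dA xs p"
    and natural: "\<And>r. \<exists>\<phi>. is_natural_map K A m (local_upto K A \<Delta> dA xs p r) \<phi> \<and>
      inj_on \<phi> (carrier (residue_kaehler K A m (local_upto K A \<Delta> dA xs p r)))"
begin

abbreviation D where "D \<equiv> diff_generate K A \<Delta> dA xs"
abbreviation AD where "AD \<equiv> A\<lparr>carrier := D\<rparr>"

lemma generators:
  shows "set xs \<subseteq> carrier A" "primeideal p AD" "\<And>i a. i \<in> \<Delta> ==> a \<in> p ==> dA i a \<in> p"
    and "D - p \<subseteq> Units A" "carrier A = fractions_in A D (D - p)"
proof -
  have g: "set xs \<subseteq> carrier A \<and> primeideal p AD \<and> (\<forall>i\<in>\<Delta>. dA i ` p \<subseteq> p) \<and> D - p \<subseteq> Units A \<and>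
      carrier A = fractions_in A D (D - p)"
    using gens unfolding local_generators_def Let_def .
  show "set xs \<subseteq> carrier A" using g by (elim conjE)
  show "primeideal p AD" using g by (elim conjE)
  show "D - p \<subseteq> Units A" using g by (elim conjE)
  show "carrier A = fractions_in A D (D - p)" using g by (elim conjE)
  have "\<forall>i\<in>\<Delta>. dA i ` p \<subseteq> p" using g by (elim conjE)
  thus "\<And>i a. i \<in> \<Delta> ==> a \<in> p ==> dA i a \<in> p" by blast
qed

lemma D_props:
  shows "subring D A" "scalars K A \<subseteq> D" "set xs \<subseteq> D" "\<And>i a. i \<in> \<Delta> ==> a \<in> D ==> dA i a \<in> D"
proof -
  let ?C = "{S. subring S A \<and> scalars K A \<subseteq> S \<and> set xs \<subseteq> S \<and> (\<forall>i\<in>\<Delta>. dA i ` S \<subseteq> S)}"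
  have "dA i ` carrier A \<subseteq> carrier A" if "i \<in> \<Delta>" for i using differential_ring.der_closed[OF dA that] by blast
  hence c: "carrier A \<in> ?C"
    using ring.carrier_is_subring[OF ring_M] scalars_sub generators(1) by simp
  have D: "D = \<Inter>?C" by (simp add: diff_generate_def)
  have sub: "subring S A" if "S \<in> ?C" for S using that by blast
  show "subring D A"
  proof (rule ring.subringI[OF ring_M])
    show "D \<subseteq> carrier A" unfolding D by (rule Inter_lower[OF c])
    show "\<one> \<in> D" unfolding D by (rule InterI) (rule subringE(3)[OF sub])
    show "\<ominus> a \<in> D" if "a \<in> D" for a
      using that unfolding D by (intro InterI) (rule subringE(5)[OF sub], assumption, erule InterD)
    show "a \<otimes> b \<in> D" if "a \<in> D" "b \<in> D" for a b
      using that unfolding D by (intro InterI) (rule subringE(6)[OF sub], assumption, (erule InterD, assumption)+)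
    show "a \<oplus> b \<in> D" if "a \<in> D" "b \<in> D" for a b
      using that unfolding D by (intro InterI) (rule subringE(7)[OF sub], assumption, (erule InterD, assumption)+)
  qed
  show "scalars K A \<subseteq> D" unfolding D by (rule Inter_greatest) (elim CollectE conjE)
  show "set xs \<subseteq> D" unfolding D by (rule Inter_greatest) (elim CollectE conjE)
  show "dA i a \<in> D" if ia: "i \<in> \<Delta>" "a \<in> D" for i a
    unfolding D
  proof (rule InterI)
    fix S assume S: "S \<in> ?C"
    have "a \<in> S" using ia(2) unfolding D by (rule InterD) (rule S)
    moreover have "dA i ` S \<subseteq> S" using S ia(1) by simp
    ultimately show "dA i a \<in> S" by blast
  qed
qed

lemma D_subring: "graded_subring K A m \<tau> D"
  by (intro graded_subring.intro graded_subring_axioms.intro graded_symmetric_axioms D_props(1,2))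

lemma D_sub: "D \<subseteq> carrier A" using subringE(1)[OF D_props(1)] .

lemma p_ideal: "ideal p AD" "ideal_in A D p"
  using primeideal.axioms(1)[OF generators(2)] ideal_in_iff[OF D_props(1)] by auto

text \<open>A prime that presents \<open>A\<close> as a localization is determined: the scalar part of an element of \<open>p\<close> outside \<open>m\<close>
  would be a unit that a denominator carries into \<open>p\<close>.\<close>

lemma p_eq: "p = m \<inter> D"
proof
  have pD: "p \<subseteq> D" using p_ideal(2) unfolding ideal_in_def by blast
  have add: "a \<oplus> b \<in> p" if "a \<in> p" "b \<in> p" for a b using p_ideal(2) that unfolding ideal_in_def by blast
  have mult: "r \<otimes> a \<in> p" if "r \<in> D" "a \<in> p" for a r using p_ideal(2) that unfolding ideal_in_def by blast
  show "m \<inter> D \<subseteq> p" using generators(4) unit_notin_m by blast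
  have "a \<in> m" if a: "a \<in> p" for a
  proof (rule ccontr)
    assume am: "a \<notin> m"
    have ac: "a \<in> carrier A" using a pD D_sub by auto
    note e = eps[OF ac]
    obtain b s where bs: "b \<in> D" "s \<in> D" "s \<notin> p" "dm a = b \<otimes> inv s"
      using e(4) generators(5) unfolding fractions_in_def by blast
    have sU: "s \<in> Units A" using bs generators(4) by auto
    have c: "b \<in> carrier A" "s \<in> carrier A" using bs D_sub by auto
    have b: "b = s \<otimes> dm a" unfolding bs(4) using m_lcomm[of s b "inv s"] sU c by simp
    have "b \<in> m" unfolding b by (rule ideal.I_l_closed[OF m_ideal e(2) c(2)])
    hence bp: "b \<in> p" using \<open>m \<inter> D \<subseteq> p\<close> bs(1) by blast
    have "s \<otimes> eps a = s \<otimes> a \<oplus> (\<ominus> \<one>) \<otimes> b" unfolding b dm_def using c ac e(3) by algebra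
    hence sp: "s \<otimes> eps a \<in> p"
      using add[OF mult[OF bs(2) a] mult[OF _ bp, of "\<ominus> \<one>"]] subringE(3,5)[OF D_props(1)] by simp
    have "eps a \<noteq> \<zero>"
    proof
      assume "eps a = \<zero>"
      hence "dm a = a" unfolding dm_def using ac by (simp add: a_minus_def)
      thus False using e(2) am by simp
    qed
    hence i: "inv (eps a) \<in> scalars K A" "inv (eps a) \<otimes> eps a = \<one>"
      using ring.subfield_m_inv[OF ring_M scalars_subfield, of "eps a"] e(1) by auto
    have ic: "inv (eps a) \<in> carrier A" "inv (eps a) \<in> D" using i(1) scalars_sub D_props(2) by auto
    have "inv (eps a) \<otimes> (s \<otimes> eps a) = s" using m_lcomm[of "inv (eps a)" s "eps a"] ic c e(3) i(2) by simp
    thus False using mult[OF ic(2) sp] bs(3) by simp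
  qed
  thus "p \<subseteq> m \<inter> D" using pD by blast
qed

text \<open>The quotient rule, as \<open>p\<close> is a differential ideal.\<close>

lemma m_stable:
  assumes i: "i \<in> \<Delta>" and a: "a \<in> m"
  shows "dA i a \<in> m"
proof -
  interpret d: differential_ring A \<Delta> dA by (rule dA)
  have ac: "a \<in> carrier A" using a m_sub by auto
  obtain b s where bs: "b \<in> D" "s \<in> D" "s \<notin> p" "a = b \<otimes> inv s"
    using ac generators(5) unfolding fractions_in_def by blast
  have sU: "s \<in> Units A" using bs generators(4) by auto
  have c: "b \<in> carrier A" "s \<in> carrier A" "dA i s \<in> carrier A" "dA i a \<in> carrier A" using bs D_sub d.der_closed[OF i] ac by auto
  have b: "b = s \<otimes> a" unfolding bs(4) using m_lcomm[of s b "inv s"] sU c by simp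
  have "b \<in> m" unfolding b by (rule ideal.I_l_closed[OF m_ideal a c(2)])
  hence "dA i b \<in> m" using p_eq bs(1) generators(3)[OF i, of b] by blast
  hence m1: "dA i s \<otimes> a \<oplus> s \<otimes> dA i a \<in> m" unfolding b d.der_mult[OF i c(2) ac] .
  have "dA i s \<otimes> a \<in> m" by (rule ideal.I_l_closed[OF m_ideal a c(3)])
  from minus_m[OF m1 this] have "(dA i s \<otimes> a \<oplus> s \<otimes> dA i a) \<ominus> dA i s \<otimes> a \<in> m" .
  moreover have "(dA i s \<otimes> a \<oplus> s \<otimes> dA i a) \<ominus> dA i s \<otimes> a = s \<otimes> dA i a" using c ac by algebra
  ultimately have "inv s \<otimes> (s \<otimes> dA i a) \<in> m" using ideal.I_l_closed[OF m_ideal] sU by simp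
  thus ?thesis using m_assoc[of "inv s" s "dA i a"] sU c by simp
qed

lemma J2_stable:
  assumes i: "i \<in> \<Delta>" and a: "a \<in> J 2"
  shows "dA i a \<in> J 2"
proof -
  interpret d: differential_ring A \<Delta> dA by (rule dA)
  have J2: "J 2 = ideal_prod A m m" using ideal_prod_one[OF m_ideal] by (simp add: ideal_power.simps(2) numeral_2_eq_2)
  have "a \<in> ideal_prod A m m" using a J2 by simp
  thus ?thesis
  proof (induct rule: ideal_prod.induct)
    case (prod u v)
    have "dA i u \<otimes> v \<in> J 2" "u \<otimes> dA i v \<in> J 2"
      unfolding J2 using prod m_stable[OF i] by (auto intro: ideal_prod.prod)
    moreover have "u \<in> carrier A" "v \<in> carrier A" using prod m_sub by auto
    ultimately show ?case using d.der_mult[OF i] J_add by simp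
  next
    case (sum u v)
    hence "u \<in> carrier A" "v \<in> carrier A" using J2 J_sub[of 2] by auto
    thus ?case using d.der_add[OF i] J_add sum by simp
  qed
qed

text \<open>Both \<open>K\<close> and \<open>m\<close> are stable under derivations.\<close>

lemma dm_der:
  assumes i: "i \<in> \<Delta>" and a: "a \<in> carrier A"
  shows "dm (dA i a) = dA i (dm a)"
proof -
  interpret d: differential_ring A \<Delta> dA by (rule dA)
  note e = eps[OF a]
  have c: "dA i a \<in> carrier A" "dA i (dm a) \<in> carrier A" "dA i (eps a) \<in> carrier A" using d.der_closed[OF i] a e by auto
  obtain k where k: "k \<in> carrier K" "eps a = k \<odot> \<one>" using e(1) unfolding scalars_def by blast
  have s: "dA i (eps a) \<in> scalars K A" unfolding k(2) scalars_def using dK[OF i k(1)] by auto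
  have "a = dm a \<oplus> eps a" unfolding dm_def using a e(3) by algebra
  hence da: "dA i a = dA i (dm a) \<oplus> dA i (eps a)" using d.der_add[OF i e(4,3)] by simp
  have eq: "dA i a \<ominus> dA i (eps a) = dA i (dm a)" unfolding da using c by algebra
  have "eps (dA i a) = dA i (eps a)"
    by (rule eps_unique[OF c(1) s]) (use eq m_stable[OF i e(2)] in simp)
  thus ?thesis using eq by (simp add: dm_def)
qed

lemma foldr_D: "w \<in> lists \<Delta> ==> a \<in> D ==> foldr dA w a \<in> D"
  by (induction w) (auto intro: D_props(4))

lemma derivatives_D: "derivatives_upto \<Delta> dA xs t \<subseteq> D"
  unfolding derivatives_upto_def using foldr_D D_props(3) by blast

lemma derivatives_finite: "finite (derivatives_upto \<Delta> dA xs t)"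
proof -
  have "finite {w. w \<in> lists \<Delta> \<and> length w \<le> t}"
    using finite_lists_length_le[OF fin, of t] by (simp add: lists_eq_set conj_commute Collect_conj_eq Int_commute)
  hence "finite ((\<lambda>(w, a). foldr dA w a) ` ({w. w \<in> lists \<Delta> \<and> length w \<le> t} \<times> set xs))" by blast
  moreover have "derivatives_upto \<Delta> dA xs t = (\<lambda>(w, a). foldr dA w a) ` ({w. w \<in> lists \<Delta> \<and> length w \<le> t} \<times> set xs)"
    unfolding derivatives_upto_def by auto
  ultimately show ?thesis by simp
qed

text \<open>So the span of the derivatives of \<open>dx\<close> is the span of the classes of \<open>dm z\<close> for the derivatives \<open>z\<close> of \<open>x\<close>.\<close>

lemma derivatives_dx:
  "derivatives_upto \<Delta> (quot_der A (J 2) dA) (map (dx_bar K A m) xs) t = cc ` dm ` derivatives_upto \<Delta> dA xs t"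
proof -
  interpret d: differential_ring A \<Delta> dA by (rule dA)
  have words: "foldr (quot_der A (J 2) dA) w (cc (dm a)) = cc (dm (foldr dA w a)) \<and> foldr dA w a \<in> carrier A"
    if "w \<in> lists \<Delta>" "a \<in> carrier A" for w a
    using that
  proof (induction w)
    case (Cons i w)
    hence w: "foldr (quot_der A (J 2) dA) w (cc (dm a)) = cc (dm (foldr dA w a))" "foldr dA w a \<in> carrier A" "i \<in> \<Delta>" by auto
    have "quot_der A (J 2) dA i (cc (dm (foldr dA w a))) = cc (dA i (dm (foldr dA w a)))"
      by (rule ring.quot_der_coset[OF ring_M J_ideal])
        (use d.der_closed[OF w(3)] d.der_add[OF w(3)] J2_stable[OF w(3)] eps(4)[OF w(2)] in auto)
    thus ?case using w d.der_closed[OF w(3) w(2)] dm_der[OF w(3,2)] by simp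
  qed simp
  have *: "foldr (quot_der A (J 2) dA) w (dx_bar K A m a) = cc (dm (foldr dA w a))" if "w \<in> lists \<Delta>" "a \<in> set xs" for w a
  proof -
    have a: "a \<in> carrier A" using that(2) generators(1) by blast
    show ?thesis unfolding dx_bar_class[OF a] using words[OF that(1) a] by blast
  qed
  show ?thesis
  proof (intro equalityI subsetI)
    fix X assume "X \<in> derivatives_upto \<Delta> (quot_der A (J 2) dA) (map (dx_bar K A m) xs) t"
    then obtain w a where w: "X = foldr (quot_der A (J 2) dA) w (dx_bar K A m a)" "w \<in> lists \<Delta>" "length w \<le> t" "a \<in> set xs"
      unfolding derivatives_upto_def by auto
    thus "X \<in> cc ` dm ` derivatives_upto \<Delta> dA xs t"
      unfolding w(1) *[OF w(2,4)] derivatives_upto_def by blast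
  next
    fix X assume "X \<in> cc ` dm ` derivatives_upto \<Delta> dA xs t"
    then obtain w a where w: "X = cc (dm (foldr dA w a))" "w \<in> lists \<Delta>" "length w \<le> t" "a \<in> set xs"
      unfolding derivatives_upto_def by auto
    thus "X \<in> derivatives_upto \<Delta> (quot_der A (J 2) dA) (map (dx_bar K A m) xs) t"
      unfolding w(1) *[OF w(2,4), symmetric] derivatives_upto_def set_map by blast
  qed
qed

text \<open>The injectivity of the natural map for order \<open>t\<close> is what makes the coordinates generate the maximal ideal of the
  local ring of order \<open>t\<close> modulo its square.\<close>

lemma dimensions:
  shows "\<exists>e. krull_dim (A\<lparr>carrier := generate_upto K A \<Delta> dA xs t\<rparr>) = enat e \<and>
    krull_dim (A\<lparr>carrier := local_upto K A \<Delta> dA xs p t\<rparr>) = enat e \<and>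
    ring.dim QQ (scalars K QQ) (module_span K Cot (cc ` dm ` derivatives_upto \<Delta> dA xs t)) = e"
proof -
  interpret d: differential_ring A \<Delta> dA by (rule dA)
  let ?Z = "derivatives_upto \<Delta> dA xs t" and ?B = "generate_upto K A \<Delta> dA xs t" and ?S = "local_upto K A \<Delta> dA xs p t"
  have B: "?B = generate_ring A (scalars K A \<union> ?Z)" by (simp add: generate_upto_def)
  have ZA: "?Z \<subseteq> carrier A" using derivatives_D D_sub by blast
  have B_ring: "subring ?B A" unfolding B by (rule ring.generate_ring_is_subring[OF ring_M]) (use ZA scalars_sub in blast)
  have BD: "?B \<subseteq> D" unfolding B
    by (rule ring.generate_ring_min_subring1[OF ring_M _ D_props(1)]) (use ZA scalars_sub derivatives_D D_props(2) in blast)+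
  have S: "?S = fractions_in A ?B (?B - m)"
  proof -
    have "?B - ?B \<inter> p = ?B - m" using BD p_eq by blast
    thus ?thesis by (simp add: local_upto_def Let_def)
  qed
  have U: "?B - m \<subseteq> Units A" using BD generators(4) p_eq by blast
  have kB: "scalars K A \<subseteq> ?B" "?Z \<subseteq> ?B" unfolding B by (auto intro: generate_ring.incl)
  have one: "\<one> \<in> ?B - m" using subringE(3)[OF B_ring] one_notin_m by blast
  have S_ring: "subring ?S A"
    unfolding S
  proof (rule ring.subring_fractions[OF ring_M M_cring B_ring _ U one])
    fix u v assume "u \<in> ?B - m" "v \<in> ?B - m"
    thus "u \<otimes> v \<in> ?B - m"
      using U subringE(6)[OF B_ring] unit_notin_m[of "u \<otimes> v"] by auto
  qed blast
  have BS: "?B \<subseteq> ?S"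
  proof
    fix b assume b: "b \<in> ?B"
    hence "b = b \<otimes> inv \<one>" using subringE(1)[OF B_ring] by auto
    thus "b \<in> ?S" unfolding S fractions_in_def using b one by blast
  qed
  interpret GS: graded_subring K A m \<tau> ?S
    by (intro graded_subring.intro graded_subring_axioms.intro graded_symmetric_axioms S_ring subset_trans[OF kB(1) BS])
  have inj: "?S \<inter> J 2 \<subseteq> GS.mS2" using natural[of t] GS.natural_map_injective by blast
  have dmB: "dm z \<in> ?B \<inter> m" if "z \<in> ?Z" for z
  proof -
    have z: "z \<in> ?B" "z \<in> carrier A" using that kB ZA by auto
    have "eps z \<in> ?B" using eps(1)[OF z(2)] kB by blast
    hence "dm z \<in> ?B" unfolding dm_def a_minus_def using subringE(5,7)[OF B_ring] z by simp
    thus ?thesis using eps(2)[OF z(2)] by blast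
  qed
  have X: "finite (dm ` ?Z)" "dm ` ?Z \<subseteq> m" using derivatives_finite dmB by auto
  obtain e y where y: "y \<in> {..<e} \<rightarrow> dm ` ?Z" "independent_mod K A (J 2) e y"
    "\<forall>x\<in>dm ` ?Z. \<exists>l\<in>Span (scalars K A) (map y [0..<e]). x \<ominus> l \<in> J 2"
    "ring.dim QQ (scalars K QQ) (module_span K Cot (cc ` dm ` ?Z)) = e"
    using exists_coordinates[OF X] by (elim exE conjE)
  have yB: "y \<in> {..<e} \<rightarrow> ?B \<inter> m"
  proof
    fix i assume "i \<in> {..<e}"
    hence "y i \<in> dm ` ?Z" using y(1) by (rule funcset_mem[rotated])
    thus "y i \<in> ?B \<inter> m" using dmB by (elim imageE) simp
  qed
  hence yA: "y \<in> {..<e} \<rightarrow> carrier A" using m_sub by (simp add: Pi_iff subset_iff)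
  have ys: "set (map y [0..<e]) \<subseteq> ?S \<inter> m" using yB BS by (auto simp: Pi_iff)
  have span: "\<exists>c. (\<forall>i<e. c i \<in> carrier K) \<and> a \<ominus> finsum A (\<lambda>i. c i \<odot> y i) {..<e} \<in> GS.mS2"
    if a: "a \<in> ?S \<inter> m" for a
  proof -
    have "\<exists>l\<in>Span (scalars K A) (map y [0..<e]). a \<ominus> l \<in> GS.mS2"
      by (rule GS.generators_span[OF ZA B S BS U inj ys _ a]) (use y(3) in blast)
    then obtain l where l: "l \<in> Span (scalars K A) (map y [0..<e])" "a \<ominus> l \<in> GS.mS2" by blast
    have "set (map y [0..<e]) \<subseteq> carrier A" using yA by (auto simp: Pi_iff)
    then obtain Ks where Ks: "set Ks \<subseteq> scalars K A" "length Ks = e" "l = combine Ks (map y [0..<e])"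
      using l(1) Span_mem_iff_length_version[OF scalars_subfield, of "map y [0..<e]" l] by auto
    have "\<forall>i<e. \<exists>c. c \<in> carrier K \<and> Ks ! i = c \<odot> \<one>"
      using Ks(1,2) nth_mem[of _ Ks] unfolding scalars_def by blast
    then obtain c where c: "\<forall>i<e. c i \<in> carrier K \<and> Ks ! i = c i \<odot> \<one>" by metis
    have "Ks = map (\<lambda>i. c i \<odot> \<one>) [0..<e]" by (rule nth_equalityI) (use Ks(2) c in auto)
    hence "l = finsum A (\<lambda>i. c i \<odot> y i) {..<e}" using Ks(3) combine_finsum[OF yA, of c] c by simp
    thus ?thesis using l(2) c by blast
  qed
  interpret RC: regular_core K A m \<tau> ?B ?S ?Z e y
  proof (intro regular_core.intro regular_core_axioms.intro)
    show "add_pow A k \<one> \<in> Units A" if "0 < k" for k :: nat by (rule d.contains_rationals[OF that])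
  qed (fact graded_symmetric_axioms derivatives_finite ZA B S_ring S U yB y(2) span)+
  show ?thesis using RC.krull_dims y(4) by blast
qed

lemma AD_algebra: "algebra K AD"
proof -
  interpret GD: graded_subring K A m \<tau> D by (rule D_subring)
  have cl: "c \<odot> a \<in> D" if "c \<in> carrier K" "a \<in> D" for c a
  proof -
    have "a \<in> carrier A" "c \<odot> \<one> \<in> D" using that D_sub D_props(2) by (auto simp: scalars_def)
    thus ?thesis using smult_eq_mult[OF that(1), of a] subringE(6)[OF D_props(1) _ that(2)] by simp
  qed
  show ?thesis
    by (rule algebraI)
      (use GD.AS_cring R.is_cring cl in \<open>simp_all add: subsetD[OF D_sub] smult_l_distr smult_r_distr smult_assoc1 smult_assoc2\<close>)
qed

text \<open>Every element of \<open>B/p\<close> is a scalar, so \<open>B/p\<close> and its subrings of bounded order are the field \<open>K\<close>.\<close>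

lemma residue_dimension: "chi_algebra K (quot_module AD p) \<Delta> (quot_der AD p dA) (map (\<lambda>a. p +>\<^bsub>AD\<^esub> a) xs) t = 0"
proof -
  interpret d: differential_ring A \<Delta> dA by (rule dA)
  interpret GD: graded_subring K A m \<tau> D by (rule D_subring)
  interpret AD: algebra K AD by (rule AD_algebra)
  let ?R = "quot_module AD p" and ?c = "\<lambda>a. p +>\<^bsub>AD\<^esub> a"
  have ringAD: "ring AD" using cring.axioms(1)[OF GD.AS_cring] .
  note ops = AD.quot_module_ops[OF p_ideal(1)]
  have carr: "carrier ?R = ?c ` D"
    unfolding quot_module_def FactRing_def A_RCOSETS_def RCOSETS_def a_r_coset_def by auto
  have scal: "\<exists>k\<in>carrier K. ?c b = ?c (k \<odot> \<one>)" if b: "b \<in> D" for b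
  proof -
    have bc: "b \<in> carrier A" using b D_sub by auto
    obtain k where k: "k \<in> carrier K" "eps b = k \<odot> \<one>" using eps(1)[OF bc] unfolding scalars_def by blast
    have e: "eps b \<in> D" using eps(1)[OF bc] D_props(2) by blast
    have "b \<ominus>\<^bsub>AD\<^esub> eps b \<in> p"
      using GD.AS_minus[OF b e] GD.dm_mS[OF b] unfolding dm_def[symmetric] p_eq by auto
    hence "?c b = ?c (eps b)" using ring.quotient_eq_iff_same_a_r_cos[OF ringAD p_ideal(1), of b "eps b"] b e by simp
    thus ?thesis using k by auto
  qed
  have scal_eq: "k \<odot>\<^bsub>?R\<^esub> \<one>\<^bsub>?R\<^esub> = ?c (k \<odot> \<one>)" if "k \<in> carrier K" for k
    using ops(4,5)[OF that AD.one_closed AD.one_closed] by simp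
  have sc: "scalars K ?R = carrier ?R"
  proof
    show "scalars K ?R \<subseteq> carrier ?R"
      unfolding scalars_def using scal_eq D_props(2) carr by (auto simp: scalars_def)
    show "carrier ?R \<subseteq> scalars K ?R"
      unfolding carr scalars_def using scal scal_eq by (auto simp: image_iff)
  qed
  have der: "quot_der AD p dA i (?c b) = ?c (dA i b)" if "i \<in> \<Delta>" "b \<in> D" for i b
    by (rule ring.quot_der_coset[OF ringAD p_ideal(1)])
      (use that(2) in \<open>simp_all add: D_props(4)[OF that(1)] d.der_add[OF that(1)] subsetD[OF D_sub] generators(3)[OF that(1)]\<close>)
  have "foldr (quot_der AD p dA) w (?c b) \<in> ?c ` D" if "w \<in> lists \<Delta>" "b \<in> D" for w b
    using that by (induction w) (auto simp: der D_props(4))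
  hence "derivatives_upto \<Delta> (quot_der AD p dA) (map ?c xs) t \<subseteq> carrier ?R"
    unfolding carr derivatives_upto_def using D_props(3) by auto
  hence "scalars K ?R \<union> derivatives_upto \<Delta> (quot_der AD p dA) (map ?c xs) t = carrier ?R" using sc by blast
  moreover have "generate_ring ?R (carrier ?R) = carrier ?R"
  proof
    show "carrier ?R \<subseteq> generate_ring ?R (carrier ?R)" by (auto intro: generate_ring.incl)
    have cl: "\<ominus>\<^bsub>?R\<^esub> x \<in> carrier ?R" if "x \<in> carrier ?R" for x
    proof -
      have "abelian_group (AD Quot p)" using ring.is_abelian_group[OF ideal.quotient_is_ring[OF p_ideal(1)]] .
      from abelian_group.a_inv_closed[OF this] that show ?thesis
        by (simp add: quot_module_def a_inv_def m_inv_def)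
    qed
    show "generate_ring ?R (carrier ?R) \<subseteq> carrier ?R"
    proof
      fix x assume "x \<in> generate_ring ?R (carrier ?R)"
      thus "x \<in> carrier ?R"
      proof (induct rule: generate_ring.induct)
        case one
        thus ?case using ops(1,5)[OF R.one_closed AD.one_closed AD.one_closed] by simp
      next
        case (eng_add u v)
        thus ?case using ops(3)[OF R.one_closed] subringE(7)[OF D_props(1)] unfolding carr by auto
      next
        case (eng_mult u v)
        thus ?case using ops(2)[OF R.one_closed] subringE(6)[OF D_props(1)] unfolding carr by auto
      qed (use cl in auto)
    qed
  qed
  ultimately have gen: "generate_upto K ?R \<Delta> (quot_der AD p dA) (map ?c xs) t = carrier ?R"
    unfolding generate_upto_def by simp
  have "l = 0" if P: "\<forall>i\<le>l. primeideal (P i) ?R" "\<forall>i<l. P i \<subset> P (Suc i)" for l and P :: "nat \<Rightarrow> 'c set set"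
  proof (rule ccontr)
    assume "l \<noteq> 0"
    hence prime: "primeideal (P 0) ?R" "primeideal (P 1) ?R" and "P 0 \<subset> P 1" using P by auto
    then obtain x where x: "x \<in> P 1" "x \<notin> P 0" by blast
    note id = prime[THEN primeideal.axioms(1)]
    have "x \<in> ?c ` D" using ideal.Icarr[OF id(2) x(1)] unfolding carr .
    then obtain k where k: "k \<in> carrier K" "x = ?c (k \<odot> \<one>)" using scal by blast
    have "k \<noteq> \<zero>\<^bsub>K\<^esub>"
    proof
      assume "k = \<zero>\<^bsub>K\<^esub>"
      hence "x = \<zero>\<^bsub>?R\<^esub>" using k(2) ops(6)[OF R.one_closed AD.one_closed AD.one_closed] by simp
      thus False using x(2) additive_subgroup.zero_closed[OF ideal.axioms(1)[OF id(1)]] by simp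
    qed
    hence kU: "k \<in> Units K" using K.field_Units k(1) by simp
    have D: "k \<odot> \<one> \<in> D" "inv\<^bsub>K\<^esub> k \<odot> \<one> \<in> D" using k(1) kU D_props(2) unfolding scalars_def by auto
    have "(inv\<^bsub>K\<^esub> k \<odot> \<one>) \<otimes> (k \<odot> \<one>) = \<one>"
      using smult_eq_mult[of "inv\<^bsub>K\<^esub> k" "k \<odot> \<one>"] smult_assoc1[of "inv\<^bsub>K\<^esub> k" k \<one>] k(1) kU by simp
    hence "?c (inv\<^bsub>K\<^esub> k \<odot> \<one>) \<otimes>\<^bsub>?R\<^esub> x = \<one>\<^bsub>?R\<^esub>"
      unfolding k(2) using ops(2)[OF R.one_closed, of "inv\<^bsub>K\<^esub> k \<odot> \<one>" "k \<odot> \<one>"] ops(5)[OF R.one_closed AD.one_closed AD.one_closed] D by simp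
    moreover have "?c (inv\<^bsub>K\<^esub> k \<odot> \<one>) \<otimes>\<^bsub>?R\<^esub> x \<in> P 1"
      by (rule ideal.I_l_closed[OF id(2) x(1)]) (use D(2) carr in blast)
    ultimately have "P 1 = carrier ?R" using ideal.one_imp_carrier[OF id(2)] by simp
    thus False using primeideal.I_notcarr[OF prime(2)] by simp
  qed
  hence "krull_dim ?R \<le> 0"
    unfolding krull_dim_def by (intro Sup_least) (auto simp: zero_enat_def)
  thus ?thesis unfolding chi_algebra_def gen by simp
qed

end

theorem mainTheorem4:
  fixes K :: "('k, 'l) ring_scheme" and A :: "('k, 'a, 'b) module_scheme"
    and \<Delta> :: "'d set" and dK :: "'d \<Rightarrow> 'k \<Rightarrow> 'k" and dA :: "'d \<Rightarrow> 'a \<Rightarrow> 'a"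
    and m :: "'a set" and xs :: "'a list"
  assumes "finite \<Delta>"
    and "differential_field K \<Delta> dK"
    and "differential_algebra K dK A dA \<Delta>"
    and "local_ring A m"
    and "\<exists>ys q. local_generators K A \<Delta> dA ys q"
    and "regular_differential_local_algebra K A m \<Delta> dA"
    and "regular_local_generators K A m \<Delta> dA xs"
    and "B = A\<lparr>carrier := diff_generate K A \<Delta> dA xs\<rparr>"
    and "p = m \<inter> carrier B"
  shows "bij_betw (cotangent_map K A m)
      (carrier (cotangent A m)) (carrier (residue_kaehler K A m (carrier A))) \<and>
    (\<forall>t. chi_cotangent K A m \<Delta> dA (map (dx_bar K A m) xs) t = chi_algebra K B \<Delta> dA xs t \<and>
      chi_algebra K B \<Delta> dA xs t =
        chi_algebra K (quot_module B p) \<Delta> (quot_der B p dA) (map (\<lambda>a. p +>\<^bsub>B\<^esub> a) xs) t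
          + chi_local K A \<Delta> dA xs p t)"
proof -
  obtain \<tau> where \<tau>: "\<tau> \<in> algebra_homs K (symmetric_algebra K (cotangent A m)) (associated_graded A m)"
    "\<forall>v\<in>carrier (cotangent A m). \<tau> (symmetric_incl K (cotangent A m) v) = in_degree_one A m v"
    "bij_betw \<tau> (carrier (symmetric_algebra K (cotangent A m))) (carrier (associated_graded A m))"
    using assms(6) unfolding regular_differential_local_algebra_def by blast
  obtain q where q: "local_generators K A \<Delta> dA xs q"
    "\<And>r. \<exists>\<phi>. is_natural_map K A m (local_upto K A \<Delta> dA xs q r) \<phi> \<and>
        inj_on \<phi> (carrier (residue_kaehler K A m (local_upto K A \<Delta> dA xs q r)))"
    using assms(7) unfolding regular_local_generators_def by blast
  have alg: "algebra K A" and dA: "differential_ring A \<Delta> dA" and dK: "differential_ring K \<Delta> dK"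
    and comp: "\<And>i c. i \<in> \<Delta> \<Longrightarrow> c \<in> carrier K \<Longrightarrow> dA i (c \<odot>\<^bsub>A\<^esub> \<one>\<^bsub>A\<^esub>) = dK i c \<odot>\<^bsub>A\<^esub> \<one>\<^bsub>A\<^esub>"
    using assms(3) unfolding differential_algebra_def by auto
  have fld: "field K" using assms(2) unfolding differential_field_def by blast
  have max: "maximalideal m A" using assms(4) unfolding local_ring_def by blast
  have sym: "graded_symmetric K A m \<tau>"
    by (intro graded_symmetric.intro graded_symmetric_axioms.intro) (fact alg fld max \<tau>)+
  interpret regular_generators K A m \<tau> \<Delta> dK dA xs q
  proof (intro regular_generators.intro regular_generators_axioms.intro)
    show "dK i c \<in> carrier K \<and> dA i (c \<odot>\<^bsub>A\<^esub> \<one>\<^bsub>A\<^esub>) = dK i c \<odot>\<^bsub>A\<^esub> \<one>\<^bsub>A\<^esub>" if "i \<in> \<Delta>" "c \<in> carrier K" for i c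
      using differential_ring.der_closed[OF dK that] comp[OF that] by blast
  qed (fact sym assms(1) dA q)+
  have p: "p = q" using assms(9) p_eq unfolding assms(8) by simp
  show ?thesis
  proof (intro conjI allI)
    show "bij_betw (cotangent_map K A m) (carrier (cotangent A m)) (carrier (residue_kaehler K A m (carrier A)))"
      by (rule cotangent_map_bij)
    fix t
    obtain e where e: "krull_dim (A\<lparr>carrier := generate_upto K A \<Delta> dA xs t\<rparr>) = enat e"
      "krull_dim (A\<lparr>carrier := local_upto K A \<Delta> dA xs q t\<rparr>) = enat e"
      "ring.dim QQ (scalars K QQ) (module_span K Cot (cc ` dm ` derivatives_upto \<Delta> dA xs t)) = e"
      using dimensions[of t] by blast
    have "generate_upto K B \<Delta> dA xs t = generate_upto K A \<Delta> dA xs t"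
    proof -
      have "scalars K B = scalars K A" unfolding assms(8) by (simp add: scalars_def)
      thus ?thesis
        unfolding generate_upto_def
        using ring.subring_gen_equality[OF ring_M D_props(1), of "scalars K A \<union> derivatives_upto \<Delta> dA xs t"]
          derivatives_D[of t] D_props(2) assms(8) by simp
    qed
    hence B: "chi_algebra K B \<Delta> dA xs t = enat e"
      unfolding chi_algebra_def using e(1) assms(8) by simp
    show "chi_cotangent K A m \<Delta> dA (map (dx_bar K A m) xs) t = chi_algebra K B \<Delta> dA xs t"
      unfolding B chi_cotangent_def Let_def derivatives_dx e(3) ..
    show "chi_algebra K B \<Delta> dA xs t =
        chi_algebra K (quot_module B p) \<Delta> (quot_der B p dA) (map (\<lambda>a. p +>\<^bsub>B\<^esub> a) xs) t + chi_local K A \<Delta> dA xs p t"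
      unfolding B unfolding p assms(8) residue_dimension chi_local_def e(2) by simp
  qed
qed

end
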